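(* Let $c:(0,\infty)\to[0,\infty)$ be measurable and locally bounded. For each $F\in\mathcal{FC}_b^\infty(\mathcal D(\hat X),\mathbb K(X))$ define, for $\eta\in\mathbb K(X)$, $$(L^{\mathrm{int}}F)(\eta):=\int_X d\eta(x)\,\frac{c(s(x))}{s(x)^2}(\Delta^X_xF)(\eta),\qquad (L^{\mathrm{ext}}F)(\eta):=\int_X d\eta(x)\,(\Delta^{\mathbb R_+^*}_xF)(\eta),\qquad L^{\mathbb M}F:=L^{\mathrm{int}}F+L^{\mathrm{ext}}F.$$ Then, for each $\sharp\in\{\mathrm{int},\mathrm{ext},\mathbb M\}$: (i) $(L^\sharp,\mathcal{FC}_b^\infty(\mathcal D(\hat X),\mathbb K(X)))$ is a symmetric operator in $L^2(\mathbb K(X),\mathcal G)$ which satisfies $$\mathcal E^\sharp(F,G)=(-L^\sharp F,G)_{L^2(\mathbb K(X),\mathcal G)},\quad F,G\in\mathcal{FC}_b^\infty(\mathcal D(\hat X),\mathbb K(X)).$$ (ii) The bilinear form $(\mathcal E^\sharp,\mathcal{FC}_b^\infty(\mathcal D(\hat X),\mathbb K(X)))$ is closable on $L^2(\mathbb K(X),\mathcal G)$, and its closure is a Dirichlet form. (iii) The operator $(-L^\sharp,\mathcal{FC}_b^\infty(\mathcal D(\hat X),\mathbb K(X)))$ has a Friedrichs extension.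
   Context: Let $X=\mathbb R^d$, $d\in\mathbb N$, with scalar product $\langle\cdot,\cdot\rangle_X$, and $\mathbb R_+^*=(0,\infty)$, $\hat X=X\times\mathbb R_+^*$. "Locally bounded" for a function on $\mathbb R_+^*$ means bounded on every $[a,b]$ with $0<a<b<\infty$. $\mathbb M(X)$ is the space of nonnegative Radon measures on $X$ with the vague topology and its Borel $\sigma$-algebra. $\mathbb K(X)\subset\mathbb M(X)$ is the (Borel) subset of discrete Radon measures, i.e. Radon measures $\eta=\sum_i s_i\delta_{x_i}$ with $s_i>0$, distinct $x_i\in X$, at most countably many atoms (including $\eta=0$), with the trace $\sigma$-algebra. For $\eta\in\mathbb K(X)$, $\tau(\eta)=\{x_i\}$ is the set of atoms, and $s(x)=\eta(\{x\})$ for $x\in\tau(\eta)$. The gamma measure $\mathcal G$ is the unique probability measure on $\mathbb K(X)$ with $$\int_{\mathbb K(X)}e^{\int_X\varphi\,d\eta}\,d\mathcal G(\eta)=\exp\Big[-\int_X\log(1-\varphi(x))\,dx\Big]$$ for all continuous compactly supported $\varphi:X\to\mathbb R$ with $\varphi<1$. Equivalently, $\mathcal G$ is the pushforward under $\{(x_i,s_i)\}\mapsto\sum_i s_i\delta_{x_i}$ of the Poisson measure on configurations in $\hat X$ with intensity measure $dx\,s^{-1}e^{-s}\,ds$. $L^2(\mathbb K(X),\mathcal G)$ is the real $L^2$-space. $\mathcal D(\hat X)$ is the space of smooth real functions on $\hat X$ with compact support in $\hat X$ (support contained in some $A\times[a,b]$ with $A\subset X$ bounded, $0<a<b<\infty$).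 For $\varphi\in\mathcal D(\hat X)$, $\langle\!\langle\varphi,\eta\rangle\!\rangle:=\sum_{x\in\tau(\eta)}\varphi(x,s(x))$. $\mathcal{FC}_b^\infty(\mathcal D(\hat X),\mathbb K(X))$ is the set of functions $$F(\eta)=g(\langle\!\langle\varphi_1,\eta\rangle\!\rangle,\dots,\langle\!\langle\varphi_N,\eta\rangle\!\rangle),\quad \eta\in\mathbb K(X),$$ with $N\in\mathbb N$, $\varphi_1,\dots,\varphi_N\in\mathcal D(\hat X)$ and $g\in C_b^\infty(\mathbb R^N)$ (smooth real function, bounded together with all its derivatives); it is a dense subset of $L^2(\mathbb K(X),\mathcal G)$. For such $F$, $\eta\in\mathbb K(X)$ and $x\in\tau(\eta)$, the intrinsic and extrinsic gradients are $$(\nabla^{\mathrm{int}}F)(\eta,x)=\sum_{i=1}^N(\partial_ig)(\langle\!\langle\varphi_1,\eta\rangle\!\rangle,\dots,\langle\!\langle\varphi_N,\eta\rangle\!\rangle)\frac1{s(x)}\nabla_y\big|_{y=x}\varphi_i(y,s(x)),$$ $$(\nabla^{\mathrm{ext}}F)(\eta,x)=\sum_{i=1}^N(\partial_ig)(\langle\!\langle\varphi_1,\eta\rangle\!\rangle,\dots,\langle\!\langle\varphi_N,\eta\rangle\!\rangle)\frac{\partial}{\partial u}\Big|_{u=s(x)}\varphi_i(x,u).$$ For $F,G\in\mathcal{FC}_b^\infty(\mathcal D(\hat X),\mathbb K(X))$, $$\mathcal E^{\mathrm{int}}(F,G):=\int_{\mathbb K(X)}d\mathcal G(\eta)\int_Xd\eta(x)\,\big\langle(\nabla^{\mathrm{int}}F)(\eta,x),c(s(x))(\nabla^{\mathrm{int}}G)(\eta,x)\big\rangle_X,$$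 $$\mathcal E^{\mathrm{ext}}(F,G):=\int_{\mathbb K(X)}d\mathcal G(\eta)\int_Xd\eta(x)\,(\nabla^{\mathrm{ext}}F)(\eta,x)(\nabla^{\mathrm{ext}}G)(\eta,x),\qquad \mathcal E^{\mathbb M}:=\mathcal E^{\mathrm{int}}+\mathcal E^{\mathrm{ext}}.$$ For $F\in\mathcal{FC}_b^\infty(\mathcal D(\hat X),\mathbb K(X))$ of the form $F(\eta)=g(\langle\!\langle\varphi_1,\eta\rangle\!\rangle,\dots,\langle\!\langle\varphi_N,\eta\rangle\!\rangle)$ with $N\in\mathbb N$, $\varphi_1,\dots,\varphi_N\in\mathcal D(\hat X)$ and $g\in C_b^\infty(\mathbb R^N)$, for $\eta\in\mathbb K(X)$ and $x\in\tau(\eta)$, put $$(\Delta^X_xF)(\eta):=\Delta_y\big|_{y=x}F(\eta-s(x)\delta_x+s(x)\delta_y),\qquad (\Delta^{\mathbb R_+^*}_xF)(\eta):=\Big(\frac{d^2}{du^2}-\frac{d}{du}\Big)\Big|_{u=s(x)}F(\eta-s(x)\delta_x+u\delta_x),$$ where $\Delta_y$ is the Laplacian on $X$ in the variable $y$, and $F(\eta-s(x)\delta_x+u\delta_y)$ is understood as the smooth function of $(y,u)\in\hat X$ obtained by replacing each argument $\langle\!\langle\varphi_i,\eta\rangle\!\rangle$ of $g$ by $\langle\!\langle\varphi_i,\eta\rangle\!\rangle-\varphi_i(x,s(x))+\varphi_i(y,u)$. *)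

theory Defs
  imports "HOL-Probability.Probability"
begin

section \<open>Differential calculus\<close>

definition dir_deriv :: "'a::real_normed_vector \<Rightarrow> ('a \<Rightarrow> real) \<Rightarrow> 'a \<Rightarrow> real" where
  "dir_deriv b f = (\<lambda>x. frechet_derivative f (at x) b)"

text \<open>Meant for open \<open>S\<close>: all iterated partial derivatives exist and are differentiable,
  hence continuous, on \<open>S\<close>.\<close>

definition smooth_on :: "'a::euclidean_space set \<Rightarrow> ('a \<Rightarrow> real) \<Rightarrow> bool" where
  "smooth_on S f \<longleftrightarrow>
     (\<forall>bs. set bs \<subseteq> Basis \<longrightarrow> (\<forall>x\<in>S. foldr dir_deriv bs f differentiable (at x)))"

definition gradient :: "('a::euclidean_space \<Rightarrow> real) \<Rightarrow> 'a \<Rightarrow> 'a" where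
  "gradient f x = (\<Sum>b\<in>Basis. dir_deriv b f x *\<^sub>R b)"

definition laplacian :: "('a::euclidean_space \<Rightarrow> real) \<Rightarrow> 'a \<Rightarrow> real" where
  "laplacian f x = (\<Sum>b\<in>Basis. dir_deriv b (dir_deriv b f) x)"

text \<open>The dimension \<open>N\<close> in a cylinder function is existentially quantified, so it cannot be a type.
  A function on \<open>N\<close>-dimensional space is represented by a function of sequences that depends on
  the coordinates \<open>0, \<dots>, N - 1\<close> only.  For such functions, continuity in the product
  topology on sequences is continuity on \<open>N\<close>-dimensional space.\<close>

definition coord_deriv :: "nat \<Rightarrow> ((nat \<Rightarrow> real) \<Rightarrow> real) \<Rightarrow> (nat \<Rightarrow> real) \<Rightarrow> real" where
  "coord_deriv i g = (\<lambda>v. deriv (\<lambda>t. g (v(i := t))) (v i))"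

definition Cb_smooth :: "nat \<Rightarrow> ((nat \<Rightarrow> real) \<Rightarrow> real) set" where
  "Cb_smooth N = {g.
     (\<forall>v w. (\<forall>i<N. v i = w i) \<longrightarrow> g v = g w) \<and>
     (\<forall>is. set is \<subseteq> {..<N} \<longrightarrow>
        (let h = foldr coord_deriv is g in
          continuous_on UNIV h \<and> bounded (range h) \<and>
          (\<forall>i<N. \<forall>v. (\<lambda>t. h (v(i := t))) differentiable (at (v i)))))}"


section \<open>Discrete Radon measures and the gamma measure\<close>

definition Cc :: "('a::euclidean_space \<Rightarrow> real) set" where
  "Cc = {f. continuous_on UNIV f \<and> (\<exists>K. compact K \<and> (\<forall>x. x \<notin> K \<longrightarrow> f x = 0))}"

text \<open>On a Euclidean space a Borel measure that is finite on compact sets is automatically regular.\<close>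

definition radon_measures :: "'a::euclidean_space measure set" where
  "radon_measures = {\<eta>. sets \<eta> = sets borel \<and> (\<forall>K. compact K \<longrightarrow> emeasure \<eta> K < \<infinity>)}"

definition vague_topology :: "'a::euclidean_space measure topology" where
  "vague_topology = topology_generated_by
     {{\<eta> \<in> radon_measures. (\<integral>x. f x \<partial>\<eta>) \<in> U} | f U. f \<in> Cc \<and> open U}"

definition vague_borel :: "'a::euclidean_space measure measure" where
  "vague_borel = sigma radon_measures (Collect (openin vague_topology))"

definition discrete_radon :: "'a::euclidean_space measure set" where
  "discrete_radon = {\<eta> \<in> radon_measures. \<exists>A w. countable A \<and> (\<forall>x\<in>A. 0 < w x) \<and>
     (\<forall>B\<in>sets borel. emeasure \<eta> B = (\<integral>\<^sup>+x. ennreal (w x) * indicator B x \<partial>count_space A))}"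

definition discrete_radon_space :: "'a::euclidean_space measure measure" where
  "discrete_radon_space = restrict_space vague_borel discrete_radon"

definition gamma_measure :: "'a::euclidean_space measure measure \<Rightarrow> bool" where
  "gamma_measure \<G> \<longleftrightarrow> prob_space \<G> \<and> sets \<G> = sets discrete_radon_space \<and>
     (\<forall>\<phi>\<in>Cc. (\<forall>x. \<phi> x < 1) \<longrightarrow>
        has_bochner_integral \<G> (\<lambda>\<eta>. exp (\<integral>x. \<phi> x \<partial>\<eta>))
          (exp (- (\<integral>x. ln (1 - \<phi> x) \<partial>lborel))))"

definition atoms :: "'a measure \<Rightarrow> 'a set" where
  "atoms \<eta> = {x. 0 < emeasure \<eta> {x}}"

definition wt :: "'a measure \<Rightarrow> 'a \<Rightarrow> real" where
  "wt \<eta> x = measure \<eta> {x}"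


section \<open>Cylinder functions and their derivatives\<close>

text \<open>Functions on \<open>X \<times> (0, \<infinity>)\<close> with support bounded and bounded away from \<open>X \<times> {0}\<close>
  are represented by their extension by zero.\<close>

definition test_functions :: "('a::euclidean_space \<times> real \<Rightarrow> real) set" where
  "test_functions = {\<phi>. smooth_on (UNIV \<times> {0<..}) \<phi> \<and>
     (\<exists>A a b. bounded A \<and> 0 < a \<and> a < b \<and> (\<forall>p. p \<notin> A \<times> {a..b} \<longrightarrow> \<phi> p = 0))}"

text \<open>Only finitely many terms of this sum are nonzero if \<open>\<phi>\<close> is a test function and \<open>\<eta>\<close> is Radon.\<close>

definition pairing :: "('a \<times> real \<Rightarrow> real) \<Rightarrow> 'a measure \<Rightarrow> real" where
  "pairing \<phi> \<eta> = (\<Sum>\<^sub>\<infinity>x\<in>atoms \<eta>. \<phi> (x, wt \<eta> x))"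

definition FC_repr ::
  "nat \<Rightarrow> ((nat \<Rightarrow> real) \<Rightarrow> real) \<Rightarrow> (nat \<Rightarrow> 'a::euclidean_space \<times> real \<Rightarrow> real)
    \<Rightarrow> ('a measure \<Rightarrow> real) \<Rightarrow> bool" where
  "FC_repr N g \<phi> F \<longleftrightarrow> 1 \<le> N \<and> g \<in> Cb_smooth N \<and> (\<forall>i<N. \<phi> i \<in> test_functions) \<and>
     (\<forall>\<eta>\<in>discrete_radon. F \<eta> = g (\<lambda>i. pairing (\<phi> i) \<eta>))"

definition FC :: "('a::euclidean_space measure \<Rightarrow> real) set" where
  "FC = {F. \<exists>N g \<phi>. FC_repr N g \<phi> F}"

text \<open>The gradients, and below the function of the moved atom, are given by formulas in a
  representation of \<open>F\<close>.  Their value does not depend on the representation: by continuity,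
  \<open>F(\<eta> - s(x)\<delta>\<^sub>x + u\<delta>\<^sub>y)\<close> with \<open>y\<close> outside the countable set of the other atoms
  of \<open>\<eta>\<close> determines \<open>moved_atom F \<eta> x\<close>, and with it the gradients.  The definite
  description picks this common value.\<close>

definition grad_int :: "('a::euclidean_space measure \<Rightarrow> real) \<Rightarrow> 'a measure \<Rightarrow> 'a \<Rightarrow> 'a" where
  "grad_int F \<eta> x = (THE v. \<exists>N g \<phi>. FC_repr N g \<phi> F \<and>
     v = (\<Sum>i<N. (coord_deriv i g (\<lambda>j. pairing (\<phi> j) \<eta>) * (1 / wt \<eta> x)) *\<^sub>R
                   gradient (\<lambda>y. \<phi> i (y, wt \<eta> x)) x))"

definition grad_ext :: "('a::euclidean_space measure \<Rightarrow> real) \<Rightarrow> 'a measure \<Rightarrow> 'a \<Rightarrow> real" where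
  "grad_ext F \<eta> x = (THE v. \<exists>N g \<phi>. FC_repr N g \<phi> F \<and>
     v = (\<Sum>i<N. coord_deriv i g (\<lambda>j. pairing (\<phi> j) \<eta>) * deriv (\<lambda>u. \<phi> i (x, u)) (wt \<eta> x)))"

text \<open>The function \<open>(y, u) \<mapsto> F(\<eta> - s(x)\<delta>\<^sub>x + u\<delta>\<^sub>y)\<close>, read as the smooth function in which the
  contribution \<open>\<phi>\<^sub>i(x, s(x))\<close> of the atom \<open>x\<close> is replaced by \<open>\<phi>\<^sub>i(y, u)\<close>.\<close>

definition moved_atom ::
  "('a::euclidean_space measure \<Rightarrow> real) \<Rightarrow> 'a measure \<Rightarrow> 'a \<Rightarrow> 'a \<times> real \<Rightarrow> real" where
  "moved_atom F \<eta> x = (THE H. \<exists>N g \<phi>. FC_repr N g \<phi> F \<and>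
     H = (\<lambda>(y, u). g (\<lambda>i. pairing (\<phi> i) \<eta> - \<phi> i (x, wt \<eta> x) + \<phi> i (y, u))))"

definition Delta_X :: "('a::euclidean_space measure \<Rightarrow> real) \<Rightarrow> 'a measure \<Rightarrow> 'a \<Rightarrow> real" where
  "Delta_X F \<eta> x = laplacian (\<lambda>y. moved_atom F \<eta> x (y, wt \<eta> x)) x"

definition Delta_R :: "('a::euclidean_space measure \<Rightarrow> real) \<Rightarrow> 'a measure \<Rightarrow> 'a \<Rightarrow> real" where
  "Delta_R F \<eta> x = (let f = (\<lambda>u. moved_atom F \<eta> x (x, u)) in
     deriv (deriv f) (wt \<eta> x) - deriv f (wt \<eta> x))"

definition E_int ::
  "'a::euclidean_space measure measure \<Rightarrow> (real \<Rightarrow> real) \<Rightarrow>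
     ('a measure \<Rightarrow> real) \<Rightarrow> ('a measure \<Rightarrow> real) \<Rightarrow> real" where
  "E_int \<G> c F G =
     (\<integral>\<eta>. (\<integral>x. grad_int F \<eta> x \<bullet> (c (wt \<eta> x) *\<^sub>R grad_int G \<eta> x) \<partial>\<eta>) \<partial>\<G>)"

definition E_ext ::
  "'a::euclidean_space measure measure \<Rightarrow> ('a measure \<Rightarrow> real) \<Rightarrow> ('a measure \<Rightarrow> real) \<Rightarrow> real" where
  "E_ext \<G> F G = (\<integral>\<eta>. (\<integral>x. grad_ext F \<eta> x * grad_ext G \<eta> x \<partial>\<eta>) \<partial>\<G>)"

definition E_M ::
  "'a::euclidean_space measure measure \<Rightarrow> (real \<Rightarrow> real) \<Rightarrow>
     ('a measure \<Rightarrow> real) \<Rightarrow> ('a measure \<Rightarrow> real) \<Rightarrow> real" where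
  "E_M \<G> c F G = E_int \<G> c F G + E_ext \<G> F G"

definition L_int ::
  "(real \<Rightarrow> real) \<Rightarrow> ('a::euclidean_space measure \<Rightarrow> real) \<Rightarrow> 'a measure \<Rightarrow> real" where
  "L_int c F \<eta> = (\<integral>x. c (wt \<eta> x) / (wt \<eta> x)\<^sup>2 * Delta_X F \<eta> x \<partial>\<eta>)"

definition L_ext :: "('a::euclidean_space measure \<Rightarrow> real) \<Rightarrow> 'a measure \<Rightarrow> real" where
  "L_ext F \<eta> = (\<integral>x. Delta_R F \<eta> x \<partial>\<eta>)"

definition L_M ::
  "(real \<Rightarrow> real) \<Rightarrow> ('a::euclidean_space measure \<Rightarrow> real) \<Rightarrow> 'a measure \<Rightarrow> real" where
  "L_M c F \<eta> = L_int c F \<eta> + L_ext F \<eta>"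


section \<open>Operators and bilinear forms in a real \<open>L\<^sup>2\<close> space\<close>

text \<open>Elements of \<open>L\<^sup>2(M)\<close> are represented by square integrable functions.  Operators and forms on
  a set \<open>D\<close> of functions are required to respect equality almost everywhere, so that they are
  operators and forms on the set of equivalence classes of \<open>D\<close>.\<close>

definition L2 :: "'s measure \<Rightarrow> ('s \<Rightarrow> real) set" where
  "L2 M = {f \<in> borel_measurable M. integrable M (\<lambda>x. (f x)\<^sup>2)}"

definition L2_inner :: "'s measure \<Rightarrow> ('s \<Rightarrow> real) \<Rightarrow> ('s \<Rightarrow> real) \<Rightarrow> real" where
  "L2_inner M f g = (\<integral>x. f x * g x \<partial>M)"

definition L2_norm :: "'s measure \<Rightarrow> ('s \<Rightarrow> real) \<Rightarrow> real" where
  "L2_norm M f = sqrt (L2_inner M f f)"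

definition dense_subspace :: "'s measure \<Rightarrow> ('s \<Rightarrow> real) set \<Rightarrow> bool" where
  "dense_subspace M D \<longleftrightarrow> D \<noteq> {} \<and> D \<subseteq> L2 M \<and>
     (\<forall>f\<in>D. \<forall>g\<in>D. \<forall>a b. (\<lambda>x. a * f x + b * g x) \<in> D) \<and>
     (\<forall>f\<in>L2 M. \<forall>e>0. \<exists>g\<in>D. L2_norm M (\<lambda>x. f x - g x) < e)"

definition symmetric_operator ::
  "'s measure \<Rightarrow> (('s \<Rightarrow> real) \<Rightarrow> ('s \<Rightarrow> real)) \<Rightarrow> ('s \<Rightarrow> real) set \<Rightarrow> bool" where
  "symmetric_operator M A D \<longleftrightarrow> dense_subspace M D \<and>
     (\<forall>f\<in>D. A f \<in> L2 M) \<and>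
     (\<forall>f\<in>D. \<forall>g\<in>D. (AE x in M. f x = g x) \<longrightarrow> (AE x in M. A f x = A g x)) \<and>
     (\<forall>f\<in>D. \<forall>g\<in>D. \<forall>a b. AE x in M. A (\<lambda>y. a * f y + b * g y) x = a * A f x + b * A g x) \<and>
     (\<forall>f\<in>D. \<forall>g\<in>D. L2_inner M (A f) g = L2_inner M f (A g))"

text \<open>The last condition says that the domain of the adjoint is contained in \<open>D\<close>.\<close>

definition self_adjoint_operator ::
  "'s measure \<Rightarrow> (('s \<Rightarrow> real) \<Rightarrow> ('s \<Rightarrow> real)) \<Rightarrow> ('s \<Rightarrow> real) set \<Rightarrow> bool" where
  "self_adjoint_operator M A D \<longleftrightarrow> symmetric_operator M A D \<and>
     (\<forall>g\<in>L2 M. (\<exists>h\<in>L2 M. \<forall>f\<in>D. L2_inner M (A f) g = L2_inner M f h) \<longrightarrow> g \<in> D)"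

definition symmetric_form ::
  "'s measure \<Rightarrow> (('s \<Rightarrow> real) \<Rightarrow> ('s \<Rightarrow> real) \<Rightarrow> real) \<Rightarrow> ('s \<Rightarrow> real) set \<Rightarrow> bool" where
  "symmetric_form M E D \<longleftrightarrow> dense_subspace M D \<and>
     (\<forall>f\<in>D. \<forall>g\<in>D. \<forall>h\<in>D. (AE x in M. f x = g x) \<longrightarrow> E f h = E g h) \<and>
     (\<forall>f\<in>D. \<forall>g\<in>D. \<forall>h\<in>D. \<forall>a b. E (\<lambda>x. a * f x + b * g x) h = a * E f h + b * E g h) \<and>
     (\<forall>f\<in>D. \<forall>g\<in>D. E f g = E g f) \<and>
     (\<forall>f\<in>D. 0 \<le> E f f)"

definition form_Cauchy ::
  "(('s \<Rightarrow> real) \<Rightarrow> ('s \<Rightarrow> real) \<Rightarrow> real) \<Rightarrow> (nat \<Rightarrow> 's \<Rightarrow> real) \<Rightarrow> bool" where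
  "form_Cauchy E u \<longleftrightarrow> (\<forall>e>0. \<exists>n0. \<forall>m\<ge>n0. \<forall>n\<ge>n0.
     E (\<lambda>x. u m x - u n x) (\<lambda>x. u m x - u n x) < e)"

definition form_1 ::
  "'s measure \<Rightarrow> (('s \<Rightarrow> real) \<Rightarrow> ('s \<Rightarrow> real) \<Rightarrow> real) \<Rightarrow> ('s \<Rightarrow> real) \<Rightarrow> ('s \<Rightarrow> real) \<Rightarrow> real" where
  "form_1 M E f g = E f g + L2_inner M f g"

definition closed_form ::
  "'s measure \<Rightarrow> (('s \<Rightarrow> real) \<Rightarrow> ('s \<Rightarrow> real) \<Rightarrow> real) \<Rightarrow> ('s \<Rightarrow> real) set \<Rightarrow> bool" where
  "closed_form M E D \<longleftrightarrow> symmetric_form M E D \<and>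
     (\<forall>u. (\<forall>n. u n \<in> D) \<and> form_Cauchy (form_1 M E) u \<longrightarrow>
        (\<exists>f\<in>D. (\<lambda>n. form_1 M E (\<lambda>x. u n x - f x) (\<lambda>x. u n x - f x)) \<longlonglongrightarrow> 0))"

definition closable_form ::
  "'s measure \<Rightarrow> (('s \<Rightarrow> real) \<Rightarrow> ('s \<Rightarrow> real) \<Rightarrow> real) \<Rightarrow> ('s \<Rightarrow> real) set \<Rightarrow> bool" where
  "closable_form M E D \<longleftrightarrow> symmetric_form M E D \<and>
     (\<forall>u. (\<forall>n. u n \<in> D) \<and> form_Cauchy E u \<and> (\<lambda>n. L2_norm M (u n)) \<longlonglongrightarrow> 0 \<longrightarrow>
        (\<lambda>n. E (u n) (u n)) \<longlonglongrightarrow> 0)"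

definition approximates ::
  "'s measure \<Rightarrow> (('s \<Rightarrow> real) \<Rightarrow> ('s \<Rightarrow> real) \<Rightarrow> real) \<Rightarrow> ('s \<Rightarrow> real) set \<Rightarrow>
     (nat \<Rightarrow> 's \<Rightarrow> real) \<Rightarrow> ('s \<Rightarrow> real) \<Rightarrow> bool" where
  "approximates M E D u f \<longleftrightarrow> (\<forall>n. u n \<in> D) \<and> form_Cauchy E u \<and>
     (\<lambda>n. L2_norm M (\<lambda>x. u n x - f x)) \<longlonglongrightarrow> 0"

text \<open>The closure (smallest closed extension) of a closable form, by completion inside \<open>L\<^sup>2(M)\<close>;
  closability makes the limit defining \<open>closure_form\<close> independent of the sequences.\<close>

definition closure_dom ::
  "'s measure \<Rightarrow> (('s \<Rightarrow> real) \<Rightarrow> ('s \<Rightarrow> real) \<Rightarrow> real) \<Rightarrow> ('s \<Rightarrow> real) set \<Rightarrow> ('s \<Rightarrow> real) set" where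
  "closure_dom M E D = {f \<in> L2 M. \<exists>u. approximates M E D u f}"

definition closure_form ::
  "'s measure \<Rightarrow> (('s \<Rightarrow> real) \<Rightarrow> ('s \<Rightarrow> real) \<Rightarrow> real) \<Rightarrow> ('s \<Rightarrow> real) set \<Rightarrow>
     ('s \<Rightarrow> real) \<Rightarrow> ('s \<Rightarrow> real) \<Rightarrow> real" where
  "closure_form M E D f g = (THE l. \<exists>u v. approximates M E D u f \<and> approximates M E D v g \<and>
     (\<lambda>n. E (u n) (v n)) \<longlonglongrightarrow> l)"

definition dirichlet_form ::
  "'s measure \<Rightarrow> (('s \<Rightarrow> real) \<Rightarrow> ('s \<Rightarrow> real) \<Rightarrow> real) \<Rightarrow> ('s \<Rightarrow> real) set \<Rightarrow> bool" where
  "dirichlet_form M E D \<longleftrightarrow> closed_form M E D \<and>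
     (\<forall>f\<in>D. let f1 = (\<lambda>x. min (max (f x) 0) 1) in f1 \<in> D \<and> E f1 f1 \<le> E f f)"

text \<open>The Friedrichs extension of a nonnegative symmetric operator \<open>A\<close> is the self-adjoint extension
  \<open>B\<close> of \<open>A\<close> that is the operator of the closure of the form \<open>(f, g) \<mapsto> (A f, g)\<close>.\<close>

definition friedrichs_extension ::
  "'s measure \<Rightarrow> (('s \<Rightarrow> real) \<Rightarrow> ('s \<Rightarrow> real)) \<Rightarrow> ('s \<Rightarrow> real) set \<Rightarrow>
     (('s \<Rightarrow> real) \<Rightarrow> ('s \<Rightarrow> real)) \<Rightarrow> ('s \<Rightarrow> real) set \<Rightarrow> bool" where
  "friedrichs_extension M A D B D' \<longleftrightarrow>
     (let q = (\<lambda>f g. L2_inner M (A f) g); Dq = closure_dom M q D; q' = closure_form M q D in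
       symmetric_operator M A D \<and> (\<forall>f\<in>D. 0 \<le> L2_inner M (A f) f) \<and>
       closable_form M q D \<and>
       self_adjoint_operator M B D' \<and>
       D \<subseteq> D' \<and> (\<forall>f\<in>D. AE x in M. B f x = A f x) \<and>
       D' = {f \<in> Dq. \<exists>h\<in>L2 M. \<forall>g\<in>Dq. q' f g = L2_inner M h g} \<and>
       (\<forall>f\<in>D'. \<forall>g\<in>Dq. q' f g = L2_inner M (B f) g))"

end

theory Submission
 imports Defs
begin

text \<open>Every form is an integral of a weighted square of first derivatives in the position and the mark of an
 atom.  The Mecke identity for \<open>\<G>\<close>, which is obtained by differentiating the Laplace transform, turns
 \<open>\<integral> d\<G>(\<eta>) \<integral> d\<eta>(x) f(\<eta>, x)\<close> into \<open>\<integral> d\<G>(\<eta>) \<integral> dx \<integral>\<^sub>0\<^sup>\<infinity> ds e\<^sup>-\<^sup>s f(\<eta> + s \<delta>\<^sub>x, x)\<close>; for fixed \<open>\<eta>\<close> one can then integrate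
 by parts in \<open>(x, s)\<close>, which gives \<open>\<E>(F, G) = (- L F, G)\<close>.  This identity implies that the form is closable
 and that the Friedrichs extension exists.  The closure is Markovian because smooth contractions do not
 increase the form on cylinder functions and the closure is lower semicontinuous in \<open>L\<^sup>2\<close>.\<close>

text \<open>The coefficient \<open>c\<close> is only measurable and locally bounded, so no
  derivative may fall on it. In a spatial direction the weight \<open>c s / s^2\<close> is constant
  along the lines of integration; in the mark direction the weight is \<open>exp (- s)\<close>
  alone, whose logarithmic derivative -1 is the first-order term of \<open>Delta_R\<close>. Both
  cases become one computation over basis vectors \<open>e\<close> of
  \<open>'a \<times> real\<close> with a weight \<open>ew e\<close>, and the intrinsic and extrinsic
  operators differ only in the set of directions. The Laplace transform speaks only about
  exponentials of integrals of \<open>Cc\<close> functions. To reach functions of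
  \<open>(\<eta>, x)\<close>, and to see that cylinder functions are dense, three \<sigma>-algebras
  on \<open>\<K>\<close> have to agree: the trace of the vague Borel sets, the one generated by
  integrals of \<open>Cc\<close> functions, and the one generated by \<open>FC\<close>. A countable
  base of the vague topology and a functional monotone class theorem achieve this. Square
  integrability of \<open>L F\<close> rests on exponential moments contained in the Laplace
  transform, because \<open>L F\<close> is bounded by a multiple of the mass near a bounded
  set.\<close>

abbreviation L2_dist :: "'s measure \<Rightarrow> ('s \<Rightarrow> real) \<Rightarrow> ('s \<Rightarrow> real) \<Rightarrow> real" where
 "L2_dist M f g \<equiv> L2_norm M (\<lambda>x. f x - g x)"

abbreviation discrete_measures ("\<K>") where "\<K> \<equiv> discrete_radon"

section \<open>Nonnegative symmetric bilinear forms\<close>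

text \<open>Interpreted for the inner product of \<open>L2\<close>, for a form on its domain, for
  the closure of a form, and for \<open>form_1\<close>. Members are functions and not classes, so
  the form may be degenerate and \<open>nrm\<close> is only a seminorm.\<close>

locale semi_inner =
 fixes B :: "('s \<Rightarrow> real) \<Rightarrow> ('s \<Rightarrow> real) \<Rightarrow> real" and D :: "('s \<Rightarrow> real) set"
 assumes ne: "D \<noteq> {}"
  and lin: "f \<in> D \<Longrightarrow> g \<in> D \<Longrightarrow> (\<lambda>x. a * f x + b * g x) \<in> D"
  and lin1: "f \<in> D \<Longrightarrow> g \<in> D \<Longrightarrow> h \<in> D \<Longrightarrow> B (\<lambda>x. a * f x + b * g x) h = a * B f h + b * B g h"
  and sym: "f \<in> D \<Longrightarrow> g \<in> D \<Longrightarrow> B f g = B g f"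
  and nonneg: "f \<in> D \<Longrightarrow> 0 \<le> B f f"
begin

lemma lin2: "f \<in> D \<Longrightarrow> g \<in> D \<Longrightarrow> h \<in> D \<Longrightarrow> B h (\<lambda>x. a * f x + b * g x) = a * B h f + b * B h g"
 using sym[of h "\<lambda>x. a * f x + b * g x"] lin[of f g a b] lin1[of f g h a b] sym[of f h] sym[of g h] by simp

lemma diff_mem: "f \<in> D \<Longrightarrow> g \<in> D \<Longrightarrow> (\<lambda>x. f x - g x) \<in> D" using lin[of f g 1 "-1"] by simp

lemma add_mem: "f \<in> D \<Longrightarrow> g \<in> D \<Longrightarrow> (\<lambda>x. f x + g x) \<in> D" using lin[of f g 1 1] by simp

lemma scale_mem: "f \<in> D \<Longrightarrow> (\<lambda>x. a * f x) \<in> D" using lin[of f f a 0] by simp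

lemma zero_mem: "(\<lambda>x. 0) \<in> D" using ne scale_mem[of _ 0] by auto

lemma diff1: "f \<in> D \<Longrightarrow> g \<in> D \<Longrightarrow> h \<in> D \<Longrightarrow> B (\<lambda>x. f x - g x) h = B f h - B g h" using lin1[of f g h 1 "-1"] by simp

lemma diff2: "f \<in> D \<Longrightarrow> g \<in> D \<Longrightarrow> h \<in> D \<Longrightarrow> B h (\<lambda>x. f x - g x) = B h f - B h g" using lin2[of f g h 1 "-1"] by simp

lemma scale1: "f \<in> D \<Longrightarrow> h \<in> D \<Longrightarrow> B (\<lambda>x. a * f x) h = a * B f h" using lin1[of f f h a 0] by simp

lemma quad: "f \<in> D \<Longrightarrow> g \<in> D \<Longrightarrow>
  B (\<lambda>x. a * f x + b * g x) (\<lambda>x. a * f x + b * g x) = a\<^sup>2 * B f f + 2 * a * b * B f g + b\<^sup>2 * B g g"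
 by (simp add: lin1 lin2 lin sym[of g f] algebra_simps power2_eq_square)

lemma quad_diff: "f \<in> D \<Longrightarrow> g \<in> D \<Longrightarrow>
  B (\<lambda>x. f x - g x) (\<lambda>x. f x - g x) = B f f - 2 * B f g + B g g"
 using quad[of f g 1 "-1"] by simp

definition nrm :: "('s \<Rightarrow> real) \<Rightarrow> real" where "nrm f = sqrt (B f f)"

lemma nrm_nonneg: "f \<in> D \<Longrightarrow> 0 \<le> nrm f" by (simp add: nrm_def nonneg)

lemma nrm_sq: "f \<in> D \<Longrightarrow> (nrm f)\<^sup>2 = B f f" by (simp add: nrm_def nonneg)

lemma Cauchy_Schwarz:
 assumes f: "f \<in> D" and g: "g \<in> D"
 shows "\<bar>B f g\<bar> \<le> nrm f * nrm g"
proof -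
 have pos: "0 \<le> a\<^sup>2 * B f f + 2 * a * b * B f g + b\<^sup>2 * B g g" for a b
  using nonneg[OF lin[OF f g, of a b]] quad[OF f g, of a b] by simp
 have "(B f g)\<^sup>2 \<le> B f f * B g g"
 proof (cases "B g g = 0")
  case True
  have "B f g = 0"
  proof (rule ccontr)
   assume n: "B f g \<noteq> 0"
   \<comment> \<open>With \<open>B g g = 0\<close> the quadratic is affine in the coefficient of
     \<open>g\<close>; this coefficient makes its value -1.\<close>
   have "0 \<le> B f f + 2 * (- (B f f + 1) / (2 * B f g)) * B f g"
    using pos[of 1 "- (B f f + 1) / (2 * B f g)"] True by simp
   then show False using n by (simp add: field_simps)
  qed
  then show ?thesis using nonneg[OF f] True by simp
 next
  case False
  then have gp: "0 < B g g" using nonneg[OF g] by simp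
  \<comment> \<open>Coefficients of the part of \<open>f\<close> orthogonal to \<open>g\<close>,
    scaled by \<open>B g g\<close> to avoid a quotient.\<close>
  have "0 \<le> (B g g)\<^sup>2 * B f f + 2 * (B g g) * (- B f g) * B f g + (- B f g)\<^sup>2 * B g g" by (rule pos)
  then have "0 \<le> B g g * (B f f * B g g - (B f g)\<^sup>2)" by (simp add: power2_eq_square algebra_simps)
  then have "0 \<le> B f f * B g g - (B f g)\<^sup>2" using gp by (simp add: zero_le_mult_iff)
  then show ?thesis by simp
 qed
 then have "sqrt ((B f g)\<^sup>2) \<le> sqrt (B f f * B g g)" by (rule real_sqrt_le_mono)
 then show ?thesis by (simp add: nrm_def real_sqrt_mult)
qed

lemma nrm_diff_sym: "f \<in> D \<Longrightarrow> g \<in> D \<Longrightarrow> nrm (\<lambda>x. f x - g x) = nrm (\<lambda>x. g x - f x)"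
 by (simp add: nrm_def quad_diff sym[of f g])

lemma nrm_scale: "f \<in> D \<Longrightarrow> nrm (\<lambda>x. a * f x) = \<bar>a\<bar> * nrm f"
 using quad[of f f a 0] nonneg[of f] by (simp add: nrm_def real_sqrt_mult)

lemma nrm_add:
 assumes f: "f \<in> D" and g: "g \<in> D"
 shows "nrm (\<lambda>x. f x + g x) \<le> nrm f + nrm g"
proof -
 have "(nrm (\<lambda>x. f x + g x))\<^sup>2 = B f f + 2 * B f g + B g g"
  using quad[OF f g, of 1 1] nrm_sq[OF add_mem[OF f g]] by simp
 also have "\<dots> \<le> (nrm f + nrm g)\<^sup>2" using Cauchy_Schwarz[OF f g] nrm_sq[OF f] nrm_sq[OF g] by (simp add: power2_sum)
 finally show ?thesis by (rule power2_le_imp_le) (simp add: nrm_nonneg f g)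
qed

lemma nrm_lin:
 assumes "f \<in> D" "g \<in> D"
 shows "nrm (\<lambda>x. a * f x + b * g x) \<le> \<bar>a\<bar> * nrm f + \<bar>b\<bar> * nrm g"
 using nrm_add[OF scale_mem[OF assms(1), of a] scale_mem[OF assms(2), of b]] by (simp add: nrm_scale assms)

lemma nrm_triangle:
 assumes "f \<in> D" "g \<in> D" "h \<in> D"
 shows "nrm (\<lambda>x. f x - h x) \<le> nrm (\<lambda>x. f x - g x) + nrm (\<lambda>x. g x - h x)"
 using nrm_add[OF diff_mem[OF assms(1,2)] diff_mem[OF assms(2,3)]] by simp

lemma nrm_abs_diff:
 assumes f: "f \<in> D" and g: "g \<in> D"
 shows "\<bar>nrm f - nrm g\<bar> \<le> nrm (\<lambda>x. f x - g x)"
 using nrm_triangle[OF f g zero_mem] nrm_triangle[OF g f zero_mem] nrm_diff_sym[OF f g] by (simp add: abs_le_iff)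

text \<open>Written with the midpoint because it is applied to minimising sequences in convex sets:
  the energy of the midpoint is bounded below by the infimum, so the energy of the difference is
  small.\<close>

lemma parallelogram:
 assumes f: "f \<in> D" and g: "g \<in> D"
 shows "B (\<lambda>x. f x - g x) (\<lambda>x. f x - g x)
   = 2 * B f f + 2 * B g g - 4 * B (\<lambda>x. 1/2 * f x + 1/2 * g x) (\<lambda>x. 1/2 * f x + 1/2 * g x)"
 unfolding quad[OF f g] quad_diff[OF f g] by (simp add: power2_eq_square)

lemma form_Cauchy_nrm:
 assumes u: "\<And>n. u n \<in> D"
 shows "form_Cauchy B u \<longleftrightarrow> (\<forall>e>0. \<exists>n0. \<forall>m\<ge>n0. \<forall>n\<ge>n0. nrm (\<lambda>x. u m x - u n x) < e)"
proof
 assume L: "form_Cauchy B u"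
 show "\<forall>e>0. \<exists>n0. \<forall>m\<ge>n0. \<forall>n\<ge>n0. nrm (\<lambda>x. u m x - u n x) < e"
 proof (intro allI impI)
  fix e :: real assume e: "0 < e"
  then have "0 < e\<^sup>2" by simp
  then obtain n0 where n0: "\<And>m n. m \<ge> n0 \<Longrightarrow> n \<ge> n0 \<Longrightarrow>
    B (\<lambda>x. u m x - u n x) (\<lambda>x. u m x - u n x) < e\<^sup>2"
   using L unfolding form_Cauchy_def by blast
  have "nrm (\<lambda>x. u m x - u n x) < e" if "m \<ge> n0" "n \<ge> n0" for m n
   using real_sqrt_less_mono[OF n0[OF that]] e by (simp add: nrm_def)
  then show "\<exists>n0. \<forall>m\<ge>n0. \<forall>n\<ge>n0. nrm (\<lambda>x. u m x - u n x) < e" by blast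
 qed
next
 assume R: "\<forall>e>0. \<exists>n0. \<forall>m\<ge>n0. \<forall>n\<ge>n0. nrm (\<lambda>x. u m x - u n x) < e"
 show "form_Cauchy B u" unfolding form_Cauchy_def
 proof (intro allI impI)
  fix e :: real assume e: "0 < e"
  then have "0 < sqrt e" by simp
  then obtain n0 where n0: "\<And>m n. m \<ge> n0 \<Longrightarrow> n \<ge> n0 \<Longrightarrow> nrm (\<lambda>x. u m x - u n x) < sqrt e" using R by blast
  then have "B (\<lambda>x. u m x - u n x) (\<lambda>x. u m x - u n x) < e" if "m \<ge> n0" "n \<ge> n0" for m n
   using that by (force simp: nrm_def)
  then show "\<exists>n0. \<forall>m\<ge>n0. \<forall>n\<ge>n0. B (\<lambda>x. u m x - u n x) (\<lambda>x. u m x - u n x) < e" by blast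
 qed
qed

lemma form_Cauchy_lin:
 assumes u: "\<And>n. u n \<in> D" and v: "\<And>n. v n \<in> D"
  and cu: "form_Cauchy B u" and cv: "form_Cauchy B v"
 shows "form_Cauchy B (\<lambda>n x. a * u n x + b * v n x)"
 unfolding form_Cauchy_nrm[of "\<lambda>n x. a * u n x + b * v n x", OF lin[OF u v]]
proof (intro allI impI)
 fix e :: real assume e: "0 < e"
 define d where "d = e / (\<bar>a\<bar> + \<bar>b\<bar> + 1)"
 have d: "0 < d" using e by (simp add: d_def)
 obtain n1 where n1: "\<And>m n. m \<ge> n1 \<Longrightarrow> n \<ge> n1 \<Longrightarrow> nrm (\<lambda>x. u m x - u n x) < d"
  using cu d unfolding form_Cauchy_nrm[of u, OF u] by blast
 obtain n2 where n2: "\<And>m n. m \<ge> n2 \<Longrightarrow> n \<ge> n2 \<Longrightarrow> nrm (\<lambda>x. v m x - v n x) < d"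
  using cv d unfolding form_Cauchy_nrm[of v, OF v] by blast
 have "nrm (\<lambda>x. (a * u m x + b * v m x) - (a * u n x + b * v n x)) < e"
  if m: "m \<ge> max n1 n2" and n: "n \<ge> max n1 n2" for m n
 proof -
  have "(\<lambda>x. (a * u m x + b * v m x) - (a * u n x + b * v n x)) =
    (\<lambda>x. a * (u m x - u n x) + b * (v m x - v n x))" by (simp add: algebra_simps fun_eq_iff)
  then have "nrm (\<lambda>x. (a * u m x + b * v m x) - (a * u n x + b * v n x))
    \<le> \<bar>a\<bar> * nrm (\<lambda>x. u m x - u n x) + \<bar>b\<bar> * nrm (\<lambda>x. v m x - v n x)"
   using nrm_lin[OF diff_mem[OF u u] diff_mem[OF v v]] by simp
  also have "\<dots> \<le> \<bar>a\<bar> * d + \<bar>b\<bar> * d" using n1[of m n] n2[of m n] m n by (intro add_mono mult_left_mono) auto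
  also have "\<dots> < (\<bar>a\<bar> + \<bar>b\<bar> + 1) * d" using d by (simp add: algebra_simps)
  also have "\<dots> = e" by (simp add: d_def)
  finally show ?thesis .
 qed
 then show "\<exists>n0. \<forall>m\<ge>n0. \<forall>n\<ge>n0. nrm (\<lambda>x. (a * u m x + b * v m x) - (a * u n x + b * v n x)) < e" by blast
qed

text \<open>The reverse triangle inequality makes \<open>nrm (u n)\<close> a Cauchy sequence of
  reals, so the energies converge although \<open>u\<close> may have no limit in
  \<open>D\<close>.\<close>

lemma form_Cauchy_convergent:
 assumes u: "\<And>n. u n \<in> D" and cu: "form_Cauchy B u"
 shows "convergent (\<lambda>n. B (u n) (u n))"
proof -
 have "Cauchy (\<lambda>n. nrm (u n))"
 proof (rule CauchyI)
  fix e :: real assume "0 < e"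
  then obtain n0 where n0: "\<And>m n. m \<ge> n0 \<Longrightarrow> n \<ge> n0 \<Longrightarrow> nrm (\<lambda>x. u m x - u n x) < e"
   using cu unfolding form_Cauchy_nrm[of u, OF u] by blast
  have "norm (nrm (u m) - nrm (u n)) < e" if "m \<ge> n0" "n \<ge> n0" for m n
   using nrm_abs_diff[OF u[of m] u[of n]] n0[OF that] by simp
  then show "\<exists>M. \<forall>m\<ge>M. \<forall>n\<ge>M. norm (nrm (u m) - nrm (u n)) < e" by blast
 qed
 then obtain l where "(\<lambda>n. nrm (u n)) \<longlonglongrightarrow> l" using Cauchy_convergent convergent_def by blast
 then have "(\<lambda>n. (nrm (u n))\<^sup>2) \<longlonglongrightarrow> l\<^sup>2" by (rule tendsto_power)
 then show ?thesis by (auto simp: convergent_def nrm_sq u)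
qed

lemma form_Cauchy_bounded:
 assumes u: "\<And>n. u n \<in> D" and cu: "form_Cauchy B u"
 obtains K where "\<And>n. nrm (u n) \<le> K" "0 < K"
proof -
 have "Bseq (\<lambda>n. B (u n) (u n))" using form_Cauchy_convergent[OF assms] by (rule convergent_imp_Bseq)
 then obtain K where K: "0 < K" "\<And>n. norm (B (u n) (u n)) \<le> K" by (auto simp: Bseq_def)
 have "nrm (u n) \<le> sqrt K" for n using K(2)[of n] by (simp add: nrm_def)
 then show ?thesis using that[of "sqrt K"] K by simp
qed

end


section \<open>The space of square integrable functions\<close>

lemma L2_mult_integrable:
 assumes "f \<in> L2 M" "g \<in> L2 M"
 shows "integrable M (\<lambda>x. f x * g x)"
proof (rule Bochner_Integration.integrable_bound)
 show "integrable M (\<lambda>x. (f x)\<^sup>2 + (g x)\<^sup>2)" using assms by (auto simp: L2_def)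
 show "(\<lambda>x. f x * g x) \<in> borel_measurable M" using assms by (auto simp: L2_def)
 have "\<bar>a * b\<bar> \<le> a\<^sup>2 + b\<^sup>2" for a b :: real
 proof -
  have "2 * \<bar>a * b\<bar> \<le> a\<^sup>2 + b\<^sup>2" using sum_squares_bound[of "\<bar>a\<bar>" "\<bar>b\<bar>"] by (simp add: abs_mult)
  then show ?thesis using abs_ge_zero[of "a * b"] by linarith
 qed
 then show "AE x in M. norm (f x * g x) \<le> norm ((f x)\<^sup>2 + (g x)\<^sup>2)" by simp
qed

lemma L2_lin:
 assumes "f \<in> L2 M" "g \<in> L2 M"
 shows "(\<lambda>x. a * f x + b * g x) \<in> L2 M"
proof -
 have "(\<lambda>x. (a * f x + b * g x)\<^sup>2) = (\<lambda>x. a\<^sup>2 * (f x)\<^sup>2 + 2 * a * b * (f x * g x) + b\<^sup>2 * (g x)\<^sup>2)"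
  by (simp add: fun_eq_iff power2_eq_square algebra_simps)
 then show ?thesis using assms L2_mult_integrable[OF assms] by (auto simp: L2_def)
qed

interpretation L2: semi_inner "L2_inner M" "L2 M"
proof
 show "L2 M \<noteq> {}" by (auto simp: L2_def intro!: exI[of _ "\<lambda>_. 0"])
 show "(\<lambda>x. a * f x + b * g x) \<in> L2 M" if "f \<in> L2 M" "g \<in> L2 M" for f g a b using that by (rule L2_lin)
 show "L2_inner M (\<lambda>x. a * f x + b * g x) h = a * L2_inner M f h + b * L2_inner M g h"
  if "f \<in> L2 M" "g \<in> L2 M" "h \<in> L2 M" for f g h a b
 proof -
  have "(\<lambda>x. (a * f x + b * g x) * h x) = (\<lambda>x. a * (f x * h x) + b * (g x * h x))"
   by (simp add: fun_eq_iff algebra_simps)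
  then show ?thesis
   using L2_mult_integrable[OF that(1,3)] L2_mult_integrable[OF that(2,3)] by (simp add: L2_inner_def)
 qed
 show "L2_inner M f g = L2_inner M g f" for f g by (simp add: L2_inner_def mult.commute)
 show "0 \<le> L2_inner M f f" for f by (simp add: L2_inner_def)
qed

lemma L2_nrm_eq: "semi_inner.nrm (L2_inner M) = L2_norm M" by (simp add: fun_eq_iff L2.nrm_def L2_norm_def)

lemma L2_norm_nonneg [simp]: "0 \<le> L2_norm M f" by (simp add: L2_norm_def L2_inner_def)

lemma L2_norm_sq: "(L2_norm M f)\<^sup>2 = (\<integral>x. (f x)\<^sup>2 \<partial>M)"
 by (simp add: L2_norm_def L2_inner_def power2_eq_square[symmetric])

lemma L2_inner_cong:
 assumes "f \<in> L2 M" "f' \<in> L2 M" "g \<in> L2 M" "g' \<in> L2 M" "AE x in M. f x = f' x" "AE x in M. g x = g' x"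
 shows "L2_inner M f g = L2_inner M f' g'"
 unfolding L2_inner_def by (rule integral_cong_AE) (use assms in \<open>auto simp: L2_def\<close>)

lemma L2_norm_eq_0:
 assumes "f \<in> L2 M"
 shows "L2_norm M f = 0 \<longleftrightarrow> (AE x in M. f x = 0)"
proof -
 have "L2_norm M f = 0 \<longleftrightarrow> (\<integral>x. (f x)\<^sup>2 \<partial>M) = 0" unfolding L2_norm_sq[symmetric] by simp
 also have "\<dots> \<longleftrightarrow> (AE x in M. (f x)\<^sup>2 = 0)" by (rule integral_nonneg_eq_0_iff_AE) (use assms in \<open>auto simp: L2_def\<close>)
 finally show ?thesis by simp
qed

text \<open>For an approximant \<open>g\<close> of \<open>f\<close> in \<open>D\<close> the squared
  norm of \<open>f\<close> equals the inner product of \<open>f\<close> with \<open>f - g\<close>,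
  which is at most the norm of \<open>f\<close> times an arbitrarily small number.\<close>

lemma dense_orthogonal:
 assumes D: "dense_subspace M D" and f: "f \<in> L2 M" and orth: "\<And>g. g \<in> D \<Longrightarrow> L2_inner M f g = 0"
 shows "AE x in M. f x = 0"
proof -
 have "L2_norm M f \<le> e" if e: "0 < e" for e
 proof -
  obtain g where g: "g \<in> D" and ge: "L2_dist M f g < e" using D f e unfolding dense_subspace_def by blast
  have g2: "g \<in> L2 M" using g D by (auto simp: dense_subspace_def)
  have "(L2_norm M f)\<^sup>2 = L2_inner M f (\<lambda>x. f x - g x)"
   using L2.diff2[OF f g2 f] orth[OF g] L2.nrm_sq[OF f] by (simp add: L2_nrm_eq)
  also have "\<dots> \<le> L2_norm M f * L2_dist M f g"
   using L2.Cauchy_Schwarz[OF f L2.diff_mem[OF f g2]] by (simp add: L2_nrm_eq)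
  also have "\<dots> \<le> L2_norm M f * e" using ge by (intro mult_left_mono) auto
  finally show ?thesis using e by (cases "L2_norm M f = 0") (auto simp: power2_eq_square order_less_le)
 qed
 then have "L2_norm M f = 0" using field_le_epsilon[of "L2_norm M f" 0] L2_norm_nonneg[of M f] by force
 then show ?thesis using L2_norm_eq_0[OF f] by simp
qed

lemma L2_dominated_convergence:
 assumes f: "f \<in> borel_measurable M" and fn: "\<And>n. fn n \<in> borel_measurable M"
  and w: "w \<in> L2 M" and lim: "AE x in M. (\<lambda>n. fn n x) \<longlonglongrightarrow> f x"
  and bd: "\<And>n. AE x in M. \<bar>fn n x - f x\<bar> \<le> w x"
 shows "(\<lambda>n. L2_dist M (fn n) f) \<longlonglongrightarrow> 0"
proof -
 have "(\<lambda>n. \<integral>x. (fn n x - f x)\<^sup>2 \<partial>M) \<longlonglongrightarrow> (\<integral>x. 0 \<partial>M)"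
 proof (rule integral_dominated_convergence[where w = "\<lambda>x. (w x)\<^sup>2"])
  show "AE x in M. (\<lambda>n. (fn n x - f x)\<^sup>2) \<longlonglongrightarrow> 0" using lim
  proof eventually_elim
   case (elim x)
   have "(\<lambda>n. (fn n x - f x)\<^sup>2) \<longlonglongrightarrow> (f x - f x)\<^sup>2" by (intro tendsto_intros elim)
   then show ?case by simp
  qed
  show "AE x in M. norm ((fn n x - f x)\<^sup>2) \<le> (w x)\<^sup>2" for n
   using bd[of n] by eventually_elim (simp add: abs_le_square_iff[symmetric])
 qed (use f fn w in \<open>auto simp: L2_def\<close>)
 then have "(\<lambda>n. sqrt (\<integral>x. (fn n x - f x)\<^sup>2 \<partial>M)) \<longlonglongrightarrow> sqrt 0" by (intro tendsto_real_sqrt) simp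
 then show ?thesis by (simp add: L2_norm_def L2_inner_def power2_eq_square)
qed

text \<open>The partial sums of the increments have norm at most 2, so by monotone convergence the
  square of their supremum is integrable and hence finite almost everywhere; there the telescoping
  series converges absolutely.\<close>

lemma L2_Cauchy_AE:
 assumes u: "\<And>n. u n \<in> L2 M" and fast: "\<And>n. L2_dist M (u (Suc n)) (u n) \<le> (1/2) ^ n"
 shows "AE x in M. convergent (\<lambda>n. u n x)"
proof -
 define d where "d = (\<lambda>n x. \<bar>u (Suc n) x - u n x\<bar>)"
 have dL: "d n \<in> L2 M" for n using L2.diff_mem[OF u[of "Suc n"] u[of n]] by (auto simp: d_def L2_def)
 have dn: "L2_norm M (d n) \<le> (1/2) ^ n" for n
  using fast[of n] by (simp add: d_def L2_norm_def L2_inner_def power2_eq_square[symmetric])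
 define S where "S = (\<lambda>m x. \<Sum>n<m. d n x)"
 have SL: "S m \<in> L2 M \<and> L2_norm M (S m) \<le> 2" for m
 proof -
  have "S m \<in> L2 M \<and> L2_norm M (S m) \<le> (\<Sum>n<m. (1/2) ^ n)"
  proof (induction m)
   case 0
   show ?case using L2.zero_mem[of M] by (simp add: S_def L2_norm_def L2_inner_def)
  next
   case (Suc m)
   have eq: "S (Suc m) = (\<lambda>x. S m x + d m x)" by (simp add: S_def fun_eq_iff)
   show ?case unfolding eq using Suc L2.add_mem[of "S m" M "d m"] L2.nrm_add[of "S m" M "d m"] dL[of m] dn[of m]
    by (simp add: L2_nrm_eq)
  qed
  moreover have "(\<Sum>n<m. (1/2::real) ^ n) \<le> 2" using sum_gp_strict[of "1/2::real" m] by simp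
  ultimately show ?thesis by linarith
 qed
 have Smeas: "S m \<in> borel_measurable M" for m using SL[of m] by (auto simp: L2_def)
 have "(\<integral>\<^sup>+x. ennreal ((S m x)\<^sup>2) \<partial>M) \<le> ennreal 4" for m
 proof -
  have "(\<integral>\<^sup>+x. ennreal ((S m x)\<^sup>2) \<partial>M) = ennreal (\<integral>x. (S m x)\<^sup>2 \<partial>M)"
   by (rule nn_integral_eq_integral) (use SL[of m] in \<open>auto simp: L2_def\<close>)
  also have "(\<integral>x. (S m x)\<^sup>2 \<partial>M) \<le> 2\<^sup>2" unfolding L2_norm_sq[symmetric] using SL[of m] by (intro power_mono) auto
  finally show ?thesis by (simp add: ennreal_leI)
 qed
 then have sup: "(SUP m. \<integral>\<^sup>+x. ennreal ((S m x)\<^sup>2) \<partial>M) \<le> ennreal 4" by (simp add: SUP_le_iff)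
 have Smono: "S m x \<le> S n x" if "m \<le> n" for m n x unfolding S_def using that by (intro sum_mono2) (auto simp: d_def)
 have S0: "0 \<le> S m x" for m x by (auto simp: S_def d_def intro: sum_nonneg)
 have "(\<integral>\<^sup>+x. (SUP m. ennreal ((S m x)\<^sup>2)) \<partial>M) = (SUP m. \<integral>\<^sup>+x. ennreal ((S m x)\<^sup>2) \<partial>M)"
 proof (rule nn_integral_monotone_convergence_SUP)
  show "incseq (\<lambda>m x. ennreal ((S m x)\<^sup>2))"
   using Smono S0 by (auto simp: incseq_def le_fun_def intro!: ennreal_leI power_mono)
  show "(\<lambda>x. ennreal ((S i x)\<^sup>2)) \<in> borel_measurable M" for i using Smeas[of i] by measurable
 qed
 also have "\<dots> \<le> ennreal 4" by (rule sup)
 finally have "(\<integral>\<^sup>+x. (SUP m. ennreal ((S m x)\<^sup>2)) \<partial>M) < \<infinity>" by (rule le_less_trans) simp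
 then have "(\<integral>\<^sup>+x. (SUP m. ennreal ((S m x)\<^sup>2)) \<partial>M) \<noteq> \<infinity>" by simp
 moreover have "(\<lambda>x. (SUP m. ennreal ((S m x)\<^sup>2))) \<in> borel_measurable M" using Smeas by measurable
 ultimately have "AE x in M. (SUP m. ennreal ((S m x)\<^sup>2)) \<noteq> \<infinity>" using nn_integral_PInf_AE by blast
 then show ?thesis
 proof eventually_elim
  case (elim x)
  obtain K where K: "(SUP m. ennreal ((S m x)\<^sup>2)) = ennreal K" "0 \<le> K"
   using elim by (cases "SUP m. ennreal ((S m x)\<^sup>2)") auto
  have "S m x \<le> sqrt K" for m
  proof -
   have "ennreal ((S m x)\<^sup>2) \<le> ennreal K" unfolding K(1)[symmetric] by (rule SUP_upper) simp
   then have "(S m x)\<^sup>2 \<le> K" using K(2) by simp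
   then show ?thesis by (rule real_le_rsqrt)
  qed
  then have "summable (\<lambda>n. d n x)" by (intro summableI_nonneg_bounded[of _ "sqrt K"]) (auto simp: d_def S_def)
  then have "summable (\<lambda>n. u (Suc n) x - u n x)" unfolding d_def by (rule summable_rabs_cancel)
  then have "convergent (\<lambda>n. \<Sum>i<n. u (Suc i) x - u i x)" by (simp add: summable_iff_convergent)
  then have "convergent (\<lambda>n. (u n x - u 0 x) + u 0 x)"
   unfolding sum_lessThan_telescope[of "\<lambda>i. u i x"] by (intro convergent_add convergent_const)
  then show ?case by simp
 qed
qed

text \<open>Riesz-Fischer: a subsequence with distances at most \<open>(1/2) ^ n\<close> converges
  almost everywhere, and Fatou's lemma carries the Cauchy estimate over to its limit.\<close>

lemma L2_complete:
 assumes u: "\<And>n. u n \<in> L2 M" and C: "form_Cauchy (L2_inner M) u"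
 obtains f where "f \<in> L2 M" "(\<lambda>n. L2_dist M (u n) f) \<longlonglongrightarrow> 0"
proof -
 note Cauchy = C[unfolded L2.form_Cauchy_nrm[of u M, OF u] L2_nrm_eq]
 have "\<exists>r. \<forall>n. (\<forall>k\<ge>r n. \<forall>l\<ge>r n. L2_dist M (u k) (u l) \<le> (1/2) ^ n) \<and> r n < r (Suc n)"
 proof (rule dependent_nat_choice)
  show "\<exists>x. \<forall>k\<ge>x. \<forall>l\<ge>x. L2_norm M (\<lambda>xa. u k xa - u l xa) \<le> (1/2) ^ 0"
  proof -
   obtain n0 where "\<forall>k\<ge>n0. \<forall>l\<ge>n0. L2_dist M (u k) (u l) < 1" using Cauchy zero_less_one by blast
   then show ?thesis by (intro exI[of _ n0]) (auto intro: less_imp_le)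
  qed
  show "\<exists>y. (\<forall>k\<ge>y. \<forall>l\<ge>y. L2_dist M (u k) (u l) \<le> (1/2) ^ Suc n) \<and> x < y" for x n
  proof -
   have "(0::real) < (1/2) ^ Suc n" by simp
   then obtain n0 where "\<forall>k\<ge>n0. \<forall>l\<ge>n0. L2_dist M (u k) (u l) < (1/2) ^ Suc n" using Cauchy by blast
   then show ?thesis by (intro exI[of _ "max n0 (Suc x)"]) (auto intro: less_imp_le)
  qed
 qed
 then obtain r where r: "\<And>n k l. k \<ge> r n \<Longrightarrow> l \<ge> r n \<Longrightarrow> L2_dist M (u k) (u l) \<le> (1/2) ^ n"
  and rS: "\<And>n. r n < r (Suc n)" by blast
 have rm: "strict_mono r" using rS by (simp add: strict_mono_Suc_iff)
 define v where "v n = u (r n)" for n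
 have vL: "v n \<in> L2 M" for n using u by (simp add: v_def)
 have vm [measurable]: "v n \<in> borel_measurable M" for n using vL[of n] by (auto simp: L2_def)
 \<comment> \<open>Where the subsequence diverges \<open>lim\<close> has an unspecified value; this
   happens on a null set only, and \<open>f\<close> is measurable all the same.\<close>
 define f where "f = (\<lambda>x. lim (\<lambda>n. v n x))"
 have fm [measurable]: "f \<in> borel_measurable M" unfolding f_def by measurable
 have "AE x in M. convergent (\<lambda>n. v n x)"
 proof (rule L2_Cauchy_AE[OF vL])
  show "L2_dist M (v (Suc n)) (v n) \<le> (1/2) ^ n" for n
   using r[of n "r (Suc n)" "r n"] rS[of n] by (simp add: v_def)
 qed
 then have lim: "AE x in M. (\<lambda>n. v n x) \<longlonglongrightarrow> f x" by eventually_elim (simp add: f_def convergent_LIMSEQ_iff)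
 \<comment> \<open>Fatou along the subsequence turns a bound on all late distances to
   \<open>v n\<close> into a bound on the distance to \<open>f\<close>. It serves both
   \<open>f \<in> L2 M\<close> and the convergence of the whole sequence.\<close>
 have fatou: "(\<integral>\<^sup>+x. ennreal ((h x - f x)\<^sup>2) \<partial>M) \<le> ennreal (e\<^sup>2)"
  if h: "h \<in> L2 M" and e: "0 \<le> e" and n: "\<And>n. n \<ge> n0 \<Longrightarrow> L2_dist M h (v n) \<le> e" for h e n0
 proof -
  have [measurable]: "h \<in> borel_measurable M" using h by (auto simp: L2_def)
  have "(\<integral>\<^sup>+x. ennreal ((h x - f x)\<^sup>2) \<partial>M) = (\<integral>\<^sup>+x. liminf (\<lambda>n. ennreal ((h x - v n x)\<^sup>2)) \<partial>M)"
  proof (rule nn_integral_cong_AE, use lim in eventually_elim)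
   case (elim x)
   have "(\<lambda>n. ennreal ((h x - v n x)\<^sup>2)) \<longlonglongrightarrow> ennreal ((h x - f x)\<^sup>2)" by (intro tendsto_intros elim)
   then show ?case using lim_imp_Liminf[OF sequentially_bot] by metis
  qed
  also have "\<dots> \<le> liminf (\<lambda>n. \<integral>\<^sup>+x. ennreal ((h x - v n x)\<^sup>2) \<partial>M)" by (rule nn_integral_liminf) measurable
  also have "\<dots> \<le> limsup (\<lambda>n. \<integral>\<^sup>+x. ennreal ((h x - v n x)\<^sup>2) \<partial>M)" by (rule Liminf_le_Limsup) simp
  also have "\<dots> \<le> ennreal (e\<^sup>2)"
  proof (rule Limsup_bounded, rule eventually_sequentiallyI[of n0])
   fix n assume "n0 \<le> n"
   have hv: "(\<lambda>x. h x - v n x) \<in> L2 M" by (rule L2.diff_mem[OF h vL])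
   have "(\<integral>\<^sup>+x. ennreal ((h x - v n x)\<^sup>2) \<partial>M) = ennreal (\<integral>x. (h x - v n x)\<^sup>2 \<partial>M)"
    by (rule nn_integral_eq_integral) (use hv in \<open>auto simp: L2_def\<close>)
   also have "(\<integral>x. (h x - v n x)\<^sup>2 \<partial>M) \<le> e\<^sup>2"
    unfolding L2_norm_sq[symmetric] using n[OF \<open>n0 \<le> n\<close>] by (intro power_mono) auto
   finally show "(\<integral>\<^sup>+x. ennreal ((h x - v n x)\<^sup>2) \<partial>M) \<le> ennreal (e\<^sup>2)" by (simp add: ennreal_leI)
  qed
  finally show ?thesis .
 qed
 have diffL: "(\<lambda>x. h x - f x) \<in> L2 M \<and> L2_dist M h f \<le> e"
  if h: "h \<in> L2 M" and e: "0 \<le> e" and n: "\<And>n. n \<ge> n0 \<Longrightarrow> L2_dist M h (v n) \<le> e" for h e n0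
 proof -
  have [measurable]: "h \<in> borel_measurable M" using h by (auto simp: L2_def)
  have int: "integrable M (\<lambda>x. (h x - f x)\<^sup>2)" by (rule integrableI_bounded)
    (use le_less_trans[OF fatou[OF h e n, of n0]] in \<open>auto\<close>)
  have "ennreal (\<integral>x. (h x - f x)\<^sup>2 \<partial>M) \<le> ennreal (e\<^sup>2)"
   using fatou[OF h e n, of n0] nn_integral_eq_integral[OF int] by simp
  then have "(L2_dist M h f)\<^sup>2 \<le> e\<^sup>2" by (simp add: L2_norm_sq)
  then have "L2_dist M h f \<le> e" using e by (rule power2_le_imp_le)
  then show ?thesis using int by (simp add: L2_def)
 qed
 have "(\<lambda>x. u (r 0) x - f x) \<in> L2 M"
  using diffL[OF u, of 1 0 "r 0"] r[of 0 "r 0"] rm by (simp add: v_def strict_mono_less_eq)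
 then have fL: "f \<in> L2 M" using L2.diff_mem[OF u[of "r 0"]] by fastforce
 have "(\<lambda>n. L2_dist M (u n) f) \<longlonglongrightarrow> 0"
 proof (rule LIMSEQ_I)
  fix e :: real assume e: "0 < e"
  then obtain n0 where n0: "\<And>m n. m \<ge> n0 \<Longrightarrow> n \<ge> n0 \<Longrightarrow> L2_dist M (u m) (u n) < e / 2"
   using Cauchy half_gt_zero[OF e] by blast
  have "norm (L2_dist M (u n) f - 0) < e" if "n \<ge> n0" for n
  proof -
   have "L2_dist M (u n) (v k) \<le> e / 2" if "k \<ge> n0" for k
    using n0[OF \<open>n \<ge> n0\<close>, of "r k"] strict_mono_imp_increasing[OF rm, of k] that by (simp add: v_def less_imp_le)
   then have "L2_dist M (u n) f \<le> e / 2" using diffL[OF u[of n], of "e/2" n0] e by simp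
   then show ?thesis using e by simp
  qed
  then show "\<exists>no. \<forall>n\<ge>no. norm (L2_dist M (u n) f - 0) < e" by blast
 qed
 then show ?thesis using that fL by blast
qed


section \<open>Closure of a closable form\<close>

lemma symmetric_form_semi_inner:
 assumes "symmetric_form M E D" shows "semi_inner E D"
 using assms unfolding symmetric_form_def dense_subspace_def by unfold_locales blast+

lemma tendsto_nrm_sq_iff:
 assumes "semi_inner E D" and w: "\<And>n. w n \<in> D"
 shows "(\<lambda>n. E (w n) (w n)) \<longlonglongrightarrow> 0 \<longleftrightarrow> (\<lambda>n. semi_inner.nrm E (w n)) \<longlonglongrightarrow> 0"
proof
 interpret semi_inner E D by fact
 show "(\<lambda>n. nrm (w n)) \<longlonglongrightarrow> 0" if "(\<lambda>n. E (w n) (w n)) \<longlonglongrightarrow> 0" using tendsto_real_sqrt[OF that] by (simp add: nrm_def)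
 show "(\<lambda>n. E (w n) (w n)) \<longlonglongrightarrow> 0" if "(\<lambda>n. nrm (w n)) \<longlonglongrightarrow> 0" using tendsto_power[OF that, of 2] by (simp add: nrm_sq w)
qed

lemma form_Cauchy_mono:
 assumes C: "form_Cauchy q u"
  and le: "\<And>m n. p (\<lambda>x. u m x - u n x) (\<lambda>x. u m x - u n x) \<le> q (\<lambda>x. u m x - u n x) (\<lambda>x. u m x - u n x)"
 shows "form_Cauchy p u"
 unfolding form_Cauchy_def
proof (intro allI impI)
 fix e :: real assume "0 < e"
 then obtain n0 where "\<And>m n. m \<ge> n0 \<Longrightarrow> n \<ge> n0 \<Longrightarrow> q (\<lambda>x. u m x - u n x) (\<lambda>x. u m x - u n x) < e"
  using C unfolding form_Cauchy_def by blast
 then show "\<exists>n0. \<forall>m\<ge>n0. \<forall>n\<ge>n0. p (\<lambda>x. u m x - u n x) (\<lambda>x. u m x - u n x) < e"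
  using le_less_trans[OF le] by (intro exI[of _ n0]) auto
qed

locale closable =
 fixes M :: "'s measure" and E and D
 assumes cl: "closable_form M E D"
begin

lemma sf: "symmetric_form M E D" using cl by (simp add: closable_form_def)

lemma D_L2: "f \<in> D \<Longrightarrow> f \<in> L2 M" using sf by (auto simp: symmetric_form_def dense_subspace_def)

sublocale E: semi_inner E D by (rule symmetric_form_semi_inner[OF sf])

lemma approx_mem: "approximates M E D u f \<Longrightarrow> u n \<in> D" by (simp add: approximates_def)

lemma approx_Cauchy: "approximates M E D u f \<Longrightarrow> form_Cauchy E u" by (simp add: approximates_def)

lemma approx_L2: "approximates M E D u f \<Longrightarrow> (\<lambda>n. L2_dist M (u n) f) \<longlonglongrightarrow> 0" by (simp add: approximates_def)

lemma approx_lin: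
 assumes u: "approximates M E D u f" and v: "approximates M E D v g" and f: "f \<in> L2 M" and g: "g \<in> L2 M"
 shows "approximates M E D (\<lambda>n x. a * u n x + b * v n x) (\<lambda>x. a * f x + b * g x)"
 unfolding approximates_def
proof (intro conjI allI)
 show "(\<lambda>x. a * u n x + b * v n x) \<in> D" for n using approx_mem[OF u] approx_mem[OF v] by (rule E.lin)
 show "form_Cauchy E (\<lambda>n x. a * u n x + b * v n x)"
  using approx_mem[OF u] approx_mem[OF v] approx_Cauchy[OF u] approx_Cauchy[OF v] by (rule E.form_Cauchy_lin)
 show "(\<lambda>n. L2_norm M (\<lambda>x. a * u n x + b * v n x - (a * f x + b * g x))) \<longlonglongrightarrow> 0"
 proof (rule tendsto_sandwich[OF always_eventually always_eventually])
  show "\<forall>n. 0 \<le> L2_norm M (\<lambda>x. a * u n x + b * v n x - (a * f x + b * g x))" by simp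
  show "\<forall>n. L2_norm M (\<lambda>x. a * u n x + b * v n x - (a * f x + b * g x))
    \<le> \<bar>a\<bar> * L2_dist M (u n) f + \<bar>b\<bar> * L2_dist M (v n) g"
  proof
   fix n
   have "(\<lambda>x. a * u n x + b * v n x - (a * f x + b * g x)) =
     (\<lambda>x. a * (u n x - f x) + b * (v n x - g x))" by (simp add: fun_eq_iff algebra_simps)
   then show "L2_norm M (\<lambda>x. a * u n x + b * v n x - (a * f x + b * g x))
    \<le> \<bar>a\<bar> * L2_dist M (u n) f + \<bar>b\<bar> * L2_dist M (v n) g"
    using L2.nrm_lin[OF L2.diff_mem[OF D_L2[OF approx_mem[OF u]] f] L2.diff_mem[OF D_L2[OF approx_mem[OF v]] g]]
    by (simp add: L2_nrm_eq)
  qed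
  show "(\<lambda>n. \<bar>a\<bar> * L2_dist M (u n) f + \<bar>b\<bar> * L2_dist M (v n) g) \<longlonglongrightarrow> 0"
   using tendsto_add[OF tendsto_mult_left[OF approx_L2[OF u], of "\<bar>a\<bar>"]
     tendsto_mult_left[OF approx_L2[OF v], of "\<bar>b\<bar>"]] by simp
 qed simp
qed

lemma approx_diff:
 assumes "approximates M E D u f" "approximates M E D v g" "f \<in> L2 M" "g \<in> L2 M"
 shows "approximates M E D (\<lambda>n x. u n x - v n x) (\<lambda>x. f x - g x)"
 using approx_lin[OF assms, of 1 "-1"] by simp

lemma approx_const: "f \<in> D \<Longrightarrow> approximates M E D (\<lambda>n. f) f"
 using E.nonneg[of f] E.scale1[OF E.zero_mem E.zero_mem, of 0] by (simp add: approximates_def form_Cauchy_def L2_norm_def L2_inner_def)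

lemma approx_cong:
 assumes u: "approximates M E D u f" and f: "f \<in> L2 M" and g: "g \<in> L2 M" and eq: "AE x in M. f x = g x"
 shows "approximates M E D u g"
proof -
 have "L2_dist M (u n) f = L2_dist M (u n) g" for n unfolding L2_norm_def
  using L2.diff_mem[OF D_L2[OF approx_mem[OF u, of n]] f] L2.diff_mem[OF D_L2[OF approx_mem[OF u, of n]] g] eq
  by (subst L2_inner_cong[of _ M "\<lambda>x. u n x - g x" _ "\<lambda>x. u n x - g x"]) auto
 then show ?thesis using u by (simp add: approximates_def)
qed

text \<open>The one place where the convergence clause of closability enters: the difference of the
  two sequences is Cauchy for the form and tends to 0 in \<open>L2\<close>.\<close>

lemma approx_unique:
 assumes u: "approximates M E D u f" and v: "approximates M E D v g" and f: "f \<in> L2 M" and g: "g \<in> L2 M"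
  and eq: "AE x in M. f x = g x"
 shows "(\<lambda>n. E.nrm (\<lambda>x. u n x - v n x)) \<longlonglongrightarrow> 0"
proof -
 have v': "approximates M E D v f" using eq by (intro approx_cong[OF v g f]) auto
 have d: "approximates M E D (\<lambda>n x. u n x - v n x) (\<lambda>x. f x - f x)" by (rule approx_diff[OF u v' f f])
 then have "(\<lambda>n. E (\<lambda>x. u n x - v n x) (\<lambda>x. u n x - v n x)) \<longlonglongrightarrow> 0"
  using cl unfolding closable_form_def approximates_def by simp
 then show ?thesis using tendsto_nrm_sq_iff[OF E.semi_inner_axioms, of "\<lambda>n x. u n x - v n x"] approx_mem[OF d] by blast
qed

text \<open>Polarisation: sums and differences of the two sequences are Cauchy for the form, so
  their energies converge.\<close>

lemma approx_convergent:
 assumes u: "approximates M E D u f" and v: "approximates M E D v g"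
  and f: "f \<in> L2 M" and g: "g \<in> L2 M"
 shows "convergent (\<lambda>n. E (u n) (v n))"
proof -
 have eq: "E (u n) (v n) = 1/4 * (E (\<lambda>x. 1 * u n x + 1 * v n x) (\<lambda>x. 1 * u n x + 1 * v n x)
   + - 1 * E (\<lambda>x. 1 * u n x + (-1) * v n x) (\<lambda>x. 1 * u n x + (-1) * v n x))" for n
  unfolding E.quad[OF approx_mem[OF u] approx_mem[OF v]] by simp
 have c: "convergent (\<lambda>n. E (\<lambda>x. a * u n x + b * v n x) (\<lambda>x. a * u n x + b * v n x))" for a b
  using approx_lin[OF u v f g, of a b] by (intro E.form_Cauchy_convergent) (auto dest: approx_mem approx_Cauchy)
 show ?thesis unfolding eq by (intro convergent_mult convergent_const convergent_add c)
qed

text \<open>The difference of the two values splits as \<open>E (u - u') v + E u' (v - v')\<close>.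
  Cauchy sequences are bounded, and the differences vanish in the seminorm by
  \<open>approx_unique\<close>.\<close>

lemma approx_limit_unique:
 assumes u: "approximates M E D u f" and v: "approximates M E D v g"
  and u': "approximates M E D u' f'" and v': "approximates M E D v' g'"
  and f: "f \<in> L2 M" and g: "g \<in> L2 M" and f': "f' \<in> L2 M" and g': "g' \<in> L2 M"
  and eq: "AE x in M. f x = f' x" "AE x in M. g x = g' x"
 shows "(\<lambda>n. E (u n) (v n) - E (u' n) (v' n)) \<longlonglongrightarrow> 0"
proof -
 note m = approx_mem[OF u] approx_mem[OF v] approx_mem[OF u'] approx_mem[OF v']
 obtain K where K: "\<And>n. E.nrm (v n) \<le> K" using E.form_Cauchy_bounded[OF approx_mem[OF v] approx_Cauchy[OF v]] by blast
 obtain L where L: "\<And>n. E.nrm (u' n) \<le> L"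
  using E.form_Cauchy_bounded[OF approx_mem[OF u'] approx_Cauchy[OF u']] by blast
 have bd: "\<bar>E (u n) (v n) - E (u' n) (v' n)\<bar> \<le> E.nrm (\<lambda>x. u n x - u' n x) * K + L * E.nrm (\<lambda>x. v n x - v' n x)" for n
 proof -
  have split: "E (u n) (v n) - E (u' n) (v' n) = E (\<lambda>x. u n x - u' n x) (v n) + E (u' n) (\<lambda>x. v n x - v' n x)"
   by (simp add: E.diff1 E.diff2 m)
  have "\<bar>E (u n) (v n) - E (u' n) (v' n)\<bar> \<le> E.nrm (\<lambda>x. u n x - u' n x) * E.nrm (v n) + E.nrm (u' n) * E.nrm (\<lambda>x. v n x - v' n x)"
   unfolding split using E.Cauchy_Schwarz[OF E.diff_mem[OF m(1) m(3)] m(2), of n n n] E.Cauchy_Schwarz[OF m(3) E.diff_mem[OF m(2) m(4)], of n n n]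
   by linarith
  also have "\<dots> \<le> E.nrm (\<lambda>x. u n x - u' n x) * K + L * E.nrm (\<lambda>x. v n x - v' n x)"
  proof (rule add_mono)
   have "0 \<le> E.nrm (\<lambda>x. u n x - u' n x)" by (rule E.nrm_nonneg, rule E.diff_mem, rule m, rule m)
   then show "E.nrm (\<lambda>x. u n x - u' n x) * E.nrm (v n) \<le> E.nrm (\<lambda>x. u n x - u' n x) * K"
    by (rule mult_left_mono[OF K])
   have "0 \<le> E.nrm (\<lambda>x. v n x - v' n x)" by (rule E.nrm_nonneg, rule E.diff_mem, rule m, rule m)
   then show "E.nrm (u' n) * E.nrm (\<lambda>x. v n x - v' n x) \<le> L * E.nrm (\<lambda>x. v n x - v' n x)"
    by (rule mult_right_mono[OF L])
  qed
  finally show ?thesis .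
 qed
 have "(\<lambda>n. E.nrm (\<lambda>x. u n x - u' n x) * K + L * E.nrm (\<lambda>x. v n x - v' n x)) \<longlonglongrightarrow> 0 * K + L * 0"
  by (intro tendsto_intros approx_unique[OF u u' f f' eq(1)] approx_unique[OF v v' g g' eq(2)])
 then have "(\<lambda>n. E.nrm (\<lambda>x. u n x - u' n x) * K + L * E.nrm (\<lambda>x. v n x - v' n x)) \<longlonglongrightarrow> 0" by simp
 then show ?thesis by (rule Lim_null_comparison[OF always_eventually, rotated]) (use bd in auto)
qed

abbreviation "E' \<equiv> closure_form M E D"
abbreviation "D' \<equiv> closure_dom M E D"

text \<open>Resolves the definite description in \<open>closure_form\<close>; every later property
  of the closure is read off along freely chosen approximating sequences.\<close>

lemma closure_form_limit:
 assumes u: "approximates M E D u f" and v: "approximates M E D v g"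
  and f: "f \<in> L2 M" and g: "g \<in> L2 M"
 shows "(\<lambda>n. E (u n) (v n)) \<longlonglongrightarrow> E' f g"
proof -
 obtain l where l: "(\<lambda>n. E (u n) (v n)) \<longlonglongrightarrow> l" using approx_convergent[OF assms] by (auto simp: convergent_def)
 have "E' f g = l" unfolding closure_form_def
 proof (rule the_equality)
  show "\<exists>u v. approximates M E D u f \<and> approximates M E D v g \<and> (\<lambda>n. E (u n) (v n)) \<longlonglongrightarrow> l" using u v l by blast
  fix l' assume "\<exists>u v. approximates M E D u f \<and> approximates M E D v g \<and> (\<lambda>n. E (u n) (v n)) \<longlonglongrightarrow> l'"
  then obtain u' v' where u': "approximates M E D u' f" and v': "approximates M E D v' g"
   and l': "(\<lambda>n. E (u' n) (v' n)) \<longlonglongrightarrow> l'" by blast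
  have "(\<lambda>n. E (u n) (v n) - E (u' n) (v' n)) \<longlonglongrightarrow> l - l'" by (intro tendsto_intros l l')
  moreover have "(\<lambda>n. E (u n) (v n) - E (u' n) (v' n)) \<longlonglongrightarrow> 0" by (rule approx_limit_unique[OF u v u' v' f g f g]) auto
  ultimately show "l' = l" using LIMSEQ_unique by fastforce
 qed
 then show ?thesis using l by simp
qed

lemma closure_dom_L2: "f \<in> D' \<Longrightarrow> f \<in> L2 M" by (simp add: closure_dom_def)

lemma closure_domE: assumes "f \<in> D'" obtains u where "approximates M E D u f"
 using assms by (auto simp: closure_dom_def)

lemma D_subset: "D \<subseteq> D'" using approx_const D_L2 by (auto simp: closure_dom_def)

lemma closure_form_eq: "f \<in> D \<Longrightarrow> g \<in> D \<Longrightarrow> E' f g = E f g"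
 by (rule LIMSEQ_unique[OF closure_form_limit[OF approx_const approx_const] tendsto_const]) (auto intro: D_L2)

lemma closure_dom_AE:
 assumes "f \<in> D'" "g \<in> L2 M" "AE x in M. f x = g x" shows "g \<in> D'"
 using assms approx_cong by (auto simp: closure_dom_def)

lemma closure_symmetric_form: "symmetric_form M E' D'" unfolding symmetric_form_def
proof (intro conjI ballI allI impI)
 show "dense_subspace M D'" unfolding dense_subspace_def
 proof (intro conjI ballI allI impI)
  show "D' \<noteq> {}" using D_subset E.ne by blast
  show "D' \<subseteq> L2 M" using closure_dom_L2 by blast
  show "(\<lambda>x. a * f x + b * g x) \<in> D'" if fg: "f \<in> D'" "g \<in> D'" for f g a b
  proof -
   obtain u where u: "approximates M E D u f" by (rule closure_domE[OF fg(1)])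
   obtain v where v: "approximates M E D v g" by (rule closure_domE[OF fg(2)])
   have "approximates M E D (\<lambda>n x. a * u n x + b * v n x) (\<lambda>x. a * f x + b * g x)"
    using approx_lin[OF u v closure_dom_L2[OF fg(1)] closure_dom_L2[OF fg(2)]] .
   then show ?thesis using L2_lin fg closure_dom_L2 unfolding closure_dom_def by blast
  qed
  show "\<exists>g\<in>D'. L2_dist M f g < e" if "f \<in> L2 M" "0 < e" for f e
   using sf that D_subset unfolding symmetric_form_def dense_subspace_def by blast
 qed
next
 fix f g h assume fgh: "f \<in> D'" "g \<in> D'" "h \<in> D'" 
 note L = closure_dom_L2[OF fgh(1)] closure_dom_L2[OF fgh(2)] closure_dom_L2[OF fgh(3)]
 obtain u where u: "approximates M E D u f" by (rule closure_domE[OF fgh(1)])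
 obtain v where v: "approximates M E D v g" by (rule closure_domE[OF fgh(2)])
 obtain w where w: "approximates M E D w h" by (rule closure_domE[OF fgh(3)])
 { assume "AE x in M. f x = g x"
  then have "approximates M E D u g" using approx_cong[OF u] L by blast
  then show "E' f h = E' g h"
   using closure_form_limit[OF u w L(1,3)] closure_form_limit[OF _ w L(2,3), of u] LIMSEQ_unique by blast }
 fix a b
 have "(\<lambda>n. E (\<lambda>x. a * u n x + b * v n x) (w n)) \<longlonglongrightarrow> E' (\<lambda>x. a * f x + b * g x) h"
  by (rule closure_form_limit[OF approx_lin[OF u v L(1,2)] w L2_lin[OF L(1,2)] L(3)])
 moreover have "(\<lambda>n. E (\<lambda>x. a * u n x + b * v n x) (w n)) \<longlonglongrightarrow> a * E' f h + b * E' g h"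
  unfolding E.lin1[OF approx_mem[OF u] approx_mem[OF v] approx_mem[OF w]]
  by (intro tendsto_intros closure_form_limit u v w L)
 ultimately show "E' (\<lambda>x. a * f x + b * g x) h = a * E' f h + b * E' g h" using LIMSEQ_unique by blast
next
 fix f g assume fg: "f \<in> D'" "g \<in> D'" 
 note L = closure_dom_L2[OF fg(1)] closure_dom_L2[OF fg(2)]
 obtain u where u: "approximates M E D u f" by (rule closure_domE[OF fg(1)])
 obtain v where v: "approximates M E D v g" by (rule closure_domE[OF fg(2)])
 have "(\<lambda>n. E (u n) (v n)) \<longlonglongrightarrow> E' g f"
  using closure_form_limit[OF v u L(2,1)] by (simp add: E.sym[OF approx_mem[OF u] approx_mem[OF v]])
 then show "E' f g = E' g f" using closure_form_limit[OF u v L] LIMSEQ_unique by blast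
next
 fix f assume f: "f \<in> D'"
 obtain u where u: "approximates M E D u f" using closure_domE[OF f] by blast
 show "0 \<le> E' f f" using closure_form_limit[OF u u] closure_dom_L2[OF f] E.nonneg[OF approx_mem[OF u]]
  by (auto intro: LIMSEQ_le_const)
qed

sublocale E': semi_inner E' D' by (rule symmetric_form_semi_inner[OF closure_symmetric_form])

text \<open>For fixed \<open>n\<close> the seminorm of \<open>u n - f\<close> is the limit over
  \<open>m\<close> of the seminorms of \<open>u n - u m\<close>, and the Cauchy property bounds
  these uniformly.\<close>

lemma approx_E':
 assumes u: "approximates M E D u f" and f: "f \<in> L2 M"
 shows "(\<lambda>n. E'.nrm (\<lambda>x. u n x - f x)) \<longlonglongrightarrow> 0"
proof (rule LIMSEQ_I)
 fix e :: real assume e: "0 < e"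
 have fD: "f \<in> D'" using u f by (auto simp: closure_dom_def)
 obtain n0 where n0: "\<And>m n. m \<ge> n0 \<Longrightarrow> n \<ge> n0 \<Longrightarrow> E.nrm (\<lambda>x. u m x - u n x) < e / 2"
  using approx_Cauchy[OF u] unfolding E.form_Cauchy_nrm[of u, OF approx_mem[OF u]] using half_gt_zero[OF e] by blast
 have "norm (E'.nrm (\<lambda>x. u n x - f x) - 0) < e" if "n \<ge> n0" for n
 proof -
  have uD: "u n \<in> D" by (rule approx_mem[OF u])
  have d: "approximates M E D (\<lambda>m x. u n x - u m x) (\<lambda>x. u n x - f x)"
   by (rule approx_diff[OF approx_const[OF uD] u D_L2[OF uD] f])
  have "(\<lambda>m. E (\<lambda>x. u n x - u m x) (\<lambda>x. u n x - u m x)) \<longlonglongrightarrow> E' (\<lambda>x. u n x - f x) (\<lambda>x. u n x - f x)"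
   using closure_form_limit[OF d d] L2.diff_mem[OF D_L2[OF uD] f] by blast
  then have "(\<lambda>m. E.nrm (\<lambda>x. u n x - u m x)) \<longlonglongrightarrow> E'.nrm (\<lambda>x. u n x - f x)"
   unfolding E.nrm_def E'.nrm_def by (rule tendsto_real_sqrt)
  then have "E'.nrm (\<lambda>x. u n x - f x) \<le> e / 2"
   by (rule LIMSEQ_le_const2) (use n0[OF that] in \<open>auto intro!: exI[of _ n0] less_imp_le\<close>)
  then show ?thesis using e E'.nrm_nonneg[OF E'.diff_mem[OF subsetD[OF D_subset uD] fD]] by simp
 qed
 then show "\<exists>no. \<forall>n\<ge>no. norm (E'.nrm (\<lambda>x. u n x - f x) - 0) < e" by blast
qed

text \<open>A Cauchy sequence in the closure has an \<open>L2\<close> limit by completeness;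
  replacing its members by nearby elements of \<open>D\<close> gives a sequence which approximates
  that limit in the sense of the definition.\<close>

lemma closed_closure: "closed_form M E' D'" unfolding closed_form_def
proof (intro conjI allI impI closure_symmetric_form)
 fix u assume "(\<forall>n. u n \<in> D') \<and> form_Cauchy (form_1 M E') u"
 then have u: "\<And>n. u n \<in> D'" and C: "form_Cauchy (form_1 M E') u" by auto
 have uL: "u n \<in> L2 M" for n using u closure_dom_L2 by blast
 have dD: "(\<lambda>x. u m x - u n x) \<in> D'" for m n by (rule E'.diff_mem[OF u u])
 have CE: "form_Cauchy E' u" and CL: "form_Cauchy (L2_inner M) u"
 proof -
  have "E' (\<lambda>x. u m x - u n x) (\<lambda>x. u m x - u n x) \<le> form_1 M E' (\<lambda>x. u m x - u n x) (\<lambda>x. u m x - u n x)"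
     "L2_inner M (\<lambda>x. u m x - u n x) (\<lambda>x. u m x - u n x) \<le> form_1 M E' (\<lambda>x. u m x - u n x) (\<lambda>x. u m x - u n x)" for m n
   using E'.nonneg[OF dD[of m n]] by (auto simp: form_1_def L2_inner_def)
  then show "form_Cauchy E' u" "form_Cauchy (L2_inner M) u" by (auto intro: form_Cauchy_mono[OF C])
 qed
 obtain f where f: "f \<in> L2 M" and lim: "(\<lambda>n. L2_dist M (u n) f) \<longlonglongrightarrow> 0" using L2_complete[OF uL CL] .
 \<comment> \<open>Diagonal choice: \<open>v n\<close> is close to \<open>u n\<close> both in the
   closure seminorm and in \<open>L2\<close>, and so inherits the Cauchy property and the
   limit.\<close>
 have "\<exists>v. v \<in> D \<and> E'.nrm (\<lambda>x. u n x - v x) < 1 / real (Suc n) \<and> L2_dist M v (u n) < 1 / real (Suc n)" for n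
 proof -
  obtain w where w: "approximates M E D w (u n)" using closure_domE[OF u] by blast
  have "eventually (\<lambda>k. E'.nrm (\<lambda>x. w k x - u n x) < 1 / real (Suc n)) sequentially"
   by (rule order_tendstoD[OF approx_E'[OF w uL]]) simp
  moreover have "eventually (\<lambda>k. L2_dist M (w k) (u n) < 1 / real (Suc n)) sequentially"
   by (rule order_tendstoD[OF approx_L2[OF w]]) simp
  ultimately have "eventually (\<lambda>k. E'.nrm (\<lambda>x. w k x - u n x) < 1 / real (Suc n) \<and> L2_dist M (w k) (u n) < 1 / real (Suc n)) sequentially"
   by (rule eventually_conj)
  then obtain k where "E'.nrm (\<lambda>x. w k x - u n x) < 1 / real (Suc n)" "L2_dist M (w k) (u n) < 1 / real (Suc n)"
   by (auto dest: eventually_happens)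
  then show ?thesis using approx_mem[OF w, of k] E'.nrm_diff_sym[OF subsetD[OF D_subset approx_mem[OF w, of k]] u[of n]]
   by (intro exI[of _ "w k"]) simp
 qed
 then obtain v where v: "\<And>n. v n \<in> D" and vE: "\<And>n. E'.nrm (\<lambda>x. u n x - v n x) < 1 / real (Suc n)"
  and vL: "\<And>n. L2_dist M (v n) (u n) < 1 / real (Suc n)" by metis
 have vD': "v n \<in> D'" for n using v D_subset by blast
 have small: "(\<lambda>n. 1 / real (Suc n)) \<longlonglongrightarrow> 0" using LIMSEQ_inverse_real_of_nat by (simp add: field_simps)
 have app: "approximates M E D v f" unfolding approximates_def
 proof (intro conjI allI v)
  show "form_Cauchy E v" unfolding E.form_Cauchy_nrm[of v, OF v]
  proof (intro allI impI)
   fix e :: real assume e: "0 < e"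
   then obtain n1 where n1: "\<And>m n. m \<ge> n1 \<Longrightarrow> n \<ge> n1 \<Longrightarrow> E'.nrm (\<lambda>x. u m x - u n x) < e / 3"
    using CE[unfolded E'.form_Cauchy_nrm[of u, OF u], rule_format, of "e / 3"] by auto
   obtain n2 where n2: "\<And>n. n \<ge> n2 \<Longrightarrow> 1 / real (Suc n) < e / 3"
    using order_tendstoD(2)[OF small, of "e/3"] e by (auto simp: eventually_sequentially)
   have "E.nrm (\<lambda>x. v m x - v n x) < e" if m: "m \<ge> max n1 n2" and n: "n \<ge> max n1 n2" for m n
   proof -
    have "E.nrm (\<lambda>x. v m x - v n x) = E'.nrm (\<lambda>x. v m x - v n x)"
     using closure_form_eq[OF E.diff_mem[OF v v] E.diff_mem[OF v v]] by (simp add: E.nrm_def E'.nrm_def)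
    also have "\<dots> \<le> E'.nrm (\<lambda>x. v m x - u m x) + E'.nrm (\<lambda>x. u m x - v n x)" by (rule E'.nrm_triangle[OF vD' u vD'])
    also have "\<dots> \<le> E'.nrm (\<lambda>x. v m x - u m x) + (E'.nrm (\<lambda>x. u m x - u n x) + E'.nrm (\<lambda>x. u n x - v n x))"
     by (intro add_left_mono E'.nrm_triangle[OF u u vD'])
    also have "\<dots> < e / 3 + (e / 3 + e / 3)"
     using vE[of m] vE[of n] n1[of m n] n2[of m] n2[of n] m n E'.nrm_diff_sym[OF vD' u, of m m]
     by (intro add_strict_mono) auto
    finally show ?thesis by simp
   qed
   then show "\<exists>n0. \<forall>m\<ge>n0. \<forall>n\<ge>n0. E.nrm (\<lambda>x. v m x - v n x) < e" by blast
  qed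
  show "(\<lambda>n. L2_dist M (v n) f) \<longlonglongrightarrow> 0"
  proof (rule tendsto_sandwich[OF always_eventually always_eventually])
   show "\<forall>n. 0 \<le> L2_dist M (v n) f" by simp
   show "\<forall>n. L2_dist M (v n) f \<le> 1 / real (Suc n) + L2_dist M (u n) f"
    using L2.nrm_triangle[OF D_L2[OF v] uL f] less_imp_le[OF vL] unfolding L2_nrm_eq
    by (meson add_right_mono order_trans)
   show "(\<lambda>n. 1 / real (Suc n) + L2_dist M (u n) f) \<longlonglongrightarrow> 0" using tendsto_add[OF small lim] by simp
  qed auto
 qed
 have fD: "f \<in> D'" using app f by (auto simp: closure_dom_def)
 have "(\<lambda>n. E'.nrm (\<lambda>x. u n x - f x)) \<longlonglongrightarrow> 0"
 proof (rule tendsto_sandwich[OF always_eventually always_eventually])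
  show "\<forall>n. 0 \<le> E'.nrm (\<lambda>x. u n x - f x)" using E'.nrm_nonneg[OF E'.diff_mem[OF u fD]] by blast
  show "\<forall>n. E'.nrm (\<lambda>x. u n x - f x) \<le> 1 / real (Suc n) + E'.nrm (\<lambda>x. v n x - f x)"
   using E'.nrm_triangle[OF u vD' fD] less_imp_le[OF vE] by (meson add_right_mono order_trans)
  show "(\<lambda>n. 1 / real (Suc n) + E'.nrm (\<lambda>x. v n x - f x)) \<longlonglongrightarrow> 0" using tendsto_add[OF small approx_E'[OF app f]] by simp
 qed auto
 then have "(\<lambda>n. E' (\<lambda>x. u n x - f x) (\<lambda>x. u n x - f x)) \<longlonglongrightarrow> 0"
  using tendsto_nrm_sq_iff[OF E'.semi_inner_axioms, of "\<lambda>n x. u n x - f x"] E'.diff_mem[OF u fD] by blast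
 moreover have "(\<lambda>n. L2_inner M (\<lambda>x. u n x - f x) (\<lambda>x. u n x - f x)) \<longlonglongrightarrow> 0"
  using tendsto_power[OF lim, of 2] by (simp add: L2_norm_def L2_inner_def)
 ultimately have "(\<lambda>n. form_1 M E' (\<lambda>x. u n x - f x) (\<lambda>x. u n x - f x)) \<longlonglongrightarrow> 0"
  unfolding form_1_def using tendsto_add by fastforce
 then show "\<exists>f\<in>D'. (\<lambda>n. form_1 M E' (\<lambda>x. u n x - f x) (\<lambda>x. u n x - f x)) \<longlonglongrightarrow> 0" using fD by blast
qed

end

text \<open>The numerical half of \<open>closure_lsc\<close>: \<open>a\<close> and \<open>b\<close>
  are energies of two near-minimisers, \<open>x\<close> is the energy of their midpoint, and
  \<open>dd\<close> is the limit of the infima.\<close>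

lemma parallelogram_arith:
 fixes a b x s s' s'' d dm dn dd :: real
 assumes "d \<le> x" "a < dm + s'" "b < dn + s''" "s' \<le> s" "s'' \<le> s" "dm \<le> dd" "dn \<le> dd"
 shows "2 * a + 2 * b - 4 * x \<le> 4 * (dd - d) + 4 * s"
proof -
 have "a \<le> dd + s" "b \<le> dd + s" using assms by simp_all
 then have "2 * a + 2 * b \<le> 4 * dd + 4 * s" by simp
 then show ?thesis using assms(1) by (simp add: algebra_simps)
qed

context closable
begin

text \<open>A substitute for weak compactness: minimising \<open>E\<close> over the elements of \<open>D\<close> that are
 \<open>1/n\<close>-close to \<open>f\<close> gives, by the parallelogram identity, an \<open>E\<close>-Cauchy sequence.\<close>

lemma closure_lsc:
 assumes v: "\<And>n. v n \<in> D" and f: "f \<in> L2 M" and lim: "(\<lambda>n. L2_dist M (v n) f) \<longlonglongrightarrow> 0"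
  and K: "\<And>n. E (v n) (v n) \<le> K"
 shows "f \<in> D' \<and> E' f f \<le> K"
proof -
 define C where "C n = {g \<in> D. L2_dist M g f \<le> 1 / real (Suc n)}" for n
 define d where "d n = (INF g\<in>C n. E g g)" for n
 have CD: "g \<in> D" if "g \<in> C n" for g n using that by (simp add: C_def)
 have vC: "\<exists>k. v k \<in> C n" for n
 proof -
  have "eventually (\<lambda>k. L2_dist M (v k) f < 1 / real (Suc n)) sequentially"
   by (rule order_tendstoD[OF lim]) simp
  then obtain k where "L2_dist M (v k) f < 1 / real (Suc n)" by (auto dest: eventually_happens)
  then show ?thesis using v by (intro exI[of _ k]) (simp add: C_def less_imp_le)
 qed
 have bdd: "bdd_below ((\<lambda>g. E g g) ` C n)" for n by (rule bdd_belowI[of _ 0]) (auto dest: CD intro: E.nonneg)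
 have dle: "d n \<le> E g g" if "g \<in> C n" for g n unfolding d_def by (rule cINF_lower[OF bdd that])
 have dK: "d n \<le> K" for n using vC[of n] dle K order_trans by blast
 have dmono: "d n \<le> d m" if "n \<le> m" for n m unfolding d_def
 proof (rule cINF_superset_mono)
  show "C m \<noteq> {}" using vC by blast
  have "1 / real (Suc m) \<le> 1 / real (Suc n)" using that by (simp add: field_simps)
  then show "C m \<subseteq> C n" by (auto simp: C_def)
 qed (use bdd in auto)
 have ex: "\<exists>w. w \<in> C n \<and> E w w < d n + 1 / real (Suc n)" for n
 proof -
  have "Inf ((\<lambda>g. E g g) ` C n) < d n + 1 / real (Suc n)" by (simp add: d_def)
  moreover have "(\<lambda>g. E g g) ` C n \<noteq> {}" using vC by blast
  ultimately obtain y where "y \<in> (\<lambda>g. E g g) ` C n" "y < d n + 1 / real (Suc n)" by (meson cInf_lessD)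
  then show ?thesis by auto
 qed
 define w where "w n = (SOME w. w \<in> C n \<and> E w w < d n + 1 / real (Suc n))" for n
 have "w n \<in> C n \<and> E (w n) (w n) < d n + 1 / real (Suc n)" for n unfolding w_def by (rule someI_ex[OF ex])
 then have wC: "\<And>n. w n \<in> C n" and wE: "\<And>n. E (w n) (w n) < d n + 1 / real (Suc n)" by auto
 have wD: "w n \<in> D" for n using wC CD by blast
 have wL: "L2_dist M (w n) f \<le> 1 / real (Suc n)" for n using wC by (simp add: C_def)
 have small: "(\<lambda>n. 1 / real (Suc n)) \<longlonglongrightarrow> 0" using LIMSEQ_inverse_real_of_nat by (simp add: field_simps)
 \<comment> \<open>Smaller balls have larger infima. All of them stay below \<open>K\<close>, since
   every ball contains some \<open>v k\<close>; hence they converge and their differences become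
   small.\<close>
 have "incseq d" using dmono by (simp add: incseq_def)
 moreover have "bdd_above (range d)" by (rule bdd_aboveI[of _ K]) (use dK in auto)
 ultimately have dlim: "d \<longlonglongrightarrow> (SUP i. d i)" by (rule LIMSEQ_incseq_SUP[rotated])
 define dd where "dd = (SUP i. d i)"
 note dlim = dlim[folded dd_def]
 have ddn: "d n \<le> dd" for n using \<open>incseq d\<close> dlim by (rule incseq_le)
 have ddK: "dd \<le> K" by (rule LIMSEQ_le_const2[OF dlim]) (use dK in auto)
 have key: "E (\<lambda>x. w m x - w n x) (\<lambda>x. w m x - w n x) \<le> 4 * (dd - d n0) + 4 * (1 / real (Suc n0))"
  if m: "n0 \<le> m" and n: "n0 \<le> n" for m n n0
 proof -
  have sm: "1 / real (Suc k) \<le> 1 / real (Suc n0)" if "n0 \<le> k" for k using that by (simp add: field_simps)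
  \<comment> \<open>The midpoint stays in the ball \<open>C n0\<close> by convexity, so its energy
    is at least \<open>d n0\<close>; this is the lower bound that the parallelogram identity
    needs.\<close>
  have "L2_norm M (\<lambda>x. 1/2 * (w m x - f x) + 1/2 * (w n x - f x)) \<le>
    \<bar>1/2\<bar> * L2_dist M (w m) f + \<bar>1/2\<bar> * L2_dist M (w n) f"
   by (rule L2.nrm_lin[unfolded L2_nrm_eq, OF L2.diff_mem[OF D_L2[OF wD] f] L2.diff_mem[OF D_L2[OF wD] f]])
  also have "\<dots> \<le> 1 / real (Suc n0)" using wL[of m] wL[of n] sm[OF m] sm[OF n] by simp
  also have "(\<lambda>x. 1/2 * (w m x - f x) + 1/2 * (w n x - f x)) = (\<lambda>x. (1/2 * w m x + 1/2 * w n x) - f x)"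
   by (simp add: fun_eq_iff field_simps)
  finally have "(\<lambda>x. 1/2 * w m x + 1/2 * w n x) \<in> C n0" using E.lin[OF wD wD, of "1/2" m "1/2" n] by (simp add: C_def)
  then have mid: "d n0 \<le> E (\<lambda>x. 1/2 * w m x + 1/2 * w n x) (\<lambda>x. 1/2 * w m x + 1/2 * w n x)" by (rule dle)
  show ?thesis unfolding E.parallelogram[OF wD wD]
   by (rule parallelogram_arith[OF mid wE wE sm[OF m] sm[OF n] ddn ddn])
 qed
 have app: "approximates M E D w f" unfolding approximates_def
 proof (intro conjI allI wD)
  show "form_Cauchy E w" unfolding form_Cauchy_def
  proof (intro allI impI)
   fix e :: real assume e: "0 < e"
   have "(\<lambda>n. 4 * (dd - d n) + 4 * (1 / real (Suc n))) \<longlonglongrightarrow> 4 * (dd - dd) + 4 * 0" by (intro tendsto_intros dlim small)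
   then have "eventually (\<lambda>n. 4 * (dd - d n) + 4 * (1 / real (Suc n)) < e) sequentially"
    by (rule order_tendstoD(2)) (use e in simp)
   then obtain n0 where "4 * (dd - d n0) + 4 * (1 / real (Suc n0)) < e" by (auto dest: eventually_happens)
   then show "\<exists>n0. \<forall>m\<ge>n0. \<forall>n\<ge>n0. E (\<lambda>x. w m x - w n x) (\<lambda>x. w m x - w n x) < e"
    using key[of n0] le_less_trans by (intro exI[of _ n0]) blast
  qed
  show "(\<lambda>n. L2_dist M (w n) f) \<longlonglongrightarrow> 0"
   by (rule tendsto_sandwich[OF always_eventually always_eventually tendsto_const small]) (use wL in auto)
 qed
 have "(\<lambda>n. d n + 1 / real (Suc n)) \<longlonglongrightarrow> dd + 0" by (intro tendsto_intros dlim small)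
 then have "E' f f \<le> dd + 0"
  by (rule LIMSEQ_le[OF closure_form_limit[OF app app f f]]) (use wE in \<open>auto intro: less_imp_le\<close>)
 then show ?thesis using ddK app f by (auto simp: closure_dom_def)
qed

end

text \<open>Split \<open>E (u n) (u n)\<close> at a fixed late index \<open>n0\<close>. The part
  with \<open>u n - u n0\<close> is small uniformly in \<open>n\<close> by the Cauchy property and
  boundedness; the part \<open>E (u n0) (u n)\<close> is an inner product with a fixed
  \<open>h\<close> and tends to 0 with the \<open>L2\<close> norm.\<close>

lemma closable_formI:
 assumes sf: "symmetric_form M E D"
  and repr: "\<And>f. f \<in> D \<Longrightarrow> \<exists>h\<in>L2 M. \<forall>g\<in>D. E f g = L2_inner M h g"
 shows "closable_form M E D"
 unfolding closable_form_def
proof (intro conjI allI impI sf)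
 interpret semi_inner E D by (rule symmetric_form_semi_inner[OF sf])
 have DL: "g \<in> L2 M" if "g \<in> D" for g using sf that by (auto simp: symmetric_form_def dense_subspace_def)
 fix u assume A: "(\<forall>n. u n \<in> D) \<and> form_Cauchy E u \<and> (\<lambda>n. L2_norm M (u n)) \<longlonglongrightarrow> 0"
 then have u: "\<And>n. u n \<in> D" and C: "form_Cauchy E u" and lim: "(\<lambda>n. L2_norm M (u n)) \<longlonglongrightarrow> 0" by auto
 obtain K where K: "\<And>n. nrm (u n) \<le> K" "0 < K" using form_Cauchy_bounded[OF u C] by blast
 show "(\<lambda>n. E (u n) (u n)) \<longlonglongrightarrow> 0"
 proof (rule LIMSEQ_I)
  fix e :: real assume e: "0 < e"
  define d where "d = e / (2 * K)"
  have d: "0 < d" using e K by (simp add: d_def)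
  obtain n0 where n0: "\<And>m n. m \<ge> n0 \<Longrightarrow> n \<ge> n0 \<Longrightarrow> nrm (\<lambda>x. u m x - u n x) < d"
   using C[unfolded form_Cauchy_nrm[of u, OF u], rule_format, OF d] by auto
  obtain h where h: "h \<in> L2 M" and hE: "\<And>g. g \<in> D \<Longrightarrow> E (u n0) g = L2_inner M h g" using repr[OF u[of n0]] by blast
  have "(\<lambda>n. L2_norm M h * L2_norm M (u n)) \<longlonglongrightarrow> L2_norm M h * 0" by (intro tendsto_intros lim)
  then have "eventually (\<lambda>n. L2_norm M h * L2_norm M (u n) < e / 2) sequentially"
   by (rule order_tendstoD(2)) (use e in simp)
  then obtain n1 where n1: "\<And>n. n \<ge> n1 \<Longrightarrow> L2_norm M h * L2_norm M (u n) < e / 2"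
   by (auto simp: eventually_sequentially)
  have "norm (E (u n) (u n) - 0) < e" if n: "n \<ge> max n0 n1" for n
  proof -
   have "E (u n) (u n) = E (\<lambda>x. u n x - u n0 x) (u n) + E (u n0) (u n)" by (simp add: diff1 u)
   also have "\<dots> \<le> nrm (\<lambda>x. u n x - u n0 x) * nrm (u n) + L2_norm M h * L2_norm M (u n)"
    using Cauchy_Schwarz[OF diff_mem[OF u u] u, of n n0 n] L2.Cauchy_Schwarz[OF h DL[OF u[of n]]] hE[OF u[of n]]
    unfolding L2_nrm_eq by linarith
   also have "nrm (\<lambda>x. u n x - u n0 x) * nrm (u n) \<le> d * K"
    using n0[of n n0] n K(1)[of n] d by (intro mult_mono) (auto intro: nrm_nonneg u)
   also have "d * K = e / 2" using K by (simp add: d_def)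
   finally show ?thesis using n1[of n] n nonneg[OF u[of n]] by simp
  qed
  then show "\<exists>no. \<forall>n\<ge>no. norm (E (u n) (u n) - 0) < e" by blast
 qed
qed


section \<open>Representation theorem and Friedrichs extension\<close>

lemma linear_part_zero:
 fixes a b :: real
 assumes "\<And>t. 0 \<le> 2 * t * a + t\<^sup>2 * b" and b: "0 \<le> b"
 shows "a = 0"
proof (rule ccontr)
 assume a: "a \<noteq> 0"
 \<comment> \<open>Close to the minimiser \<open>- a / b\<close> of the quadratic; the
   \<open>+ 1\<close> covers \<open>b = 0\<close>.\<close>
 define t where "t = - a / (b + 1)"
 have "t * (b + 1) = - a" using b by (simp add: t_def)
 then have "2 * t * a + t\<^sup>2 * b = t * a - t\<^sup>2" by (simp add: power2_eq_square) algebra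
 also have "t * a = - (a\<^sup>2 / (b + 1))" by (simp add: t_def power2_eq_square)
 finally have "2 * t * a + t\<^sup>2 * b < 0" using a b by (smt (verit) divide_pos_pos zero_le_power2 zero_less_power2)
 then show False using assms(1)[of t] by simp
qed

text \<open>The representing \<open>u\<close> minimises
  \<open>form_1 M E u u - 2 * L2_inner M k u\<close>. Minimising sequences are Cauchy by the
  parallelogram identity, closedness supplies the limit, and the vanishing first variation is the
  required equation.\<close>

lemma Riesz_closed_form:
 assumes cf: "closed_form M E D" and k: "k \<in> L2 M"
 shows "\<exists>u\<in>D. \<forall>v\<in>D. form_1 M E u v = L2_inner M k v"
proof -
 have sf: "symmetric_form M E D" using cf by (simp add: closed_form_def)
 interpret E: semi_inner E D by (rule symmetric_form_semi_inner[OF sf])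
 have DL: "g \<in> L2 M" if "g \<in> D" for g using sf that by (auto simp: symmetric_form_def dense_subspace_def)
 interpret B: semi_inner "form_1 M E" D
 proof
  show "D \<noteq> {}" by (rule E.ne)
  show "(\<lambda>x. a * f x + b * g x) \<in> D" if "f \<in> D" "g \<in> D" for f g a b using that by (rule E.lin)
  show "form_1 M E (\<lambda>x. a * f x + b * g x) h = a * form_1 M E f h + b * form_1 M E g h"
   if "f \<in> D" "g \<in> D" "h \<in> D" for f g h a b
   using E.lin1[OF that] L2.lin1[of f M g h] that DL by (simp add: form_1_def algebra_simps)
  show "form_1 M E f g = form_1 M E g f" if "f \<in> D" "g \<in> D" for f g
   using E.sym[OF that] L2.sym[of f M g] that DL by (simp add: form_1_def)
  show "0 \<le> form_1 M E f f" if "f \<in> D" for f using E.nonneg[OF that] by (simp add: form_1_def L2_inner_def)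
 qed
 let ?B = "form_1 M E"
 define J where "J u = ?B u u - 2 * L2_inner M k u" for u
 have ku: "\<bar>L2_inner M k u\<bar> \<le> L2_norm M k * B.nrm u" if u: "u \<in> D" for u
 proof -
  have "L2_norm M u \<le> B.nrm u" unfolding L2_norm_def B.nrm_def using E.nonneg[OF u] by (simp add: form_1_def)
  then have "L2_norm M k * L2_norm M u \<le> L2_norm M k * B.nrm u" by (intro mult_left_mono) auto
  then show ?thesis using L2.Cauchy_Schwarz[OF k DL[OF u]] unfolding L2_nrm_eq by simp
 qed
 have Jbd: "- (L2_norm M k)\<^sup>2 \<le> J u" if u: "u \<in> D" for u
 proof -
  have "- (L2_norm M k)\<^sup>2 \<le> (B.nrm u)\<^sup>2 - 2 * (L2_norm M k * B.nrm u)"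
   using zero_le_power2[of "B.nrm u - L2_norm M k"] by (simp add: power2_diff algebra_simps)
  also have "\<dots> \<le> J u" using ku[OF u] B.nrm_sq[OF u] by (simp add: J_def)
  finally show ?thesis .
 qed
 define m where "m = (INF u\<in>D. J u)"
 have bdd: "bdd_below (J ` D)" by (rule bdd_belowI[of _ "- (L2_norm M k)\<^sup>2"]) (use Jbd in auto)
 have mJ: "m \<le> J u" if "u \<in> D" for u unfolding m_def by (rule cINF_lower[OF bdd that])
 have ex: "\<exists>u. u \<in> D \<and> J u < m + 1 / real (Suc n)" for n
 proof -
  have "Inf (J ` D) < m + 1 / real (Suc n)" by (simp add: m_def)
  moreover have "J ` D \<noteq> {}" using E.ne by blast
  ultimately obtain y where "y \<in> J ` D" "y < m + 1 / real (Suc n)" by (meson cInf_lessD)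
  then show ?thesis by auto
 qed
 define u where "u n = (SOME u. u \<in> D \<and> J u < m + 1 / real (Suc n))" for n
 have "u n \<in> D \<and> J (u n) < m + 1 / real (Suc n)" for n unfolding u_def by (rule someI_ex[OF ex])
 then have u: "\<And>n. u n \<in> D" and uJ: "\<And>n. J (u n) < m + 1 / real (Suc n)" by auto
 have small: "(\<lambda>n. 1 / real (Suc n)) \<longlonglongrightarrow> 0" using LIMSEQ_inverse_real_of_nat by (simp add: field_simps)
 have "form_Cauchy ?B u" unfolding form_Cauchy_def
 proof (intro allI impI)
  fix e :: real assume e: "0 < e"
  obtain n0 where n0: "\<And>n. n \<ge> n0 \<Longrightarrow> 1 / real (Suc n) < e / 4"
   using order_tendstoD(2)[OF small, of "e/4"] e by (auto simp: eventually_sequentially)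
  have "?B (\<lambda>x. u i x - u j x) (\<lambda>x. u i x - u j x) < e" if "i \<ge> n0" "j \<ge> n0" for i j
  proof -
   have "?B (\<lambda>x. u i x - u j x) (\<lambda>x. u i x - u j x) =
     2 * J (u i) + 2 * J (u j) - 4 * J (\<lambda>x. 1/2 * u i x + 1/2 * u j x)"
    unfolding B.parallelogram[OF u u] J_def L2.lin2[OF DL[OF u] DL[OF u] k] by simp
   also have "\<dots> < e"
    using uJ[of i] uJ[of j] n0[OF that(1)] n0[OF that(2)] mJ[OF E.lin[OF u[of i] u[of j], of "1/2" "1/2"]] by linarith
   finally show ?thesis .
  qed
  then show "\<exists>n0. \<forall>i\<ge>n0. \<forall>j\<ge>n0. ?B (\<lambda>x. u i x - u j x) (\<lambda>x. u i x - u j x) < e" by blast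
 qed
 then obtain w where w: "w \<in> D" and wl: "(\<lambda>n. ?B (\<lambda>x. u n x - w x) (\<lambda>x. u n x - w x)) \<longlonglongrightarrow> 0"
  using cf u unfolding closed_form_def by blast
 have nl: "(\<lambda>n. B.nrm (\<lambda>x. u n x - w x)) \<longlonglongrightarrow> 0" using tendsto_real_sqrt[OF wl] by (simp add: B.nrm_def)
 have "(\<lambda>n. B.nrm (u n)) \<longlonglongrightarrow> B.nrm w" by (rule LIM_zero_cancel, rule Lim_null_comparison[OF always_eventually nl])
   (use B.nrm_abs_diff[OF u w] in auto)
 then have l1: "(\<lambda>n. ?B (u n) (u n)) \<longlonglongrightarrow> ?B w w"
  using tendsto_power[of "\<lambda>n. B.nrm (u n)" "B.nrm w" sequentially 2] by (simp add: B.nrm_sq u w)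
 have "(\<lambda>n. L2_norm M k * B.nrm (\<lambda>x. u n x - w x)) \<longlonglongrightarrow> 0" using tendsto_mult_left[OF nl] by simp
 then have "(\<lambda>n. L2_inner M k (u n) - L2_inner M k w) \<longlonglongrightarrow> 0" by (rule Lim_null_comparison[OF always_eventually, rotated])
   (use ku[OF B.diff_mem[OF u w]] L2.diff2[OF DL[OF u] DL[OF w] k] in auto)
 then have l2: "(\<lambda>n. L2_inner M k (u n)) \<longlonglongrightarrow> L2_inner M k w" by (rule LIM_zero_cancel)
 have "(\<lambda>n. J (u n)) \<longlonglongrightarrow> J w" unfolding J_def by (intro tendsto_intros l1 l2)
 moreover have "(\<lambda>n. m + 1 / real (Suc n)) \<longlonglongrightarrow> m + 0" by (intro tendsto_intros small)
 ultimately have Jw: "J w \<le> m + 0" by (rule LIMSEQ_le) (use uJ in \<open>auto intro: less_imp_le\<close>)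
 have "?B w v = L2_inner M k v" if v: "v \<in> D" for v
 proof -
  have "0 \<le> 2 * t * (?B w v - L2_inner M k v) + t\<^sup>2 * ?B v v" for t
  proof -
   have "J w \<le> J (\<lambda>x. 1 * w x + t * v x)" using Jw mJ[OF E.lin[OF w v, of 1 t]] by linarith
   then show ?thesis unfolding J_def B.quad[OF w v] L2.lin2[OF DL[OF w] DL[OF v] k] by (simp add: algebra_simps)
  qed
  then show ?thesis using linear_part_zero B.nonneg[OF v] by fastforce
 qed
 then show ?thesis using w by blast
qed

text \<open>The extension is the operator of the closed form: its domain consists of those
  \<open>f\<close> for which \<open>E' f\<close> is represented by an \<open>L2\<close> function.
  Self-adjointness follows from symmetry and the surjectivity of the identity plus \<open>B\<close>,
  which is \<open>Riesz_closed_form\<close>.\<close>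

theorem friedrichs_extension_exists:
 assumes so: "symmetric_operator M A D" and nn: "\<And>f. f \<in> D \<Longrightarrow> 0 \<le> L2_inner M (A f) f"
 shows "\<exists>B D'. friedrichs_extension M A D B D'"
proof -
 define q where "q = (\<lambda>f g. L2_inner M (A f) g)"
 have dense: "dense_subspace M D" and AL: "\<And>f. f \<in> D \<Longrightarrow> A f \<in> L2 M"
  and AAE: "\<And>f g. f \<in> D \<Longrightarrow> g \<in> D \<Longrightarrow> (AE x in M. f x = g x) \<Longrightarrow> (AE x in M. A f x = A g x)"
  and Alin: "\<And>f g a b. f \<in> D \<Longrightarrow> g \<in> D \<Longrightarrow> AE x in M. A (\<lambda>y. a * f y + b * g y) x = a * A f x + b * A g x"
  and Asym: "\<And>f g. f \<in> D \<Longrightarrow> g \<in> D \<Longrightarrow> L2_inner M (A f) g = L2_inner M f (A g)"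
  using so unfolding symmetric_operator_def by blast+
 have DL: "f \<in> L2 M" if "f \<in> D" for f using dense that by (auto simp: dense_subspace_def)
 have Dlin: "(\<lambda>x. a * f x + b * g x) \<in> D" if "f \<in> D" "g \<in> D" for f g a b
  using dense that by (auto simp: dense_subspace_def)
 have sf: "symmetric_form M q D" unfolding symmetric_form_def
 proof (intro conjI ballI allI impI dense)
  show "q f h = q g h" if "f \<in> D" "g \<in> D" "h \<in> D" "AE x in M. f x = g x" for f g h
   unfolding q_def by (rule L2_inner_cong) (use that AAE AL DL in auto)
  show "q (\<lambda>x. a * f x + b * g x) h = a * q f h + b * q g h" if "f \<in> D" "g \<in> D" "h \<in> D" for f g h a b
  proof -
   have "q (\<lambda>x. a * f x + b * g x) h = L2_inner M (\<lambda>x. a * A f x + b * A g x) h"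
    unfolding q_def by (rule L2_inner_cong[OF AL[OF Dlin] L2_lin[OF AL AL] DL DL Alin]) (use that in auto)
   then show ?thesis unfolding q_def using L2.lin1 AL DL that by metis
  qed
  show "q f g = q g f" if "f \<in> D" "g \<in> D" for f g unfolding q_def using Asym[OF that] L2.sym[OF DL AL] that by simp
  show "0 \<le> q f f" if "f \<in> D" for f using nn[OF that] by (simp add: q_def)
 qed
 have cl: "closable_form M q D" by (rule closable_formI[OF sf]) (use AL in \<open>auto simp: q_def\<close>)
 interpret closable M q D by unfold_locales (rule cl)
 define P where "P f h \<longleftrightarrow> h \<in> L2 M \<and> (\<forall>g\<in>D'. E' f g = L2_inner M h g)" for f h
 define DF where "DF = {f \<in> D'. \<exists>h\<in>L2 M. \<forall>g\<in>D'. E' f g = L2_inner M h g}"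
 \<comment> \<open>The representing function is unique only up to null sets, so one is chosen; for
   this reason the operator equations for \<open>B\<close> hold almost everywhere.\<close>
 define B where "B f = (SOME h. P f h)" for f
 have PB: "P f (B f)" if "f \<in> DF" for f
 proof -
  have "\<exists>h. P f h" using that by (auto simp: DF_def P_def)
  then show ?thesis unfolding B_def by (rule someI_ex)
 qed
 have DFI: "f \<in> DF" if "f \<in> D'" "P f h" for f h using that by (auto simp: DF_def P_def)
 have DFD': "f \<in> D'" if "f \<in> DF" for f using that by (simp add: DF_def)
 have dense': "dense_subspace M D'" using closure_symmetric_form by (simp add: symmetric_form_def)
 have Puniq: "AE x in M. h x = h' x" if "P f h" "P f h'" for f h h'
 proof -
  have "AE x in M. h x - h' x = 0"
  proof (rule dense_orthogonal[OF dense'])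
   show "(\<lambda>x. h x - h' x) \<in> L2 M" using that L2.diff_mem by (auto simp: P_def)
   show "L2_inner M (\<lambda>x. h x - h' x) g = 0" if "g \<in> D'" for g
    using \<open>P f h\<close> \<open>P f h'\<close> that L2.diff1[of h M h' g] closure_dom_L2[OF that] by (auto simp: P_def)
  qed
  then show ?thesis by simp
 qed
 \<comment> \<open>\<open>B\<close> extends \<open>A\<close>: a constant sequence approximates
   \<open>f\<close>, and \<open>q f (v n)\<close> is the inner product of \<open>A f\<close> with
   \<open>v n\<close>, which is continuous in \<open>L2\<close>.\<close>
 have PA: "P f (A f)" if f: "f \<in> D" for f unfolding P_def
 proof (intro conjI ballI AL[OF f])
  fix g assume g: "g \<in> D'"
  obtain v where v: "approximates M q D v g" by (rule closure_domE[OF g])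
  have gL: "g \<in> L2 M" by (rule closure_dom_L2[OF g])
  have lim: "(\<lambda>n. L2_norm M (A f) * L2_dist M (v n) g) \<longlonglongrightarrow> 0"
   using tendsto_mult_left[OF approx_L2[OF v]] by simp
  have bd: "norm (L2_inner M (A f) (v n) - L2_inner M (A f) g) \<le> L2_norm M (A f) * L2_dist M (v n) g" for n
   using L2.Cauchy_Schwarz[OF AL[OF f] L2.diff_mem[OF D_L2[OF approx_mem[OF v]] gL]]
   by (simp add: L2_nrm_eq L2.diff2[OF D_L2[OF approx_mem[OF v]] gL AL[OF f]])
  have "(\<lambda>n. L2_inner M (A f) (v n) - L2_inner M (A f) g) \<longlonglongrightarrow> 0"
   by (rule Lim_null_comparison[OF always_eventually lim]) (use bd in blast)
  then have "(\<lambda>n. q f (v n)) \<longlonglongrightarrow> L2_inner M (A f) g" unfolding q_def by (rule LIM_zero_cancel)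
  then show "E' f g = L2_inner M (A f) g"
   using closure_form_limit[OF approx_const[OF f] v DL[OF f] gL] LIMSEQ_unique by blast
 qed
 have DDF: "D \<subseteq> DF" using DFI PA D_subset by blast
 have Plin: "P (\<lambda>x. a * f x + b * g x) (\<lambda>x. a * h x + b * h' x)" if "f \<in> D'" "g \<in> D'" "P f h" "P g h'" for a b f g h h'
  unfolding P_def
 proof (intro conjI ballI)
  show "(\<lambda>x. a * h x + b * h' x) \<in> L2 M" using that by (auto simp: P_def intro: L2_lin)
  fix k assume k: "k \<in> D'"
  show "E' (\<lambda>x. a * f x + b * g x) k = L2_inner M (\<lambda>x. a * h x + b * h' x) k"
   using that k E'.lin1[OF that(1,2) k] L2.lin1[of h M h' k] closure_dom_L2[OF k] by (simp add: P_def)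
 qed
 have BL: "B f \<in> L2 M" if "f \<in> DF" for f using PB[OF that] by (simp add: P_def)
 have BE: "E' f g = L2_inner M (B f) g" if "f \<in> DF" "g \<in> D'" for f g using PB[OF that(1)] that(2) by (simp add: P_def)
 have so': "symmetric_operator M B DF" unfolding symmetric_operator_def
 proof (intro conjI ballI allI impI)
  show "dense_subspace M DF" unfolding dense_subspace_def
  proof (intro conjI ballI allI impI)
   show "DF \<noteq> {}" using DDF E.ne by blast
   show "DF \<subseteq> L2 M" using DFD' closure_dom_L2 by blast
   show "(\<lambda>x. a * f x + b * g x) \<in> DF" if "f \<in> DF" "g \<in> DF" for f g a b
    by (rule DFI[OF E'.lin Plin]) (use that DFD' PB in auto)
   show "\<exists>g\<in>DF. L2_dist M f g < e" if "f \<in> L2 M" "0 < e" for f e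
    using dense that DDF unfolding dense_subspace_def by blast
  qed
  show "B f \<in> L2 M" if "f \<in> DF" for f by (rule BL[OF that])
  show "AE x in M. B f x = B g x" if f: "f \<in> DF" and g: "g \<in> DF" and eq: "AE x in M. f x = g x" for f g
  proof -
   have "E' f k = E' g k" if "k \<in> D'" for k
    using closure_symmetric_form DFD'[OF f] DFD'[OF g] eq that unfolding symmetric_form_def by blast
   then have "P f (B g)" using PB[OF g] by (simp add: P_def)
   then show ?thesis by (rule Puniq[OF PB[OF f]])
  qed
  show "AE x in M. B (\<lambda>y. a * f y + b * g y) x = a * B f x + b * B g x" if f: "f \<in> DF" and g: "g \<in> DF" for f g a b
  proof -
   have "P (\<lambda>y. a * f y + b * g y) (\<lambda>x. a * B f x + b * B g x)"
    by (rule Plin[OF DFD'[OF f] DFD'[OF g] PB[OF f] PB[OF g]])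
   moreover have "(\<lambda>y. a * f y + b * g y) \<in> DF" using calculation DFI E'.lin[OF DFD'[OF f] DFD'[OF g]] by blast
   ultimately show ?thesis using Puniq[OF PB] by blast
  qed
  show "L2_inner M (B f) g = L2_inner M f (B g)" if f: "f \<in> DF" and g: "g \<in> DF" for f g
   using BE[OF f DFD'[OF g]] BE[OF g DFD'[OF f]] E'.sym[OF DFD'[OF f] DFD'[OF g]]
    L2.sym[OF BL[OF g] closure_dom_L2[OF DFD'[OF f]]] by simp
 qed
 have sa: "self_adjoint_operator M B DF" unfolding self_adjoint_operator_def
 proof (intro conjI ballI impI so')
  fix g assume g: "g \<in> L2 M" and "\<exists>h\<in>L2 M. \<forall>f\<in>DF. L2_inner M (B f) g = L2_inner M f h"
  then obtain h where h: "h \<in> L2 M" and hE: "\<And>f. f \<in> DF \<Longrightarrow> L2_inner M (B f) g = L2_inner M f h" by blast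
  \<comment> \<open>The equation \<open>k = u + B u\<close> is solvable for every \<open>k\<close>,
    since \<open>form_1 M E' u v = L2_inner M k v\<close> says exactly that \<open>k - u\<close>
    represents \<open>E' u\<close>.\<close>
  have surj: "\<exists>u\<in>DF. P u (\<lambda>x. k x - u x)" if k: "k \<in> L2 M" for k
  proof -
   obtain u where u: "u \<in> D'" and uE: "\<And>v. v \<in> D' \<Longrightarrow> form_1 M E' u v = L2_inner M k v"
    using Riesz_closed_form[OF closed_closure k] by blast
   have "P u (\<lambda>x. k x - u x)" unfolding P_def
   proof (intro conjI ballI)
    show "E' u v = L2_inner M (\<lambda>x. k x - u x) v" if v: "v \<in> D'" for v
     using uE[OF v] L2.diff1[OF k closure_dom_L2[OF u] closure_dom_L2[OF v]] by (simp add: form_1_def)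
   qed (rule L2.diff_mem[OF k closure_dom_L2[OF u]])
   then show ?thesis using DFI u by blast
  qed
  \<comment> \<open>\<open>g0\<close> solves \<open>g0 + B g0 = h + g\<close>. As \<open>g\<close>
    lies in the domain of the adjoint with value \<open>h\<close>, testing against all
    \<open>k = f + B f\<close> forces \<open>g = g0\<close> almost everywhere.\<close>
  obtain g0 where g0: "g0 \<in> DF" and Pg0: "P g0 (\<lambda>x. (h x + g x) - g0 x)" using surj[OF L2.add_mem[OF h g]] by blast
  have g0L: "g0 \<in> L2 M" by (rule closure_dom_L2[OF DFD'[OF g0]])
  have gg: "(\<lambda>x. g x - g0 x) \<in> L2 M" by (rule L2.diff_mem[OF g g0L])
  have "AE x in M. g x - g0 x = 0"
  proof (rule dense_orthogonal[OF _ gg])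
   show "dense_subspace M (L2 M)" unfolding dense_subspace_def
    using L2.ne L2_lin by (auto intro!: bexI simp: L2_norm_def L2_inner_def)
   fix k assume k: "k \<in> L2 M"
   obtain f where f: "f \<in> DF" and Pf: "P f (\<lambda>x. k x - f x)" using surj[OF k] by blast
   have fL: "f \<in> L2 M" by (rule closure_dom_L2[OF DFD'[OF f]])
   have kf: "(\<lambda>x. k x - f x) \<in> L2 M" by (rule L2.diff_mem[OF k fL])
   have "L2_inner M (\<lambda>x. k x - f x) g = L2_inner M (B f) g"
    by (rule L2_inner_cong[OF kf BL[OF f] g g Puniq[OF Pf PB[OF f]]]) auto
   also have "\<dots> = L2_inner M f h" by (rule hE[OF f])
   finally have 1: "L2_inner M k g = L2_inner M f h + L2_inner M f g" using L2.diff1[OF k fL g] by simp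
   have "L2_inner M (\<lambda>x. k x - f x) g0 = E' f g0" using Pf DFD'[OF g0] by (simp add: P_def)
   also have "\<dots> = E' g0 f" by (rule E'.sym[OF DFD'[OF f] DFD'[OF g0]])
   also have "\<dots> = L2_inner M (\<lambda>x. (h x + g x) - g0 x) f" using Pg0 DFD'[OF f] by (simp add: P_def)
   also have "\<dots> = L2_inner M h f + L2_inner M g f - L2_inner M g0 f"
    using L2.diff1[OF L2.add_mem[OF h g] g0L fL] L2.lin1[OF h g fL, of 1 1] by simp
   finally have 2: "L2_inner M k g0 = L2_inner M f h + L2_inner M f g"
    using L2.diff1[OF k fL g0L] L2.sym[OF h fL] L2.sym[OF g fL] L2.sym[OF g0L fL] by simp
   show "L2_inner M (\<lambda>x. g x - g0 x) k = 0" using 1 2 L2.diff1[OF g g0L k] L2.sym[OF k g] L2.sym[OF k g0L] by simp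
  qed
  then have eq: "AE x in M. g0 x = g x" by eventually_elim simp
  \<comment> \<open>The domain consists of functions, so \<open>g\<close> itself and not only its
    class has to be placed in it.\<close>
  have gD': "g \<in> D'" by (rule closure_dom_AE[OF DFD'[OF g0] g eq])
  have "E' g0 k = E' g k" if "k \<in> D'" for k
   using closure_symmetric_form DFD'[OF g0] gD' eq that unfolding symmetric_form_def by blast
  then have "P g (B g0)" using PB[OF g0] by (simp add: P_def)
  then show "g \<in> DF" using DFI gD' by blast
 qed
 have "friedrichs_extension M A D B DF" unfolding friedrichs_extension_def Let_def q_def[symmetric]
 proof (intro conjI ballI)
  show "AE x in M. B f x = A f x" if "f \<in> D" for f using Puniq[OF PB PA] that DDF by blast
  show "DF = {f \<in> D'. \<exists>h\<in>L2 M. \<forall>g\<in>D'. E' f g = L2_inner M h g}" by (rule DF_def)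
  show "E' f g = L2_inner M (B f) g" if "f \<in> DF" "g \<in> D'" for f g by (rule BE[OF that])
  show "0 \<le> L2_inner M (A f) f" if "f \<in> D" for f by (rule nn[OF that])
 qed (rule so cl sa DDF)+
 then show ?thesis by blast
qed


section \<open>Functional monotone class theorem\<close>

text \<open>All conditions in \<open>lim\<close> concern points of \<Omega> only, so a constant
  sequence replaces a bounded function by any other one that agrees with it there. As an inductive
  set the class yields the monotone class theorem in the form of an induction rule.\<close>

inductive_set mono_class :: "'a set \<Rightarrow> ('a \<Rightarrow> real) set \<Rightarrow> ('a \<Rightarrow> real) set"
 for \<Omega> :: "'a set" and M :: "('a \<Rightarrow> real) set" where
 one: "(\<lambda>x. 1) \<in> mono_class \<Omega> M"
| base: "f \<in> M \<Longrightarrow> f \<in> mono_class \<Omega> M"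
| lin: "f \<in> mono_class \<Omega> M \<Longrightarrow> g \<in> mono_class \<Omega> M \<Longrightarrow> (\<lambda>x. a * f x + b * g x) \<in> mono_class \<Omega> M"
| lim: "(\<And>n. fn n \<in> mono_class \<Omega> M) \<Longrightarrow> (\<And>n x. x \<in> \<Omega> \<Longrightarrow> \<bar>fn n x\<bar> \<le> C) \<Longrightarrow>
  (\<And>x. x \<in> \<Omega> \<Longrightarrow> (\<lambda>n. fn n x) \<longlonglongrightarrow> f x) \<Longrightarrow> f \<in> mono_class \<Omega> M"

context
 fixes \<Omega> :: "'a set" and M :: "('a \<Rightarrow> real) set"
 assumes mult: "\<And>f g. f \<in> M \<Longrightarrow> g \<in> M \<Longrightarrow> (\<lambda>x. f x * g x) \<in> M"
  and bd: "\<And>f. f \<in> M \<Longrightarrow> \<exists>C. \<forall>x\<in>\<Omega>. \<bar>f x\<bar> \<le> C"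
begin

lemma mono_class_bounded: "f \<in> mono_class \<Omega> M \<Longrightarrow> \<exists>C. \<forall>x\<in>\<Omega>. \<bar>f x\<bar> \<le> C"
proof (induction rule: mono_class.induct)
 case (lin f g a b)
 then obtain C D where C: "\<forall>x\<in>\<Omega>. \<bar>f x\<bar> \<le> C" and D: "\<forall>x\<in>\<Omega>. \<bar>g x\<bar> \<le> D" by blast
 have "\<bar>a * f x + b * g x\<bar> \<le> \<bar>a\<bar> * C + \<bar>b\<bar> * D" if "x \<in> \<Omega>" for x
 proof -
  have "\<bar>a * f x + b * g x\<bar> \<le> \<bar>a\<bar> * \<bar>f x\<bar> + \<bar>b\<bar> * \<bar>g x\<bar>" by (metis abs_mult abs_triangle_ineq)
  also have "\<dots> \<le> \<bar>a\<bar> * C + \<bar>b\<bar> * D" using C D that by (intro add_mono mult_left_mono) auto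
  finally show ?thesis .
 qed
 then show ?case by blast
next
 case (lim fn C f)
 have "\<bar>f x\<bar> \<le> C" if "x \<in> \<Omega>" for x
  by (rule LIMSEQ_le_const2[OF tendsto_rabs[OF lim.hyps(3)[OF that]]]) (use lim.hyps(2)[OF that] in auto)
 then show ?case by blast
qed (use bd in \<open>auto intro!: exI[of _ "1::real"]\<close>)

lemma mono_class_mult_base:
 assumes g: "g \<in> M" shows "f \<in> mono_class \<Omega> M \<Longrightarrow> (\<lambda>x. f x * g x) \<in> mono_class \<Omega> M"
proof (induction rule: mono_class.induct)
 case one show ?case using mono_class.base[OF g] by simp
next
 case (base f) show ?case using mono_class.base[OF mult[OF base g]] .
next
 case (lin f h a b) show ?case using mono_class.lin[OF lin.IH, of a b] by (simp add: algebra_simps)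
next
 case (lim fn C f)
 obtain D where D: "\<forall>x\<in>\<Omega>. \<bar>g x\<bar> \<le> D" using bd[OF g] by blast
 show ?case
 proof (rule mono_class.lim[where fn = "\<lambda>n x. fn n x * g x" and C = "C * D"])
  show "\<bar>fn n x * g x\<bar> \<le> C * D" if "x \<in> \<Omega>" for n x
   unfolding abs_mult using D that lim.hyps(2)[OF that, of n] by (intro mult_mono) auto
  show "(\<lambda>n. fn n x * g x) \<longlonglongrightarrow> f x * g x" if "x \<in> \<Omega>" for x by (intro tendsto_intros lim.hyps(3) that)
 qed (use lim.IH in auto)
qed

lemma mono_class_mult:
 assumes g: "g \<in> mono_class \<Omega> M" shows "f \<in> mono_class \<Omega> M \<Longrightarrow> (\<lambda>x. f x * g x) \<in> mono_class \<Omega> M"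
proof (induction rule: mono_class.induct)
 case one show ?case using g by simp
next
 case (base f) show ?case using mono_class_mult_base[OF base g] by (simp add: mult.commute)
next
 case (lin f h a b) show ?case using mono_class.lin[OF lin.IH, of a b] by (simp add: algebra_simps)
next
 case (lim fn C f)
 obtain D where D: "\<forall>x\<in>\<Omega>. \<bar>g x\<bar> \<le> D" using mono_class_bounded[OF g] by blast
 show ?case
 proof (rule mono_class.lim[where fn = "\<lambda>n x. fn n x * g x" and C = "C * D"])
  show "\<bar>fn n x * g x\<bar> \<le> C * D" if "x \<in> \<Omega>" for n x
   unfolding abs_mult using D that lim.hyps(2)[OF that, of n] by (intro mult_mono) auto
  show "(\<lambda>n. fn n x * g x) \<longlonglongrightarrow> f x * g x" if "x \<in> \<Omega>" for x by (intro tendsto_intros lim.hyps(3) that)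
 qed (use lim.IH in auto)
qed

lemma mono_class_const: "(\<lambda>x. c) \<in> mono_class \<Omega> M"
 using mono_class.lin[OF mono_class.one mono_class.one, of c 0] by simp

text \<open>Weierstrass: on a compact interval containing the values of \<open>f\<close> the
  function \<phi> is a uniform limit of polynomials, and the class is closed under products.\<close>

lemma mono_class_continuous:
 assumes f: "f \<in> mono_class \<Omega> M" and \<phi>: "continuous_on UNIV (\<phi> :: real \<Rightarrow> real)"
 shows "(\<lambda>x. \<phi> (f x)) \<in> mono_class \<Omega> M"
proof -
 obtain C where C: "\<forall>x\<in>\<Omega>. \<bar>f x\<bar> \<le> C" using mono_class_bounded[OF f] by blast
 have poly: "(\<lambda>x. p (f x)) \<in> mono_class \<Omega> M" if "real_polynomial_function p" for p using that
 proof (induction rule: real_polynomial_function.induct)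
  case (linear p)
  then obtain c where "p = (\<lambda>x. x * c)" by (auto simp: real_bounded_linear)
  then show ?case using mono_class.lin[OF f f, of c 0] by (simp add: mult.commute)
 next
  case (const c) show ?case by (rule mono_class_const)
 next
  case (add p q) then show ?case using mono_class.lin[of "\<lambda>x. p (f x)" \<Omega> M "\<lambda>x. q (f x)" 1 1] by simp
 next
  case (mult p q) then show ?case using mono_class_mult by blast
 qed
 have co: "continuous_on {-C..C} \<phi>" using \<phi> continuous_on_subset by blast
 have ex: "\<exists>p. real_polynomial_function p \<and> (\<forall>t\<in>{-C..C}. \<bar>\<phi> t - p t\<bar> < 1 / real (Suc n))" for n
 proof -
  have "0 < 1 / real (Suc n)" by simp
  then obtain g where "real_polynomial_function g" "\<And>x. x \<in> {-C..C} \<Longrightarrow> \<bar>\<phi> x - g x\<bar> < 1 / real (Suc n)"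
   by (rule Stone_Weierstrass_real_polynomial_function[OF compact_Icc co]) blast
  then show ?thesis by blast
 qed
 define p where "p n = (SOME p. real_polynomial_function p \<and> (\<forall>t\<in>{-C..C}. \<bar>\<phi> t - p t\<bar> < 1 / real (Suc n)))" for n
 have p: "real_polynomial_function (p n) \<and> (\<forall>t\<in>{-C..C}. \<bar>\<phi> t - p n t\<bar> < 1 / real (Suc n))" for n
  unfolding p_def by (rule someI_ex[OF ex])
 have "compact (\<phi> ` {-C..C})" by (rule compact_continuous_image[OF co compact_Icc])
 then obtain K where K: "\<And>t. t \<in> {-C..C} \<Longrightarrow> \<bar>\<phi> t\<bar> \<le> K"
  using compact_imp_bounded[of "\<phi> ` {-C..C}"] unfolding bounded_iff by (auto simp del: atLeastAtMost_iff)
 have small: "(\<lambda>n. 1 / real (Suc n)) \<longlonglongrightarrow> 0" using LIMSEQ_inverse_real_of_nat by (simp add: field_simps)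
 show ?thesis
 proof (rule mono_class.lim[where fn = "\<lambda>n x. p n (f x)" and C = "K + 1"])
  show "(\<lambda>x. p n (f x)) \<in> mono_class \<Omega> M" for n using p poly by blast
  fix x assume x: "x \<in> \<Omega>"
  then have fx: "f x \<in> {-C..C}" using C by (auto simp: abs_le_iff)
  have d: "\<bar>\<phi> (f x) - p n (f x)\<bar> < 1 / real (Suc n)" for n using p fx by blast
  have "1 / real (Suc n) \<le> 1" for n by (simp add: field_simps)
  then show "\<bar>p n (f x)\<bar> \<le> K + 1" for n using K[OF fx] d[of n] by (smt (verit, best))
  show "(\<lambda>n. p n (f x)) \<longlonglongrightarrow> \<phi> (f x)"
  proof (rule LIM_zero_cancel, rule Lim_null_comparison[OF always_eventually small], rule allI)
   show "norm (p n (f x) - \<phi> (f x)) \<le> 1 / real (Suc n)" for n using d[of n] by (simp add: abs_minus_commute)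
  qed
 qed
qed

text \<open>Ramps of slope \<open>n\<close> starting at the level \<open>a\<close> increase to the
  indicator of \<open>f > a\<close>.\<close>

lemma mono_class_indicator_gt:
 assumes f: "f \<in> mono_class \<Omega> M" shows "indicat_real (f -` {a<..} \<inter> \<Omega>) \<in> mono_class \<Omega> M"
proof (rule mono_class.lim[where fn = "\<lambda>n x. min 1 (max 0 (real n * (f x - a)))" and C = 1])
 show "(\<lambda>x. min 1 (max 0 (real n * (f x - a)))) \<in> mono_class \<Omega> M" for n
  by (rule mono_class_continuous[OF f, of "\<lambda>t. min 1 (max 0 (real n * (t - a)))"]) (intro continuous_intros)
 show "\<bar>min 1 (max 0 (real n * (f x - a)))\<bar> \<le> 1" for n x by auto
 show "(\<lambda>n. min 1 (max 0 (real n * (f x - a)))) \<longlonglongrightarrow> indicat_real (f -` {a<..} \<inter> \<Omega>) x" if x: "x \<in> \<Omega>" for x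
 proof (cases "f x > a")
  case True
  obtain n0 :: nat where n0: "1 / (f x - a) \<le> real n0" using real_arch_simple by blast
  have "min 1 (max 0 (real n * (f x - a))) = 1" if "n \<ge> n0" for n
  proof -
   have "1 / (f x - a) \<le> real n" using n0 that by linarith
   then have "1 \<le> real n * (f x - a)" using True by (simp add: field_simps)
   then show ?thesis by simp
  qed
  then have "eventually (\<lambda>n. min 1 (max 0 (real n * (f x - a))) = 1) sequentially"
   by (auto simp: eventually_sequentially)
  then have "(\<lambda>n. min 1 (max 0 (real n * (f x - a)))) \<longlonglongrightarrow> 1" by (rule tendsto_eventually)
  then show ?thesis using True x by simp
 next
  case False
  then have "min 1 (max 0 (real n * (f x - a))) = 0" for n
   using mult_nonneg_nonpos[of "real n" "f x - a"] by (simp add: max_absorb1)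
  then show ?thesis using False by simp
 qed
qed

text \<open>Because the class is multiplicative, the complement of a countable union is a limit of
  finite products of complements, and no disjointness has to be arranged.\<close>

lemma mono_class_sigma_sets:
 assumes "A \<in> sigma_sets \<Omega> {f -` {a<..} \<inter> \<Omega> |f a. f \<in> M}"
 shows "indicat_real A \<in> mono_class \<Omega> M"
 using assms
proof (induction rule: sigma_sets.induct)
 case (Basic A)
 then obtain f a where A: "A = f -` {a<..} \<inter> \<Omega>" and "f \<in> M" by blast
 then show ?case unfolding A by (intro mono_class_indicator_gt mono_class.base)
next
 case Empty show ?case using mono_class_const[of 0] by (simp add: indicator_def)
next
 case (Compl A)
 have "(\<lambda>x. 1 * 1 + (-1) * indicat_real A x) \<in> mono_class \<Omega> M" by (rule mono_class.lin[OF mono_class.one Compl.IH])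
 \<comment> \<open>A constant sequence: it only replaces \<open>1 - indicat_real A\<close> by the
   indicator of \<open>\<Omega> - A\<close>, from which it may differ outside \<Omega>.\<close>
 then show ?case by (rule mono_class.lim[where fn = "\<lambda>n x. 1 * 1 + (-1) * indicat_real A x" and C = 1])
   (auto simp: indicator_def)
next
 case (Union A)
 have fin: "(\<lambda>x. \<Prod>i<n. (1 * 1 + (-1) * indicat_real (A i) x)) \<in> mono_class \<Omega> M" for n
 proof (induction n)
  case 0 show ?case using mono_class.one by simp
 next
  case (Suc n)
  show ?case using mono_class_mult[OF mono_class.lin[OF mono_class.one Union.IH[of n], of 1 "-1"] Suc] by simp
 qed
 have val: "(\<Prod>i<n. (1 * 1 + (-1) * indicat_real (A i) x)) = (if x \<in> (\<Union>i<n. A i) then 0 else 1)" for n x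
  by (induction n) (auto simp: indicator_def lessThan_Suc)
 have lim: "(\<lambda>x. 1 - indicat_real (\<Union>i. A i) x) \<in> mono_class \<Omega> M"
 proof (rule mono_class.lim[OF fin, where C = 1])
  show "\<bar>\<Prod>i<n. 1 * 1 + - 1 * indicat_real (A i) x\<bar> \<le> 1" for n x unfolding val by simp
  show "(\<lambda>n. \<Prod>i<n. 1 * 1 + - 1 * indicat_real (A i) x) \<longlonglongrightarrow> 1 - indicat_real (\<Union>i. A i) x" for x unfolding val
  proof (cases "x \<in> (\<Union>i. A i)")
   case True
   then obtain k where "x \<in> A k" by blast
   then have "eventually (\<lambda>n. (if x \<in> (\<Union>i<n. A i) then 0 else 1) = (0::real)) sequentially"
    by (intro eventually_sequentiallyI[of "Suc k"]) auto
   then show "(\<lambda>n. if x \<in> (\<Union>i<n. A i) then 0 else 1) \<longlonglongrightarrow> 1 - indicat_real (\<Union>i. A i) x"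
    using True tendsto_eventually by (auto simp: indicator_def)
  qed (auto simp: indicator_def)
 qed
 show ?case using mono_class.lin[OF mono_class.one lim, of 1 "-1"] by simp
qed

text \<open>Staircase approximation: \<open>h\<close> rounded down to multiples of
  \<open>1 / (n + 1)\<close> takes finitely many values because \<open>h\<close> is bounded, and
  each level set has its indicator in the class.\<close>

lemma mono_class_measurable:
 assumes N: "space N = \<Omega>" "sets N \<subseteq> sigma_sets \<Omega> {f -` {a<..} \<inter> \<Omega> |f a. f \<in> M}"
  and h [measurable]: "h \<in> borel_measurable N" and C: "\<And>x. x \<in> \<Omega> \<Longrightarrow> \<bar>h x\<bar> \<le> C"
 shows "h \<in> mono_class \<Omega> M"
proof -
 define A where "A n k = {x \<in> space N. \<lfloor>real (Suc n) * h x\<rfloor> = k}" for n :: nat and k :: int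
 have "A n k \<in> sets N" for n k unfolding A_def by measurable
 then have iA: "indicat_real (A n k) \<in> mono_class \<Omega> M" for n k using N(2) mono_class_sigma_sets by blast
 \<comment> \<open>A finite set containing every integer the floor can take, with a margin of 1 on
   both sides for rounding.\<close>
 define K where "K n = {- \<lceil>real (Suc n) * \<bar>C\<bar>\<rceil> - 1 .. \<lceil>real (Suc n) * \<bar>C\<bar>\<rceil> + 1}" for n :: nat
 define hn where "hn n x = (\<Sum>k\<in>K n. real_of_int k / real (Suc n) * indicat_real (A n k) x)" for n x
 have fin: "finite (K n)" for n by (simp add: K_def)
 have sumc: "(\<lambda>x. \<Sum>k\<in>F. real_of_int k / real (Suc n) * indicat_real (A n k) x) \<in> mono_class \<Omega> M" if "finite F" for F n
  using that
 proof (induction rule: finite_induct)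
  case empty show ?case using mono_class_const[of 0] by simp
 next
  case (insert k F)
  show ?case using mono_class.lin[OF iA[of n k] insert.IH, of "real_of_int k / real (Suc n)" 1] insert.hyps by simp
 qed
 have hnval: "hn n x = real_of_int \<lfloor>real (Suc n) * h x\<rfloor> / real (Suc n)" if x: "x \<in> \<Omega>" for n x
 proof -
  have "\<bar>real (Suc n) * h x\<bar> \<le> real (Suc n) * \<bar>C\<bar>" unfolding abs_mult using C[OF x] by (intro mult_mono) auto
  then have "\<lfloor>real (Suc n) * h x\<rfloor> \<in> K n" unfolding K_def atLeastAtMost_iff abs_le_iff by linarith
  moreover have "hn n x = (\<Sum>k\<in>K n. if k = \<lfloor>real (Suc n) * h x\<rfloor> then real_of_int k / real (Suc n) else 0)"
   unfolding hn_def by (rule sum.cong) (use x N(1) in \<open>auto simp: A_def indicator_def\<close>)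
  ultimately show ?thesis using fin[of n] by (simp add: sum.delta)
 qed
 have close: "\<bar>hn n x - h x\<bar> \<le> 1 / real (Suc n)" if x: "x \<in> \<Omega>" for n x
 proof -
  have "\<bar>real_of_int \<lfloor>real (Suc n) * h x\<rfloor> - real (Suc n) * h x\<bar> \<le> 1" by linarith
  then have "\<bar>real_of_int \<lfloor>real (Suc n) * h x\<rfloor> - real (Suc n) * h x\<bar> / real (Suc n) \<le> 1 / real (Suc n)"
   by (rule divide_right_mono) simp
  moreover have "hn n x - h x = (real_of_int \<lfloor>real (Suc n) * h x\<rfloor> - real (Suc n) * h x) / real (Suc n)"
   unfolding hnval[OF x] by (simp add: diff_divide_distrib)
  ultimately show ?thesis by simp
 qed
 have small: "(\<lambda>n. 1 / real (Suc n)) \<longlonglongrightarrow> 0" using LIMSEQ_inverse_real_of_nat by (simp add: field_simps)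
 show ?thesis
 proof (rule mono_class.lim[where fn = hn and C = "C + 1"])
  show "hn n \<in> mono_class \<Omega> M" for n unfolding hn_def by (rule sumc[OF fin])
  fix x assume x: "x \<in> \<Omega>"
  have "1 / real (Suc n) \<le> 1" for n by (simp add: field_simps)
  then show "\<bar>hn n x\<bar> \<le> C + 1" for n using close[OF x, of n] C[OF x] by (smt (verit, best))
  show "(\<lambda>n. hn n x) \<longlonglongrightarrow> h x"
   by (rule LIM_zero_cancel, rule Lim_null_comparison[OF always_eventually small]) (use close[OF x] in simp)
 qed
qed

text \<open>Applied to the measurability of kernel integrals, to the \<sigma>-algebra generated by
  \<open>FC\<close>, to the density of \<open>FC\<close> and to the Mecke identity.\<close>

theorem monotone_class_induct:
 assumes N: "space N = \<Omega>" "sets N \<subseteq> sigma_sets \<Omega> {f -` {a<..} \<inter> \<Omega> |f a. f \<in> M}"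
  and h: "h \<in> borel_measurable N" "\<And>x. x \<in> \<Omega> \<Longrightarrow> \<bar>h x\<bar> \<le> C"
  and one: "P (\<lambda>x. 1)" and base: "\<And>f. f \<in> M \<Longrightarrow> P f"
  and lin: "\<And>f g a b. P f \<Longrightarrow> P g \<Longrightarrow> P (\<lambda>x. a * f x + b * g x)"
  and lim: "\<And>fn f C. (\<And>n. P (fn n)) \<Longrightarrow> (\<And>n x. x \<in> \<Omega> \<Longrightarrow> \<bar>fn n x\<bar> \<le> C) \<Longrightarrow> (\<And>x. x \<in> \<Omega> \<Longrightarrow> (\<lambda>n. fn n x) \<longlonglongrightarrow> f x) \<Longrightarrow> P f"
 shows "P h"
proof -
 have "h \<in> mono_class \<Omega> M" by (rule mono_class_measurable[OF N h])
 then show ?thesis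
 proof (induction rule: mono_class.induct)
  case (lim fn C f)
  show ?case by (rule assms(8)[of fn C, OF lim.IH lim.hyps(2,3)])
 qed (use one base lin in auto)
qed

end


section \<open>Algebras of smooth functions\<close>

text \<open>Both notions of smoothness of the statement ask that all iterated derivatives satisfy a
 basic condition \<open>ok\<close>.  Membership is proved by coinduction up to the generated algebra.\<close>

locale diff_algebra =
 fixes I :: "'i set" and Dv :: "'i \<Rightarrow> ('a \<Rightarrow> real) \<Rightarrow> 'a \<Rightarrow> real" and ok :: "('a \<Rightarrow> real) \<Rightarrow> bool"
 assumes ok_const: "ok (\<lambda>x. c)"
  and ok_add: "ok f \<Longrightarrow> ok g \<Longrightarrow> ok (\<lambda>x. f x + g x)"
  and ok_mult: "ok f \<Longrightarrow> ok g \<Longrightarrow> ok (\<lambda>x. f x * g x)"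
  and D_const: "i \<in> I \<Longrightarrow> Dv i (\<lambda>x. c) = (\<lambda>x. 0)"
  and D_add: "i \<in> I \<Longrightarrow> ok f \<Longrightarrow> ok g \<Longrightarrow> Dv i (\<lambda>x. f x + g x) = (\<lambda>x. Dv i f x + Dv i g x)"
  and D_mult: "i \<in> I \<Longrightarrow> ok f \<Longrightarrow> ok g \<Longrightarrow> Dv i (\<lambda>x. f x * g x) = (\<lambda>x. Dv i f x * g x + f x * Dv i g x)"
begin

definition smooth :: "('a \<Rightarrow> real) \<Rightarrow> bool" where "smooth f \<longleftrightarrow> (\<forall>is. set is \<subseteq> I \<longrightarrow> ok (foldr Dv is f))"

inductive_set alg :: "('a \<Rightarrow> real) set \<Rightarrow> ('a \<Rightarrow> real) set" for S where
 const: "(\<lambda>x. c) \<in> alg S"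
| base: "f \<in> S \<Longrightarrow> f \<in> alg S"
| add: "f \<in> alg S \<Longrightarrow> g \<in> alg S \<Longrightarrow> (\<lambda>x. f x + g x) \<in> alg S"
| mult: "f \<in> alg S \<Longrightarrow> g \<in> alg S \<Longrightarrow> (\<lambda>x. f x * g x) \<in> alg S"

text \<open>The sum and product rules carry the derivatives of the generators through the algebra. A
  generator may therefore have a derivative that is a polynomial in generators, as happens for
  \<open>logistic\<close> and \<open>exp_bump\<close>.\<close>

lemma smooth_coinduct:
 assumes S: "\<And>f. f \<in> S \<Longrightarrow> ok f \<and> (\<forall>i\<in>I. Dv i f \<in> alg S)"
  and f: "f \<in> alg S"
 shows "smooth f"
proof -
 have step: "ok f \<and> (\<forall>i\<in>I. Dv i f \<in> alg S)" if "f \<in> alg S" for f using that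
 proof (induction rule: alg.induct)
  case (const c) then show ?case using D_const ok_const alg.const by auto
 next
  case (base f) then show ?case using S by blast
 next
  case (add f g) then show ?case by (auto intro!: ok_add alg.add simp: D_add)
 next
  case (mult f g) then show ?case by (auto intro!: ok_mult alg.add alg.mult simp: D_mult)
 qed
 have "foldr Dv is f \<in> alg S" if "set is \<subseteq> I" for "is" using that by (induction "is") (use f step in auto)
 then show ?thesis using step unfolding smooth_def by blast
qed

lemma smooth_ok: "smooth f \<Longrightarrow> ok f" unfolding smooth_def by (metis empty_subsetI foldr.simps(1) id_apply list.set(1))

lemma smooth_D: "smooth f \<Longrightarrow> i \<in> I \<Longrightarrow> smooth (Dv i f)" unfolding smooth_def
proof (intro allI impI)
 fix "is" assume *: "\<forall>is. set is \<subseteq> I \<longrightarrow> ok (foldr Dv is f)" "i \<in> I" "set is \<subseteq> I"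
 then have "ok (foldr Dv (is @ [i]) f)" by (auto simp del: foldr_append)
 then show "ok (foldr Dv is (Dv i f))" by simp
qed

lemma alg_smooth: "f \<in> alg (Collect smooth) \<Longrightarrow> smooth f"
 by (rule smooth_coinduct[of "Collect smooth"]) (auto intro: smooth_ok smooth_D alg.base)

lemma smooth_const: "smooth (\<lambda>x. c)" by (rule alg_smooth[OF alg.const])

lemma smooth_add: "smooth f \<Longrightarrow> smooth g \<Longrightarrow> smooth (\<lambda>x. f x + g x)"
 by (intro alg_smooth[OF alg.add[OF alg.base alg.base]] CollectI)

lemma smooth_mult: "smooth f \<Longrightarrow> smooth g \<Longrightarrow> smooth (\<lambda>x. f x * g x)"
 by (intro alg_smooth[OF alg.mult[OF alg.base alg.base]] CollectI)

lemma smooth_prod: "finite A \<Longrightarrow> (\<And>a. a \<in> A \<Longrightarrow> smooth (f a)) \<Longrightarrow> smooth (\<lambda>x. \<Prod>a\<in>A. f a x)"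
 by (induction A rule: finite_induct) (auto intro!: smooth_const smooth_mult)

end


section \<open>Smooth functions of finitely many coordinates\<close>

text \<open>\<open>Cb_smooth\<close> asks the dependence on the first \<open>N\<close> coordinates
  of \<open>g\<close> alone. The derivatives inherit it by \<open>coord_deriv_local\<close>, so it
  can be made part of the condition on every iterated derivative.\<close>

definition cb_ok :: "nat \<Rightarrow> ((nat \<Rightarrow> real) \<Rightarrow> real) \<Rightarrow> bool" where
 "cb_ok N h \<longleftrightarrow> (\<forall>v w. (\<forall>i<N. v i = w i) \<longrightarrow> h v = h w) \<and> continuous_on UNIV h \<and> bounded (range h) \<and>
   (\<forall>i<N. \<forall>v. (\<lambda>t. h (v(i := t))) differentiable (at (v i)))"

lemma cb_ok_deriv:
 assumes "cb_ok N h" "i < N"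
 shows "((\<lambda>t. h (v(i := t))) has_real_derivative coord_deriv i h (v(i := s))) (at s)"
proof -
 have "(\<lambda>t. h ((v(i := s))(i := t))) differentiable (at ((v(i := s)) i))" using assms unfolding cb_ok_def by blast
 then have "(\<lambda>t. h (v(i := t))) differentiable (at s)" by simp
 then have "DERIV (\<lambda>t. h (v(i := t))) s :> deriv (\<lambda>t. h (v(i := t))) s"
  using DERIV_deriv_iff_real_differentiable by blast
 then show ?thesis by (simp add: coord_deriv_def)
qed

lemma cb_ok_deriv': "cb_ok N h \<Longrightarrow> i < N \<Longrightarrow> ((\<lambda>t. h (v(i := t))) has_real_derivative coord_deriv i h v) (at (v i))"
 using cb_ok_deriv[of N h i v "v i"] by simp

lemma coord_derivI: "((\<lambda>t. h (v(i := t))) has_real_derivative d) (at (v i)) \<Longrightarrow> coord_deriv i h v = d"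
 by (simp add: coord_deriv_def DERIV_imp_deriv)

lemma bounded_range_iff: "bounded (range (h :: 'a \<Rightarrow> real)) \<longleftrightarrow> (\<exists>C. \<forall>v. \<bar>h v\<bar> \<le> C)" by (auto simp: bounded_iff)

interpretation cb: diff_algebra "{..<N}" coord_deriv "cb_ok N" for N
proof
 show "cb_ok N (\<lambda>x. c)" for c by (auto simp: cb_ok_def bounded_range_iff)
 fix f g assume f: "cb_ok N f" and g: "cb_ok N g"
 obtain C D where C: "\<And>v. \<bar>f v\<bar> \<le> C" and D: "\<And>v. \<bar>g v\<bar> \<le> D" using f g unfolding cb_ok_def bounded_range_iff by blast
 show "cb_ok N (\<lambda>x. f x + g x)" unfolding cb_ok_def
 proof (intro conjI allI impI)
  show "f v + g v = f w + g w" if "\<forall>i<N. v i = w i" for v w using f g that unfolding cb_ok_def by metis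
  show "continuous_on UNIV (\<lambda>x. f x + g x)" using f g by (auto simp: cb_ok_def intro: continuous_intros)
  have "\<bar>f v + g v\<bar> \<le> C + D" for v using C[of v] D[of v] by linarith
  then show "bounded (range (\<lambda>x. f x + g x))" unfolding bounded_range_iff by blast
  show "(\<lambda>t. f (v(i := t)) + g (v(i := t))) differentiable (at (v i))" if "i < N" for i v
   using f g that by (auto simp: cb_ok_def intro: differentiable_add)
 qed
 show "cb_ok N (\<lambda>x. f x * g x)" unfolding cb_ok_def
 proof (intro conjI allI impI)
  show "f v * g v = f w * g w" if "\<forall>i<N. v i = w i" for v w using f g that unfolding cb_ok_def by metis
  show "continuous_on UNIV (\<lambda>x. f x * g x)" using f g by (auto simp: cb_ok_def intro: continuous_intros)
  have "\<bar>f v * g v\<bar> \<le> C * D" for v unfolding abs_mult using C[of v] D[of v] by (intro mult_mono) auto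
  then show "bounded (range (\<lambda>x. f x * g x))" unfolding bounded_range_iff by blast
  show "(\<lambda>t. f (v(i := t)) * g (v(i := t))) differentiable (at (v i))" if "i < N" for i v
   using f g that by (auto simp: cb_ok_def intro: differentiable_mult)
 qed
 fix i assume i: "i \<in> {..<N}"
 note df = cb_ok_deriv'[OF f, of i] cb_ok_deriv'[OF g, of i]
 show "coord_deriv i (\<lambda>x. f x + g x) = (\<lambda>x. coord_deriv i f x + coord_deriv i g x)"
  by (rule ext, rule coord_derivI) (use df i in \<open>auto intro!: derivative_eq_intros\<close>)
 show "coord_deriv i (\<lambda>x. f x * g x) = (\<lambda>x. coord_deriv i f x * g x + f x * coord_deriv i g x)"
  by (rule ext, rule coord_derivI) (use df i in \<open>auto intro!: derivative_eq_intros\<close>)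
qed (auto simp: coord_deriv_def)

lemma coord_deriv_local:
 assumes "\<And>v w. (\<forall>i<N. v i = w i) \<Longrightarrow> h v = h w" and "\<forall>i<N. v i = w i" and "j < N"
 shows "coord_deriv j h v = coord_deriv j h w"
proof -
 have "(\<lambda>t. h (v(j := t))) = (\<lambda>t. h (w(j := t)))" by (rule ext, rule assms(1)) (use assms in auto)
 then show ?thesis using assms by (simp add: coord_deriv_def)
qed

lemma Cb_smooth_iff: "g \<in> Cb_smooth N \<longleftrightarrow> cb.smooth N g"
proof
 assume g: "g \<in> Cb_smooth N"
 have dep: "\<forall>v w. (\<forall>i<N. v i = w i) \<longrightarrow> foldr coord_deriv is g v = foldr coord_deriv is g w" if "set is \<subseteq> {..<N}" for "is"
  using that
 proof (induction "is")
  case Nil then show ?case using g by (auto simp: Cb_smooth_def)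
 next
  case (Cons i "is") then show ?case using coord_deriv_local[of N "foldr coord_deriv is g"] by auto
 qed
 show "cb.smooth N g" unfolding cb.smooth_def cb_ok_def using g dep unfolding Cb_smooth_def by (auto simp: Let_def)
next
 assume g: "cb.smooth N g"
 then show "g \<in> Cb_smooth N"
  using cb.smooth_ok[OF g] unfolding cb.smooth_def Cb_smooth_def by (auto simp: Let_def cb_ok_def)
qed

lemma Cb_smooth_ok: "g \<in> Cb_smooth N \<Longrightarrow> cb_ok N g" by (simp add: Cb_smooth_iff cb.smooth_ok)

lemma Cb_smooth_D: "g \<in> Cb_smooth N \<Longrightarrow> i < N \<Longrightarrow> coord_deriv i g \<in> Cb_smooth N" by (simp add: Cb_smooth_iff cb.smooth_D)

lemma Cb_smooth_cong: "g \<in> Cb_smooth N \<Longrightarrow> (\<And>i. i < N \<Longrightarrow> v i = w i) \<Longrightarrow> g v = g w"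
 using Cb_smooth_ok unfolding cb_ok_def by blast

lemma Cb_smooth_continuous: "g \<in> Cb_smooth N \<Longrightarrow> continuous_on UNIV g" using Cb_smooth_ok unfolding cb_ok_def by blast

lemma Cb_smooth_bounded: "g \<in> Cb_smooth N \<Longrightarrow> \<exists>C. \<forall>v. \<bar>g v\<bar> \<le> C"
 using Cb_smooth_ok unfolding cb_ok_def bounded_range_iff by blast

lemma Cb_smooth_measurable [measurable_dest]:
 assumes g: "g \<in> Cb_smooth N" and v: "\<And>i. i < N \<Longrightarrow> (\<lambda>x. v x i) \<in> borel_measurable M"
 shows "(\<lambda>x. g (v x)) \<in> borel_measurable M"
proof -
 \<comment> \<open>Measurability into the sequence space concerns every coordinate; those from
   \<open>N\<close> on are not controlled and are set to 0, which leaves \<open>g\<close>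
   unchanged.\<close>
 have "g (v x) = g (\<lambda>i. if i < N then v x i else 0)" for x by (rule Cb_smooth_cong[OF g]) simp
 moreover have "(\<lambda>x i. if i < N then v x i else 0) \<in> borel_measurable M"
 proof (rule measurable_coordinatewise_then_product)
  show "(\<lambda>x. if i < N then v x i else 0) \<in> borel_measurable M" for i using v[of i] by (cases "i < N") auto
 qed
 ultimately show ?thesis
  using measurable_compose[OF _ borel_measurable_continuous_onI[OF Cb_smooth_continuous[OF g]]] by simp
qed

text \<open>Only partial derivatives of \<open>g\<close> are given. Total differentiability is
  obtained by releasing one coordinate after the other, where the continuity of the next partial
  derivative justifies each step.\<close>

lemma Cb_smooth_chain:
 fixes v :: "'a::real_normed_vector \<Rightarrow> nat \<Rightarrow> real"
 assumes g: "g \<in> Cb_smooth N"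
  and v: "\<And>i x. i < N \<Longrightarrow> ((\<lambda>y. v y i) has_derivative v' i x) (at x)"
 shows "((\<lambda>y. g (v y)) has_derivative (\<lambda>h. \<Sum>i<N. coord_deriv i g (v x) * v' i x h)) (at x)"
proof -
 \<comment> \<open>Coordinates below \<open>k\<close> follow \<open>y\<close>, all others are frozen
   at their values in \<open>x\<close>.\<close>
 define w where "w k y = (\<lambda>i. if i < k then v y i else v x i)" for k y
 have wx: "w k x = v x" for k by (simp add: w_def fun_eq_iff)
 have cont: "continuous_on UNIV (\<lambda>y. v y i)" if "i < N" for i
  using has_derivative_continuous[OF v[OF that]] by (simp add: continuous_on_eq_continuous_at)
 have P: "((\<lambda>y. g (w k y)) has_derivative (\<lambda>h. \<Sum>i<k. coord_deriv i g (v x) * v' i x h)) (at x)" if "k \<le> N" for k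
  using that
 proof (induction k)
  case 0 then show ?case by (simp add: w_def)
 next
  case (Suc k)
  then have k: "k < N" by simp
  define fy where "fy y t = blinfun_mult_right (coord_deriv k g ((w k y)(k := t)))" for y t
  have wc: "continuous_on UNIV (\<lambda>p. (w k (fst p))(k := snd p))"
  proof (rule continuous_on_coordinatewise_then_product)
   fix i
   show "continuous_on UNIV (\<lambda>p::'a\<times>real. ((w k (fst p))(k := snd p)) i)"
   proof (cases "i < k")
    case True
    then have "continuous_on UNIV (\<lambda>p::'a\<times>real. v (fst p) i)"
     by (intro continuous_on_compose2[OF cont continuous_on_fst[OF continuous_on_id]]) (use k in auto)
    then show ?thesis using True by (simp add: w_def)
   next
    case False
    then show ?thesis by (cases "i = k") (auto simp: w_def intro!: continuous_intros)
   qed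
  qed
  have "((\<lambda>(y, t). g ((w k y)(k := t))) has_derivative
    (\<lambda>(ty, tt). (\<Sum>i<k. coord_deriv i g (v x) * v' i x ty) + fy x (v x k) tt)) (at (x, v x k) within UNIV \<times> UNIV)"
  proof (rule has_derivative_partialsI)
   have "(w k y)(k := v x k) = w k y" for y by (auto simp: w_def fun_eq_iff)
   then show "((\<lambda>y. g ((w k y)(k := v x k))) has_derivative (\<lambda>h. \<Sum>i<k. coord_deriv i g (v x) * v' i x h)) (at x within UNIV)"
    using Suc by simp
   show "((\<lambda>t. g ((w k y)(k := t))) has_derivative blinfun_apply (fy y t)) (at t within UNIV)" for y t
    using cb_ok_deriv[OF Cb_smooth_ok[OF g] k, of "w k y" t] by (simp add: fy_def has_field_derivative_def)
   have "continuous_on UNIV (\<lambda>p. fy (fst p) (snd p))" unfolding fy_def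
    by (intro bounded_linear.continuous_on[OF bounded_linear_blinfun_mult_right]
      continuous_on_compose2[OF Cb_smooth_continuous[OF Cb_smooth_D[OF g k]] wc]) auto
   then have "continuous (at (x, v x k)) (\<lambda>p. fy (fst p) (snd p))" by (simp add: continuous_on_eq_continuous_at)
   then show "continuous (at (x, v x k) within UNIV \<times> UNIV) (\<lambda>(x, y). fy x y)" by (simp add: case_prod_beta')
  qed auto
  then have A: "((\<lambda>p. g ((w k (fst p))(k := snd p))) has_derivative
    (\<lambda>p. (\<Sum>i<k. coord_deriv i g (v x) * v' i x (fst p)) + fy x (v x k) (snd p))) (at (x, v x k))"
   by (simp add: case_prod_beta')
  have "((\<lambda>y. (y, v y k)) has_derivative (\<lambda>h. (h, v' k x h))) (at x)"
   by (intro has_derivative_Pair has_derivative_ident v k)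
  from has_derivative_compose[OF this A]
  have "((\<lambda>y. g ((w k y)(k := v y k))) has_derivative
    (\<lambda>h. (\<Sum>i<k. coord_deriv i g (v x) * v' i x h) + fy x (v x k) (v' k x h))) (at x)" by simp
  moreover have "(w k y)(k := v y k) = w (Suc k) y" for y by (auto simp: w_def fun_eq_iff)
  moreover have "(v x)(k := v x k) = v x" by simp
  ultimately show ?case by (simp add: fy_def wx)
 qed
 have "g (w N y) = g (v y)" for y by (rule Cb_smooth_cong[OF g]) (simp add: w_def)
 then show ?thesis using P[of N] by simp
qed

lemma Cb_smooth_const: "(\<lambda>v. c) \<in> Cb_smooth N" unfolding Cb_smooth_iff by (rule cb.smooth_const)

lemma Cb_smooth_add: "f \<in> Cb_smooth N \<Longrightarrow> g \<in> Cb_smooth N \<Longrightarrow> (\<lambda>v. f v + g v) \<in> Cb_smooth N"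
 unfolding Cb_smooth_iff by (rule cb.smooth_add)

lemma Cb_smooth_mult: "f \<in> Cb_smooth N \<Longrightarrow> g \<in> Cb_smooth N \<Longrightarrow> (\<lambda>v. f v * g v) \<in> Cb_smooth N"
 unfolding Cb_smooth_iff by (rule cb.smooth_mult)

lemma coord_deriv_indep: "(\<And>t. h (v(i := t)) = h v) \<Longrightarrow> coord_deriv i h v = 0" by (simp add: coord_deriv_def)

lemma Cb_smooth_mono:
 assumes g: "g \<in> Cb_smooth N" and NN: "N \<le> N'" shows "g \<in> Cb_smooth N'"
 unfolding Cb_smooth_iff
proof (rule cb.smooth_coinduct[of "Cb_smooth N"])
 show "g \<in> cb.alg (Cb_smooth N)" by (rule cb.alg.base[OF g])
 fix f assume f: "f \<in> Cb_smooth N"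
 have upd: "f (v(i := t)) = f v" if "i \<ge> N" for v i t by (rule Cb_smooth_cong[OF f]) (use that in auto)
 show "cb_ok N' f \<and> (\<forall>i\<in>{..<N'}. coord_deriv i f \<in> cb.alg (Cb_smooth N))"
 proof
  show "cb_ok N' f" unfolding cb_ok_def
  proof (intro conjI allI impI)
   show "f v = f w" if "\<forall>i<N'. v i = w i" for v w by (rule Cb_smooth_cong[OF f]) (use that NN in auto)
   show "(\<lambda>t. f (v(i := t))) differentiable (at (v i))" for i v
   proof (cases "i < N")
    case True then show ?thesis using Cb_smooth_ok[OF f] by (simp add: cb_ok_def)
   next
    case False then show ?thesis using upd[of i] by simp
   qed
  qed (use Cb_smooth_ok[OF f] in \<open>auto simp: cb_ok_def\<close>)
  show "\<forall>i\<in>{..<N'}. coord_deriv i f \<in> cb.alg (Cb_smooth N)"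
  proof
   fix i
   show "coord_deriv i f \<in> cb.alg (Cb_smooth N)"
   proof (cases "i < N")
    case True then show ?thesis using Cb_smooth_D[OF f] cb.alg.base by blast
   next
    case False
    then have "coord_deriv i f = (\<lambda>x. 0)" using upd[of i] by (auto simp: fun_eq_iff intro!: coord_deriv_indep)
    then show ?thesis using cb.alg.const by simp
   qed
  qed
 qed
qed

text \<open>Makes room for a second block of \<open>k\<close> coordinates in front, so that two
  cylinder functions can be written over the concatenation of their test functions.\<close>

lemma Cb_smooth_shift:
 assumes g: "g \<in> Cb_smooth N" shows "(\<lambda>v. g (\<lambda>i. v (i + k))) \<in> Cb_smooth (N + k)"
 unfolding Cb_smooth_iff
proof (rule cb.smooth_coinduct[of "(\<lambda>g v. g (\<lambda>i. v (i + k))) ` Cb_smooth N"])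
 let ?S = "(\<lambda>g v. g (\<lambda>i. v (i + k))) ` Cb_smooth N"
 show "(\<lambda>v. g (\<lambda>i. v (i + k))) \<in> cb.alg ?S" by (rule cb.alg.base) (use g in blast)
 fix f assume "f \<in> ?S"
 then obtain h where f: "f = (\<lambda>v. h (\<lambda>i. v (i + k)))" and h: "h \<in> Cb_smooth N" by blast
 have low: "(\<lambda>j. (v(i := t)) (j + k)) = (\<lambda>j. v (j + k))" if "i < k" for v :: "nat \<Rightarrow> real" and i t
  using that by (auto simp: fun_eq_iff)
 have high: "(\<lambda>j. (v(i := t)) (j + k)) = (\<lambda>j. v (j + k))(i - k := t)" if "k \<le> i" for v :: "nat \<Rightarrow> real" and i t
  using that by (auto simp: fun_eq_iff)
 show "cb_ok (N + k) f \<and> (\<forall>i\<in>{..<N + k}. coord_deriv i f \<in> cb.alg ?S)"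
 proof
  show "cb_ok (N + k) f" unfolding cb_ok_def
  proof (intro conjI allI impI)
   show "f v = f w" if "\<forall>i<N + k. v i = w i" for v w unfolding f by (rule Cb_smooth_cong[OF h]) (use that in auto)
   show "continuous_on UNIV f" unfolding f by (rule continuous_on_compose2[OF Cb_smooth_continuous[OF h]])
     (auto intro!: continuous_on_coordinatewise_then_product)
   show "bounded (range f)" using Cb_smooth_bounded[OF h] unfolding bounded_range_iff f by blast
   show "(\<lambda>t. f (v(i := t))) differentiable (at (v i))" if "i < N + k" for i v
   proof (cases "i < k")
    case False
    have "(\<lambda>t. h ((\<lambda>j. v (j + k))(i - k := t))) differentiable (at ((\<lambda>j. v (j + k)) (i - k)))"
     using Cb_smooth_ok[OF h] that False unfolding cb_ok_def by (metis add_less_cancel_right le_add_diff_inverse2 not_less)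
    moreover have "(\<lambda>t. f (v(i := t))) = (\<lambda>t. h ((\<lambda>j. v (j + k))(i - k := t)))"
     unfolding f using False by (intro ext, subst high) auto
    ultimately show ?thesis using False by simp
   qed (simp add: f low)
  qed
  show "\<forall>i\<in>{..<N + k}. coord_deriv i f \<in> cb.alg ?S"
  proof
   fix i assume i: "i \<in> {..<N + k}"
   show "coord_deriv i f \<in> cb.alg ?S"
   proof (cases "i < k")
    case True
    then have "coord_deriv i f = (\<lambda>x. 0)" unfolding f by (auto simp: fun_eq_iff low intro!: coord_deriv_indep)
    then show ?thesis using cb.alg.const by simp
   next
    case False
    then have "coord_deriv i f = (\<lambda>v. coord_deriv (i - k) h (\<lambda>j. v (j + k)))"
    proof (intro ext)
     fix v
     have "(\<lambda>t. f (v(i := t))) = (\<lambda>t. h ((\<lambda>j. v (j + k))(i - k := t)))"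
      unfolding f using False by (intro ext, subst high) auto
     then show "coord_deriv i f v = coord_deriv (i - k) h (\<lambda>j. v (j + k))"
      using False by (simp add: coord_deriv_def)
    qed
    then show ?thesis using Cb_smooth_D[OF h, of "i - k"] i False by (intro cb.alg.base) auto
   qed
  qed
 qed
qed

section \<open>The logistic function and softplus\<close>

definition logistic :: "real \<Rightarrow> real" where "logistic t = 1 / (1 + exp (- t))"

definition softplus :: "real \<Rightarrow> real" where "softplus t = ln (1 + exp t)"

lemma logistic_bounds: "0 < logistic t" "logistic t < 1" by (simp_all add: logistic_def add_pos_pos field_simps)

text \<open>The derivative is a polynomial in the function itself, so one generator controls all
  derivatives in the coinduction. The function is also the derivative of \<open>softplus\<close>,
  and, bounded and increasing, it brings unbounded pairings into \<open>FC\<close>.\<close>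

lemma logistic_deriv: "(logistic has_real_derivative logistic t * (1 - logistic t)) (at t)"
proof -
 have p: "1 + exp (- t) \<noteq> 0" using exp_gt_zero[of "-t"] by linarith
 show ?thesis unfolding logistic_def[abs_def]
  by (rule derivative_eq_intros refl p)+ (use p in \<open>simp add: field_simps power2_eq_square\<close>)
qed

lemma softplus_deriv: "(softplus has_real_derivative logistic t) (at t)"
proof -
 have p: "0 < 1 + exp t" using exp_gt_zero[of t] by linarith
 show ?thesis unfolding softplus_def[abs_def] logistic_def
  by (rule derivative_eq_intros refl p)+ (use p in \<open>simp add: field_simps exp_minus\<close>)
qed

lemma softplus_mono: "s \<le> t \<Longrightarrow> softplus s \<le> softplus t" by (simp add: softplus_def add_pos_pos)

text \<open>Boundedness of \<psi> is asked on compact intervals, because \<open>g\<close> has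
  bounded range; this admits \<open>softplus\<close>.\<close>

lemma cb_ok_compose:
 assumes g: "g \<in> Cb_smooth N" and \<psi>: "\<And>t. (\<psi> has_real_derivative \<psi>' t) (at t)" and bd: "\<And>R. bounded (\<psi> ` {-R..R})"
 shows "cb_ok N (\<lambda>v. \<psi> (g v))"
  and "i < N \<Longrightarrow> coord_deriv i (\<lambda>v. \<psi> (g v)) = (\<lambda>v. \<psi>' (g v) * coord_deriv i g v)"
proof -
 have d: "((\<lambda>t. \<psi> (g (v(i := t)))) has_real_derivative \<psi>' (g v) * coord_deriv i g v) (at (v i))" if "i < N" for i v
  using DERIV_chain2[OF \<psi> cb_ok_deriv'[OF Cb_smooth_ok[OF g] that, of v]] by simp
 show "cb_ok N (\<lambda>v. \<psi> (g v))" unfolding cb_ok_def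
 proof (intro conjI allI impI)
  show "\<psi> (g v) = \<psi> (g w)" if "\<forall>i<N. v i = w i" for v w using Cb_smooth_cong[OF g, of v w] that by simp
  have "continuous_on UNIV \<psi>" using \<psi> DERIV_isCont continuous_at_imp_continuous_on by blast
  then show "continuous_on UNIV (\<lambda>v. \<psi> (g v))" by (rule continuous_on_compose2[OF _ Cb_smooth_continuous[OF g]]) auto
  obtain R where R: "\<And>v. \<bar>g v\<bar> \<le> R" using Cb_smooth_bounded[OF g] by blast
  have "range (\<lambda>v. \<psi> (g v)) \<subseteq> \<psi> ` {-R..R}" using R by (auto simp: abs_le_iff minus_le_iff)
  then show "bounded (range (\<lambda>v. \<psi> (g v)))" using bd bounded_subset by blast
  show "(\<lambda>t. \<psi> (g (v(i := t)))) differentiable (at (v i))" if "i < N" for i v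
   using d[OF that] real_differentiable_def by blast
 qed
 show "coord_deriv i (\<lambda>v. \<psi> (g v)) = (\<lambda>v. \<psi>' (g v) * coord_deriv i g v)" if "i < N"
  by (rule ext, rule coord_derivI, rule d[OF that])
qed

lemma Cb_smooth_logistic:
 assumes g: "g \<in> Cb_smooth N" shows "(\<lambda>v. logistic (g v)) \<in> Cb_smooth N"
 unfolding Cb_smooth_iff
proof (rule cb.smooth_coinduct[of "insert (\<lambda>v. logistic (g v)) (Cb_smooth N)"])
 let ?S = "insert (\<lambda>v. logistic (g v)) (Cb_smooth N)"
 show "(\<lambda>v. logistic (g v)) \<in> cb.alg ?S" by (rule cb.alg.base) simp
 have bd: "bounded (logistic ` {-R..R})" for R
 proof (rule boundedI)
  show "norm x \<le> 1" if "x \<in> logistic ` {-R..R}" for x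
  proof -
   from that obtain t where "x = logistic t" by blast
   then show ?thesis using logistic_bounds[of t] by simp
  qed
 qed
 fix f assume "f \<in> ?S"
 then consider "f \<in> Cb_smooth N" | "f = (\<lambda>v. logistic (g v))" by blast
 then show "cb_ok N f \<and> (\<forall>i\<in>{..<N}. coord_deriv i f \<in> cb.alg ?S)"
 proof cases
  case 1
  then show ?thesis using Cb_smooth_ok Cb_smooth_D cb.alg.base by blast
 next
  case 2
  have "(\<lambda>v. (logistic (g v) * (1 + (-1) * logistic (g v))) * coord_deriv i g v) \<in> cb.alg ?S" if "i < N" for i
   by (intro cb.alg.mult cb.alg.add cb.alg.const cb.alg.base) (use Cb_smooth_D[OF g that] in auto)
  then show ?thesis unfolding 2 using cb_ok_compose[OF g logistic_deriv bd] by simp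
 qed
qed

lemma Cb_smooth_softplus:
 assumes g: "g \<in> Cb_smooth N" shows "(\<lambda>v. softplus (g v)) \<in> Cb_smooth N"
 unfolding Cb_smooth_iff
proof (rule cb.smooth_coinduct[of "insert (\<lambda>v. softplus (g v)) (Cb_smooth N)"])
 let ?S = "insert (\<lambda>v. softplus (g v)) (Cb_smooth N)"
 show "(\<lambda>v. softplus (g v)) \<in> cb.alg ?S" by (rule cb.alg.base) simp
 have bd: "bounded (softplus ` {-R..R})" for R
 proof (rule boundedI)
  fix x assume "x \<in> softplus ` {-R..R}"
  then have "softplus (-R) \<le> x" "x \<le> softplus R" by (auto intro: softplus_mono)
  then show "norm x \<le> \<bar>softplus (-R)\<bar> + \<bar>softplus R\<bar>" by simp
 qed
 fix f assume "f \<in> ?S"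
 then consider "f \<in> Cb_smooth N" | "f = (\<lambda>v. softplus (g v))" by blast
 then show "cb_ok N f \<and> (\<forall>i\<in>{..<N}. coord_deriv i f \<in> cb.alg ?S)"
 proof cases
  case 1
  then show ?thesis using Cb_smooth_ok Cb_smooth_D cb.alg.base by blast
 next
  case 2
  have "(\<lambda>v. logistic (g v) * coord_deriv i g v) \<in> cb.alg ?S" if "i < N" for i
   by (intro cb.alg.mult cb.alg.base) (use Cb_smooth_D[OF g that] Cb_smooth_logistic[OF g] in auto)
  then show ?thesis unfolding 2 using cb_ok_compose[OF g softplus_deriv bd] by simp
 qed
qed


section \<open>Test functions\<close>

lemma dir_derivI: "(f has_derivative f') (at x) \<Longrightarrow> dir_deriv b f x = f' b"
 by (simp add: dir_deriv_def frechet_derivative_at[symmetric])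

lemma differentiable_frechet: "f differentiable (at x) \<Longrightarrow> (f has_derivative frechet_derivative f (at x)) (at x)"
 by (simp add: frechet_derivative_works)

interpretation sm: diff_algebra Basis dir_deriv "\<lambda>f :: 'a::euclidean_space \<Rightarrow> real. \<forall>x. f differentiable (at x)"
proof
 fix f g :: "'a \<Rightarrow> real" and b :: 'a
 assume f: "\<forall>x. f differentiable (at x)" and g: "\<forall>x. g differentiable (at x)"
 show "\<forall>x. (\<lambda>x. f x + g x) differentiable (at x)" using f g by auto
 show "\<forall>x. (\<lambda>x. f x * g x) differentiable (at x)" using f g by auto
 note d = differentiable_frechet[OF f[rule_format]] differentiable_frechet[OF g[rule_format]]
 show "dir_deriv b (\<lambda>x. f x + g x) = (\<lambda>x. dir_deriv b f x + dir_deriv b g x)"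
  by (rule ext, subst dir_derivI[OF has_derivative_add[OF d]]) (simp add: dir_deriv_def)
 show "dir_deriv b (\<lambda>x. f x * g x) = (\<lambda>x. dir_deriv b f x * g x + f x * dir_deriv b g x)"
  by (rule ext, subst dir_derivI[OF has_derivative_mult[OF d]]) (simp add: dir_deriv_def)
next
 show "dir_deriv b (\<lambda>x::'a. c) = (\<lambda>x. 0)" for b c by (rule ext, subst dir_derivI[OF has_derivative_const]) simp
qed auto

lemma zero_open_has_derivative:
 assumes "open S" "x \<in> S" "\<And>y. y \<in> S \<Longrightarrow> f y = (0::real)"
 shows "(f has_derivative (\<lambda>h. 0)) (at x)"
 by (rule has_derivative_transform_within_open[OF has_derivative_const assms(1,2)]) (use assms(3) in auto)

lemma foldr_dir_deriv_zero_open: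
 assumes S: "open S" and z: "\<And>y. y \<in> S \<Longrightarrow> f y = (0::real)"
 shows "x \<in> S \<Longrightarrow> foldr dir_deriv bs f x = 0"
proof (induction bs arbitrary: x)
 case (Cons b bs)
 show ?case using dir_derivI[OF zero_open_has_derivative[OF S Cons.prems Cons.IH]] by simp
qed (use z in auto)

text \<open>Smoothness on the open half-space together with support away from its boundary makes the
  extension by zero smooth everywhere. All later calculus can then take place on the full product
  space.\<close>

lemma test_functions_iff: "\<phi> \<in> test_functions \<longleftrightarrow> sm.smooth \<phi> \<and>
  (\<exists>A a b. compact A \<and> 0 < a \<and> a < b \<and> (\<forall>p. p \<notin> A \<times> {a..b} \<longrightarrow> \<phi> p = 0))"
proof
 assume \<phi>: "\<phi> \<in> test_functions"
 then obtain A a b where A: "bounded A" "0 < a" "a < b" and z: "\<And>p. p \<notin> A \<times> {a..b} \<Longrightarrow> \<phi> p = 0"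
  and sm: "smooth_on (UNIV \<times> {0<..}) \<phi>"
  unfolding test_functions_def by blast
 let ?K = "closure A \<times> {a..b}"
 have comp: "compact (closure A)" using A(1) by simp
 have z': "\<phi> p = 0" if "p \<notin> ?K" for p using that z[of p] closure_subset[of A] by fastforce
 have op: "open (- ?K)" using comp by (intro open_Compl compact_imp_closed compact_Times compact_Icc) 
 have "foldr dir_deriv bs \<phi> differentiable (at x)" if bs: "set bs \<subseteq> Basis" for bs x
 proof (cases "0 < snd x")
  case True
  then have "x \<in> UNIV \<times> {0<..}" by (simp add: mem_Times_iff)
  then show ?thesis using sm bs unfolding smooth_on_def by blast
 next
  case False
  \<comment> \<open>A point with mark at most 0 has a neighbourhood off the support, where all
    iterated derivatives of the extension vanish.\<close>
  then have x: "x \<in> - ?K" using A(2) by (auto simp: mem_Times_iff)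
  have "foldr dir_deriv bs \<phi> y = 0" if "y \<in> - ?K" for y
   by (rule foldr_dir_deriv_zero_open[OF op _ that]) (use z' in auto)
  then have "(foldr dir_deriv bs \<phi> has_derivative (\<lambda>h. 0)) (at x)" by (rule zero_open_has_derivative[OF op x])
  then show ?thesis by (rule differentiableI)
 qed
 then have "sm.smooth \<phi>" unfolding sm.smooth_def by blast
 then show "sm.smooth \<phi> \<and> (\<exists>A a b. compact A \<and> 0 < a \<and> a < b \<and> (\<forall>p. p \<notin> A \<times> {a..b} \<longrightarrow> \<phi> p = 0))"
  using comp A z' by blast
next
 assume "sm.smooth \<phi> \<and> (\<exists>A a b. compact A \<and> 0 < a \<and> a < b \<and> (\<forall>p. p \<notin> A \<times> {a..b} \<longrightarrow> \<phi> p = 0))"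
 then show "\<phi> \<in> test_functions"
  unfolding test_functions_def sm.smooth_def smooth_on_def using compact_imp_bounded by blast
qed

lemma test_functionsE:
 assumes "\<phi> \<in> test_functions"
 obtains A a b where "compact A" "0 < a" "a < b" "\<And>p. p \<notin> A \<times> {a..b} \<Longrightarrow> \<phi> p = 0"
 using assms unfolding test_functions_iff by blast

lemma test_differentiable: "\<phi> \<in> test_functions \<Longrightarrow> \<phi> differentiable (at p)"
 unfolding test_functions_iff using sm.smooth_ok by blast

lemma test_has_derivative: "\<phi> \<in> test_functions \<Longrightarrow> (\<phi> has_derivative frechet_derivative \<phi> (at p)) (at p)"
 by (rule differentiable_frechet[OF test_differentiable])

lemma test_continuous: "\<phi> \<in> test_functions \<Longrightarrow> continuous_on UNIV \<phi>"
 unfolding continuous_on_eq_continuous_at[OF open_UNIV]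
 using has_derivative_continuous[OF test_has_derivative] by blast

lemma test_measurable [measurable_dest]: "\<phi> \<in> test_functions \<Longrightarrow> \<phi> \<in> borel_measurable borel"
 by (rule borel_measurable_continuous_onI[OF test_continuous])

lemma test_bounded:
 assumes \<phi>: "\<phi> \<in> test_functions" obtains C where "\<And>p. \<bar>\<phi> p\<bar> \<le> C" "0 \<le> C"
proof -
 obtain A a b where A: "compact A" "0 < a" "a < b" "\<And>p. p \<notin> A \<times> {a..b} \<Longrightarrow> \<phi> p = 0" using test_functionsE[OF \<phi>] by blast
 have "compact (\<phi> ` (A \<times> {a..b}))"
  using continuous_on_subset[OF test_continuous[OF \<phi>]] A(1) by (intro compact_continuous_image compact_Times compact_Icc) auto
 then obtain C where C: "\<And>p. p \<in> A \<times> {a..b} \<Longrightarrow> \<bar>\<phi> p\<bar> \<le> C"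
  using compact_imp_bounded[of "\<phi> ` (A \<times> {a..b})"] unfolding bounded_iff by (metis imageI real_norm_def)
 have "\<bar>\<phi> p\<bar> \<le> max C 0" for p using C[of p] A(4)[of p] by (cases "p \<in> A \<times> {a..b}") auto
 then show ?thesis using that by (meson max.cobounded2)
qed

lemma test_dir_deriv:
 assumes \<phi>: "\<phi> \<in> test_functions" and b: "b \<in> Basis"
 shows "dir_deriv b \<phi> \<in> test_functions"
proof -
 obtain A a' b' where A: "compact A" "0 < a'" "a' < b'" "\<And>p. p \<notin> A \<times> {a'..b'} \<Longrightarrow> \<phi> p = 0"
  using test_functionsE[OF \<phi>] by blast
 have op: "open (- (A \<times> {a'..b'}))" using A(1) by (intro open_Compl compact_imp_closed compact_Times compact_Icc) 
 have "dir_deriv b \<phi> p = 0" if "p \<notin> A \<times> {a'..b'}" for p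
  using foldr_dir_deriv_zero_open[OF op, of \<phi> p "[b]"] A(4) that by auto
 then show ?thesis using \<phi> A(1-3) sm.smooth_D[of \<phi> b] b unfolding test_functions_iff by blast
qed

lemma test_mult:
 assumes \<phi>: "\<phi> \<in> test_functions" and \<psi>: "\<psi> \<in> test_functions"
 shows "(\<lambda>p. \<phi> p * \<psi> p) \<in> test_functions"
 using assms sm.smooth_mult[of \<phi> \<psi>] unfolding test_functions_iff by (metis mult_zero_left)

section \<open>Smooth bump functions\<close>

definition exp_bump :: "real poly \<Rightarrow> real \<Rightarrow> real" where
 "exp_bump q t = (if 0 < t then poly q (1 / t) * exp (- (1 / t)) else 0)"

lemma poly_exp_tendsto_0: "((\<lambda>s. poly q s * exp (- s)) \<longlongrightarrow> (0::real)) at_top"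
proof -
 have "((\<lambda>s. \<Sum>i\<le>degree q. coeff q i * (s ^ i / exp s)) \<longlongrightarrow> (\<Sum>i\<le>degree q. coeff q i * 0)) at_top"
  by (intro tendsto_intros tendsto_power_div_exp_0)
 moreover have "poly q s * exp (- s) = (\<Sum>i\<le>degree q. coeff q i * (s ^ i / exp s))" for s
  by (simp add: poly_altdef exp_minus sum_distrib_right divide_inverse mult.assoc)
 ultimately show ?thesis by simp
qed

lemma exp_bump_tendsto_0: "(exp_bump q \<longlongrightarrow> 0) (at 0)"
proof -
 have R: "(exp_bump q \<longlongrightarrow> 0) (at_right 0)"
 proof (rule Lim_transform_eventually)
  show "((\<lambda>t. poly q (inverse t) * exp (- (inverse t))) \<longlongrightarrow> 0) (at_right 0)"
   by (rule filterlim_compose[OF poly_exp_tendsto_0 filterlim_inverse_at_top_right])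
  show "eventually (\<lambda>t. poly q (inverse t) * exp (- (inverse t)) = exp_bump q t) (at_right 0)"
   by (auto simp: exp_bump_def eventually_at_filter divide_inverse)
 qed
 have L: "(exp_bump q \<longlongrightarrow> 0) (at_left 0)"
  by (rule Lim_transform_eventually[OF tendsto_const]) (auto simp: exp_bump_def eventually_at_filter)
 show ?thesis using R L by (simp add: filterlim_at_split)
qed

text \<open>With \<open>s = 1 / t\<close> the function is \<open>q(s) exp (- s)\<close>, and the
  derivative \<open>- s^2\<close> of \<open>s\<close> produces the new polynomial
  \<open>s^2 (q - q')\<close>. The polynomial index closes the family under differentiation;
  \<open>q = 1\<close> is the classical flat function.\<close>

lemma exp_bump_deriv: "(exp_bump q has_real_derivative exp_bump ([:0, 0, 1:] * (q - pderiv q)) t) (at t)"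
proof -
 consider "t < 0" | "t = 0" | "0 < t" by linarith
 then show ?thesis
 proof cases
  case 1
  have "(exp_bump q has_derivative (\<lambda>h. 0)) (at t)"
   by (rule zero_open_has_derivative[of "{..<0}"]) (use 1 in \<open>auto simp: exp_bump_def\<close>)
  then show ?thesis using 1 by (simp add: has_field_derivative_def exp_bump_def lambda_zero)
 next
  case 2
  \<comment> \<open>The difference quotient at 0 is again a bump, with the polynomial multiplied by
    its variable, and so it tends to 0.\<close>
  have "(\<lambda>h. (exp_bump q (0 + h) - exp_bump q 0) / h) = exp_bump (pCons 0 q)" by (auto simp: fun_eq_iff exp_bump_def)
  then have "(exp_bump q has_real_derivative 0) (at 0)" using exp_bump_tendsto_0 unfolding DERIV_def by metis
  then show ?thesis using 2 by (simp add: exp_bump_def)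
 next
  case 3
  have "((\<lambda>t. poly q (1 / t) * exp (- (1 / t))) has_real_derivative
    poly (pderiv q) (1 / t) * (- (1 / t\<^sup>2)) * exp (- (1 / t)) + exp (- (1 / t)) * (1 / t\<^sup>2) * poly q (1 / t)) (at t)"
   using 3 by (auto intro!: derivative_eq_intros DERIV_chain2[OF poly_DERIV] simp: power2_eq_square)
  moreover have "poly (pderiv q) (1 / t) * (- (1 / t\<^sup>2)) * exp (- (1 / t)) + exp (- (1 / t)) * (1 / t\<^sup>2) * poly q (1 / t)
    = exp_bump ([:0, 0, 1:] * (q - pderiv q)) t"
   using 3 by (simp add: exp_bump_def power2_eq_square algebra_simps)
  ultimately have "((\<lambda>t. poly q (1 / t) * exp (- (1 / t))) has_real_derivative exp_bump ([:0, 0, 1:] * (q - pderiv q)) t) (at t)"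
   by simp
  then show ?thesis
   by (rule has_field_derivative_transform_within_open[of _ _ _ "{0<..}"]) (use 3 in \<open>auto simp: exp_bump_def\<close>)
 qed
qed

lemma exp_bump_smooth: "sm.smooth (\<lambda>p::'a::euclidean_space. exp_bump q (\<alpha> * (p \<bullet> b) + \<gamma>))"
proof (rule sm.smooth_coinduct)
 let ?S = "{\<lambda>p::'a. exp_bump q (\<alpha> * (p \<bullet> b) + \<gamma>) |q \<alpha> \<gamma> b. True}"
 show "(\<lambda>p::'a. exp_bump q (\<alpha> * (p \<bullet> b) + \<gamma>)) \<in> sm.alg ?S" by (rule sm.alg.base) blast
 fix f assume "f \<in> ?S"
 then obtain q \<alpha> \<gamma> b where f: "f = (\<lambda>p::'a. exp_bump q (\<alpha> * (p \<bullet> b) + \<gamma>))" by blast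
 let ?q = "[:0, 0, 1:] * (q - pderiv q)"
 have d: "(f has_derivative (\<lambda>h. exp_bump ?q (\<alpha> * (p \<bullet> b) + \<gamma>) * (\<alpha> * (h \<bullet> b)))) (at p)" for p
 proof -
  have "((\<lambda>p. \<alpha> * (p \<bullet> b) + \<gamma>) has_derivative (\<lambda>h. \<alpha> * (h \<bullet> b))) (at p)" by (auto intro!: derivative_eq_intros)
  from has_derivative_compose[OF this exp_bump_deriv[unfolded has_field_derivative_def]]
  show ?thesis unfolding f by simp
 qed
 show "(\<forall>x. f differentiable (at x)) \<and> (\<forall>i\<in>Basis. dir_deriv i f \<in> sm.alg ?S)"
 proof (intro conjI allI ballI)
  show "f differentiable (at x)" for x by (rule differentiableI[OF d])
  fix i :: 'a
  have "dir_deriv i f = (\<lambda>p. exp_bump ?q (\<alpha> * (p \<bullet> b) + \<gamma>) * (\<alpha> * (i \<bullet> b)))" by (rule ext) (rule dir_derivI[OF d])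
  moreover have "(\<lambda>p. exp_bump ?q (\<alpha> * (p \<bullet> b) + \<gamma>) * (\<alpha> * (i \<bullet> b))) \<in> sm.alg ?S"
   by (intro sm.alg.mult sm.alg.const sm.alg.base) blast
  ultimately show "dir_deriv i f \<in> sm.alg ?S" by simp
 qed
qed

text \<open>The factor \<open>m\<close> rescales the distances to the faces: for every
  \<open>m > 0\<close> the positivity set is the same open box, and as \<open>m\<close> grows the
  bump tends to the indicator of that box.\<close>

definition box_bump :: "real \<Rightarrow> 'a::euclidean_space \<Rightarrow> 'a \<Rightarrow> 'a \<Rightarrow> real" where
 "box_bump m l u p = (\<Prod>b\<in>Basis. exp_bump 1 (m * (p \<bullet> b) + - (m * (l \<bullet> b))) * exp_bump 1 (- m * (p \<bullet> b) + m * (u \<bullet> b)))"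

lemma exp_bump_1: "0 \<le> exp_bump 1 t" "exp_bump 1 t \<le> 1" "0 < exp_bump 1 t \<longleftrightarrow> 0 < t" by (auto simp: exp_bump_def)

lemma box_bump_bounds: "0 \<le> box_bump m l u p" "box_bump m l u p \<le> 1"
 unfolding box_bump_def by (auto intro!: prod_nonneg prod_le_1 mult_nonneg_nonneg mult_le_one simp: exp_bump_1)

lemma box_bump_pos:
 assumes m: "0 < m" shows "0 < box_bump m l u p \<longleftrightarrow> p \<in> box l u"
proof
 assume p: "p \<in> box l u"
 show "0 < box_bump m l u p" unfolding box_bump_def
  by (intro prod_pos mult_pos_pos) (use p m in \<open>auto simp: exp_bump_1 box_def\<close>)
next
 assume pos: "0 < box_bump m l u p"
 have "l \<bullet> b < p \<bullet> b \<and> p \<bullet> b < u \<bullet> b" if b: "b \<in> Basis" for b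
 proof (rule ccontr)
  assume n: "\<not> (l \<bullet> b < p \<bullet> b \<and> p \<bullet> b < u \<bullet> b)"
  have "exp_bump 1 (m * (p \<bullet> b) + - (m * (l \<bullet> b))) * exp_bump 1 (- m * (p \<bullet> b) + m * (u \<bullet> b)) = 0"
   using n m by (auto simp: exp_bump_def)
  then have "box_bump m l u p = 0" unfolding box_bump_def using b by (intro prod_zero) auto
  then show False using pos by simp
 qed
 then show "p \<in> box l u" by (simp add: box_def)
qed

lemma box_bump_test:
 fixes l u :: "'a::euclidean_space \<times> real"
 assumes m: "0 < m" and lu: "0 < snd l" "snd l < snd u"
 shows "box_bump m l u \<in> test_functions"
proof -
 have "sm.smooth (box_bump m l u)" unfolding box_bump_def[abs_def]
  by (intro sm.smooth_prod sm.smooth_mult exp_bump_smooth finite_Basis)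
 moreover have "box_bump m l u p = 0" if "p \<notin> cbox (fst l) (fst u) \<times> {snd l..snd u}" for p
 proof (rule ccontr)
  assume "box_bump m l u p \<noteq> 0"
  then have "0 < box_bump m l u p" using box_bump_bounds(1)[of m l u p] by linarith
  then have "p \<in> box l u" using box_bump_pos[OF m] by blast
  then have "p \<in> cbox l u" using box_subset_cbox by blast
  then show False using that cbox_Pair_eq[of "fst l" "snd l" "fst u" "snd u"] by (simp add: cbox_interval)
 qed
 ultimately show ?thesis unfolding test_functions_iff using lu compact_cbox by blast
qed

lemma box_bump_limit: "(\<lambda>n. box_bump (real (Suc n)) l u p) \<longlonglongrightarrow> indicat_real (box l u) p"
proof (cases "p \<in> box l u")
 case True
 have lim: "(\<lambda>n. exp_bump 1 (real (Suc n) * t)) \<longlonglongrightarrow> 1" if t: "0 < t" for t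
 proof -
  have "(\<lambda>n. 1 / real (Suc n)) \<longlonglongrightarrow> 0" using LIMSEQ_inverse_real_of_nat by (simp add: field_simps)
  then have "(\<lambda>n. exp (- (1 / t * (1 / real (Suc n))))) \<longlonglongrightarrow> exp (- (1 / t * 0))" by (intro tendsto_intros)
  then show ?thesis using t by (simp add: exp_bump_def mult.commute)
 qed
 have "(\<lambda>n. box_bump (real (Suc n)) l u p) \<longlonglongrightarrow> (\<Prod>b\<in>(Basis::'a set). 1 * 1)" unfolding box_bump_def
 proof (intro tendsto_intros)
  fix b :: 'a assume b: "b \<in> Basis"
  have e: "real (Suc n) * (p \<bullet> b) + - (real (Suc n) * (l \<bullet> b)) = real (Suc n) * (p \<bullet> b - l \<bullet> b)"
   "- real (Suc n) * (p \<bullet> b) + real (Suc n) * (u \<bullet> b) = real (Suc n) * (u \<bullet> b - p \<bullet> b)" for n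
   by (simp_all add: algebra_simps)
  show "(\<lambda>n. exp_bump 1 (real (Suc n) * (p \<bullet> b) + - (real (Suc n) * (l \<bullet> b)))) \<longlonglongrightarrow> 1"
   unfolding e by (rule lim) (use True b in \<open>auto simp: box_def\<close>)
  show "(\<lambda>n. exp_bump 1 (- real (Suc n) * (p \<bullet> b) + real (Suc n) * (u \<bullet> b))) \<longlonglongrightarrow> 1"
   unfolding e by (rule lim) (use True b in \<open>auto simp: box_def\<close>)
 qed
 then show ?thesis using True by simp
next
 case False
 then have "box_bump (real (Suc n)) l u p = 0" for n
  using box_bump_pos[of "real (Suc n)" l u p] box_bump_bounds(1)[of "real (Suc n)" l u p] by simp
 then show ?thesis using False by simp
qed


section \<open>Discrete Radon measures\<close>

text \<open>The existential data of the definition are recovered canonically as \<open>atoms\<close>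
  and \<open>wt\<close>; afterwards a measure in \<open>\<K>\<close> is handled through its weight
  function.\<close>

lemma discrete_radonE:
 assumes "\<eta> \<in> \<K>"
 shows "sets \<eta> = sets borel" "compact K \<Longrightarrow> emeasure \<eta> K < \<infinity>" "countable (atoms \<eta>)"
  and "ennreal (wt \<eta> x) = emeasure \<eta> {x}" "x \<in> atoms \<eta> \<longleftrightarrow> 0 < wt \<eta> x" "0 \<le> wt \<eta> x"
  and "B \<in> sets borel \<Longrightarrow> emeasure \<eta> B = (\<integral>\<^sup>+x. ennreal (wt \<eta> x) * indicator B x \<partial>count_space UNIV)"
proof -
 obtain A w where A: "countable A" "\<And>x. x \<in> A \<Longrightarrow> 0 < w x"
  and em: "\<And>B. B \<in> sets borel \<Longrightarrow> emeasure \<eta> B = (\<integral>\<^sup>+x. ennreal (w x) * indicator B x \<partial>count_space A)"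
  and R: "\<eta> \<in> radon_measures"
  using assms unfolding discrete_radon_def by blast
 show "sets \<eta> = sets borel" "compact K \<Longrightarrow> emeasure \<eta> K < \<infinity>" using R by (auto simp: radon_measures_def)
 have at: "emeasure \<eta> {x} = (if x \<in> A then ennreal (w x) else 0)" for x
 proof -
  have "emeasure \<eta> {x} = (\<integral>\<^sup>+y. ennreal (w y) * indicator {x} y * indicator A y \<partial>count_space UNIV)"
   by (simp add: em nn_integral_count_space_indicator)
  also have "(\<lambda>y. ennreal (w y) * indicator {x} y * indicator A y) = (\<lambda>y. (if x \<in> A then ennreal (w x) else 0) * indicator {x} y)"
   by (auto simp: fun_eq_iff indicator_def)
  finally show ?thesis by (simp add: nn_integral_cmult_indicator)
 qed
 have wt: "wt \<eta> x = (if x \<in> A then w x else 0)" for x using A(2)[of x] by (simp add: wt_def measure_def at)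
 have "atoms \<eta> = A" using A(2) by (auto simp: atoms_def at)
 then show "countable (atoms \<eta>)" "x \<in> atoms \<eta> \<longleftrightarrow> 0 < wt \<eta> x" using A by (auto simp: wt)
 show "ennreal (wt \<eta> x) = emeasure \<eta> {x}" by (simp add: wt at)
 show "0 \<le> wt \<eta> x" by (simp add: wt_def)
 show "emeasure \<eta> B = (\<integral>\<^sup>+x. ennreal (wt \<eta> x) * indicator B x \<partial>count_space UNIV)" if "B \<in> sets borel"
  unfolding em[OF that] by (subst nn_integral_count_space_indicator) (auto simp: wt indicator_def intro!: nn_integral_cong)
qed

lemma atoms_iff: "\<eta> \<in> \<K> \<Longrightarrow> x \<in> atoms \<eta> \<longleftrightarrow> 0 < wt \<eta> x" by (rule discrete_radonE(5))

lemma wt_nonneg [simp]: "0 \<le> wt \<eta> x" by (simp add: wt_def)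

lemma wt_nonatom: "\<eta> \<in> \<K> \<Longrightarrow> x \<notin> atoms \<eta> \<Longrightarrow> wt \<eta> x = 0" using atoms_iff[of \<eta> x] wt_nonneg[of \<eta> x] by linarith

text \<open>The density lives on the power set as \<sigma>-algebra; pushing it forward along the
  identity gives a measure on the Borel sets, as membership in \<open>\<K>\<close> demands.\<close>

definition atomic :: "('a::euclidean_space \<Rightarrow> real) \<Rightarrow> 'a measure" where
 "atomic w = distr (density (count_space UNIV) (\<lambda>x. ennreal (w x))) borel (\<lambda>x. x)"

lemma sets_atomic [simp]: "sets (atomic w) = sets borel" by (simp add: atomic_def)

lemma emeasure_atomic:
 assumes "B \<in> sets borel"
 shows "emeasure (atomic w) B = (\<integral>\<^sup>+x. ennreal (w x) * indicator B x \<partial>count_space UNIV)"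
proof -
 have "emeasure (atomic w) B = emeasure (density (count_space UNIV) (\<lambda>x. ennreal (w x))) B"
  unfolding atomic_def using assms by (subst emeasure_distr) auto
 then show ?thesis by (simp add: emeasure_density)
qed

lemma emeasure_atomic_point: "emeasure (atomic w) {x} = ennreal (w x)"
proof -
 have "emeasure (atomic w) {x} = (\<integral>\<^sup>+y. ennreal (w y) * indicator {x} y \<partial>count_space UNIV)"
  by (rule emeasure_atomic) simp
 also have "(\<lambda>y. ennreal (w y) * indicator {x} y) = (\<lambda>y. ennreal (w x) * indicator {x} y)"
  by (auto simp: fun_eq_iff indicator_def)
 finally show ?thesis by (simp add: nn_integral_cmult_indicator)
qed

lemma atomic_wt: "0 \<le> w x \<Longrightarrow> wt (atomic w) x = w x" by (simp add: wt_def measure_def emeasure_atomic_point)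

text \<open>Off one point the new weights are dominated by those of \<eta>, and that point adds a
  finite mass, so local finiteness is preserved. This covers both moving and adding an atom.\<close>

lemma atomic_discrete_radon:
 assumes \<eta>: "\<eta> \<in> \<K>" and w0: "\<And>x. 0 \<le> w x" and le: "\<And>x. x \<noteq> y \<Longrightarrow> w x \<le> wt \<eta> x"
 shows "atomic w \<in> \<K>"
proof -
 have sub: "{x. 0 < w x} \<subseteq> insert y (atoms \<eta>)" using le atoms_iff[OF \<eta>] by fastforce
 then have cnt: "countable {x. 0 < w x}" using discrete_radonE(3)[OF \<eta>] by (meson countable_insert countable_subset)
 have fin: "emeasure (atomic w) K < \<infinity>" if K: "compact K" for K
 proof -
  have Kb: "K \<in> sets borel" using K by (simp add: borel_compact)
  have "emeasure (atomic w) K \<le> (\<integral>\<^sup>+x. ennreal (wt \<eta> x) * indicator K x + ennreal (w y) * indicator {y} x \<partial>count_space UNIV)"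
   unfolding emeasure_atomic[OF Kb]
  proof (rule nn_integral_mono)
   fix x show "ennreal (w x) * indicator K x \<le> ennreal (wt \<eta> x) * indicator K x + ennreal (w y) * indicator {y} x"
    using le[of x] by (cases "x = y") (auto simp: indicator_def ennreal_leI)
  qed
  also have "\<dots> = emeasure \<eta> K + ennreal (w y)"
   by (subst nn_integral_add) (auto simp: discrete_radonE(7)[OF \<eta> Kb] nn_integral_cmult_indicator)
  also have "\<dots> < \<infinity>" using discrete_radonE(2)[OF \<eta> K] by simp
  finally show ?thesis .
 qed
 have wz: "w x = 0" if "\<not> 0 < w x" for x using w0[of x] that by simp
 have "emeasure (atomic w) B = (\<integral>\<^sup>+x. ennreal (w x) * indicator B x \<partial>count_space {x. 0 < w x})" if "B \<in> sets borel" for B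
  unfolding emeasure_atomic[OF that] by (subst (2) nn_integral_count_space_indicator)
   (use wz in \<open>auto simp: indicator_def intro!: nn_integral_cong\<close>)
 then show ?thesis unfolding discrete_radon_def radon_measures_def
  using cnt fin by (auto intro!: exI[of _ "{x. 0 < w x}"] exI[of _ w])
qed

lemma atomic_wt_eq:
 assumes \<eta>: "\<eta> \<in> \<K>" shows "atomic (wt \<eta>) = \<eta>"
 by (rule measure_eqI) (auto simp: discrete_radonE(1,7)[OF \<eta>] emeasure_atomic)

lemma finite_emeasure_point: "\<eta> \<in> \<K> \<Longrightarrow> emeasure \<eta> {x} < \<infinity>" by (rule discrete_radonE(2)) auto

lemma integral_finite_support:
 assumes \<eta>: "\<eta> \<in> \<K>" and T: "finite T" and h: "\<And>x. x \<notin> T \<Longrightarrow> h x = 0"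
 shows "integrable \<eta> (h :: 'a::euclidean_space \<Rightarrow> real)" "(\<integral>x. h x \<partial>\<eta>) = (\<Sum>x\<in>T. wt \<eta> x * h x)" (is "?claim1")
proof -
 have eq: "h = (\<lambda>y. \<Sum>x\<in>T. h x * indicator {x} y)"
 proof
  fix y show "h y = (\<Sum>x\<in>T. h x * indicator {x} y)"
   using h[of y] T by (cases "y \<in> T") (auto simp: indicator_def sum.delta if_distrib cong: if_cong)
 qed
 have i: "integrable \<eta> (indicat_real {x})" for x
  by (rule integrable_real_indicator) (use discrete_radonE(1)[OF \<eta>] finite_emeasure_point[OF \<eta>, of x] in auto)
 show "integrable \<eta> h" by (subst eq) (intro Bochner_Integration.integrable_sum integrable_mult_right i)
 have "(\<integral>x. h x \<partial>\<eta>) = (\<Sum>x\<in>T. h x * measure \<eta> {x})"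
  by (subst eq) (simp add: i Bochner_Integration.integral_sum sets_eq_imp_space_eq[OF discrete_radonE(1)[OF \<eta>]])
 then show ?claim1 by (simp add: wt_def mult.commute)
qed

text \<open>The part of the support condition that makes the sum over atoms finite. It also applies
  to indicators of boxes, which are not test functions.\<close>

definition bdd_supp :: "('a::euclidean_space \<times> real \<Rightarrow> 'b::zero) \<Rightarrow> bool" where
 "bdd_supp \<phi> \<longleftrightarrow> (\<exists>A a. bounded A \<and> 0 < a \<and> (\<forall>p. \<phi> p \<noteq> 0 \<longrightarrow> fst p \<in> A \<and> a \<le> snd p))"

lemma bdd_supp_zero: "bdd_supp \<phi> \<Longrightarrow> u \<le> 0 \<Longrightarrow> \<phi> (x, u) = 0" unfolding bdd_supp_def by fastforce

lemma test_bdd_supp: "\<phi> \<in> test_functions \<Longrightarrow> bdd_supp \<phi>"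
proof (erule test_functionsE)
 fix A and a b :: real assume "compact A" "0 < a" "a < b" and z: "\<And>p. p \<notin> A \<times> {a..b} \<Longrightarrow> \<phi> p = 0"
 have "fst p \<in> A \<and> a \<le> snd p" if "\<phi> p \<noteq> 0" for p using z[of p] that by (cases p) auto
 then show "bdd_supp \<phi>" unfolding bdd_supp_def using \<open>0 < a\<close> compact_imp_bounded[OF \<open>compact A\<close>] by blast
qed

lemma bdd_supp_mono: "bdd_supp \<phi> \<Longrightarrow> (\<And>p. \<psi> p \<noteq> 0 \<Longrightarrow> \<phi> p \<noteq> 0) \<Longrightarrow> bdd_supp \<psi>" unfolding bdd_supp_def by metis

text \<open>Each such atom contributes at least \<open>a\<close> to the finite mass of the compact
  closure of \<open>A\<close>, which bounds the number of atoms in every finite subset.\<close>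

lemma finite_heavy_atoms:
 assumes \<eta>: "\<eta> \<in> \<K>" and A: "bounded A" and a: "0 < a"
 shows "finite {x. x \<in> A \<and> a \<le> wt \<eta> x}"
proof -
 have comp: "compact (closure A)" using A by simp
 have clo: "closure A \<in> sets \<eta>" using discrete_radonE(1)[OF \<eta>] by simp
 have fin: "emeasure \<eta> (closure A) \<noteq> \<infinity>" using discrete_radonE(2)[OF \<eta> comp] by simp
 define C where "C = nat \<lceil>measure \<eta> (closure A) / a\<rceil>"
 have "card G \<le> C" if G: "G \<subseteq> {x. x \<in> A \<and> a \<le> wt \<eta> x}" "finite G" for G
 proof -
  have "a * real (card G) \<le> (\<Sum>x\<in>G. wt \<eta> x)" using sum_mono[of G "\<lambda>_. a" "wt \<eta>"] G by (auto simp: mult.commute)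
  also have "\<dots> = (\<Sum>x\<in>G. measure \<eta> {x})" by (simp add: wt_def)
  also have "\<dots> = measure \<eta> (\<Union>x\<in>G. {x})"
  proof (rule measure_finite_Union[symmetric])
   show "emeasure \<eta> {x} \<noteq> \<infinity>" for x using finite_emeasure_point[OF \<eta>, of x] by simp
  qed (use G discrete_radonE(1)[OF \<eta>] in \<open>auto simp: disjoint_family_on_def\<close>)
  also have "\<dots> \<le> measure \<eta> (closure A)" by (rule measure_mono_fmeasurable)
    (use G closure_subset[of A] discrete_radonE(1)[OF \<eta>] clo fin in \<open>auto simp: fmeasurable_def less_top finite_imp_closed\<close>)
  finally have "real (card G) \<le> measure \<eta> (closure A) / a" using a by (simp add: field_simps)
  then show ?thesis unfolding C_def by linarith
 qed
 then show ?thesis using finite_if_finite_subsets_card_bdd by blast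
qed

lemma finite_supp:
 assumes \<eta>: "\<eta> \<in> \<K>" and \<phi>: "bdd_supp \<phi>"
 shows "finite {x. \<phi> (x, wt \<eta> x) \<noteq> 0}"
proof -
 obtain A a where "bounded A" "0 < a" "\<And>p. \<phi> p \<noteq> 0 \<Longrightarrow> fst p \<in> A \<and> a \<le> snd p" using \<phi> unfolding bdd_supp_def by blast
 then have "{x. \<phi> (x, wt \<eta> x) \<noteq> 0} \<subseteq> {x. x \<in> A \<and> a \<le> wt \<eta> x}" "finite {x. x \<in> A \<and> a \<le> wt \<eta> x}"
  using finite_heavy_atoms[OF \<eta>] by force+
 then show ?thesis by (rule finite_subset)
qed

lemma pairing_eq_sum:
 assumes \<eta>: "\<eta> \<in> \<K>" and \<phi>: "bdd_supp \<phi>" and T: "finite T" and sub: "{x. \<phi> (x, wt \<eta> x) \<noteq> 0} \<subseteq> T"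
 shows "pairing \<phi> \<eta> = (\<Sum>x\<in>T. \<phi> (x, wt \<eta> x))"
proof -
 have "\<phi> (x, wt \<eta> x) = 0" if "x \<notin> atoms \<eta>" for x using bdd_supp_zero[OF \<phi>, of "wt \<eta> x" x] wt_nonatom[OF \<eta> that] by simp
 then have "pairing \<phi> \<eta> = (\<Sum>\<^sub>\<infinity>x\<in>T. \<phi> (x, wt \<eta> x))"
  unfolding pairing_def by (intro infsum_cong_neutral) (use sub in auto)
 then show ?thesis using T by simp
qed

text \<open>Dividing by the weight turns the sum over atoms into an integral against \<eta>;
  measurability of pairings is obtained in this form.\<close>

lemma pairing_integral:
 assumes \<eta>: "\<eta> \<in> \<K>" and \<phi>: "bdd_supp \<phi>"
 shows "pairing \<phi> \<eta> = (\<integral>x. \<phi> (x, wt \<eta> x) / wt \<eta> x \<partial>\<eta>)"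
proof -
 let ?T = "{x. \<phi> (x, wt \<eta> x) \<noteq> 0}"
 have T: "finite ?T" by (rule finite_supp[OF assms])
 have "(\<integral>x. \<phi> (x, wt \<eta> x) / wt \<eta> x \<partial>\<eta>) = (\<Sum>x\<in>?T. wt \<eta> x * (\<phi> (x, wt \<eta> x) / wt \<eta> x))"
  by (rule integral_finite_support(2)[OF \<eta> T]) auto
 also have "\<dots> = (\<Sum>x\<in>?T. \<phi> (x, wt \<eta> x))"
 proof (rule sum.cong[OF refl])
  fix x assume "x \<in> ?T"
  then have "wt \<eta> x \<noteq> 0" using bdd_supp_zero[OF \<phi>, of "wt \<eta> x" x] by auto
  then show "wt \<eta> x * (\<phi> (x, wt \<eta> x) / wt \<eta> x) = \<phi> (x, wt \<eta> x)" by simp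
 qed
 finally show ?thesis using pairing_eq_sum[OF \<eta> \<phi> T] by simp
qed

text \<open>At another atom of \<eta> the weights would have to be added, hence the condition on
  \<open>y\<close>. The order of the two updates also covers \<open>y = x\<close>, where only the
  weight changes.\<close>

lemma pairing_move:
 assumes \<eta>: "\<eta> \<in> \<K>" and \<phi>: "bdd_supp \<phi>" and u: "0 \<le> u" and y: "y \<notin> atoms \<eta> - {x}"
 defines "w \<equiv> (wt \<eta>)(x := 0, y := u)"
 shows "atomic w \<in> \<K>" "pairing \<phi> (atomic w) = pairing \<phi> \<eta> - \<phi> (x, wt \<eta> x) + \<phi> (y, u)" (is "?claim1")
proof -
 have w0: "0 \<le> w z" for z using u by (simp add: w_def)
 show dr: "atomic w \<in> \<K>" by (rule atomic_discrete_radon[OF \<eta> w0, of y]) (simp add: w_def)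
 have wt: "wt (atomic w) z = w z" for z using atomic_wt[of w z] w0[of z] by simp
 define T where "T = {z. \<phi> (z, wt \<eta> z) \<noteq> 0} \<union> {z. \<phi> (z, w z) \<noteq> 0} \<union> {x, y}"
 have T: "finite T" unfolding T_def using finite_supp[OF \<eta> \<phi>] finite_supp[OF dr \<phi>] by (simp add: wt)
 have 1: "pairing \<phi> \<eta> = (\<Sum>z\<in>T. \<phi> (z, wt \<eta> z))" by (rule pairing_eq_sum[OF \<eta> \<phi> T]) (auto simp: T_def)
 have 2: "pairing \<phi> (atomic w) = (\<Sum>z\<in>T. \<phi> (z, w z))" using pairing_eq_sum[OF dr \<phi> T] by (auto simp: T_def wt)
 have z0: "\<phi> (z, 0) = 0" for z by (rule bdd_supp_zero[OF \<phi>]) simp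
 have yT: "y \<in> T" and xT: "x \<in> T" by (auto simp: T_def)
 have "(\<Sum>z\<in>T. \<phi> (z, w z)) = (\<Sum>z\<in>T. \<phi> (z, wt \<eta> z) - (if z = x then \<phi> (x, wt \<eta> x) else 0) + (if z = y then \<phi> (y, u) else 0))"
 proof (rule sum.cong[OF refl])
  fix z
  have "wt \<eta> y = 0" if "y \<noteq> x" using wt_nonatom[OF \<eta>, of y] y that by blast
  then show "\<phi> (z, w z) = \<phi> (z, wt \<eta> z) - (if z = x then \<phi> (x, wt \<eta> x) else 0) + (if z = y then \<phi> (y, u) else 0)"
   by (auto simp: w_def z0)
 qed
 also have "\<dots> = (\<Sum>z\<in>T. \<phi> (z, wt \<eta> z)) - \<phi> (x, wt \<eta> x) + \<phi> (y, u)"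
  using T xT yT by (simp add: sum.distrib sum_subtractf)
 finally show ?claim1 unfolding 1 2 .
qed


section \<open>Cylinder functions\<close>

text \<open>\<open>v\<close> is the contribution of the remaining atoms to the pairings and
  \<open>p\<close> the moved atom. Keeping them apart makes bounds visible that are uniform in
  \<open>v\<close>.\<close>

definition shifted :: "((nat \<Rightarrow> real) \<Rightarrow> real) \<Rightarrow> (nat \<Rightarrow> 'b \<Rightarrow> real) \<Rightarrow> (nat \<Rightarrow> real) \<Rightarrow> 'b \<Rightarrow> real" where
 "shifted g \<phi> v p = g (\<lambda>i. v i + \<phi> i p)"

definition shifted_D1 where "shifted_D1 N g \<phi> e v p = (\<Sum>i<N. coord_deriv i g (\<lambda>j. v j + \<phi> j p) * dir_deriv e (\<phi> i) p)"

definition shifted_D2 where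
 "shifted_D2 N g \<phi> e v p = (\<Sum>i<N. (\<Sum>j<N. coord_deriv j (coord_deriv i g) (\<lambda>j. v j + \<phi> j p) * dir_deriv e (\<phi> j) p) * dir_deriv e (\<phi> i) p
   + coord_deriv i g (\<lambda>j. v j + \<phi> j p) * dir_deriv e (dir_deriv e (\<phi> i)) p)"

lemma shifted_derivative:
 assumes g: "g \<in> Cb_smooth N" and \<phi>: "\<forall>i<N. \<phi> i \<in> test_functions"
 shows "(shifted g \<phi> v has_derivative (\<lambda>e. shifted_D1 N g \<phi> e v p)) (at p)"
proof -
 have "((\<lambda>p. v i + \<phi> i p) has_derivative frechet_derivative (\<phi> i) (at p)) (at p)" if "i < N" for i p
  using has_derivative_add[OF has_derivative_const test_has_derivative[OF \<phi>[rule_format, OF that]], of "v i"] by simp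
 from Cb_smooth_chain[OF g this, where x = p] show ?thesis
  unfolding shifted_def[abs_def] shifted_D1_def dir_deriv_def by simp
qed

lemma shifted_dir_deriv:
 assumes "g \<in> Cb_smooth N" "\<forall>i<N. \<phi> i \<in> test_functions"
 shows "dir_deriv e (shifted g \<phi> v) = shifted_D1 N g \<phi> e v"
 by (rule ext, rule dir_derivI[OF shifted_derivative[OF assms]])

lemma shifted_D1_derivative:
 assumes g: "g \<in> Cb_smooth N" and \<phi>: "\<forall>i<N. \<phi> i \<in> test_functions" and e: "e \<in> Basis"
 shows "(shifted_D1 N g \<phi> e v has_derivative frechet_derivative (shifted_D1 N g \<phi> e v) (at p)) (at p)" (is "?claim1")
  and "dir_deriv e (shifted_D1 N g \<phi> e v) p = shifted_D2 N g \<phi> e v p" (is "?claim2")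
proof -
 have s: "(shifted (coord_deriv i g) \<phi> v has_derivative (\<lambda>e. shifted_D1 N (coord_deriv i g) \<phi> e v p)) (at p)" if "i < N" for i p
  by (rule shifted_derivative[OF Cb_smooth_D[OF g that] \<phi>])
 have t: "(dir_deriv e (\<phi> i) has_derivative frechet_derivative (dir_deriv e (\<phi> i)) (at p)) (at p)" if "i < N" for i p
  by (rule test_has_derivative[OF test_dir_deriv[OF \<phi>[rule_format, OF that] e]])
 have "((\<lambda>p. \<Sum>i<N. shifted (coord_deriv i g) \<phi> v p * dir_deriv e (\<phi> i) p) has_derivative
   (\<lambda>h. \<Sum>i<N. shifted (coord_deriv i g) \<phi> v p * frechet_derivative (dir_deriv e (\<phi> i)) (at p) h
     + shifted_D1 N (coord_deriv i g) \<phi> h v p * dir_deriv e (\<phi> i) p)) (at p)" for p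
  by (rule has_derivative_sum, rule has_derivative_mult[OF s t]) auto
 moreover have eq: "(\<lambda>p. \<Sum>i<N. shifted (coord_deriv i g) \<phi> v p * dir_deriv e (\<phi> i) p) = shifted_D1 N g \<phi> e v"
  by (simp add: fun_eq_iff shifted_def shifted_D1_def)
 ultimately have d: "(shifted_D1 N g \<phi> e v has_derivative (\<lambda>h. \<Sum>i<N. shifted (coord_deriv i g) \<phi> v p * frechet_derivative (dir_deriv e (\<phi> i)) (at p) h
     + shifted_D1 N (coord_deriv i g) \<phi> h v p * dir_deriv e (\<phi> i) p)) (at p)" for p by simp
 show ?claim1
  by (rule differentiable_frechet[OF differentiableI[OF d]])
 show ?claim2 unfolding dir_derivI[OF d] shifted_D2_def
  by (rule sum.cong) (auto simp: shifted_D1_def shifted_def dir_deriv_def)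
qed

lemma shifted_cont_first:
 assumes g: "g \<in> Cb_smooth N" and \<phi>: "\<forall>i<N. \<phi> i \<in> test_functions"
 shows "continuous_on UNIV (\<lambda>y. shifted g \<phi> v (y, u))"
proof -
 have "continuous_on UNIV (shifted g \<phi> v)" unfolding continuous_on_eq_continuous_at[OF open_UNIV]
  using has_derivative_continuous[OF shifted_derivative[OF assms]] by blast
 then show ?thesis by (rule continuous_on_compose2) (auto intro!: continuous_intros)
qed

lemma FC_reprD:
 assumes "FC_repr N g \<phi> F"
 shows "1 \<le> N" "g \<in> Cb_smooth N" "\<forall>i<N. \<phi> i \<in> test_functions" "\<And>\<eta>. \<eta> \<in> \<K> \<Longrightarrow> F \<eta> = g (\<lambda>i. pairing (\<phi> i) \<eta>)"
 using assms unfolding FC_repr_def by auto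

definition reduced :: "(nat \<Rightarrow> 'a::euclidean_space \<times> real \<Rightarrow> real) \<Rightarrow> 'a measure \<Rightarrow> 'a \<Rightarrow> nat \<Rightarrow> real" where
 "reduced \<phi> \<eta> x = (\<lambda>i. pairing (\<phi> i) \<eta> - \<phi> i (x, wt \<eta> x))"

lemma reduced_add: "(\<lambda>i. reduced \<phi> \<eta> x i + \<phi> i (x, wt \<eta> x)) = (\<lambda>i. pairing (\<phi> i) \<eta>)" by (simp add: reduced_def)

text \<open>Connects the formula of a representation with values of \<open>F\<close> at genuine
  measures. A mark \<open>u \<le> 0\<close> amounts to deleting the atom, since test functions
  vanish there; hence \<open>max u 0\<close>.\<close>

lemma FC_repr_move:
 assumes F: "FC_repr N g \<phi> F" and \<eta>: "\<eta> \<in> \<K>" and y: "y \<notin> atoms \<eta> - {x}"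
 shows "shifted g \<phi> (reduced \<phi> \<eta> x) (y, u) = F (atomic ((wt \<eta>)(x := 0, y := max u 0)))"
proof -
 note r = FC_reprD[OF F]
 have b: "bdd_supp (\<phi> i)" if "i < N" for i using test_bdd_supp[OF r(3)[rule_format, OF that]] .
 have "F (atomic ((wt \<eta>)(x := 0, y := max u 0))) = g (\<lambda>i. pairing (\<phi> i) (atomic ((wt \<eta>)(x := 0, y := max u 0))))"
  by (rule r(4), rule pairing_move(1)[OF \<eta> b[of 0]]) (use r(1) y in auto)
 also have "\<dots> = shifted g \<phi> (reduced \<phi> \<eta> x) (y, u)" unfolding shifted_def reduced_def
 proof (rule Cb_smooth_cong[OF r(2)])
  fix i assume i: "i < N"
  have "\<phi> i (y, max u 0) = \<phi> i (y, u)" using bdd_supp_zero[OF b[OF i]] by (cases "u \<le> 0") (auto simp: max_def)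
  then show "pairing (\<phi> i) (atomic ((wt \<eta>)(x := 0, y := max u 0))) = pairing (\<phi> i) \<eta> - \<phi> i (x, wt \<eta> x) + \<phi> i (y, u)"
   using pairing_move(2)[OF \<eta> b[OF i] _ y, of "max u 0"] by simp
 qed
 finally show ?thesis by simp
qed

lemma continuous_eq_off_countable:
 fixes f h :: "'a::euclidean_space \<Rightarrow> real"
 assumes "continuous_on UNIV f" "continuous_on UNIV h" "countable S" "\<And>y. y \<notin> S \<Longrightarrow> f y = h y"
 shows "f y = h y"
proof (rule ccontr)
 assume n: "f y \<noteq> h y"
 have "open {y. f y \<noteq> h y}" using assms(1,2) by (rule open_Collect_neq)
 then obtain r where r: "0 < r" "ball y r \<subseteq> {y. f y \<noteq> h y}" using n by (auto simp: open_contains_ball)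
 have "ball y r - S \<noteq> {}" by (rule ball_minus_countable_nonempty[OF assms(3) r(1)])
 then show False using r assms(4) by blast
qed

text \<open>For \<open>y\<close> off the countably many other atoms both sides are values at a
  measure in \<open>\<K>\<close>, where the two functions agree. Both sides are continuous in
  \<open>y\<close>, and the complement of a countable set is dense.\<close>

lemma FC_repr_unique:
 assumes F: "FC_repr N g \<phi> F" and F': "FC_repr N' g' \<phi>' F'" and \<eta>: "\<eta> \<in> \<K>"
  and eq: "\<And>\<eta>. \<eta> \<in> \<K> \<Longrightarrow> F \<eta> = F' \<eta>"
 shows "shifted g \<phi> (reduced \<phi> \<eta> x) = shifted g' \<phi>' (reduced \<phi>' \<eta> x)"
proof (rule ext, clarify)
 fix y u
 have *: "atomic ((wt \<eta>)(x := 0, y := max u 0)) \<in> \<K>" if "y \<notin> atoms \<eta> - {x}" for y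
  by (rule pairing_move(1)[OF \<eta> test_bdd_supp[OF FC_reprD(3)[OF F, rule_format, of 0]]]) (use FC_reprD(1)[OF F] that in auto)
 show "shifted g \<phi> (reduced \<phi> \<eta> x) (y, u) = shifted g' \<phi>' (reduced \<phi>' \<eta> x) (y, u)"
  by (rule continuous_eq_off_countable[OF shifted_cont_first shifted_cont_first, of _ N _ _ N' _ "atoms \<eta> - {x}"])
   (use FC_reprD[OF F] FC_reprD[OF F'] discrete_radonE(3)[OF \<eta>] FC_repr_move[OF F \<eta>] FC_repr_move[OF F' \<eta>] eq * in auto)
qed

lemma moved_atom_eq:
 assumes F: "FC_repr N g \<phi> F" and \<eta>: "\<eta> \<in> \<K>"
 shows "moved_atom F \<eta> x = shifted g \<phi> (reduced \<phi> \<eta> x)"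
 unfolding moved_atom_def
proof (rule the_equality)
 have c: "(\<lambda>(y, u). g (\<lambda>i. pairing (\<phi> i) \<eta> - \<phi> i (x, wt \<eta> x) + \<phi> i (y, u))) = shifted g \<phi> (reduced \<phi> \<eta> x)"
  for g and \<phi> :: "nat \<Rightarrow> 'a \<times> real \<Rightarrow> real" by (simp add: fun_eq_iff shifted_def reduced_def)
 show "\<exists>N g' \<phi>'. FC_repr N g' \<phi>' F \<and> shifted g \<phi> (reduced \<phi> \<eta> x) =
   (\<lambda>(y, u). g' (\<lambda>i. pairing (\<phi>' i) \<eta> - \<phi>' i (x, wt \<eta> x) + \<phi>' i (y, u)))"
  unfolding c using F by blast
 fix H assume "\<exists>N g \<phi>. FC_repr N g \<phi> F \<and> H = (\<lambda>(y, u). g (\<lambda>i. pairing (\<phi> i) \<eta> - \<phi> i (x, wt \<eta> x) + \<phi> i (y, u)))"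
 then show "H = shifted g \<phi> (reduced \<phi> \<eta> x)" unfolding c using FC_repr_unique[OF _ F \<eta>] by blast
qed

text \<open>The directions \<open>(b, 0)\<close> and \<open>(0, 1)\<close> give all gradients and
  Laplacians of the statement, so later arguments are carried out once for an arbitrary basis
  direction.\<close>

definition atom_D1 :: "'a::euclidean_space \<times> real \<Rightarrow> ('a measure \<Rightarrow> real) \<Rightarrow> 'a measure \<Rightarrow> 'a \<Rightarrow> real" where
 "atom_D1 e F \<eta> x = dir_deriv e (moved_atom F \<eta> x) (x, wt \<eta> x)"

definition atom_D2 :: "'a::euclidean_space \<times> real \<Rightarrow> ('a measure \<Rightarrow> real) \<Rightarrow> 'a measure \<Rightarrow> 'a \<Rightarrow> real" where
 "atom_D2 e F \<eta> x = dir_deriv e (dir_deriv e (moved_atom F \<eta> x)) (x, wt \<eta> x)"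

lemma atom_D_eq:
 assumes F: "FC_repr N g \<phi> F" and \<eta>: "\<eta> \<in> \<K>"
 shows "atom_D1 e F \<eta> x = shifted_D1 N g \<phi> e (reduced \<phi> \<eta> x) (x, wt \<eta> x)"
  and "e \<in> Basis \<Longrightarrow> atom_D2 e F \<eta> x = shifted_D2 N g \<phi> e (reduced \<phi> \<eta> x) (x, wt \<eta> x)"
 unfolding atom_D1_def atom_D2_def moved_atom_eq[OF assms]
 using FC_reprD[OF F] by (simp_all add: shifted_dir_deriv shifted_D1_derivative(2))

text \<open>Lets the separate derivatives in position and in mark be read as directional derivatives
  on the product space.\<close>

lemma dir_deriv_slice:
 fixes \<psi> :: "'a::euclidean_space \<times> real \<Rightarrow> real"
 assumes "\<And>p. \<psi> differentiable (at p)"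
 shows "dir_deriv b (\<lambda>y. \<psi> (y, s)) = (\<lambda>y. dir_deriv (b, 0) \<psi> (y, s))" (is "?claim1")
  and "deriv (\<lambda>u. \<psi> (x, u)) = (\<lambda>u. dir_deriv (0, 1) \<psi> (x, u))" (is "?claim2")
proof -
 have d: "(\<psi> has_derivative frechet_derivative \<psi> (at p)) (at p)" for p by (rule differentiable_frechet[OF assms])
 show ?claim1
 proof
  fix y :: 'a
  have "((\<lambda>y. (y, s)) has_derivative (\<lambda>h. (h, 0))) (at y)" by (auto intro!: derivative_eq_intros)
  from dir_derivI[OF has_derivative_compose[OF this d[of "(y, s)"]]]
  show "dir_deriv b (\<lambda>y. \<psi> (y, s)) y = dir_deriv (b, 0) \<psi> (y, s)" by (simp add: dir_deriv_def)
 qed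
 show ?claim2
 proof
  fix u :: real
  interpret bounded_linear "frechet_derivative \<psi> (at (x, u))" by (rule has_derivative_bounded_linear[OF d])
  have "((\<lambda>u. (x, u)) has_derivative (\<lambda>h. (0, h))) (at u)" by (auto intro!: derivative_eq_intros)
  from has_derivative_compose[OF this d[of "(x, u)"]]
  have "((\<lambda>u. \<psi> (x, u)) has_derivative (\<lambda>h. frechet_derivative \<psi> (at (x, u)) (h *\<^sub>R (0, 1)))) (at u)" by simp
  then have "((\<lambda>u. \<psi> (x, u)) has_real_derivative frechet_derivative \<psi> (at (x, u)) (0, 1)) (at u)"
   unfolding scaleR has_field_derivative_def by (simp add: mult.commute[of _ "frechet_derivative \<psi> (at (x, u)) (0, 1)"] mult_commute_abs)
  then show "deriv (\<lambda>u. \<psi> (x, u)) u = dir_deriv (0, 1) \<psi> (x, u)" by (simp add: DERIV_imp_deriv dir_deriv_def)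
 qed
qed

text \<open>Every representation yields a value expressed by \<open>moved_atom\<close>, which does
  not depend on the representation; this gives existence and uniqueness for the definite description
  at once.\<close>

lemma grad_int_eq:
 assumes F: "FC_repr N g \<phi> F" and \<eta>: "\<eta> \<in> \<K>"
 shows "grad_int F \<eta> x = (\<Sum>b\<in>Basis. (1 / wt \<eta> x * atom_D1 (b, 0) F \<eta> x) *\<^sub>R b)"
proof -
 have c: "(\<Sum>i<N. (coord_deriv i g (\<lambda>j. pairing (\<phi> j) \<eta>) * (1 / wt \<eta> x)) *\<^sub>R gradient (\<lambda>y. \<phi> i (y, wt \<eta> x)) x)
   = (\<Sum>b\<in>Basis. (1 / wt \<eta> x * atom_D1 (b, 0) F \<eta> x) *\<^sub>R b)" if "FC_repr N g \<phi> F" for N g \<phi>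
 proof -
  have "(\<Sum>i<N. (coord_deriv i g (\<lambda>j. pairing (\<phi> j) \<eta>) * (1 / wt \<eta> x)) *\<^sub>R gradient (\<lambda>y. \<phi> i (y, wt \<eta> x)) x)
   = (\<Sum>i<N. \<Sum>b\<in>Basis. (1 / wt \<eta> x * (coord_deriv i g (\<lambda>j. pairing (\<phi> j) \<eta>) * dir_deriv (b, 0) (\<phi> i) (x, wt \<eta> x))) *\<^sub>R b)"
   unfolding gradient_def scaleR_sum_right
   by (intro sum.cong refl) (simp add: dir_deriv_slice(1)[OF test_differentiable[OF FC_reprD(3)[OF that, rule_format]]] mult_ac)
  also have "\<dots> = (\<Sum>b\<in>Basis. (1 / wt \<eta> x * atom_D1 (b, 0) F \<eta> x) *\<^sub>R b)"
   unfolding atom_D_eq[OF that \<eta>] shifted_D1_def reduced_add sum_distrib_left scaleR_sum_left by (rule sum.swap)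
  finally show ?thesis .
 qed
 show ?thesis unfolding grad_int_def
 proof (rule the_equality)
  show "\<exists>N g \<phi>. FC_repr N g \<phi> F \<and> (\<Sum>b\<in>Basis. (1 / wt \<eta> x * atom_D1 (b, 0) F \<eta> x) *\<^sub>R b) =
   (\<Sum>i<N. (coord_deriv i g (\<lambda>j. pairing (\<phi> j) \<eta>) * (1 / wt \<eta> x)) *\<^sub>R gradient (\<lambda>y. \<phi> i (y, wt \<eta> x)) x)"
   using c[OF F, symmetric] F by blast
  fix v assume "\<exists>N g \<phi>. FC_repr N g \<phi> F \<and> v =
   (\<Sum>i<N. (coord_deriv i g (\<lambda>j. pairing (\<phi> j) \<eta>) * (1 / wt \<eta> x)) *\<^sub>R gradient (\<lambda>y. \<phi> i (y, wt \<eta> x)) x)"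
  then obtain N g \<phi> where "FC_repr N g \<phi> F" "v =
   (\<Sum>i<N. (coord_deriv i g (\<lambda>j. pairing (\<phi> j) \<eta>) * (1 / wt \<eta> x)) *\<^sub>R gradient (\<lambda>y. \<phi> i (y, wt \<eta> x)) x)" by blast
  then show "v = (\<Sum>b\<in>Basis. (1 / wt \<eta> x * atom_D1 (b, 0) F \<eta> x) *\<^sub>R b)" using c by simp
 qed
qed

lemma grad_ext_eq:
 assumes F: "FC_repr N g \<phi> F" and \<eta>: "\<eta> \<in> \<K>"
 shows "grad_ext F \<eta> x = atom_D1 (0, 1) F \<eta> x"
proof -
 have c: "(\<Sum>i<N. coord_deriv i g (\<lambda>j. pairing (\<phi> j) \<eta>) * deriv (\<lambda>u. \<phi> i (x, u)) (wt \<eta> x))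
   = atom_D1 (0, 1) F \<eta> x" if "FC_repr N g \<phi> F" for N g \<phi>
  unfolding atom_D_eq[OF that \<eta>] shifted_D1_def reduced_add
  by (intro sum.cong refl) (simp add: dir_deriv_slice(2)[OF test_differentiable[OF FC_reprD(3)[OF that, rule_format]]])
 show ?thesis unfolding grad_ext_def
 proof (rule the_equality)
  show "\<exists>N g \<phi>. FC_repr N g \<phi> F \<and> atom_D1 (0, 1) F \<eta> x =
   (\<Sum>i<N. coord_deriv i g (\<lambda>j. pairing (\<phi> j) \<eta>) * deriv (\<lambda>u. \<phi> i (x, u)) (wt \<eta> x))"
   using c[OF F, symmetric] F by blast
  fix v assume "\<exists>N g \<phi>. FC_repr N g \<phi> F \<and> v =
   (\<Sum>i<N. coord_deriv i g (\<lambda>j. pairing (\<phi> j) \<eta>) * deriv (\<lambda>u. \<phi> i (x, u)) (wt \<eta> x))"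
  then obtain N g \<phi> where "FC_repr N g \<phi> F" "v =
   (\<Sum>i<N. coord_deriv i g (\<lambda>j. pairing (\<phi> j) \<eta>) * deriv (\<lambda>u. \<phi> i (x, u)) (wt \<eta> x))" by blast
  then show "v = atom_D1 (0, 1) F \<eta> x" using c by simp
 qed
qed

lemma Delta_X_eq:
 assumes F: "FC_repr N g \<phi> F" and \<eta>: "\<eta> \<in> \<K>"
 shows "Delta_X F \<eta> x = (\<Sum>b\<in>Basis. atom_D2 (b, 0) F \<eta> x)"
 unfolding Delta_X_def laplacian_def
proof (rule sum.cong[OF refl])
 fix b :: 'a assume b: "b \<in> Basis"
 then have e: "(b, 0::real) \<in> Basis" by (simp add: Basis_prod_def)
 note r = FC_reprD(2,3)[OF F]
 show "dir_deriv b (dir_deriv b (\<lambda>y. moved_atom F \<eta> x (y, wt \<eta> x))) x = atom_D2 (b, 0) F \<eta> x"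
  unfolding atom_D2_def moved_atom_eq[OF assms]
   dir_deriv_slice(1)[OF differentiableI[OF shifted_derivative[OF r]]] shifted_dir_deriv[OF r]
   dir_deriv_slice(1)[OF differentiableI[OF shifted_D1_derivative(1)[OF r e]]] ..
qed

lemma Delta_R_eq:
 assumes F: "FC_repr N g \<phi> F" and \<eta>: "\<eta> \<in> \<K>"
 shows "Delta_R F \<eta> x = atom_D2 (0, 1) F \<eta> x - atom_D1 (0, 1) F \<eta> x"
proof -
 have e: "(0, 1::real) \<in> (Basis :: ('a \<times> real) set)" by (simp add: Basis_prod_def)
 note r = FC_reprD(2,3)[OF F]
 show ?thesis unfolding Delta_R_def Let_def atom_D1_def atom_D2_def moved_atom_eq[OF assms]
   dir_deriv_slice(2)[OF differentiableI[OF shifted_derivative[OF r]]] shifted_dir_deriv[OF r]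
   dir_deriv_slice(2)[OF differentiableI[OF shifted_D1_derivative(1)[OF r e]]] ..
qed

text \<open>Two representations are put side by side: the test functions are concatenated and
  \<open>g'\<close> reads its arguments from coordinate \<open>N\<close> on. For the same reason
  \<open>op\<close> acts directly on \<open>moved_atom\<close>.\<close>

lemma FC_repr_combine:
 assumes F: "FC_repr N g \<phi> F" and G: "FC_repr N' g' \<phi>' G"
  and op: "(\<lambda>v. op (g v) (g' (\<lambda>i. v (i + N)))) \<in> Cb_smooth (N' + N)"
 shows "FC_repr (N' + N) (\<lambda>v. op (g v) (g' (\<lambda>i. v (i + N)))) (\<lambda>i. if i < N then \<phi> i else \<phi>' (i - N)) (\<lambda>\<eta>. op (F \<eta>) (G \<eta>))"
  and "\<eta> \<in> \<K> \<Longrightarrow> moved_atom (\<lambda>\<eta>. op (F \<eta>) (G \<eta>)) \<eta> x = (\<lambda>p. op (moved_atom F \<eta> x p) (moved_atom G \<eta> x p))"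
proof -
 note r = FC_reprD[OF F] and r' = FC_reprD[OF G]
 let ?\<phi> = "\<lambda>i. if i < N then \<phi> i else \<phi>' (i - N)"
 have 1: "g (\<lambda>i. f (?\<phi> i)) = g (\<lambda>i. f (\<phi> i))" "g' (\<lambda>i. f (?\<phi> (i + N))) = g' (\<lambda>i. f (\<phi>' i))" for f
  by (rule Cb_smooth_cong[OF r(2)], simp) (rule Cb_smooth_cong[OF r'(2)], simp)
 show R: "FC_repr (N' + N) (\<lambda>v. op (g v) (g' (\<lambda>i. v (i + N)))) ?\<phi> (\<lambda>\<eta>. op (F \<eta>) (G \<eta>))" unfolding FC_repr_def
 proof (intro conjI allI impI ballI op)
  show "1 \<le> N' + N" using r(1) by simp
  show "?\<phi> i \<in> test_functions" if "i < N' + N" for i using r(3) r'(3) that by auto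
  show "op (F \<eta>) (G \<eta>) = op (g (\<lambda>i. pairing (?\<phi> i) \<eta>)) (g' (\<lambda>i. pairing (?\<phi> (i + N)) \<eta>))" if "\<eta> \<in> \<K>" for \<eta>
   using 1[of "\<lambda>\<phi>. pairing \<phi> \<eta>"] r(4)[OF that] r'(4)[OF that] by simp
 qed
 show "moved_atom (\<lambda>\<eta>. op (F \<eta>) (G \<eta>)) \<eta> x = (\<lambda>p. op (moved_atom F \<eta> x p) (moved_atom G \<eta> x p))" if "\<eta> \<in> \<K>"
  unfolding moved_atom_eq[OF R that] moved_atom_eq[OF F that] moved_atom_eq[OF G that]
  using 1[of "\<lambda>\<phi>. pairing \<phi> \<eta> - \<phi> (x, wt \<eta> x) + \<phi> _"]
  by (intro ext) (simp only: shifted_def reduced_def 1[of "\<lambda>\<phi>. pairing \<phi> \<eta> - \<phi> (x, wt \<eta> x) + \<phi> _"])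
qed

lemma FC_E: assumes "F \<in> FC" obtains N g \<phi> where "FC_repr N g \<phi> F" using assms by (auto simp: FC_def)

lemma FC_lin:
 assumes F: "F \<in> FC" and G: "G \<in> FC"
 shows "(\<lambda>\<eta>. a * F \<eta> + b * G \<eta>) \<in> FC" (is "?claim1")
  and "\<eta> \<in> \<K> \<Longrightarrow> moved_atom (\<lambda>\<eta>. a * F \<eta> + b * G \<eta>) \<eta> x = (\<lambda>p. a * moved_atom F \<eta> x p + b * moved_atom G \<eta> x p)"
proof -
 obtain N g \<phi> where F: "FC_repr N g \<phi> F" by (rule FC_E[OF F])
 obtain N' g' \<phi>' where G: "FC_repr N' g' \<phi>' G" by (rule FC_E[OF G])
 have op: "(\<lambda>v. a * g v + b * g' (\<lambda>i. v (i + N))) \<in> Cb_smooth (N' + N)"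
  by (intro Cb_smooth_add Cb_smooth_mult Cb_smooth_const Cb_smooth_shift FC_reprD(2)[OF G] Cb_smooth_mono[OF FC_reprD(2)[OF F]]) simp
 show ?claim1 using FC_repr_combine(1)[OF F G op] unfolding FC_def by blast
 show "moved_atom (\<lambda>\<eta>. a * F \<eta> + b * G \<eta>) \<eta> x = (\<lambda>p. a * moved_atom F \<eta> x p + b * moved_atom G \<eta> x p)" if "\<eta> \<in> \<K>"
  by (rule FC_repr_combine(2)[OF F G op that])
qed

lemma FC_mult:
 assumes F: "F \<in> FC" and G: "G \<in> FC"
 shows "(\<lambda>\<eta>. F \<eta> * G \<eta>) \<in> FC"
proof -
 obtain N g \<phi> where F: "FC_repr N g \<phi> F" by (rule FC_E[OF F])
 obtain N' g' \<phi>' where G: "FC_repr N' g' \<phi>' G" by (rule FC_E[OF G])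
 have op: "(\<lambda>v. g v * g' (\<lambda>i. v (i + N))) \<in> Cb_smooth (N' + N)"
  by (intro Cb_smooth_mult Cb_smooth_shift FC_reprD(2)[OF G] Cb_smooth_mono[OF FC_reprD(2)[OF F]]) simp
 show ?thesis using FC_repr_combine(1)[OF F G op] unfolding FC_def by blast
qed

lemma FC_compose:
 assumes F: "F \<in> FC" and \<psi>: "\<And>N g. g \<in> Cb_smooth N \<Longrightarrow> (\<lambda>v. \<psi> (g v)) \<in> Cb_smooth N"
 shows "(\<lambda>\<eta>. \<psi> (F \<eta>)) \<in> FC" (is "?claim1")
  and "\<eta> \<in> \<K> \<Longrightarrow> moved_atom (\<lambda>\<eta>. \<psi> (F \<eta>)) \<eta> x = (\<lambda>p. \<psi> (moved_atom F \<eta> x p))"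
proof -
 obtain N g \<phi> where F: "FC_repr N g \<phi> F" by (rule FC_E[OF F])
 have R: "FC_repr N (\<lambda>v. \<psi> (g v)) \<phi> (\<lambda>\<eta>. \<psi> (F \<eta>))" using F \<psi> unfolding FC_repr_def by simp
 then show ?claim1 unfolding FC_def by blast
 show "moved_atom (\<lambda>\<eta>. \<psi> (F \<eta>)) \<eta> x = (\<lambda>p. \<psi> (moved_atom F \<eta> x p))" if "\<eta> \<in> \<K>"
  unfolding moved_atom_eq[OF F that] moved_atom_eq[OF R that] by (simp add: fun_eq_iff shifted_def)
qed


section \<open>The Borel sets of the vague topology\<close>

lemma Cc_iff: "f \<in> Cc \<longleftrightarrow> continuous_on UNIV f \<and> (\<exists>R. \<forall>x. R < norm x \<longrightarrow> f x = 0)"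
proof -
 have "(\<exists>K. compact K \<and> (\<forall>x. x \<notin> K \<longrightarrow> f x = 0)) \<longleftrightarrow> (\<exists>R. \<forall>x. R < norm x \<longrightarrow> f x = 0)"
 proof
  assume "\<exists>K. compact K \<and> (\<forall>x. x \<notin> K \<longrightarrow> f x = 0)"
  then obtain K where K: "compact K" "\<And>x. x \<notin> K \<Longrightarrow> f x = 0" by blast
  obtain R where R: "\<forall>x\<in>K. norm x \<le> R" using compact_imp_bounded[OF K(1)] by (auto simp: bounded_iff)
  have "f x = 0" if "R < norm x" for x using R K(2)[of x] that by force
  then show "\<exists>R. \<forall>x. R < norm x \<longrightarrow> f x = 0" by blast
 next
  assume "\<exists>R. \<forall>x. R < norm x \<longrightarrow> f x = 0"
  then obtain R where "\<And>x. R < norm x \<Longrightarrow> f x = 0" by blast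
  then have "\<forall>x. x \<notin> cball 0 R \<longrightarrow> f x = 0" by auto
  then show "\<exists>K. compact K \<and> (\<forall>x. x \<notin> K \<longrightarrow> f x = 0)" using compact_cball by blast
 qed
 then show ?thesis by (auto simp: Cc_def)
qed

lemma Cc_borel: "f \<in> Cc \<Longrightarrow> f \<in> borel_measurable borel" by (rule borel_measurable_continuous_onI) (simp add: Cc_def)

lemma Cc_bounded:
 assumes f: "f \<in> Cc" shows "\<exists>C R. 0 \<le> C \<and> (\<forall>x. \<bar>f x\<bar> \<le> C * indicat_real (cball 0 R) x)"
proof -
 obtain R where R: "\<And>x. R < norm x \<Longrightarrow> f x = 0" and c: "continuous_on UNIV f" using f by (auto simp: Cc_iff)
 have "compact (f ` cball 0 R)" using continuous_on_subset[OF c] by (intro compact_continuous_image) auto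
 then obtain C where C: "\<And>x. x \<in> cball 0 R \<Longrightarrow> \<bar>f x\<bar> \<le> C"
  using compact_imp_bounded[of "f ` cball 0 R"] unfolding bounded_iff by (metis imageI real_norm_def)
 have "\<bar>f x\<bar> \<le> max C 0 * indicat_real (cball 0 R) x" for x
  using C[of x] R[of x] by (cases "x \<in> cball 0 R") (auto simp: indicator_def)
 then show ?thesis by (meson max.cobounded2)
qed

lemma Cc_lin: "f \<in> Cc \<Longrightarrow> g \<in> Cc \<Longrightarrow> (\<lambda>x. a * f x + b * g x) \<in> Cc" unfolding Cc_iff
proof (elim conjE exE, intro conjI)
 fix R R' assume "\<forall>x. R < norm x \<longrightarrow> f x = 0" "\<forall>x. R' < norm x \<longrightarrow> g x = 0"
 then show "\<exists>R. \<forall>x. R < norm x \<longrightarrow> a * f x + b * g x = 0" by (intro exI[of _ "max R R'"]) auto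
qed (intro continuous_intros)

lemma Cc_add: "f \<in> Cc \<Longrightarrow> g \<in> Cc \<Longrightarrow> (\<lambda>x. f x + g x) \<in> Cc" using Cc_lin[of f g 1 1] by simp

lemma Cc_mult: "f \<in> Cc \<Longrightarrow> continuous_on UNIV g \<Longrightarrow> (\<lambda>x. f x * g x) \<in> Cc"
 unfolding Cc_iff by (auto intro!: continuous_intros)

lemma Cc_max: "f \<in> Cc \<Longrightarrow> g \<in> Cc \<Longrightarrow> (\<lambda>x. max (f x) (g x)) \<in> Cc" unfolding Cc_iff
proof (elim conjE exE, intro conjI)
 fix R R' assume "\<forall>x. R < norm x \<longrightarrow> f x = 0" "\<forall>x. R' < norm x \<longrightarrow> g x = 0"
 then show "\<exists>R. \<forall>x. R < norm x \<longrightarrow> max (f x) (g x) = 0" by (intro exI[of _ "max R R'"]) auto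
qed (intro continuous_intros)

lemma Cc_zero: "(\<lambda>x. 0) \<in> Cc" by (auto simp: Cc_iff)

definition cutoff :: "real \<Rightarrow> 'a::euclidean_space \<Rightarrow> real" where "cutoff R x = max 0 (min 1 (R + 1 - norm x))"

lemma cutoff:
 fixes x :: "'a::euclidean_space"
 shows "(cutoff R :: 'a \<Rightarrow> real) \<in> Cc" "0 \<le> cutoff R x" "cutoff R x \<le> 1" "norm x \<le> R \<Longrightarrow> cutoff R x = 1"
proof -
 have "continuous_on UNIV (cutoff R :: 'a \<Rightarrow> real)" unfolding cutoff_def[abs_def] by (intro continuous_intros)
 moreover have "\<forall>x::'a. R + 1 < norm x \<longrightarrow> cutoff R x = 0" by (auto simp: cutoff_def)
 ultimately show "(cutoff R :: 'a \<Rightarrow> real) \<in> Cc" unfolding Cc_iff by blast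
qed (auto simp: cutoff_def)

lemma cutoff_tendsto: "(\<lambda>n. cutoff (real n) x) \<longlonglongrightarrow> 1"
proof (rule tendsto_eventually)
 obtain n0 where "norm x \<le> real n0" using real_arch_simple by blast
 then have "cutoff (real n) x = 1" if "n0 \<le> n" for n using that by (intro cutoff(4)) linarith
 then show "eventually (\<lambda>n. cutoff (real n) x = 1) sequentially" by (auto simp: eventually_sequentially)
qed

lemma discrete_radon_subset: "\<K> \<subseteq> radon_measures" by (auto simp: discrete_radon_def)

lemma Cc_integrable:
 assumes \<eta>: "\<eta> \<in> radon_measures" and f: "f \<in> Cc" shows "integrable \<eta> f"
proof -
 obtain C R where C: "\<And>x. \<bar>f x\<bar> \<le> C * indicat_real (cball 0 R) x" using Cc_bounded[OF f] by blast
 have s: "sets \<eta> = sets borel" using \<eta> by (simp add: radon_measures_def)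
 have m: "f \<in> borel_measurable \<eta>" using Cc_borel[OF f] measurable_cong_sets[OF s refl] by blast
 have "emeasure \<eta> (cball 0 R) < \<infinity>" using \<eta> compact_cball unfolding radon_measures_def by blast
 then have "integrable \<eta> (\<lambda>x. C * indicat_real (cball 0 R) x)"
  using s by (intro integrable_mult_right integrable_real_indicator) auto
 then show ?thesis by (rule Bochner_Integration.integrable_bound[OF _ m]) (use C in \<open>auto intro: order_trans[OF _ abs_ge_self]\<close>)
qed

section \<open>Tents and a countable base of the vague topology\<close>

definition tent :: "'a::euclidean_space \<Rightarrow> real \<Rightarrow> real \<Rightarrow> 'a \<Rightarrow> real" where "tent q \<rho> r x = r * max 0 (1 - dist x q / \<rho>)"

definition tent_max :: "('a::euclidean_space \<Rightarrow> real) list \<Rightarrow> 'a \<Rightarrow> real" where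
 "tent_max ts x = foldr (\<lambda>t m. max (t x) m) ts 0"

lemma tent_Cc: assumes "0 < \<rho>" shows "tent q \<rho> r \<in> Cc"
proof -
 have "continuous_on UNIV (tent q \<rho> r)" unfolding tent_def[abs_def] by (intro continuous_intros) (use assms in auto)
 moreover have "tent q \<rho> r x = 0" if "norm q + \<rho> < norm x" for x
 proof -
  have "\<rho> \<le> dist x q" using that norm_triangle_ineq2[of x q] by (simp add: dist_norm)
  then show ?thesis using assms by (simp add: tent_def)
 qed
 ultimately show ?thesis unfolding Cc_iff by blast
qed

lemma tent_max_Cc: "set ts \<subseteq> Cc \<Longrightarrow> tent_max ts \<in> Cc"
proof (induction ts)
 case Nil then show ?case using Cc_zero by (simp add: tent_max_def[abs_def])
next
 case (Cons t ts) then show ?case using Cc_max[of t "tent_max ts"] by (simp add: tent_max_def[abs_def])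
qed

lemma tent_max_ge: "t \<in> set ts \<Longrightarrow> t x \<le> tent_max ts x" by (induction ts) (auto simp: tent_max_def)

lemma tent_max_le: "0 \<le> c \<Longrightarrow> (\<And>t. t \<in> set ts \<Longrightarrow> t x \<le> c) \<Longrightarrow> tent_max ts x \<le> c" by (induction ts) (auto simp: tent_max_def)

lemma tent_max_nonneg: "0 \<le> tent_max ts x" by (induction ts) (auto simp: tent_max_def)

context
 fixes Q :: "'a::euclidean_space set"
 assumes Q: "countable Q" "\<forall>X. open X \<longrightarrow> X \<noteq> {} \<longrightarrow> (\<exists>d\<in>Q. d \<in> X)"
begin

definition tents :: "('a \<Rightarrow> real) set" where "tents = {tent q \<rho> r |q \<rho> r. q \<in> Q \<and> \<rho> \<in> \<rat> \<and> r \<in> \<rat> \<and> 0 < \<rho> \<and> 0 \<le> r}"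

lemma tentsI: "q \<in> Q \<Longrightarrow> \<rho> \<in> \<rat> \<Longrightarrow> r \<in> \<rat> \<Longrightarrow> 0 < \<rho> \<Longrightarrow> 0 \<le> r \<Longrightarrow> tent q \<rho> r \<in> tents" unfolding tents_def by blast

lemma countable_tents: "countable tents"
proof -
 have "tents \<subseteq> (\<lambda>(q, \<rho>, r). tent q \<rho> r) ` (Q \<times> \<rat> \<times> \<rat>)" unfolding tents_def by force
 moreover have "countable (Q \<times> (\<rat> :: real set) \<times> (\<rat> :: real set))" by (intro countable_SIGMA Q(1) countable_rat)
 ultimately show ?thesis using countable_subset countable_image by metis
qed

lemma tents_Cc: "tents \<subseteq> Cc" using tent_Cc by (auto simp: tents_def)

text \<open>Makes every nonnegative \<open>f\<close> in \<open>Cc\<close> the pointwise supremum of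
  countably many tents below it: height slightly below \<open>f x\<close>, radius so small that
  \<open>f\<close> exceeds the height on the support, centre in the dense set near
  \<open>x\<close>.\<close>

lemma tent_below:
 assumes f: "f \<in> Cc" and f0: "\<And>x. 0 \<le> f x" and e: "0 < e"
 shows "\<exists>t\<in>tents. (\<forall>y. t y \<le> f y) \<and> f x - e < t x"
proof (cases "f x = 0")
 case True
 obtain q where q: "q \<in> Q" using Q(2)[rule_format, of UNIV] by blast
 have "tent q 1 0 \<in> tents" using q by (intro tentsI) auto
 then show ?thesis using f0 e True by (intro bexI[of _ "tent q 1 0"]) (auto simp: tent_def)
next
 case False
 then have fx: "0 < f x" using f0[of x] by simp
 then have "max 0 (f x - e / 2) < f x" using e by simp
 then obtain r where r: "r \<in> \<rat>" "max 0 (f x - e / 2) < r" "r < f x" using Rats_dense_in_real by blast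
 have "open {y. r < f y}" using f by (intro open_Collect_less) (auto simp: Cc_def)
 then obtain \<delta> where \<delta>: "0 < \<delta>" "ball x \<delta> \<subseteq> {y. r < f y}" using r(3) by (auto simp: open_contains_ball)
 obtain \<rho> where \<rho>: "\<rho> \<in> \<rat>" "0 < \<rho>" "\<rho> < \<delta> / 2" using Rats_dense_in_real[of 0 "\<delta> / 2"] \<delta>(1) by auto
 have r0: "0 < r" using r(2) by simp
 \<comment> \<open>The centre may miss \<open>x\<close> by \<open>\<rho> * \<kappa>\<close>; the
   tent then loses at most \<open>r * \<kappa> \<le> e / 2\<close> at \<open>x\<close>, besides the
   \<open>e / 2\<close> given away in the choice of \<open>r\<close>.\<close>
 define \<kappa> where "\<kappa> = min 1 (e / (2 * r))"
 have \<kappa>: "0 < \<kappa>" "\<kappa> \<le> 1" "r * \<kappa> \<le> e / 2" using e r0 by (auto simp: \<kappa>_def min_def field_simps)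
 have "x \<in> ball x (\<rho> * \<kappa>)" using mult_pos_pos[OF \<rho>(2) \<kappa>(1)] by simp
 then have "ball x (\<rho> * \<kappa>) \<noteq> {}" by blast
 then obtain q where q: "q \<in> Q" "dist x q < \<rho> * \<kappa>" using Q(2)[rule_format, of "ball x (\<rho> * \<kappa>)"] by auto
 have "tent q \<rho> r y \<le> f y" for y
 proof (cases "dist y q < \<rho>")
  case True
  have "\<rho> * \<kappa> \<le> \<rho>" using \<rho> \<kappa> by (simp add: mult_left_le)
  then have "dist x y < \<delta>" using True q(2) \<rho>(3) dist_triangle[of x y q] by (simp add: dist_commute)
  then have "r < f y" using \<delta>(2) by auto
  moreover have "tent q \<rho> r y \<le> r" unfolding tent_def using r0 \<rho> by (intro mult_left_le) auto
  ultimately show ?thesis by simp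
 next
  case False
  then show ?thesis using \<rho> f0[of y] by (simp add: tent_def)
 qed
 moreover have "f x - e < tent q \<rho> r x"
 proof -
  have "dist x q / \<rho> \<le> \<kappa>" using q(2) \<rho>(2) by (simp add: field_simps)
  then have "r * (1 - \<kappa>) \<le> r * max 0 (1 - dist x q / \<rho>)" using r0 by (intro mult_left_mono) auto
  moreover have "f x - e < r * (1 - \<kappa>)" using r(2) \<kappa>(3) e by (simp add: algebra_simps)
  ultimately show ?thesis by (simp add: tent_def)
 qed
 moreover have "tent q \<rho> r \<in> tents" using q r \<rho> by (intro tentsI) auto
 ultimately show ?thesis by blast
qed

definition tent_maxs :: "('a \<Rightarrow> real) set" where "tent_maxs = tent_max ` lists tents"

lemma countable_tent_maxs: "countable tent_maxs"
 unfolding tent_maxs_def by (intro countable_image countable_lists countable_tents)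

lemma tent_maxs_Cc: "tent_maxs \<subseteq> Cc"
 unfolding tent_maxs_def using tent_max_Cc tents_Cc by (auto simp: in_lists_conv_set)

text \<open>Maxima of the first \<open>n\<close> tents below \<open>f\<close> increase to
  \<open>f\<close>, and \<open>f\<close> dominates them, so their integrals converge to the integral
  of \<open>f\<close>.\<close>

lemma tent_maxs_below:
 assumes f: "f \<in> Cc" and f0: "\<And>x. 0 \<le> f x" and \<eta>: "\<eta> \<in> radon_measures" and a: "a < (\<integral>x. f x \<partial>\<eta>)"
 shows "\<exists>g\<in>tent_maxs. (\<forall>x. g x \<le> f x) \<and> a < (\<integral>x. g x \<partial>\<eta>)"
proof -
 define S where "S = {t \<in> tents. \<forall>y. t y \<le> f y}"
 have S: "countable S" "S \<noteq> {}" "S \<subseteq> tents"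
  using countable_tents tent_below[OF f f0, of 1] unfolding S_def by (auto intro: countable_subset[rotated])
 define ts where "ts n = map (from_nat_into S) [0..<n]" for n
 have ts: "set (ts n) \<subseteq> S" for n using from_nat_into[OF S(2)] by (auto simp: ts_def)
 have sets: "sets \<eta> = sets borel" using \<eta> by (simp add: radon_measures_def)
 have gC: "tent_max (ts n) \<in> Cc" for n using tent_max_Cc ts S(3) tents_Cc by blast
 have le: "tent_max (ts n) x \<le> f x" for n x using ts[of n] f0[of x] by (intro tent_max_le) (auto simp: S_def)
 have "(\<lambda>n. \<integral>x. tent_max (ts n) x \<partial>\<eta>) \<longlonglongrightarrow> (\<integral>x. f x \<partial>\<eta>)"
 proof (rule integral_dominated_convergence[where w = f])
  show "f \<in> borel_measurable \<eta>" "\<And>n. tent_max (ts n) \<in> borel_measurable \<eta>"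
   using Cc_integrable[OF \<eta> f] Cc_integrable[OF \<eta> gC] by auto
  show "integrable \<eta> f" by (rule Cc_integrable[OF \<eta> f])
  have "norm (tent_max (ts n) x) \<le> f x" for n x using le[of n x] tent_max_nonneg[of "ts n" x] by simp
  then show "AE x in \<eta>. norm (tent_max (ts n) x) \<le> f x" for n by simp
  show "AE x in \<eta>. (\<lambda>n. tent_max (ts n) x) \<longlonglongrightarrow> f x"
  proof (rule AE_I2, rule LIMSEQ_I)
   fix x and e :: real assume e: "0 < e"
   obtain t where t: "t \<in> S" "f x - e < t x" using tent_below[OF f f0 e] unfolding S_def by blast
   then obtain k where k: "t = from_nat_into S k" using from_nat_into_surj[OF S(1)] by metis
   have "norm (tent_max (ts n) x - f x) < e" if "n \<ge> Suc k" for n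
   proof -
    have "t \<in> set (ts n)" using that k by (auto simp: ts_def)
    then show ?thesis using tent_max_ge[of t "ts n" x] t(2) le[of n x] by simp
   qed
   then show "\<exists>no. \<forall>n\<ge>no. norm (tent_max (ts n) x - f x) < e" by blast
  qed
 qed
 then have "eventually (\<lambda>n. a < (\<integral>x. tent_max (ts n) x \<partial>\<eta>)) sequentially" using a by (rule order_tendstoD)
 then obtain n where "a < (\<integral>x. tent_max (ts n) x \<partial>\<eta>)" by (auto dest: eventually_happens)
 moreover have "tent_max (ts n) \<in> tent_maxs" unfolding tent_maxs_def using ts S(3) by (auto simp: in_lists_conv_set)
 ultimately show ?thesis using le by blast
qed

lemma tent_maxs_above:
 assumes f: "f \<in> Cc" shows "\<exists>k\<in>tent_maxs. \<forall>x. \<bar>f x\<bar> \<le> k x"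
proof -
 obtain C R where C: "\<And>x. \<bar>f x\<bar> \<le> C * indicat_real (cball 0 R) x" "0 \<le> C" using Cc_bounded[OF f] by blast
 obtain q where q: "q \<in> Q" "dist 0 q < 1" using Q(2)[rule_format, of "ball 0 1"] by auto
 \<comment> \<open>On the ball the distance to \<open>q\<close> is at most
   \<open>\<bar>R\<bar> + 1\<close>, less than half of the radius, so the tent keeps at least half
   of its height \<open>r > 2 * C\<close>.\<close>
 obtain \<rho> where \<rho>: "\<rho> \<in> \<rat>" "2 * (\<bar>R\<bar> + 1) < \<rho>" using Rats_dense_in_real[of "2 * (\<bar>R\<bar> + 1)" "2 * (\<bar>R\<bar> + 1) + 1"] by auto
 obtain r where r: "r \<in> \<rat>" "2 * C < r" using Rats_dense_in_real[of "2 * C" "2 * C + 1"] by auto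
 have "\<bar>f x\<bar> \<le> tent q \<rho> r x" for x
 proof (cases "x \<in> cball 0 R")
  case True
  have "dist x q \<le> \<bar>R\<bar> + 1" using True q(2) dist_triangle[of x q 0] by (simp add: dist_commute)
  then have "dist x q / \<rho> \<le> 1 / 2" using \<rho>(2) by (simp add: field_simps)
  then have "1 / 2 \<le> 1 - dist x q / \<rho>" by simp
  then have "1 / 2 \<le> max 0 (1 - dist x q / \<rho>)" by (rule max.coboundedI2)
  then have "r * (1 / 2) \<le> r * max 0 (1 - dist x q / \<rho>)" by (rule mult_left_mono) (use r(2) C(2) in simp)
  then have "r * (1 / 2) \<le> tent q \<rho> r x" by (simp only: tent_def)
  moreover have "\<bar>f x\<bar> \<le> C" using C(1)[of x] True by simp
  ultimately show ?thesis using r(2) by linarith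
 next
  case False
  then show ?thesis using C(1)[of x] r(2) C(2) by (simp add: tent_def)
 qed
 then have "\<bar>f x\<bar> \<le> tent_max [tent q \<rho> r] x" for x by (rule order_trans) (simp add: tent_max_ge)
 moreover have "tent q \<rho> r \<in> tents" using q r \<rho> C(2) by (intro tentsI) auto
 ultimately show ?thesis unfolding tent_maxs_def by (intro bexI[of _ "tent_max [tent q \<rho> r]"]) auto
qed

text \<open>Tents approximate nonnegative functions from below only. With a majorant
  \<open>k\<close> of \<open>\<bar>f\<bar>\<close> from the countable family, a lower bound for the
  integral of \<open>f + k\<close> and an upper bound for that of \<open>k\<close> combine to a
  lower bound for \<open>f\<close>.\<close>

lemma integral_gt_nbhd:
 assumes f: "f \<in> Cc" and \<eta>: "\<eta> \<in> radon_measures" and a: "a < (\<integral>x. f x \<partial>\<eta>)"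
 shows "\<exists>g\<in>tent_maxs. \<exists>k\<in>tent_maxs. \<exists>r\<in>\<rat>. \<exists>r'\<in>\<rat>. r < (\<integral>x. g x \<partial>\<eta>) \<and> (\<integral>x. k x \<partial>\<eta>) < r' \<and>
  (\<forall>\<zeta>\<in>radon_measures. r < (\<integral>x. g x \<partial>\<zeta>) \<and> (\<integral>x. k x \<partial>\<zeta>) < r' \<longrightarrow> a < (\<integral>x. f x \<partial>\<zeta>))"
proof -
 obtain k where k: "k \<in> tent_maxs" "\<And>x. \<bar>f x\<bar> \<le> k x" using tent_maxs_above[OF f] by blast
 have kC: "k \<in> Cc" using k(1) tent_maxs_Cc by blast
 have add: "(\<integral>x. f x + k x \<partial>\<zeta>) = (\<integral>x. f x \<partial>\<zeta>) + (\<integral>x. k x \<partial>\<zeta>)" if "\<zeta> \<in> radon_measures" for \<zeta>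
  using Cc_integrable[OF that f] Cc_integrable[OF that kC] by simp
 have "0 \<le> f x + k x" for x using k(2)[of x] by (simp add: abs_le_iff)
 then obtain g where g: "g \<in> tent_maxs" "\<And>x. g x \<le> f x + k x" "a + (\<integral>x. k x \<partial>\<eta>) < (\<integral>x. g x \<partial>\<eta>)"
  using tent_maxs_below[OF Cc_add[OF f kC] _ \<eta>, of "a + (\<integral>x. k x \<partial>\<eta>)"] a add[OF \<eta>] by auto
 have gC: "g \<in> Cc" using g(1) tent_maxs_Cc by blast
 have "(\<integral>x. k x \<partial>\<eta>) < (\<integral>x. g x \<partial>\<eta>) - a" using g(3) by simp
 then obtain r' where r': "r' \<in> \<rat>" "(\<integral>x. k x \<partial>\<eta>) < r'" "r' < (\<integral>x. g x \<partial>\<eta>) - a" using Rats_dense_in_real by blast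
 then have "a + r' < (\<integral>x. g x \<partial>\<eta>)" by simp
 then obtain r where r: "r \<in> \<rat>" "a + r' < r" "r < (\<integral>x. g x \<partial>\<eta>)" using Rats_dense_in_real by blast
 have "a < (\<integral>x. f x \<partial>\<zeta>)" if \<zeta>: "\<zeta> \<in> radon_measures" and "r < (\<integral>x. g x \<partial>\<zeta>)" "(\<integral>x. k x \<partial>\<zeta>) < r'" for \<zeta>
 proof -
  have "(\<integral>x. g x \<partial>\<zeta>) \<le> (\<integral>x. f x + k x \<partial>\<zeta>)"
   by (rule integral_mono[OF Cc_integrable[OF \<zeta> gC] Cc_integrable[OF \<zeta> Cc_add[OF f kC]] g(2)])
  then show ?thesis using add[OF \<zeta>] that r(2) by linarith
 qed
 then show ?thesis using g(1) k(1) r r' by blast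
qed

definition vague_subbase :: "'a measure set set" where
 "vague_subbase = (\<lambda>(g, r). {\<eta> \<in> radon_measures. r < (\<integral>x. g x \<partial>\<eta>)}) ` (tent_maxs \<times> \<rat>) \<union>
   (\<lambda>(g, r). {\<eta> \<in> radon_measures. (\<integral>x. g x \<partial>\<eta>) < r}) ` (tent_maxs \<times> \<rat>)"

text \<open>The intersection with \<open>radon_measures\<close> matters for the empty family, whose
  intersection is the whole type.\<close>

definition vague_base :: "'a measure set set" where
 "vague_base = (\<lambda>F. radon_measures \<inter> \<Inter>F) ` {F. finite F \<and> F \<subseteq> vague_subbase}"

lemma countable_vague_base: "countable vague_base"
proof -
 have "countable (tent_maxs \<times> (\<rat> :: real set))" using countable_tent_maxs countable_rat by (intro countable_SIGMA)
 then have "countable vague_subbase" unfolding vague_subbase_def by simp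
 then show ?thesis unfolding vague_base_def by (intro countable_image countable_Collect_finite_subset)
qed

lemma vague_base_Int: "B \<in> vague_base \<Longrightarrow> B' \<in> vague_base \<Longrightarrow> B \<inter> B' \<in> vague_base"
proof -
 assume "B \<in> vague_base" "B' \<in> vague_base"
 then obtain F F' where F: "B = radon_measures \<inter> \<Inter>F" "finite F" "F \<subseteq> vague_subbase"
  and F': "B' = radon_measures \<inter> \<Inter>F'" "finite F'" "F' \<subseteq> vague_subbase"
  unfolding vague_base_def by blast
 have "B \<inter> B' = radon_measures \<inter> \<Inter>(F \<union> F')" unfolding F F' by blast
 moreover have "radon_measures \<inter> \<Inter>(F \<union> F') \<in> vague_base" unfolding vague_base_def by (rule imageI) (use F F' in simp)
 ultimately show ?thesis by simp
qed

lemma vague_base_nbhd: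
 assumes f: "f \<in> Cc" and \<eta>: "\<eta> \<in> radon_measures" and a: "a < (\<integral>x. f x \<partial>\<eta>)"
 shows "\<exists>B\<in>vague_base. \<eta> \<in> B \<and> B \<subseteq> {\<zeta> \<in> radon_measures. a < (\<integral>x. f x \<partial>\<zeta>)}"
proof -
 obtain g k r r' where *: "g \<in> tent_maxs" "k \<in> tent_maxs" "r \<in> \<rat>" "r' \<in> \<rat>" "r < (\<integral>x. g x \<partial>\<eta>)" "(\<integral>x. k x \<partial>\<eta>) < r'"
  "\<And>\<zeta>. \<zeta> \<in> radon_measures \<Longrightarrow> r < (\<integral>x. g x \<partial>\<zeta>) \<Longrightarrow> (\<integral>x. k x \<partial>\<zeta>) < r' \<Longrightarrow> a < (\<integral>x. f x \<partial>\<zeta>)"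
  using integral_gt_nbhd[OF assms] by blast
 let ?F = "{{\<eta> \<in> radon_measures. r < (\<integral>x. g x \<partial>\<eta>)}, {\<eta> \<in> radon_measures. (\<integral>x. k x \<partial>\<eta>) < r'}}"
 have "{\<eta> \<in> radon_measures. r < (\<integral>x. g x \<partial>\<eta>)} \<in> vague_subbase"
  unfolding vague_subbase_def using *(1,3) by (intro UnI1 image_eqI[of _ _ "(g, r)"]) auto
 moreover have "{\<eta> \<in> radon_measures. (\<integral>x. k x \<partial>\<eta>) < r'} \<in> vague_subbase"
  unfolding vague_subbase_def using *(2,4) by (intro UnI2 image_eqI[of _ _ "(k, r')"]) auto
 ultimately have "radon_measures \<inter> \<Inter>?F \<in> vague_base" unfolding vague_base_def by (intro image_eqI[of _ _ ?F]) auto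
 then show ?thesis using * \<eta> by (intro bexI[of _ "radon_measures \<inter> \<Inter>?F"]) auto
qed

text \<open>Second countability of the vague topology, which replaces arbitrary unions by countable
  ones in \<open>sets_discrete_radon_space\<close>.\<close>

lemma vague_open_base:
 assumes "generate_topology_on {{\<eta> \<in> radon_measures. (\<integral>x. f x \<partial>\<eta>) \<in> U} | f U. f \<in> Cc \<and> open U} V"
 shows "\<eta> \<in> V \<Longrightarrow> \<exists>B\<in>vague_base. \<eta> \<in> B \<and> B \<subseteq> V"
 using assms
proof (induction arbitrary: \<eta> rule: generate_topology_on.induct)
 case (Int V W)
 obtain B where "B \<in> vague_base" "\<eta> \<in> B" "B \<subseteq> V" using Int.IH(1)[of \<eta>] Int.prems by blast
 moreover obtain B' where "B' \<in> vague_base" "\<eta> \<in> B'" "B' \<subseteq> W" using Int.IH(2)[of \<eta>] Int.prems by blast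
 ultimately show ?case using vague_base_Int by (intro bexI[of _ "B \<inter> B'"]) auto
next
 case (UN K)
 then obtain k where k: "k \<in> K" "\<eta> \<in> k" by blast
 then obtain B where "B \<in> vague_base" "\<eta> \<in> B" "B \<subseteq> k" using UN.IH[OF k(1), of \<eta>] by blast
 then show ?case using k(1) by (intro bexI[of _ B]) auto
next
 case (Basis V)
 then obtain f U where V: "V = {\<eta> \<in> radon_measures. (\<integral>x. f x \<partial>\<eta>) \<in> U}" and f: "f \<in> Cc" and U: "open U" by blast
 have \<eta>: "\<eta> \<in> radon_measures" and "(\<integral>x. f x \<partial>\<eta>) \<in> U" using Basis.prems V by auto
 then obtain e where e: "0 < e" "ball (\<integral>x. f x \<partial>\<eta>) e \<subseteq> U" using U by (auto simp: open_contains_ball)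
 let ?a = "\<integral>x. f x \<partial>\<eta>"
 \<comment> \<open>Lower bounds for the integrals of \<open>f\<close> and of \<open>- f\<close>
   enclose the integral in an interval of radius \<open>e\<close>.\<close>
 have f': "(\<lambda>x. - f x) \<in> Cc" using Cc_lin[OF f f, of "-1" 0] by simp
 obtain B where B: "B \<in> vague_base" "\<eta> \<in> B" "B \<subseteq> {\<zeta> \<in> radon_measures. ?a - e < (\<integral>x. f x \<partial>\<zeta>)}"
  using vague_base_nbhd[OF f \<eta>, of "?a - e"] e(1) by auto
 obtain B' where B': "B' \<in> vague_base" "\<eta> \<in> B'" "B' \<subseteq> {\<zeta> \<in> radon_measures. - ?a - e < (\<integral>x. - f x \<partial>\<zeta>)}"
  using vague_base_nbhd[OF f' \<eta>, of "- ?a - e"] e(1) by auto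
 have "B \<inter> B' \<subseteq> V"
 proof
  fix \<zeta> assume "\<zeta> \<in> B \<inter> B'"
  then have "\<zeta> \<in> radon_measures" "?a - e < (\<integral>x. f x \<partial>\<zeta>)" "(\<integral>x. f x \<partial>\<zeta>) < ?a + e" using B(3) B'(3) by auto
  then show "\<zeta> \<in> V" unfolding V using e(2) by (auto simp: dist_real_def subset_iff)
 qed
 then show ?case using vague_base_Int[OF B(1) B'(1)] B(2) B'(2) by blast
qed simp

end

section \<open>The sigma-algebra generated by integrals of continuous functions\<close>

definition Cc_sigma :: "'a::euclidean_space measure measure" where
 "Cc_sigma = sigma \<K> {{\<eta> \<in> \<K>. (\<integral>x. f x \<partial>\<eta>) \<in> U} | f U. f \<in> Cc \<and> open U}"

lemma space_Cc_sigma [simp]: "space Cc_sigma = \<K>" unfolding Cc_sigma_def by (rule space_measure_of) auto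

lemma Cc_sigma_integral_measurable:
 assumes "f \<in> Cc" shows "(\<lambda>\<eta>. \<integral>x. f x \<partial>\<eta>) \<in> borel_measurable Cc_sigma"
proof (rule borel_measurableI)
 fix U :: "real set" assume "open U"
 then have "{\<eta> \<in> \<K>. (\<integral>x. f x \<partial>\<eta>) \<in> U} \<in> sets Cc_sigma"
  unfolding Cc_sigma_def using assms by (subst sets_measure_of) (auto intro!: sigma_sets.Basic)
 moreover have "(\<lambda>\<eta>. \<integral>x. f x \<partial>\<eta>) -` U \<inter> space Cc_sigma = {\<eta> \<in> \<K>. (\<integral>x. f x \<partial>\<eta>) \<in> U}" by auto
 ultimately show "(\<lambda>\<eta>. \<integral>x. f x \<partial>\<eta>) -` U \<inter> space Cc_sigma \<in> sets Cc_sigma" by simp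
qed

lemma measurable_Cc_sigmaI:
 assumes "\<And>x. x \<in> space N \<Longrightarrow> \<kappa> x \<in> \<K>"
  and "\<And>f. f \<in> Cc \<Longrightarrow> (\<lambda>x. \<integral>y. f y \<partial>\<kappa> x) \<in> borel_measurable N"
 shows "\<kappa> \<in> measurable N Cc_sigma"
 unfolding Cc_sigma_def
proof (rule measurable_measure_of)
 show "\<kappa> \<in> space N \<rightarrow> \<K>" using assms(1) by blast
 fix A :: "'b measure set" assume "A \<in> {{\<eta> \<in> \<K>. (\<integral>x. f x \<partial>\<eta>) \<in> U} |f U. f \<in> Cc \<and> open U}"
 then obtain f U where A: "A = {\<eta> \<in> \<K>. (\<integral>x. f x \<partial>\<eta>) \<in> U}" and f: "f \<in> Cc" and U: "open (U :: real set)" by blast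
 have "\<kappa> -` A \<inter> space N = (\<lambda>x. \<integral>y. f y \<partial>\<kappa> x) -` U \<inter> space N" unfolding A using assms(1) by auto
 then show "\<kappa> -` A \<inter> space N \<in> sets N" using measurable_sets[OF assms(2)[OF f]] U by auto
qed auto

text \<open>Vaguely open sets arise from subbasic ones by arbitrary unions, while
  \<open>Cc_sigma\<close> allows countable operations; the countable base bridges the gap. The other
  inclusion holds because the generators are traces of open sets. Later measurability is checked
  against \<open>Cc_sigma\<close>.\<close>

theorem sets_discrete_radon_space: "sets discrete_radon_space = sets (Cc_sigma :: 'a::euclidean_space measure measure)"
proof
 let ?S = "{{\<eta> \<in> radon_measures. (\<integral>x. f x \<partial>\<eta>) \<in> U} | f U. f \<in> (Cc :: ('a \<Rightarrow> real) set) \<and> open U}"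
 obtain Q :: "'a set" where Q: "countable Q" "\<forall>X. open X \<longrightarrow> X \<noteq> {} \<longrightarrow> (\<exists>d\<in>Q. d \<in> X)" by (rule countable_dense_setE) blast
 have op: "openin vague_topology V \<longleftrightarrow> generate_topology_on ?S V" for V :: "'a measure set"
  unfolding vague_topology_def by (rule openin_topology_generated_by_iff)
 have sub: "V \<subseteq> radon_measures" if "openin vague_topology V" for V :: "'a measure set"
  using that unfolding op by (induction rule: generate_topology_on.induct) auto
 have int: "(\<lambda>\<eta>. \<integral>x. f x \<partial>\<eta>) \<in> borel_measurable Cc_sigma" if "f \<in> tent_maxs Q" for f
  using that tent_maxs_Cc[OF Q] Cc_sigma_integral_measurable by blast
 have sb: "A \<inter> \<K> \<in> sets Cc_sigma" if A: "A \<in> vague_subbase Q" for A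
 proof -
  consider g r where "g \<in> tent_maxs Q" "A = {\<eta> \<in> radon_measures. r < (\<integral>x. g x \<partial>\<eta>)}"
   | g r where "g \<in> tent_maxs Q" "A = {\<eta> \<in> radon_measures. (\<integral>x. g x \<partial>\<eta>) < r}"
   using A unfolding vague_subbase_def[OF Q] by auto
  then show ?thesis
  proof cases
   case (1 g r)
   note [measurable] = int[OF 1(1)]
   have "{\<eta> \<in> space Cc_sigma. r < (\<integral>x. g x \<partial>\<eta>)} \<in> sets Cc_sigma" by measurable
   moreover have "A \<inter> \<K> = {\<eta> \<in> space Cc_sigma. r < (\<integral>x. g x \<partial>\<eta>)}"
    using discrete_radon_subset by (auto simp: 1)
   ultimately show ?thesis by simp
  next
   case (2 g r)
   note [measurable] = int[OF 2(1)]
   have "{\<eta> \<in> space Cc_sigma. (\<integral>x. g x \<partial>\<eta>) < r} \<in> sets Cc_sigma" by measurable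
   moreover have "A \<inter> \<K> = {\<eta> \<in> space Cc_sigma. (\<integral>x. g x \<partial>\<eta>) < r}"
    using discrete_radon_subset by (auto simp: 2)
   ultimately show ?thesis by simp
  qed
 qed
 have dr: "\<K> \<in> sets Cc_sigma" using sets.top[of Cc_sigma] by simp
 have b: "B \<inter> \<K> \<in> sets Cc_sigma" if B: "B \<in> vague_base Q" for B
 proof -
  obtain F where F: "B = radon_measures \<inter> \<Inter>F" "finite F" "F \<subseteq> vague_subbase Q"
   using B unfolding vague_base_def[OF Q] by blast
  have "\<Inter>F \<inter> \<K> \<in> sets Cc_sigma" using F(2,3)
  proof (induction F rule: finite_induct)
   case empty show ?case using dr by simp
  next
   case (insert A F)
   have "\<Inter>(insert A F) \<inter> \<K> = (A \<inter> \<K>) \<inter> (\<Inter>F \<inter> \<K>)" by auto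
   then show ?case using sb[of A] insert by auto
  qed
  moreover have "B \<inter> \<K> = \<Inter>F \<inter> \<K>" using F(1) discrete_radon_subset by auto
  ultimately show ?thesis by simp
 qed
 have o: "V \<inter> \<K> \<in> sets Cc_sigma" if V: "openin vague_topology V" for V :: "'a measure set"
 proof -
  have "V = \<Union>{B \<in> vague_base Q. B \<subseteq> V}" using vague_open_base[OF Q V[unfolded op]] by blast
  then have "V \<inter> \<K> = (\<Union>B\<in>{B \<in> vague_base Q. B \<subseteq> V}. B \<inter> \<K>)" by blast
  moreover have "countable {B \<in> vague_base Q. B \<subseteq> V}"
   using countable_vague_base[OF Q] by (rule countable_subset[rotated]) auto
  moreover have "(\<Union>B\<in>{B \<in> vague_base Q. B \<subseteq> V}. B \<inter> \<K>) \<in> sets Cc_sigma"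
   by (rule sets.countable_UN') (use calculation(2) b in auto)
  ultimately show ?thesis by simp
 qed
 have vb: "sets (vague_borel :: 'a measure measure) = sigma_sets radon_measures (Collect (openin vague_topology))"
  unfolding vague_borel_def using sub by (intro sets_measure_of) auto
 have s: "sets (discrete_radon_space :: 'a measure measure) = (\<inter>) \<K> ` sets vague_borel"
  unfolding discrete_radon_space_def by (rule sets_restrict_space)
 have "A \<inter> \<K> \<in> sets Cc_sigma" if "A \<in> sets vague_borel" for A :: "'a measure set" using that unfolding vb
 proof (induction rule: sigma_sets.induct)
  case (Compl A)
  have "(radon_measures - A) \<inter> \<K> = \<K> - (A \<inter> \<K>)"
   using discrete_radon_subset by auto
  then show ?case using Compl.IH dr by auto
 next
  case (Union A)
  have "(\<Union>i. A i \<inter> \<K>) \<in> sets Cc_sigma" using Union.IH by (intro sets.countable_UN') auto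
  moreover have "\<Union>(range A) \<inter> \<K> = (\<Union>i. A i \<inter> \<K>)" by blast
  ultimately show ?case by (simp only:)
 qed (use o in auto)
 then show "sets discrete_radon_space \<subseteq> sets (Cc_sigma :: 'a measure measure)" unfolding s by (auto simp: Int_commute)
 have "sigma_sets \<K> {{\<eta> \<in> \<K>. (\<integral>x. f x \<partial>\<eta>) \<in> U} | f U. f \<in> (Cc :: ('a \<Rightarrow> real) set) \<and> open U}
   \<subseteq> sets discrete_radon_space"
 proof -
  have sp: "space discrete_radon_space = (\<K> :: 'a measure set)"
  proof -
   have "space vague_borel = (radon_measures :: 'a measure set)"
    unfolding vague_borel_def using sub by (intro space_measure_of) auto
   then show ?thesis unfolding discrete_radon_space_def space_restrict_space using discrete_radon_subset by blast
  qed
  have "{\<eta> \<in> \<K>. (\<integral>x. f x \<partial>\<eta>) \<in> U} \<in> sets discrete_radon_space" if f: "f \<in> (Cc :: ('a \<Rightarrow> real) set)" and U: "open U" for f U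
  proof -
   have "{\<eta> \<in> radon_measures. (\<integral>x. f x \<partial>\<eta>) \<in> U} \<in> sets vague_borel"
    unfolding vb by (rule sigma_sets.Basic) (use f U in \<open>auto simp: op intro!: generate_topology_on.Basis\<close>)
   moreover have "{\<eta> \<in> \<K>. (\<integral>x. f x \<partial>\<eta>) \<in> U} = \<K> \<inter> {\<eta> \<in> radon_measures. (\<integral>x. f x \<partial>\<eta>) \<in> U}"
    using discrete_radon_subset by auto
   ultimately show ?thesis unfolding s by blast
  qed
  then show ?thesis unfolding sp[symmetric] by (intro sets.sigma_sets_subset) (auto simp: sp)
 qed
 then show "sets (Cc_sigma :: 'a measure measure) \<subseteq> sets discrete_radon_space"
  unfolding Cc_sigma_def by (subst sets_measure_of) auto
qed


section \<open>Measurability in the discrete measure\<close>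

text \<open>Taking one factor constant shows that both coordinate projections are measurable for the
  \<sigma>-algebra generated by the products, and hence so is the identity into the product
  space.\<close>

lemma product_borel_generated:
 fixes N :: "'n measure" and \<A> :: "('n \<Rightarrow> real) set" and M :: "('n \<times> 'a::euclidean_space \<Rightarrow> real) set"
 assumes A: "sets N \<subseteq> sigma_sets (space N) {f -` {a<..} \<inter> space N |f a. f \<in> \<A>}" and one: "(\<lambda>_. 1) \<in> \<A>"
  and M: "\<And>a \<psi>. a \<in> \<A> \<Longrightarrow> continuous_on UNIV \<psi> \<Longrightarrow> (\<And>y. 0 \<le> \<psi> y \<and> \<psi> y \<le> 1) \<Longrightarrow> (\<lambda>(n, y). a n * \<psi> y) \<in> M"
 shows "sets (N \<Otimes>\<^sub>M borel) \<subseteq> sigma_sets (space N \<times> UNIV) {f -` {a<..} \<inter> (space N \<times> UNIV) |f a. f \<in> M}"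
proof -
 define G where "G = {f -` {a<..} \<inter> (space N \<times> UNIV) |f a. f \<in> M}"
 define S where "S = sigma (space N \<times> UNIV) G"
 have G: "G \<subseteq> Pow (space N \<times> UNIV)" by (auto simp: G_def)
 have sS: "sets S = sigma_sets (space N \<times> UNIV) G" unfolding S_def by (rule sets_measure_of[OF G])
 have spS: "space S = space N \<times> UNIV" unfolding S_def by (rule space_measure_of[OF G])
 have gen: "f -` {a<..} \<inter> (space N \<times> UNIV) \<in> sets S" if "f \<in> M" for f a
  unfolding sS by (rule sigma_sets.Basic) (use that in \<open>auto simp: G_def\<close>)
 have "fst -` B \<inter> space S \<in> sets S" if "B \<in> sets N" for B
 proof -
  have "B \<in> sigma_sets (space N) {f -` {a<..} \<inter> space N |f a. f \<in> \<A>}" using that A by blast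
  then show ?thesis
  proof (induction rule: sigma_sets.induct)
   case (Basic B)
   then obtain f a where B: "B = f -` {a<..} \<inter> space N" and f: "f \<in> \<A>" by blast
   have "(\<lambda>(n, y). f n * 1) \<in> M" by (rule M[OF f, of "\<lambda>_. 1"]) auto
   moreover have "fst -` B \<inter> space S = (\<lambda>(n, y). f n * 1) -` {a<..} \<inter> (space N \<times> UNIV)" unfolding B spS by auto
   ultimately show ?case using gen by simp
  next
   case Empty show ?case by simp
  next
   case (Compl B)
   have "fst -` (space N - B) \<inter> space S = space S - (fst -` B \<inter> space S)" unfolding spS by auto
   then show ?case using Compl.IH by auto
  next
   case (Union B)
   have "(\<Union>i. fst -` B i \<inter> space S) \<in> sets S" using Union.IH by (intro sets.countable_UN') auto
   moreover have "fst -` \<Union>(range B) \<inter> space S = (\<Union>i. fst -` B i \<inter> space S)" by blast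
   ultimately show ?case by (simp only:)
  qed
 qed
 then have fst: "fst \<in> measurable S N" by (intro measurableI) (auto simp: spS)
 have snd: "snd \<in> borel_measurable S"
 proof (rule borel_measurableI)
  fix U :: "'a set" assume U: "open U"
  show "snd -` U \<inter> space S \<in> sets S"
  \<comment> \<open>\<open>infdist\<close> to the empty set is 0 by convention, so the distance to
    the complement cannot detect the whole space.\<close>
  proof (cases "U = UNIV")
   case True then show ?thesis using sets.top[of S] by simp
  next
   case False
   define \<psi> where "\<psi> y = min 1 (infdist y (- U))" for y
   have c: "continuous_on UNIV \<psi>" unfolding \<psi>_def by (intro continuous_intros)
   have "(0 < \<psi> y) = (y \<in> U)" for y
   proof -
    have "(y \<in> closure (- U)) = (infdist y (- U) = 0)" using False by (intro in_closure_iff_infdist_zero) auto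
    moreover have "closure (- U) = - U" using U by (simp add: closed_Compl closure_closed)
    ultimately have "y \<in> U \<longleftrightarrow> infdist y (- U) \<noteq> 0" by blast
    then show ?thesis using infdist_nonneg[of y "- U"] unfolding \<psi>_def by (simp add: less_le[of 0])
   qed
   then have "snd -` U \<inter> space S = (\<lambda>(n, y). 1 * \<psi> y) -` {0<..} \<inter> (space N \<times> UNIV)" unfolding spS by auto
   moreover have "(\<lambda>(n, y). 1 * \<psi> y) \<in> M" by (rule M[OF one c]) (auto simp: \<psi>_def infdist_nonneg)
   ultimately show ?thesis using gen by simp
  qed
 qed
 have "(\<lambda>p. (fst p, snd p)) \<in> measurable S (N \<Otimes>\<^sub>M borel)" by (rule measurable_Pair[OF fst snd])
 then have id: "(\<lambda>p. p) \<in> measurable S (N \<Otimes>\<^sub>M borel)" by simp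
 have "B \<in> sets S" if "B \<in> sets (N \<Otimes>\<^sub>M borel)" for B
  using measurable_sets[OF id that] sets.sets_into_space[OF that] spS by (simp add: space_pair_measure Int_absorb2)
 then show ?thesis unfolding sS G_def by blast
qed

definition bdd_mble :: "'n measure \<Rightarrow> ('n \<Rightarrow> real) set" where
 "bdd_mble N = {f \<in> borel_measurable N. \<exists>C. \<forall>x\<in>space N. \<bar>f x\<bar> \<le> C}"

lemma bdd_mble_sets: "sets N \<subseteq> sigma_sets (space N) {f -` {a<..} \<inter> space N |f a. f \<in> bdd_mble N}"
proof
 fix B assume B: "B \<in> sets N"
 have "indicat_real B \<in> bdd_mble N" using B by (auto simp: bdd_mble_def indicator_def intro!: exI[of _ "1::real"])
 moreover have "B = indicat_real B -` {0<..} \<inter> space N"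
  using sets.sets_into_space[OF B] by (auto simp: indicator_def split: if_splits)
 ultimately show "B \<in> sigma_sets (space N) {f -` {a<..} \<inter> space N |f a. f \<in> bdd_mble N}"
  by (intro sigma_sets.Basic) blast
qed

lemma bdd_mble_mult: "f \<in> bdd_mble N \<Longrightarrow> g \<in> bdd_mble N \<Longrightarrow> (\<lambda>x. f x * g x) \<in> bdd_mble N" unfolding bdd_mble_def
proof safe
 fix C D assume "\<forall>x\<in>space N. \<bar>f x\<bar> \<le> C" "\<forall>x\<in>space N. \<bar>g x\<bar> \<le> D"
 then have "\<bar>f x * g x\<bar> \<le> C * D" if "x \<in> space N" for x
  unfolding abs_mult using that by (intro mult_mono) (auto intro: order_trans[OF abs_ge_zero])
 then show "\<exists>C. \<forall>x\<in>space N. \<bar>f x * g x\<bar> \<le> C" by blast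
qed auto

lemma weighted_integrable:
 assumes \<eta>: "\<eta> \<in> \<K>" and \<psi>: "\<psi> \<in> Cc" and h: "h \<in> borel_measurable borel" and C: "\<And>x. \<bar>h x\<bar> \<le> C"
 shows "integrable \<eta> (\<lambda>x. h x * \<psi> x)"
proof (rule Bochner_Integration.integrable_bound[where f = "\<lambda>x. C * \<psi> x"])
 show "integrable \<eta> (\<lambda>x. C * \<psi> x)" using Cc_integrable[OF _ \<psi>, of \<eta>] \<eta> discrete_radon_subset by auto
 show "(\<lambda>x. h x * \<psi> x) \<in> borel_measurable \<eta>"
  unfolding measurable_cong_sets[OF discrete_radonE(1)[OF \<eta>] refl] using h Cc_borel[OF \<psi>] by simp
 have "\<bar>h x\<bar> * \<bar>\<psi> x\<bar> \<le> \<bar>C\<bar> * \<bar>\<psi> x\<bar>" for x using C[of x] by (intro mult_right_mono) auto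
 then show "AE x in \<eta>. norm (h x * \<psi> x) \<le> norm (C * \<psi> x)" by (simp add: abs_mult)
qed

lemma slice_measurable: "f \<in> borel_measurable (N \<Otimes>\<^sub>M borel) \<Longrightarrow> n \<in> space N \<Longrightarrow> (\<lambda>y. f (n, y)) \<in> borel_measurable borel"
 by (rule measurable_compose[OF measurable_Pair1'])

text \<open>For a product integrand the parameter factors out, and what remains is the integral of a
  \<open>Cc\<close> function, measurable by the choice of \<open>Cc_sigma\<close>. The factor \<psi>
  keeps all integrals finite, since the measures themselves may be infinite.\<close>

theorem kernel_integral_measurable:
 fixes \<kappa> :: "'n \<Rightarrow> 'a::euclidean_space measure" and f :: "'n \<times> 'a \<Rightarrow> real"
 assumes \<kappa>: "\<kappa> \<in> measurable N Cc_sigma" and \<psi>: "\<psi> \<in> Cc"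
  and f: "f \<in> borel_measurable (N \<Otimes>\<^sub>M borel)" and bd: "\<And>p. p \<in> space N \<times> UNIV \<Longrightarrow> \<bar>f p\<bar> \<le> C"
 shows "(\<lambda>n. \<integral>y. f (n, y) * \<psi> y \<partial>\<kappa> n) \<in> borel_measurable N"
proof -
 have dr: "\<kappa> n \<in> \<K>" if "n \<in> space N" for n using measurable_space[OF \<kappa> that] by simp
 have \<kappa>f: "(\<lambda>n. \<integral>y. \<phi> y \<partial>\<kappa> n) \<in> borel_measurable N" if "\<phi> \<in> Cc" for \<phi>
  by (rule measurable_compose[OF \<kappa> Cc_sigma_integral_measurable[OF that]])
 define M where "M = {\<lambda>(n, y). a n * \<phi> y |a \<phi>. a \<in> bdd_mble N \<and> continuous_on UNIV \<phi> \<and> (\<forall>y::'a. 0 \<le> \<phi> y \<and> \<phi> y \<le> 1)}"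
 define P where "P f \<longleftrightarrow> f \<in> bdd_mble (N \<Otimes>\<^sub>M borel) \<and> (\<lambda>n. \<integral>y. f (n, y) * \<psi> y \<partial>\<kappa> n) \<in> borel_measurable N" for f
 have sp: "space (N \<Otimes>\<^sub>M borel) = space N \<times> UNIV" by (simp add: space_pair_measure)
 have int: "integrable (\<kappa> n) (\<lambda>y. f (n, y) * \<psi> y)" if f: "f \<in> bdd_mble (N \<Otimes>\<^sub>M borel)" and n: "n \<in> space N" for f n
 proof -
  obtain C where "\<And>y. \<bar>f (n, y)\<bar> \<le> C" using f n unfolding bdd_mble_def sp by blast
  then show ?thesis using f n by (intro weighted_integrable[OF dr[OF n] \<psi>] slice_measurable) (auto simp: bdd_mble_def)
 qed
 have "P f"
 proof (rule monotone_class_induct[where N = "N \<Otimes>\<^sub>M borel" and M = M and \<Omega> = "space N \<times> UNIV" and P = P])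
  show "sets (N \<Otimes>\<^sub>M borel) \<subseteq> sigma_sets (space N \<times> UNIV) {f -` {a<..} \<inter> space N \<times> UNIV |f a. f \<in> M}"
  proof (rule product_borel_generated[OF bdd_mble_sets])
   show "(\<lambda>_. 1) \<in> bdd_mble N" by (auto simp: bdd_mble_def)
   show "(\<lambda>(n, y). a n * \<phi> y) \<in> M" if "a \<in> bdd_mble N" "continuous_on UNIV \<phi>" "\<And>y. 0 \<le> \<phi> y \<and> \<phi> y \<le> 1" for a \<phi>
    unfolding M_def using that by blast
  qed
  show "(\<lambda>x. f x * g x) \<in> M" if f: "f \<in> M" and g: "g \<in> M" for f g
  proof -
   obtain a \<phi> where 1: "f = (\<lambda>(n, y). a n * \<phi> y)" "a \<in> bdd_mble N" "continuous_on UNIV \<phi>" "\<And>y. 0 \<le> \<phi> y \<and> \<phi> y \<le> 1"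
    using f unfolding M_def by blast
   obtain b \<theta> where 2: "g = (\<lambda>(n, y). b n * \<theta> y)" "b \<in> bdd_mble N" "continuous_on UNIV \<theta>" "\<And>y. 0 \<le> \<theta> y \<and> \<theta> y \<le> 1"
    using g unfolding M_def by blast
   have "(\<lambda>x. f x * g x) = (\<lambda>(n, y). (a n * b n) * (\<phi> y * \<theta> y))" unfolding 1 2 by (auto simp: fun_eq_iff)
   moreover have "0 \<le> \<phi> y * \<theta> y \<and> \<phi> y * \<theta> y \<le> 1" for y using 1(4)[of y] 2(4)[of y] by (simp add: mult_le_one)
   ultimately show ?thesis unfolding M_def using bdd_mble_mult[OF 1(2) 2(2)] continuous_on_mult[OF 1(3) 2(3)]
    by (intro CollectI exI[of _ "\<lambda>n. a n * b n"] exI[of _ "\<lambda>y. \<phi> y * \<theta> y"]) simp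
  qed
  show "\<exists>C. \<forall>x\<in>space N \<times> UNIV. \<bar>f x\<bar> \<le> C" if f: "f \<in> M" for f
  proof -
   obtain a \<phi> where 1: "f = (\<lambda>(n, y). a n * \<phi> y)" "a \<in> bdd_mble N" "\<And>y. 0 \<le> \<phi> y \<and> \<phi> y \<le> 1"
    using f unfolding M_def by blast
   obtain C where C: "\<And>n. n \<in> space N \<Longrightarrow> \<bar>a n\<bar> \<le> C" using 1(2) by (auto simp: bdd_mble_def)
   have "\<bar>a n * \<phi> y\<bar> \<le> C * 1" if "n \<in> space N" for n y
    unfolding abs_mult using C[OF that] 1(3)[of y] by (intro mult_mono) (auto intro: order_trans[OF abs_ge_zero])
   then show ?thesis unfolding 1(1) by (intro exI[of _ "C * 1"]) auto
  qed
  show "\<bar>f x\<bar> \<le> C" if "x \<in> space N \<times> UNIV" for x using bd that .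
  show "P (\<lambda>x. 1)" unfolding P_def using \<kappa>f[OF \<psi>] by (auto simp: bdd_mble_def)
  show "P f" if fM: "f \<in> M" for f
  proof -
   obtain a \<phi> where 1: "f = (\<lambda>(n, y). a n * \<phi> y)" "a \<in> bdd_mble N" "continuous_on UNIV \<phi>" "\<And>y. 0 \<le> \<phi> y \<and> \<phi> y \<le> 1"
    using fM unfolding M_def by blast
   obtain C where C: "\<And>n. n \<in> space N \<Longrightarrow> \<bar>a n\<bar> \<le> C" using 1(2) by (auto simp: bdd_mble_def)
   have am: "a \<in> borel_measurable N" using 1(2) by (simp add: bdd_mble_def)
   have "\<bar>a n * \<phi> y\<bar> \<le> C * 1" if "n \<in> space N" for n y
    unfolding abs_mult using C[OF that] 1(4)[of y] by (intro mult_mono) (auto intro: order_trans[OF abs_ge_zero])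
   moreover have "f \<in> borel_measurable (N \<Otimes>\<^sub>M borel)" unfolding 1(1)
    using am borel_measurable_continuous_onI[OF 1(3)] by measurable
   moreover have "(\<integral>y. f (n, y) * \<psi> y \<partial>\<kappa> n) = a n * (\<integral>y. \<psi> y * \<phi> y \<partial>\<kappa> n)" for n
   proof -
    have "(\<lambda>y. f (n, y) * \<psi> y) = (\<lambda>y. a n * (\<psi> y * \<phi> y))" unfolding 1(1) by (simp add: fun_eq_iff)
    then show ?thesis by (simp only: integral_mult_right_zero)
   qed
   moreover have "(\<lambda>n. a n * (\<integral>y. \<psi> y * \<phi> y \<partial>\<kappa> n)) \<in> borel_measurable N"
    using am \<kappa>f[OF Cc_mult[OF \<psi> 1(3)]] by measurable
   ultimately show ?thesis unfolding P_def bdd_mble_def sp by (auto simp: 1(1) intro!: exI[of _ "C * 1"])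
  qed
  show "P (\<lambda>x. a * f x + b * g x)" if "P f" "P g" for f g a b
  proof -
   have fb: "f \<in> bdd_mble (N \<Otimes>\<^sub>M borel)" and gb: "g \<in> bdd_mble (N \<Otimes>\<^sub>M borel)" using that by (auto simp: P_def)
   obtain C D where C: "\<And>p. p \<in> space N \<times> UNIV \<Longrightarrow> \<bar>f p\<bar> \<le> C" and D: "\<And>p. p \<in> space N \<times> UNIV \<Longrightarrow> \<bar>g p\<bar> \<le> D"
    using fb gb unfolding bdd_mble_def sp by blast
   have "\<bar>a * f p + b * g p\<bar> \<le> \<bar>a\<bar> * C + \<bar>b\<bar> * D" if p: "p \<in> space N \<times> UNIV" for p
   proof -
    have "\<bar>a * f p\<bar> \<le> \<bar>a\<bar> * C" "\<bar>b * g p\<bar> \<le> \<bar>b\<bar> * D"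
     unfolding abs_mult using C[OF p] D[OF p] by (auto intro: mult_left_mono)
    then show ?thesis by linarith
   qed
   moreover have "(\<lambda>x. a * f x + b * g x) \<in> borel_measurable (N \<Otimes>\<^sub>M borel)" using fb gb by (auto simp: bdd_mble_def)
   ultimately have m: "(\<lambda>x. a * f x + b * g x) \<in> bdd_mble (N \<Otimes>\<^sub>M borel)" unfolding bdd_mble_def sp by blast
   have "(\<integral>y. (a * f (n, y) + b * g (n, y)) * \<psi> y \<partial>\<kappa> n) = a * (\<integral>y. f (n, y) * \<psi> y \<partial>\<kappa> n) + b * (\<integral>y. g (n, y) * \<psi> y \<partial>\<kappa> n)"
    if n: "n \<in> space N" for n
   proof -
    have "(\<integral>y. (a * f (n, y) + b * g (n, y)) * \<psi> y \<partial>\<kappa> n) = (\<integral>y. a * (f (n, y) * \<psi> y) + b * (g (n, y) * \<psi> y) \<partial>\<kappa> n)"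
     by (simp add: algebra_simps)
    then show ?thesis using int[OF fb n] int[OF gb n] by simp
   qed
   moreover have "(\<lambda>n. a * (\<integral>y. f (n, y) * \<psi> y \<partial>\<kappa> n) + b * (\<integral>y. g (n, y) * \<psi> y \<partial>\<kappa> n)) \<in> borel_measurable N"
    using that unfolding P_def by auto
   ultimately have "(\<lambda>n. \<integral>y. (a * f (n, y) + b * g (n, y)) * \<psi> y \<partial>\<kappa> n) \<in> borel_measurable N"
    by (subst measurable_cong) auto
   then show ?thesis using m unfolding P_def by blast
  qed
  show "P f" if Pn: "\<And>n. P (fn n)" and C: "\<And>n x. x \<in> space N \<times> UNIV \<Longrightarrow> \<bar>fn n x\<bar> \<le> C"
   and lim: "\<And>x. x \<in> space N \<times> UNIV \<Longrightarrow> (\<lambda>n. fn n x) \<longlonglongrightarrow> f x" for fn f C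
  proof -
   have fm: "fn n \<in> borel_measurable (N \<Otimes>\<^sub>M borel)" for n using Pn[of n] by (simp add: P_def bdd_mble_def)
   have m: "f \<in> borel_measurable (N \<Otimes>\<^sub>M borel)"
    by (rule borel_measurable_LIMSEQ_real[of _ fn]) (use lim sp fm in auto)
   have "\<bar>f p\<bar> \<le> C" if p: "p \<in> space N \<times> UNIV" for p
    by (rule LIMSEQ_le_const2[OF tendsto_rabs[OF lim[OF p]]]) (use C[OF p] in auto)
   then have fb: "f \<in> bdd_mble (N \<Otimes>\<^sub>M borel)" unfolding bdd_mble_def sp using m by blast
   have "(\<lambda>n. \<integral>y. f (n, y) * \<psi> y \<partial>\<kappa> n) \<in> borel_measurable N"
   proof (rule borel_measurable_LIMSEQ_real)
    show "(\<lambda>n. \<integral>y. fn i (n, y) * \<psi> y \<partial>\<kappa> n) \<in> borel_measurable N" for i using Pn[of i] by (simp add: P_def)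
    fix n assume n: "n \<in> space N"
    show "(\<lambda>i. \<integral>y. fn i (n, y) * \<psi> y \<partial>\<kappa> n) \<longlonglongrightarrow> (\<integral>y. f (n, y) * \<psi> y \<partial>\<kappa> n)"
    proof (rule integral_dominated_convergence[where w = "\<lambda>y. \<bar>C\<bar> * \<bar>\<psi> y\<bar>"])
     show "(\<lambda>y. f (n, y) * \<psi> y) \<in> borel_measurable (\<kappa> n)" using int[OF fb n] by auto
     show "(\<lambda>y. fn i (n, y) * \<psi> y) \<in> borel_measurable (\<kappa> n)" for i using int[of "fn i", OF _ n] Pn[of i] by (auto simp: P_def)
     show "integrable (\<kappa> n) (\<lambda>y. \<bar>C\<bar> * \<bar>\<psi> y\<bar>)"
      using Cc_integrable[OF _ \<psi>, of "\<kappa> n"] dr[OF n] discrete_radon_subset by auto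
     show "AE y in \<kappa> n. (\<lambda>i. fn i (n, y) * \<psi> y) \<longlonglongrightarrow> f (n, y) * \<psi> y"
      by (rule AE_I2, intro tendsto_intros lim) (use n in auto)
     have "\<bar>fn i (n, y)\<bar> \<le> \<bar>C\<bar>" for i y using C[of "(n, y)" i] n by auto
     then have "norm (fn i (n, y) * \<psi> y) \<le> \<bar>C\<bar> * \<bar>\<psi> y\<bar>" for i y by (simp add: abs_mult mult_right_mono)
     then show "AE y in \<kappa> n. norm (fn i (n, y) * \<psi> y) \<le> \<bar>C\<bar> * \<bar>\<psi> y\<bar>" for i by simp
    qed
   qed
   then show ?thesis using fb unfolding P_def by blast
  qed
 qed (use f sp in auto)
 then show ?thesis by (simp add: P_def)
qed

text \<open>The weight at \<open>x\<close> is a limit of kernel integrals of the indicator of the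
  diagonal times a cutoff, with the pair \<open>(\<eta>, x)\<close> as parameter.\<close>

theorem wt_measurable: "(\<lambda>p. wt (fst p) (snd p)) \<in> borel_measurable (Cc_sigma \<Otimes>\<^sub>M (borel :: 'a::euclidean_space measure))"
proof (rule borel_measurable_LIMSEQ_real)
 let ?N = "Cc_sigma \<Otimes>\<^sub>M (borel :: 'a measure)"
 show "(\<lambda>p. \<integral>y. indicat_real {q. snd (fst q) = snd q} (p, y) * cutoff (real i) y \<partial>fst p) \<in> borel_measurable ?N" for i
 proof (rule kernel_integral_measurable[OF _ cutoff(1), where C = 1])
  have "{q \<in> space (?N \<Otimes>\<^sub>M (borel :: 'a measure)). dist (snd (fst q)) (snd q) = 0} \<in> sets (?N \<Otimes>\<^sub>M borel)"
   by measurable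
  then have "indicat_real {q \<in> space (?N \<Otimes>\<^sub>M (borel :: 'a measure)). dist (snd (fst q)) (snd q) = 0} \<in> borel_measurable (?N \<Otimes>\<^sub>M borel)"
   by (rule borel_measurable_indicator)
  then show "indicat_real {q. snd (fst q) = snd q} \<in> borel_measurable (?N \<Otimes>\<^sub>M (borel :: 'a measure))"
   by (rule measurable_cong[THEN iffD1, rotated]) (auto simp: indicator_def)
 qed (auto simp: indicator_def)
 fix p :: "'a measure \<times> 'a" assume p: "p \<in> space ?N"
 then have \<eta>: "fst p \<in> \<K>" by (auto simp: space_pair_measure)
 have "(\<integral>y. indicat_real {q. snd (fst q) = snd q} (p, y) * cutoff (real i) y \<partial>fst p) = wt (fst p) (snd p) * cutoff (real i) (snd p)" for i
  using integral_finite_support(2)[OF \<eta>, of "{snd p}" "\<lambda>y. indicat_real {q. snd (fst q) = snd q} (p, y) * cutoff (real i) y"]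
  by (auto simp: indicator_def)
 moreover have "(\<lambda>i. wt (fst p) (snd p) * cutoff (real i) (snd p)) \<longlonglongrightarrow> wt (fst p) (snd p) * 1"
  by (intro tendsto_intros cutoff_tendsto)
 ultimately show "(\<lambda>i. \<integral>y. indicat_real {q. snd (fst q) = snd q} (p, y) * cutoff (real i) y \<partial>fst p) \<longlonglongrightarrow> wt (fst p) (snd p)"
  by simp
qed

lemma marks_measurable [measurable]:
 "(\<lambda>p. (snd p, wt (fst p) (snd p))) \<in> measurable (Cc_sigma \<Otimes>\<^sub>M (borel :: 'a::euclidean_space measure)) borel"
 using wt_measurable by (subst borel_prod[symmetric]) measurable

text \<open>By \<open>pairing_integral\<close> the pairing is a kernel integral of \<phi> divided by
  the weight; this quotient is bounded because the marks in the support are at least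
  \<open>a\<close>.\<close>

theorem pairing_measurable:
 fixes \<phi> :: "'a::euclidean_space \<times> real \<Rightarrow> real"
 assumes \<phi>: "\<phi> \<in> borel_measurable borel" and bs: "bdd_supp \<phi>" and C: "\<And>p. \<bar>\<phi> p\<bar> \<le> C"
 shows "pairing \<phi> \<in> borel_measurable Cc_sigma"
proof -
 obtain A a where A: "bounded A" "0 < a" "\<And>p. \<phi> p \<noteq> 0 \<Longrightarrow> fst p \<in> A \<and> a \<le> snd p" using bs unfolding bdd_supp_def by blast
 obtain R where R: "\<And>x. x \<in> A \<Longrightarrow> norm x \<le> R" using A(1) by (auto simp: bounded_iff)
 define f where "f p = \<phi> (snd p, wt (fst p) (snd p)) / wt (fst p) (snd p)" for p :: "'a measure \<times> 'a"
 have "(\<lambda>\<eta>. \<integral>y. f (\<eta>, y) * cutoff R y \<partial>\<eta>) \<in> borel_measurable Cc_sigma"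
 proof (rule kernel_integral_measurable[OF _ cutoff(1), where C = "C / a"])
  show "f \<in> borel_measurable (Cc_sigma \<Otimes>\<^sub>M borel)" unfolding f_def[abs_def]
   using wt_measurable measurable_compose[OF marks_measurable \<phi>] by measurable
  show "\<bar>f p\<bar> \<le> C / a" for p
  proof (cases "\<phi> (snd p, wt (fst p) (snd p)) = 0")
   case True
   then show ?thesis using C[of undefined] A(2) by (simp add: f_def)
  next
   case False
   then have "a \<le> wt (fst p) (snd p)" using A(3) by fastforce
   then show ?thesis unfolding f_def abs_divide using A(2) C order_trans[OF abs_ge_zero C] by (intro frac_le) auto
  qed
 qed simp
 moreover have "pairing \<phi> \<eta> = (\<integral>y. f (\<eta>, y) * cutoff R y \<partial>\<eta>)" if "\<eta> \<in> space Cc_sigma" for \<eta>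
 proof -
  have \<eta>: "\<eta> \<in> \<K>" using that by simp
  have "f (\<eta>, y) * cutoff R y = \<phi> (y, wt \<eta> y) / wt \<eta> y" for y
   using A(3)[of "(y, wt \<eta> y)"] R[of y] by (cases "\<phi> (y, wt \<eta> y) = 0") (auto simp: f_def cutoff(4))
  then show ?thesis unfolding pairing_integral[OF \<eta> bs] by simp
 qed
 ultimately show ?thesis by (subst measurable_cong) auto
qed

lemma test_pairing_measurable: "\<phi> \<in> test_functions \<Longrightarrow> pairing \<phi> \<in> borel_measurable Cc_sigma"
 using pairing_measurable[OF test_measurable test_bdd_supp] test_bounded by metis

lemma FC_measurable:
 assumes F: "F \<in> FC" shows "F \<in> borel_measurable Cc_sigma"
proof -
 obtain N g \<phi> where F: "FC_repr N g \<phi> F" by (rule FC_E[OF F])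
 have "(\<lambda>\<eta>. g (\<lambda>i. pairing (\<phi> i) \<eta>)) \<in> borel_measurable Cc_sigma"
  using FC_reprD(3)[OF F] by (intro Cb_smooth_measurable[OF FC_reprD(2)[OF F]] test_pairing_measurable) auto
 then show ?thesis by (rule measurable_cong[THEN iffD1, rotated]) (use FC_reprD(4)[OF F] in auto)
qed

lemma FC_bounded:
 assumes F: "F \<in> FC" obtains C where "\<And>\<eta>. \<eta> \<in> \<K> \<Longrightarrow> \<bar>F \<eta>\<bar> \<le> C" "0 \<le> C"
proof -
 obtain N g \<phi> where F: "FC_repr N g \<phi> F" by (rule FC_E[OF F])
 obtain C where C: "\<And>v. \<bar>g v\<bar> \<le> C" using Cb_smooth_bounded[OF FC_reprD(2)[OF F]] by blast
 show ?thesis by (rule that[of C]) (use C FC_reprD(4)[OF F] order_trans[OF abs_ge_zero C] in auto)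
qed


section \<open>Density of the cylinder functions\<close>

lemma borel_measurable_fst: "fst \<in> borel_measurable (borel :: ('a::topological_space \<times> 'b::topological_space) measure)"
 and borel_measurable_snd: "snd \<in> borel_measurable (borel :: ('a \<times> 'b) measure)"
 by (intro borel_measurable_continuous_onI continuous_on_fst continuous_on_snd continuous_on_id)+

lemma test_bounded_ex: "\<phi> \<in> test_functions \<Longrightarrow> \<exists>C. \<forall>p. \<bar>\<phi> p\<bar> \<le> C" by (erule test_bounded) blast

lemma FC_bounded_ex: "F \<in> FC \<Longrightarrow> \<exists>C. \<forall>\<eta>\<in>\<K>. \<bar>F \<eta>\<bar> \<le> C" by (erule FC_bounded) blast

lemma logistic_less_iff: "logistic s < logistic t \<longleftrightarrow> s < t"
proof -
 have p: "0 < 1 + exp (- s)" "0 < 1 + exp (- t)" by (simp_all add: add_pos_pos)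
 then show ?thesis unfolding logistic_def by (simp add: divide_less_cancel field_simps)
qed

lemma Cb_smooth_logistic_coord: "(\<lambda>v. logistic (v 0)) \<in> Cb_smooth 1" unfolding Cb_smooth_iff
proof (rule cb.smooth_coinduct[of "{\<lambda>v. logistic (v 0)}"])
 let ?S = "{\<lambda>v::nat \<Rightarrow> real. logistic (v 0)}"
 show "(\<lambda>v. logistic (v 0)) \<in> cb.alg ?S" by (rule cb.alg.base) simp
 have d: "((\<lambda>t. logistic ((v(0 := t)) 0)) has_real_derivative logistic (v 0) * (1 - logistic (v 0))) (at (v 0))" for v :: "nat \<Rightarrow> real"
  using logistic_deriv by simp
 fix f assume "f \<in> ?S"
 then have f: "f = (\<lambda>v. logistic (v 0))" by simp
 show "cb_ok 1 f \<and> (\<forall>i\<in>{..<1}. coord_deriv i f \<in> cb.alg ?S)"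
 proof
  show "cb_ok 1 f" unfolding cb_ok_def f
  proof (intro conjI allI impI)
   have "continuous_on UNIV logistic" using logistic_deriv DERIV_isCont continuous_at_imp_continuous_on by blast
   then show "continuous_on UNIV (\<lambda>v::nat \<Rightarrow> real. logistic (v 0))" by (rule continuous_on_compose2) auto
   have "\<bar>logistic t\<bar> \<le> 1" for t using logistic_bounds[of t] by simp
   then show "bounded (range (\<lambda>v::nat \<Rightarrow> real. logistic (v 0)))" unfolding bounded_range_iff by blast
   show "(\<lambda>t. logistic ((v(i := t)) 0)) differentiable (at (v i))" if "i < 1" for i and v :: "nat \<Rightarrow> real"
    using d[of v] that real_differentiable_def by auto
  qed simp
  have "coord_deriv 0 f = (\<lambda>v. logistic (v 0) * (1 + (-1) * logistic (v 0)))"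
   unfolding f by (rule ext, subst coord_derivI[OF d]) simp
  moreover have "(\<lambda>v. logistic (v 0) * (1 + (-1) * logistic (v 0))) \<in> cb.alg ?S"
   by (intro cb.alg.mult cb.alg.add cb.alg.const cb.alg.base) auto
  ultimately show "\<forall>i\<in>{..<1}. coord_deriv i f \<in> cb.alg ?S" by simp
 qed
qed

text \<open>The pairing itself may be unbounded and so need not lie in \<open>FC\<close>; its
  strictly increasing bounded image has the same superlevel sets.\<close>

lemma FC_logistic_pairing:
 assumes "\<phi> \<in> test_functions" shows "(\<lambda>\<eta>. logistic (pairing \<phi> \<eta>)) \<in> FC"
proof -
 have "FC_repr 1 (\<lambda>v. logistic (v 0)) (\<lambda>_. \<phi>) (\<lambda>\<eta>. logistic (pairing \<phi> \<eta>))"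
  unfolding FC_repr_def using assms Cb_smooth_logistic_coord by simp
 then show ?thesis unfolding FC_def by blast
qed

lemma FC_const: "(\<lambda>\<eta>::'a::euclidean_space measure. c) \<in> FC"
proof -
 have "FC_repr 1 (\<lambda>v. c) (\<lambda>_ _. 0) (\<lambda>\<eta>::'a measure. c)"
 proof -
  have "compact ({} :: 'a set) \<and> 0 < (1::real) \<and> 1 < (2::real) \<and> (\<forall>p::'a \<times> real. p \<notin> {} \<times> {1..2} \<longrightarrow> (0::real) = 0)"
   by simp
  then have "(\<lambda>_::'a \<times> real. 0) \<in> test_functions" unfolding test_functions_iff using sm.smooth_const by blast
  then show ?thesis unfolding FC_repr_def using Cb_smooth_const by simp
 qed
 then show ?thesis unfolding FC_def by blast
qed

text \<open>A common support \<theta> reduces all pairings to sums over one finite set of atoms, on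
  which pointwise convergence suffices.\<close>

lemma pairing_limit:
 assumes \<eta>: "\<eta> \<in> \<K>" and \<theta>: "bdd_supp \<theta>" and sub: "\<And>n p. \<phi>n n p \<noteq> 0 \<Longrightarrow> \<theta> p \<noteq> (0::real)"
  and lim: "\<And>p. (\<lambda>n. \<phi>n n p) \<longlonglongrightarrow> \<phi> p"
 shows "(\<lambda>n. pairing (\<phi>n n) \<eta>) \<longlonglongrightarrow> pairing \<phi> \<eta>"
proof -
 let ?T = "{x. \<theta> (x, wt \<eta> x) \<noteq> 0}"
 have T: "finite ?T" by (rule finite_supp[OF \<eta> \<theta>])
 have sub': "\<theta> p \<noteq> 0" if "\<phi> p \<noteq> 0" for p
 proof (rule ccontr)
  assume "\<not> \<theta> p \<noteq> 0"
  then have "\<phi>n n p = 0" for n using sub[of n p] by blast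
  then have "(\<lambda>n. \<phi>n n p) \<longlonglongrightarrow> 0" by simp
  then show False using LIMSEQ_unique[OF lim[of p]] that by blast
 qed
 have "pairing (\<phi>n n) \<eta> = (\<Sum>x\<in>?T. \<phi>n n (x, wt \<eta> x))" for n
  by (rule pairing_eq_sum[OF \<eta> bdd_supp_mono[OF \<theta>] T]) (use sub in auto)
 moreover have "pairing \<phi> \<eta> = (\<Sum>x\<in>?T. \<phi> (x, wt \<eta> x))"
  by (rule pairing_eq_sum[OF \<eta> bdd_supp_mono[OF \<theta>] T]) (use sub' in auto)
 moreover have "(\<lambda>n. \<Sum>x\<in>?T. \<phi>n n (x, wt \<eta> x)) \<longlonglongrightarrow> (\<Sum>x\<in>?T. \<phi> (x, wt \<eta> x))" by (intro tendsto_sum lim)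
 ultimately show ?thesis by simp
qed

lemma pairing_lin:
 assumes \<eta>: "\<eta> \<in> \<K>" and \<phi>: "bdd_supp \<phi>" and \<psi>: "bdd_supp \<psi>"
 shows "pairing (\<lambda>p. a * \<phi> p + b * \<psi> p) \<eta> = a * pairing \<phi> \<eta> + b * pairing \<psi> \<eta>"
proof -
 let ?T = "{x. \<phi> (x, wt \<eta> x) \<noteq> 0} \<union> {x. \<psi> (x, wt \<eta> x) \<noteq> 0}"
 have T: "finite ?T" using finite_supp[OF \<eta> \<phi>] finite_supp[OF \<eta> \<psi>] by simp
 obtain A c where A: "bounded A" "0 < c" "\<And>p. \<phi> p \<noteq> 0 \<Longrightarrow> fst p \<in> A \<and> c \<le> snd p" using \<phi> unfolding bdd_supp_def by blast
 obtain A' c' where A': "bounded A'" "0 < c'" "\<And>p. \<psi> p \<noteq> 0 \<Longrightarrow> fst p \<in> A' \<and> c' \<le> snd p"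
  using \<psi> unfolding bdd_supp_def by blast
 have "fst p \<in> A \<union> A' \<and> min c c' \<le> snd p" if "a * \<phi> p + b * \<psi> p \<noteq> 0" for p
 proof -
  have "\<phi> p \<noteq> 0 \<or> \<psi> p \<noteq> 0" using that by auto
  then show ?thesis using A(3)[of p] A'(3)[of p] by auto
 qed
 then have s: "bdd_supp (\<lambda>p. a * \<phi> p + b * \<psi> p)" unfolding bdd_supp_def
  using A(1,2) A'(1,2) by (intro exI[of _ "A \<union> A'"] exI[of _ "min c c'"]) auto
 have "{x. a * \<phi> (x, wt \<eta> x) + b * \<psi> (x, wt \<eta> x) \<noteq> 0} \<subseteq> ?T" by auto
 from pairing_eq_sum[OF \<eta> s T this] show ?thesis using pairing_eq_sum[OF \<eta> \<phi> T] pairing_eq_sum[OF \<eta> \<psi> T]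
  by (simp add: sum.distrib sum_distrib_left)
qed

text \<open>Open boxes with marks bounded away from 0 are positivity sets of bumps. Rational boxes
  exhaust every open set with marks above \<open>e\<close>, and finally \<open>e\<close> tends to 0
  along a sequence.\<close>

lemma test_functions_generate: "sets (restrict_space borel (UNIV \<times> {0<..})) \<subseteq>
  sigma_sets (UNIV \<times> {0<..}) {\<psi> -` {a<..} \<inter> (UNIV \<times> {0<..}) |\<psi> a. \<psi> \<in> (test_functions :: ('a::euclidean_space \<times> real \<Rightarrow> real) set)}"
  (is "_ \<subseteq> sigma_sets ?\<Omega> ?G")
proof -
 define S where "S = sigma ?\<Omega> ?G"
 have sS: "sets S = sigma_sets ?\<Omega> ?G" unfolding S_def by (rule sets_measure_of) auto
 have spS: "space S = ?\<Omega>" unfolding S_def by (rule space_measure_of) auto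
 have bx: "box l u \<in> sets S" if sub: "box l u \<subseteq> UNIV \<times> {e<..}" and e: "0 < e" for l u :: "'a \<times> real" and e :: real
 proof (cases "box l u = {}")
  case True then show ?thesis by simp
 next
  case False
  then obtain p where p: "p \<in> box l u" by blast
  have sb: "(0, 1) \<in> (Basis :: ('a \<times> real) set)" by (simp add: Basis_prod_def)
  have ps: "snd l < snd p" "snd p < snd u" using p sb unfolding box_def by (cases l, cases p, cases u, force)+
  have "e \<le> snd l"
  proof (rule ccontr)
   assume n: "\<not> e \<le> snd l"
   \<comment> \<open>A mark strictly between the lower face and both \<open>e\<close> and the mark
     of \<open>p\<close>: it would produce a point of the box with mark below
     \<open>e\<close>.\<close>
   define s where "s = (snd l + min e (snd p)) / 2"
   have s: "snd l < s" "s < e" "s < snd p" using n ps by (auto simp: s_def)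
   have "(fst p, s) \<in> box l u"
    using p s ps unfolding box_def by (cases l, cases p, cases u) (auto simp: Basis_prod_def)
   then show False using sub s by auto
  qed
  then have "box_bump 1 l u \<in> test_functions" using e ps by (intro box_bump_test) auto
  then have "box_bump 1 l u -` {0<..} \<inter> ?\<Omega> \<in> sets S" unfolding sS by (intro sigma_sets.Basic) blast
  moreover have "box_bump 1 l u -` {0<..} \<inter> ?\<Omega> = box l u" using sub e box_bump_pos[of 1 l u] by force
  ultimately show ?thesis by simp
 qed
 have op: "U \<in> sets S" if U: "open U" and sub: "U \<subseteq> UNIV \<times> {e<..}" and e: "0 < e" for U :: "('a \<times> real) set" and e :: real
 proof -
  define I where "I = {f\<in>Basis \<rightarrow>\<^sub>E \<rat> \<times> \<rat>. box (\<Sum>i\<in>Basis. fst (f i) *\<^sub>R i) (\<Sum>i\<in>Basis. snd (f i) *\<^sub>R i) \<subseteq> U}"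
  have eq: "U = (\<Union>f\<in>I. box (\<Sum>i\<in>Basis. fst (f i) *\<^sub>R i) (\<Sum>i\<in>Basis. snd (f i) *\<^sub>R i))"
   unfolding I_def by (rule open_UNION_box[OF U])
  have "countable I" unfolding I_def by (simp add: countable_PiE countable_rat countable_Collect)
  moreover have "box (\<Sum>i\<in>Basis. fst (f i) *\<^sub>R i) (\<Sum>i\<in>Basis. snd (f i) *\<^sub>R i) \<in> sets S" if "f \<in> I" for f
   by (rule bx[OF _ e]) (use that sub in \<open>auto simp: I_def\<close>)
  ultimately show ?thesis by (subst eq) (rule sets.countable_UN'; auto)
 qed
 have id: "(\<lambda>p. p) \<in> borel_measurable S"
 proof (rule borel_measurableI)
  fix U :: "('a \<times> real) set" assume U: "open U"
  have "U \<inter> (UNIV \<times> {1 / real (Suc n)<..}) \<in> sets S" for n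
   by (rule op[of _ "1 / real (Suc n)"]) (use U in \<open>auto intro!: open_Int open_Times\<close>)
  then have "(\<Union>n. U \<inter> (UNIV \<times> {1 / real (Suc n)<..})) \<in> sets S" by (intro sets.countable_UN) auto
  moreover have "(\<lambda>p. p) -` U \<inter> space S = (\<Union>n. U \<inter> (UNIV \<times> {1 / real (Suc n)<..}))"
  proof -
   have "\<exists>n. 1 / real (Suc n) < s" if "0 < s" for s :: real
    using reals_Archimedean[OF that] by (simp add: inverse_eq_divide)
   moreover have "0 < s" if "1 / real (Suc n) < s" for s n using less_trans[OF _ that, of 0] by simp
   ultimately show ?thesis unfolding spS by fastforce
  qed
  ultimately show "(\<lambda>p. p) -` U \<inter> space S \<in> sets S" by simp
 qed
 have "U \<inter> ?\<Omega> \<in> sets S" if "U \<in> sets borel" for U :: "('a \<times> real) set"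
  using measurable_sets[OF id that] by (simp add: spS)
 then show ?thesis unfolding sS[symmetric] sets_restrict_space by (auto simp: Int_commute)
qed

lemma AE_atoms:
 fixes \<eta> :: "'a::euclidean_space measure"
 assumes \<eta>: "\<eta> \<in> \<K>" shows "AE x in \<eta>. 0 < wt \<eta> x"
proof (rule AE_I')
 have c: "atoms \<eta> \<in> sets borel" using discrete_radonE(3)[OF \<eta>] by (rule sets.countable[rotated]) auto
 then have "emeasure \<eta> (- atoms \<eta>) = (\<integral>\<^sup>+x. ennreal (wt \<eta> x) * indicator (- atoms \<eta>) x \<partial>count_space UNIV)"
  by (intro discrete_radonE(7)[OF \<eta>]) auto
 also have "\<dots> = (\<integral>\<^sup>+x. 0 \<partial>count_space (UNIV :: 'a set))"
  by (rule nn_integral_cong) (use wt_nonatom[OF \<eta>] in \<open>auto simp: indicator_def\<close>)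
 finally show "- atoms \<eta> \<in> null_sets \<eta>" using c discrete_radonE(1)[OF \<eta>] by (auto simp: null_sets_def)
 show "{x \<in> space \<eta>. \<not> 0 < wt \<eta> x} \<subseteq> - atoms \<eta>" using atoms_iff[OF \<eta>] by auto
qed

text \<open>Pairings with test functions are recovered from their logistic images, pairings with
  bounded Borel functions cut off to a box follow by the monotone class theorem, and integrals of
  \<open>Cc\<close> functions are limits of pairings with \<open>f (x) * s\<close>. So the identity
  is measurable from the generated \<sigma>-algebra to \<open>Cc_sigma\<close>.\<close>

theorem FC_generates: "sets (Cc_sigma :: 'a::euclidean_space measure measure) \<subseteq>
  sigma_sets \<K> {F -` {a<..} \<inter> \<K> |F a. F \<in> FC}"
  (is "_ \<subseteq> sigma_sets _ ?G")
proof -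
 define S where "S = sigma \<K> ?G"
 have sS: "sets S = sigma_sets \<K> ?G" unfolding S_def by (rule sets_measure_of) auto
 have spS: "space S = \<K>" unfolding S_def by (rule space_measure_of) auto
 have test: "pairing \<phi> \<in> borel_measurable S" if \<phi>: "\<phi> \<in> test_functions" for \<phi> :: "'a \<times> real \<Rightarrow> real"
  unfolding borel_measurable_iff_greater
 proof
  fix a
  have "(\<lambda>\<eta>. logistic (pairing \<phi> \<eta>)) -` {logistic a<..} \<inter> \<K> \<in> sets S"
   unfolding sS using FC_logistic_pairing[OF \<phi>] by (intro sigma_sets.Basic) blast
  moreover have "(\<lambda>\<eta>. logistic (pairing \<phi> \<eta>)) -` {logistic a<..} \<inter> \<K> = {\<eta> \<in> space S. a < pairing \<phi> \<eta>}"
   by (auto simp: spS logistic_less_iff)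
  ultimately show "{\<eta> \<in> space S. a < pairing \<phi> \<eta>} \<in> sets S" by simp
 qed
 \<comment> \<open>The indicator of the box gives all functions of the monotone class argument one
   common support, which pointwise limits of pairings require.\<close>
 have box: "pairing (\<lambda>p. indicat_real (box l u) p * \<psi> p) \<in> borel_measurable S"
  if l: "0 < snd l" "snd l < snd u" and \<psi>: "\<psi> \<in> borel_measurable borel" and C: "\<And>p. 0 < snd p \<Longrightarrow> \<bar>\<psi> p\<bar> \<le> C"
  for l u :: "'a \<times> real" and \<psi> C
 proof -
  let ?I = "indicat_real (box l u)"
  define \<theta> where "\<theta> = box_bump 1 l u"
  have \<theta>: "bdd_supp \<theta>" unfolding \<theta>_def by (intro test_bdd_supp box_bump_test l) simp
  have I0: "?I p \<noteq> 0 \<Longrightarrow> \<theta> p \<noteq> 0" for p unfolding \<theta>_def using box_bump_pos[of 1 l u p] by (auto simp: indicator_def split: if_splits)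
  have b0: "box_bump (real (Suc n)) l u p \<noteq> 0 \<Longrightarrow> \<theta> p \<noteq> 0" for n p
   using box_bump_pos[of 1 l u p] box_bump_pos[of "real (Suc n)" l u p] box_bump_bounds(1)[of "real (Suc n)" l u p]
   unfolding \<theta>_def by (metis le_less less_irrefl of_nat_0_less_iff zero_less_Suc zero_less_one)
  have start: "pairing (\<lambda>p. ?I p * \<psi> p) \<in> borel_measurable S" if "\<And>n. (\<lambda>p. box_bump (real (Suc n)) l u p * \<psi> p) \<in> test_functions" for \<psi>
  proof (rule borel_measurable_LIMSEQ_real)
   show "pairing (\<lambda>p. box_bump (real (Suc n)) l u p * \<psi> p) \<in> borel_measurable S" for n by (rule test[OF that])
   show "(\<lambda>n. pairing (\<lambda>p. box_bump (real (Suc n)) l u p * \<psi> p) \<eta>) \<longlonglongrightarrow> pairing (\<lambda>p. ?I p * \<psi> p) \<eta>"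
    if "\<eta> \<in> space S" for \<eta>
   proof (rule pairing_limit[OF _ \<theta>])
    show "\<eta> \<in> \<K>" using that spS by simp
    show "\<theta> p \<noteq> 0" if "box_bump (real (Suc n)) l u p * \<psi> p \<noteq> 0" for n p using b0[of n p] that by auto
    show "(\<lambda>n. box_bump (real (Suc n)) l u p * \<psi> p) \<longlonglongrightarrow> ?I p * \<psi> p" for p
     by (intro tendsto_mult box_bump_limit tendsto_const)
   qed
  qed
  have bt: "box_bump (real (Suc n)) l u \<in> test_functions" for n by (rule box_bump_test[OF _ l]) simp
  show ?thesis
  proof (rule monotone_class_induct[where N = "restrict_space borel (UNIV \<times> {0<..})" and M = test_functions
     and \<Omega> = "UNIV \<times> {0<..}" and P = "\<lambda>\<psi>. pairing (\<lambda>p. ?I p * \<psi> p) \<in> borel_measurable S"])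
   show "(\<lambda>x. f x * g x) \<in> test_functions" if "f \<in> test_functions" "g \<in> test_functions" for f g :: "'a \<times> real \<Rightarrow> real"
    by (rule test_mult[OF that])
   show "\<exists>C. \<forall>x\<in>UNIV \<times> {0<..}. \<bar>f x\<bar> \<le> C" if "f \<in> test_functions" for f :: "'a \<times> real \<Rightarrow> real"
    using test_bounded_ex[OF that] by blast
   show "sets (restrict_space borel (UNIV \<times> {0<..})) \<subseteq> sigma_sets (UNIV \<times> {0<..}) {f -` {a<..} \<inter> (UNIV \<times> {0<..}) |f a. f \<in> (test_functions :: ('a \<times> real \<Rightarrow> real) set)}"
    by (rule test_functions_generate)
   show "\<psi> \<in> borel_measurable (restrict_space borel (UNIV \<times> {0<..}))" using \<psi> by (rule measurable_restrict_space1)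
   show "\<bar>\<psi> p\<bar> \<le> C" if "p \<in> UNIV \<times> {0<..}" for p using C that by auto
   show "space (restrict_space borel (UNIV \<times> {0<..})) = (UNIV \<times> {0<..} :: ('a \<times> real) set)"
    by (simp add: space_restrict_space)
   show "pairing (\<lambda>p. ?I p * 1) \<in> borel_measurable S" by (rule start) (use bt in simp)
   show "pairing (\<lambda>p. ?I p * f p) \<in> borel_measurable S" if "f \<in> test_functions" for f
    by (rule start, rule test_mult[OF bt that])
   show "pairing (\<lambda>p. ?I p * (a * f p + b * g p)) \<in> borel_measurable S"
    if "pairing (\<lambda>p. ?I p * f p) \<in> borel_measurable S" "pairing (\<lambda>p. ?I p * g p) \<in> borel_measurable S" for f g a b
   proof -
    have "pairing (\<lambda>p. ?I p * (a * f p + b * g p)) \<eta> = a * pairing (\<lambda>p. ?I p * f p) \<eta> + b * pairing (\<lambda>p. ?I p * g p) \<eta>"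
     if "\<eta> \<in> space S" for \<eta>
    proof -
     have "bdd_supp (\<lambda>p. ?I p * f p)" "bdd_supp (\<lambda>p. ?I p * g p)" by (rule bdd_supp_mono[OF \<theta>]; use I0 in force)+
     from pairing_lin[OF _ this, of \<eta> a b] show ?thesis using that spS by (simp add: algebra_simps)
    qed
    moreover have "(\<lambda>\<eta>. a * pairing (\<lambda>p. ?I p * f p) \<eta> + b * pairing (\<lambda>p. ?I p * g p) \<eta>) \<in> borel_measurable S"
     using that by measurable
    ultimately show ?thesis by (subst measurable_cong) auto
   qed
   show "pairing (\<lambda>p. ?I p * f p) \<in> borel_measurable S"
    if "\<And>n. pairing (\<lambda>p. ?I p * fn n p) \<in> borel_measurable S" and lim: "\<And>x. x \<in> UNIV \<times> {0<..} \<Longrightarrow> (\<lambda>n. fn n x) \<longlonglongrightarrow> f x" for fn f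
   proof (rule borel_measurable_LIMSEQ_real[OF _ that(1)])
    fix \<eta> assume "\<eta> \<in> space S"
    then have \<eta>: "\<eta> \<in> \<K>" by (simp add: spS)
    have "(\<lambda>n. ?I p * fn n p) \<longlonglongrightarrow> ?I p * f p" for p
    proof (cases "p \<in> UNIV \<times> {0<..}")
     case True then show ?thesis by (intro tendsto_intros lim)
    next
     case False
     then have "\<theta> p = 0" using bdd_supp_zero[OF \<theta>, of "snd p" "fst p"] by (cases p) auto
     then have "?I p = 0" using I0 by blast
     then show ?thesis by simp
    qed
    then show "(\<lambda>n. pairing (\<lambda>p. ?I p * fn n p) \<eta>) \<longlonglongrightarrow> pairing (\<lambda>p. ?I p * f p) \<eta>"
     by (intro pairing_limit[OF \<eta> \<theta>]) (use I0 in auto)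
   qed
  qed
 qed
 have "(\<lambda>\<eta>. \<integral>x. f x \<partial>\<eta>) \<in> borel_measurable S" if f: "f \<in> Cc" for f :: "'a \<Rightarrow> real"
 proof (rule borel_measurable_LIMSEQ_real)
  define l where "l n = (- (real n + 1) *\<^sub>R (One :: 'a), 1 / (real n + 2))" for n :: nat
  define u where "u n = ((real n + 1) *\<^sub>R (One :: 'a), real n + 2)" for n :: nat
  \<comment> \<open>The factor \<open>s\<close> restores the weight of the atom and turns the
    pairing into an integral against \<eta>. The truncation keeps \<psi> bounded and is inactive
    inside the box.\<close>
  define \<psi> where "\<psi> n p = f (fst p) * max 0 (min (snd p) (real n + 2))" for n p
  obtain C where C: "\<And>x. \<bar>f x\<bar> \<le> C"
  proof -
   obtain C R where C: "0 \<le> C" "\<And>x. \<bar>f x\<bar> \<le> C * indicat_real (cball 0 R) x" using Cc_bounded[OF f] by blast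
   have "\<bar>f x\<bar> \<le> C" for x using C(1) C(2)[of x] by (cases "x \<in> cball 0 R") auto
   then show ?thesis using that by blast
  qed
  have lu: "0 < snd (l n)" "snd (l n) < snd (u n)" for n
  proof -
   have "1 / (real n + 2) < 1" by (simp add: field_simps)
   also have "1 < real n + 2" by simp
   finally show "snd (l n) < snd (u n)" by (simp add: l_def u_def)
   show "0 < snd (l n)" by (simp add: l_def)
  qed
  show "pairing (\<lambda>p. indicat_real (box (l n) (u n)) p * \<psi> n p) \<in> borel_measurable S" for n
  proof (rule box[OF lu])
   show "\<psi> n \<in> borel_measurable borel" unfolding \<psi>_def[abs_def]
    by (intro borel_measurable_times borel_measurable_max borel_measurable_min borel_measurable_const
      measurable_compose[OF borel_measurable_fst Cc_borel[OF f]] borel_measurable_snd)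
   show "\<bar>\<psi> n p\<bar> \<le> C * (real n + 2)" for p
    unfolding \<psi>_def abs_mult using C[of "fst p"] order_trans[OF abs_ge_zero C] by (intro mult_mono) auto
  qed
  fix \<eta> assume "\<eta> \<in> space S"
  then have \<eta>: "\<eta> \<in> \<K>" by (simp add: spS)
  have mem: "(x, s) \<in> box (l n) (u n) \<longleftrightarrow> (\<forall>b\<in>Basis. - (real n + 1) < x \<bullet> b \<and> x \<bullet> b < real n + 1) \<and> 1 / (real n + 2) < s \<and> s < real n + 2" for x s n
   by (auto simp: box_def l_def u_def Basis_prod_def)
  have pe: "pairing (\<lambda>p. indicat_real (box (l n) (u n)) p * \<psi> n p) \<eta> = (\<integral>x. indicat_real (box (l n) (u n)) (x, wt \<eta> x) * f x \<partial>\<eta>)" for n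
  proof -
   have "bdd_supp (\<lambda>p. indicat_real (box (l n) (u n)) p * \<psi> n p)"
    by (rule bdd_supp_mono[OF test_bdd_supp[OF box_bump_test[OF zero_less_one lu[of n]]]])
     (use box_bump_pos[of 1 "l n" "u n"] in \<open>force simp: indicator_def split: if_splits\<close>)
   from pairing_integral[OF \<eta> this]
   have "pairing (\<lambda>p. indicat_real (box (l n) (u n)) p * \<psi> n p) \<eta> =
    (\<integral>x. indicat_real (box (l n) (u n)) (x, wt \<eta> x) * \<psi> n (x, wt \<eta> x) / wt \<eta> x \<partial>\<eta>)" .
   also have "(\<lambda>x. indicat_real (box (l n) (u n)) (x, wt \<eta> x) * \<psi> n (x, wt \<eta> x) / wt \<eta> x) =
     (\<lambda>x. indicat_real (box (l n) (u n)) (x, wt \<eta> x) * f x)"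
   proof
    fix x
    show "indicat_real (box (l n) (u n)) (x, wt \<eta> x) * \<psi> n (x, wt \<eta> x) / wt \<eta> x =
     indicat_real (box (l n) (u n)) (x, wt \<eta> x) * f x"
    proof (cases "(x, wt \<eta> x) \<in> box (l n) (u n)")
     case True
     then have "1 / (real n + 2) < wt \<eta> x" "wt \<eta> x < real n + 2" unfolding mem by auto
     moreover have "0 < 1 / (real n + 2)" by simp
     ultimately have "0 < wt \<eta> x" "wt \<eta> x < real n + 2" by linarith+
     then show ?thesis by (simp add: \<psi>_def)
    qed simp
   qed
   finally show ?thesis .
  qed
  show "(\<lambda>n. pairing (\<lambda>p. indicat_real (box (l n) (u n)) p * \<psi> n p) \<eta>) \<longlonglongrightarrow> (\<integral>x. f x \<partial>\<eta>)" unfolding pe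
  proof (rule integral_dominated_convergence[where w = "\<lambda>x. \<bar>f x\<bar>"])
   have fi: "integrable \<eta> f" using Cc_integrable f \<eta> discrete_radon_subset by blast
   then show "f \<in> borel_measurable \<eta>" "integrable \<eta> (\<lambda>x. \<bar>f x\<bar>)" by auto
   have "(\<lambda>x. (x, wt \<eta> x)) \<in> measurable borel borel"
    using measurable_compose[OF measurable_Pair1'[of \<eta> Cc_sigma] marks_measurable] \<eta> by simp
   then have "(\<lambda>x. indicat_real (box (l n) (u n)) (x, wt \<eta> x)) \<in> borel_measurable borel" for n
    by (rule measurable_compose) (auto intro!: borel_measurable_indicator)
   then show "(\<lambda>x. indicat_real (box (l n) (u n)) (x, wt \<eta> x) * f x) \<in> borel_measurable \<eta>" for n
    unfolding measurable_cong_sets[OF discrete_radonE(1)[OF \<eta>] refl] using Cc_borel[OF f] by measurable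
   show "AE x in \<eta>. norm (indicat_real (box (l n) (u n)) (x, wt \<eta> x) * f x) \<le> \<bar>f x\<bar>" for n
    by (auto simp: indicator_def)
   show "AE x in \<eta>. (\<lambda>n. indicat_real (box (l n) (u n)) (x, wt \<eta> x) * f x) \<longlonglongrightarrow> f x" using AE_atoms[OF \<eta>]
   proof eventually_elim
    case (elim x)
    \<comment> \<open>Exceeds the position, the mark and the inverse mark at once, so that
      \<open>(x, wt \<eta> x)\<close> lies in all later boxes.\<close>
    obtain n0 :: nat where n0: "norm x + wt \<eta> x + 1 / wt \<eta> x < real n0" using reals_Archimedean2 by blast
    have "(x, wt \<eta> x) \<in> box (l n) (u n)" if "n0 \<le> n" for n unfolding mem
    proof (intro conjI ballI)
     have n: "norm x + wt \<eta> x + 1 / wt \<eta> x < real n" using n0 that by linarith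
     have p: "0 < 1 / wt \<eta> x" using elim by simp
     show "- (real n + 1) < x \<bullet> b" "x \<bullet> b < real n + 1" if "b \<in> Basis" for b
      using Basis_le_norm[OF that, of x] n p elim unfolding abs_le_iff by linarith+
     show "wt \<eta> x < real n + 2" using n p norm_ge_zero[of x] by linarith
     have "1 / wt \<eta> x < real n + 2" using n elim norm_ge_zero[of x] by linarith
     then show "1 / (real n + 2) < wt \<eta> x" using elim by (simp add: field_simps)
    qed
    then have "eventually (\<lambda>n. indicat_real (box (l n) (u n)) (x, wt \<eta> x) * f x = f x) sequentially"
     by (auto simp: eventually_sequentially intro!: exI[of _ n0])
    then show ?case by (rule tendsto_eventually)
   qed
  qed
 qed
 then have "(\<lambda>\<eta>. \<eta>) \<in> measurable S Cc_sigma" by (intro measurable_Cc_sigmaI) (auto simp: spS)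
 then have "A \<in> sets S" if "A \<in> sets Cc_sigma" for A :: "'a measure set"
  using measurable_sets[OF _ that, of "\<lambda>\<eta>. \<eta>" S] sets.sets_into_space[OF that] spS by (simp add: Int_absorb2)
 then show ?thesis unfolding sS by blast
qed

lemma bounded_L2:
 assumes "prob_space M" "f \<in> borel_measurable M" "\<And>x. x \<in> space M \<Longrightarrow> \<bar>f x\<bar> \<le> C"
 shows "f \<in> L2 M"
proof -
 interpret prob_space M by fact
 have "(f x)\<^sup>2 \<le> C\<^sup>2" if "x \<in> space M" for x using assms(3)[OF that] by (simp add: abs_le_square_iff[symmetric])
 then have "integrable M (\<lambda>x. (f x)\<^sup>2)" using assms(2) by (intro integrable_const_bound[where B = "C\<^sup>2"]) auto
 then show ?thesis using assms(2) by (simp add: L2_def)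
qed

text \<open>\<open>FC\<close> is multiplicative and generates the \<sigma>-algebra, so the monotone
  class theorem approximates every bounded measurable function; bounded limits are \<open>L2\<close>
  limits because the measure is finite. Truncation then reaches all of \<open>L2\<close>.\<close>

theorem FC_dense:
 assumes G: "prob_space \<G>" and sG: "sets \<G> = sets (Cc_sigma :: 'a::euclidean_space measure measure)"
 shows "dense_subspace \<G> FC"
proof -
 interpret prob_space \<G> by fact
 have spG: "space \<G> = \<K>" using sets_eq_imp_space_eq[OF sG] by simp
 have mG: "borel_measurable \<G> = borel_measurable Cc_sigma" by (rule measurable_cong_sets[OF sG refl])
 have FC_L2: "F \<in> L2 \<G>" if F: "F \<in> FC" for F
 proof -
  obtain C where "\<And>\<eta>. \<eta> \<in> \<K> \<Longrightarrow> \<bar>F \<eta>\<bar> \<le> C" using FC_bounded_ex[OF F] by blast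
  then show ?thesis using FC_measurable[OF F] by (intro bounded_L2[OF G]) (auto simp: mG spG)
 qed
 define P where "P f \<longleftrightarrow> f \<in> L2 \<G> \<and> (\<forall>e>0. \<exists>g\<in>FC. L2_dist \<G> f g < e)" for f
 have Plim: "P f" if fL: "f \<in> L2 \<G>" and Pn: "\<And>n. P (fn n)" and lim: "(\<lambda>n. L2_dist \<G> (fn n) f) \<longlonglongrightarrow> 0" for fn f
  unfolding P_def
 proof (intro conjI allI impI fL)
  fix e :: real assume e: "0 < e"
  have fnL: "fn n \<in> L2 \<G>" for n using Pn by (simp add: P_def)
  obtain n where n: "L2_dist \<G> (fn n) f < e / 2"
   using order_tendstoD(2)[OF lim, of "e / 2"] e by (auto simp: eventually_sequentially)
  obtain g where g: "g \<in> FC" "L2_dist \<G> (fn n) g < e / 2"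
   using Pn[of n] half_gt_zero[OF e] unfolding P_def by blast
  have "L2_dist \<G> f g \<le> L2_dist \<G> f (fn n) + L2_dist \<G> (fn n) g"
   using L2.nrm_triangle[OF fL fnL FC_L2[OF g(1)]] by (simp add: L2_nrm_eq)
  also have "L2_dist \<G> f (fn n) = L2_dist \<G> (fn n) f"
   using L2.nrm_diff_sym[OF fL fnL] by (simp add: L2_nrm_eq)
  finally show "\<exists>g\<in>FC. L2_dist \<G> f g < e" using g n by (intro bexI[of _ g]) auto
 qed
 have bdd: "P f" if f: "f \<in> borel_measurable \<G>" and C: "\<And>x. x \<in> \<K> \<Longrightarrow> \<bar>f x\<bar> \<le> C" for f C
 proof -
  have "P f \<and> f \<in> borel_measurable \<G>"
  proof (rule monotone_class_induct[where N = \<G> and M = FC and \<Omega> = \<K>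
     and P = "\<lambda>f. P f \<and> f \<in> borel_measurable \<G>"])
   show "(\<lambda>x. f x * g x) \<in> FC" if "f \<in> FC" "g \<in> FC" for f g :: "'a measure \<Rightarrow> real" by (rule FC_mult[OF that])
   show "\<exists>C. \<forall>x\<in>\<K>. \<bar>f x\<bar> \<le> C" if "f \<in> FC" for f :: "'a measure \<Rightarrow> real" by (rule FC_bounded_ex[OF that])
   show "sets \<G> \<subseteq> sigma_sets \<K> {f -` {a<..} \<inter> \<K> |f a. f \<in> FC}"
    unfolding sG by (rule FC_generates)
   have FC: "P f \<and> f \<in> borel_measurable \<G>" if "f \<in> FC" for f
   proof -
    have "L2_dist \<G> f f = 0" by (simp add: L2_norm_def L2_inner_def)
    then have "\<exists>g\<in>FC. L2_dist \<G> f g < e" if "0 < e" for e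
     using \<open>f \<in> FC\<close> that by (intro bexI[of _ f]) simp
    then show ?thesis unfolding P_def using FC_L2[OF that] FC_measurable[OF that, folded mG] by blast
   qed
   show "P (\<lambda>x. 1) \<and> (\<lambda>x. 1::real) \<in> borel_measurable \<G>" using FC[OF FC_const[of 1]] by blast
   show "P f \<and> f \<in> borel_measurable \<G>" if "f \<in> FC" for f by (rule FC[OF that])
   show "P (\<lambda>x. a * f x + b * g x) \<and> (\<lambda>x. a * f x + b * g x) \<in> borel_measurable \<G>"
    if fg: "P f \<and> f \<in> borel_measurable \<G>" "P g \<and> g \<in> borel_measurable \<G>" for f g a b
   proof
    have fL: "f \<in> L2 \<G>" and gL: "g \<in> L2 \<G>" using fg by (auto simp: P_def)
    show "P (\<lambda>x. a * f x + b * g x)" unfolding P_def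
    proof (intro conjI allI impI L2_lin fL gL)
     fix e :: real assume e: "0 < e"
     define d where "d = e / (\<bar>a\<bar> + \<bar>b\<bar> + 1)"
     have d: "0 < d" using e by (simp add: d_def)
     have "P f" "P g" using fg by auto
     then obtain f' g' where f': "f' \<in> FC" "L2_dist \<G> f f' < d"
      and g': "g' \<in> FC" "L2_dist \<G> g g' < d"
      using d unfolding P_def by metis
     have "L2_norm \<G> (\<lambda>x. a * (f x - f' x) + b * (g x - g' x)) \<le> \<bar>a\<bar> * L2_dist \<G> f f' + \<bar>b\<bar> * L2_dist \<G> g g'"
      using L2.nrm_lin[OF L2.diff_mem[OF fL FC_L2[OF f'(1)]] L2.diff_mem[OF gL FC_L2[OF g'(1)]]] by (simp add: L2_nrm_eq)
     also have "\<dots> \<le> \<bar>a\<bar> * d + \<bar>b\<bar> * d" using f' g' by (intro add_mono mult_left_mono) auto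
     also have "\<dots> < (\<bar>a\<bar> + \<bar>b\<bar> + 1) * d" using d by (simp add: algebra_simps)
     also have "\<dots> = e" by (simp add: d_def)
     finally have "L2_norm \<G> (\<lambda>x. (a * f x + b * g x) - (a * f' x + b * g' x)) < e" by (simp add: algebra_simps)
     then show "\<exists>k\<in>FC. L2_norm \<G> (\<lambda>x. (a * f x + b * g x) - k x) < e"
      by (intro bexI[OF _ FC_lin(1)[OF f'(1) g'(1), of a b]])
    qed
    show "(\<lambda>x. a * f x + b * g x) \<in> borel_measurable \<G>" using fg by auto
   qed
   show "P f \<and> f \<in> borel_measurable \<G>" if Pn: "\<And>n. P (fn n) \<and> fn n \<in> borel_measurable \<G>"
    and C: "\<And>n x. x \<in> \<K> \<Longrightarrow> \<bar>fn n x\<bar> \<le> C" and lim: "\<And>x. x \<in> \<K> \<Longrightarrow> (\<lambda>n. fn n x) \<longlonglongrightarrow> f x" for fn f C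
   proof -
    have m: "f \<in> borel_measurable \<G>" by (rule borel_measurable_LIMSEQ_real[of _ fn]) (use lim spG Pn in auto)
    have fC: "\<bar>f x\<bar> \<le> C" if x: "x \<in> \<K>" for x
     by (rule LIMSEQ_le_const2[OF tendsto_rabs[OF lim[OF x]]]) (use C[OF x] in auto)
    have fL: "f \<in> L2 \<G>" by (rule bounded_L2[OF G m, of C]) (use fC spG in auto)
    have "(\<lambda>n. L2_dist \<G> (fn n) f) \<longlonglongrightarrow> 0"
    proof (rule L2_dominated_convergence[OF m, where w = "\<lambda>x. 2 * C"])
     show "(\<lambda>x. 2 * C) \<in> L2 \<G>" by (rule bounded_L2[OF G, of _ "\<bar>2 * C\<bar>"]) auto
     show "AE x in \<G>. \<bar>fn n x - f x\<bar> \<le> 2 * C" for n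
     proof (rule AE_I2)
      fix x assume "x \<in> space \<G>"
      then show "\<bar>fn n x - f x\<bar> \<le> 2 * C" using fC[of x] C[of x n] spG by (simp add: abs_le_iff)
     qed
    qed (use Pn lim spG in auto)
    then show ?thesis using Plim[OF fL, of fn] Pn m by blast
   qed
  qed (use f C spG in auto)
  then show ?thesis by blast
 qed
 have "P f" if fL: "f \<in> L2 \<G>" for f
 proof -
  have m [measurable]: "f \<in> borel_measurable \<G>" using fL by (simp add: L2_def)
  \<comment> \<open>Cuts \<open>f\<close> to 0 where it exceeds \<open>n\<close>, so that
    \<open>\<bar>f\<bar>\<close> dominates the error.\<close>
  define fn where "fn n x = f x * indicat_real {t. \<bar>t\<bar> \<le> real n} (f x)" for n :: nat and x
  have fm: "fn n \<in> borel_measurable \<G>" for n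
  proof -
   have "(\<lambda>x. indicat_real {t. \<bar>t\<bar> \<le> real n} (f x)) \<in> borel_measurable \<G>"
    by (rule measurable_compose[OF m]) (auto intro!: borel_measurable_indicator)
   then show ?thesis unfolding fn_def by simp
  qed
  have "P (fn n)" for n by (rule bdd[OF fm, of _ "real n"]) (auto simp: fn_def indicator_def)
  moreover have "(\<lambda>n. L2_dist \<G> (fn n) f) \<longlonglongrightarrow> 0"
  proof (rule L2_dominated_convergence[OF m fm, where w = "\<lambda>x. \<bar>f x\<bar>"])
   show "(\<lambda>x. \<bar>f x\<bar>) \<in> L2 \<G>" using fL by (auto simp: L2_def)
   show "AE x in \<G>. \<bar>fn n x - f x\<bar> \<le> \<bar>f x\<bar>" for n by (auto simp: fn_def indicator_def)
   show "AE x in \<G>. (\<lambda>n. fn n x) \<longlonglongrightarrow> f x"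
   proof (rule AE_I2, rule tendsto_eventually)
    fix x
    obtain n0 where "\<bar>f x\<bar> \<le> real n0" using real_arch_simple by blast
    then show "eventually (\<lambda>n. fn n x = f x) sequentially"
     by (intro eventually_sequentiallyI[of n0]) (auto simp: fn_def)
   qed
  qed
  ultimately show ?thesis using Plim[OF fL, of fn] by blast
 qed
 then show ?thesis unfolding dense_subspace_def P_def using FC_L2 FC_const FC_lin(1) by blast
qed


section \<open>The Mecke identity\<close>

text \<open>Total in \<open>p\<close>: a negative mark counts as 0 and an existing atom gains
  weight. The first case has density 0 in the Mecke identity, and the second concerns a Lebesgue
  null set.\<close>

definition add_atom :: "'a::euclidean_space measure \<Rightarrow> 'a \<times> real \<Rightarrow> 'a measure" where
 "add_atom \<eta> p = atomic ((wt \<eta>)(fst p := wt \<eta> (fst p) + max 0 (snd p)))"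

lemma add_atom_dr: "\<eta> \<in> \<K> \<Longrightarrow> add_atom \<eta> p \<in> \<K>"
 unfolding add_atom_def by (rule atomic_discrete_radon[where y = "fst p"]) auto

lemma nn_integral_atomic:
 assumes f: "f \<in> borel_measurable borel"
 shows "(\<integral>\<^sup>+x. f x \<partial>atomic w) = (\<integral>\<^sup>+x. ennreal (w x) * f x \<partial>count_space UNIV)"
 unfolding atomic_def using f by (subst nn_integral_distr) (auto simp: nn_integral_density)

lemma nn_integral_add_atom:
 assumes \<eta>: "\<eta> \<in> \<K>" and f: "f \<in> borel_measurable borel"
 shows "(\<integral>\<^sup>+x. f x \<partial>add_atom \<eta> p) = (\<integral>\<^sup>+x. f x \<partial>\<eta>) + ennreal (max 0 (snd p)) * f (fst p)"
proof -
 have "(\<integral>\<^sup>+x. f x \<partial>add_atom \<eta> p) = (\<integral>\<^sup>+x. ennreal (wt \<eta> x) * f x + ennreal (max 0 (snd p)) * f (fst p) * indicator {fst p} x \<partial>count_space UNIV)"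
  unfolding add_atom_def nn_integral_atomic[OF f]
  by (rule nn_integral_cong) (auto simp: indicator_def distrib_right ennreal_plus)
 also have "\<dots> = (\<integral>\<^sup>+x. ennreal (wt \<eta> x) * f x \<partial>count_space UNIV) + ennreal (max 0 (snd p)) * f (fst p)"
  by (subst nn_integral_add) (auto simp: nn_integral_cmult_indicator)
 also have "(\<integral>\<^sup>+x. ennreal (wt \<eta> x) * f x \<partial>count_space UNIV) = (\<integral>\<^sup>+x. f x \<partial>\<eta>)"
  unfolding nn_integral_atomic[OF f, symmetric] atomic_wt_eq[OF \<eta>] ..
 finally show ?thesis .
qed

text \<open>The nonnegative case follows from \<open>nn_integral_add_atom\<close>; in general
  \<open>f\<close> is the difference of the nonnegative functions \<open>k\<close> and
  \<open>k - f\<close>, with \<open>k\<close> the positive part.\<close>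

lemma integral_add_atom:
 assumes \<eta>: "\<eta> \<in> \<K>" and f: "f \<in> Cc"
 shows "(\<integral>x. f x \<partial>add_atom \<eta> p) = (\<integral>x. f x \<partial>\<eta>) + max 0 (snd p) * f (fst p)"
proof -
 have pos: "(\<integral>x. f x \<partial>add_atom \<eta> p) = (\<integral>x. f x \<partial>\<eta>) + max 0 (snd p) * f (fst p)"
  if f: "f \<in> Cc" and f0: "\<And>x. 0 \<le> f x" for f
 proof -
  have i: "integrable \<eta> f" "integrable (add_atom \<eta> p) f"
   using Cc_integrable[OF _ f] \<eta> add_atom_dr[OF \<eta>] discrete_radon_subset by blast+
  have "ennreal (\<integral>x. f x \<partial>add_atom \<eta> p) = (\<integral>\<^sup>+x. ennreal (f x) \<partial>add_atom \<eta> p)"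
   using i(2) f0 by (simp add: nn_integral_eq_integral)
  also have "\<dots> = (\<integral>\<^sup>+x. ennreal (f x) \<partial>\<eta>) + ennreal (max 0 (snd p)) * ennreal (f (fst p))"
   using Cc_borel[OF f] by (intro nn_integral_add_atom[OF \<eta>]) simp
  also have "(\<integral>\<^sup>+x. ennreal (f x) \<partial>\<eta>) = ennreal (\<integral>x. f x \<partial>\<eta>)" using i(1) f0 by (simp add: nn_integral_eq_integral)
  also have "ennreal (\<integral>x. f x \<partial>\<eta>) + ennreal (max 0 (snd p)) * ennreal (f (fst p)) =
    ennreal ((\<integral>x. f x \<partial>\<eta>) + max 0 (snd p) * f (fst p))"
   using f0 by (simp add: ennreal_plus ennreal_mult integral_nonneg_AE)
  finally show ?thesis using f0 by (subst (asm) ennreal_inj) (auto intro!: integral_nonneg_AE add_nonneg_nonneg)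
 qed
 define k where "k x = max (f x) 0" for x
 have kC: "k \<in> Cc" unfolding k_def[abs_def] by (rule Cc_max[OF f Cc_zero])
 have kf: "(\<lambda>x. k x - f x) \<in> Cc" using Cc_lin[OF kC f, of 1 "-1"] by simp
 have d: "(\<integral>x. k x - f x \<partial>\<zeta>) = (\<integral>x. k x \<partial>\<zeta>) - (\<integral>x. f x \<partial>\<zeta>)" if "\<zeta> \<in> \<K>" for \<zeta>
  using Cc_integrable[OF _ kC] Cc_integrable[OF _ f] that discrete_radon_subset
  by (intro Bochner_Integration.integral_diff) auto
 have "(\<integral>x. k x \<partial>add_atom \<eta> p) = (\<integral>x. k x \<partial>\<eta>) + max 0 (snd p) * k (fst p)" by (rule pos[OF kC]) (simp add: k_def)
 moreover have "(\<integral>x. k x - f x \<partial>add_atom \<eta> p) = (\<integral>x. k x - f x \<partial>\<eta>) + max 0 (snd p) * (k (fst p) - f (fst p))"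
  by (rule pos[OF kf]) (simp add: k_def)
 ultimately show ?thesis unfolding d[OF \<eta>] d[OF add_atom_dr[OF \<eta>]] by (simp add: algebra_simps)
qed

text \<open>A new atom is treated as an atom of weight 0 that is moved from \<open>x\<close> to
  \<open>x\<close> and receives the mark \<open>s\<close>, so that \<open>pairing_move\<close>
  applies.\<close>

lemma add_atom_new:
 assumes \<eta>: "\<eta> \<in> \<K>" and x: "x \<notin> atoms \<eta>" and s: "0 < s"
 shows "wt (add_atom \<eta> (x, s)) x = s"
  and "bdd_supp \<phi> \<Longrightarrow> pairing \<phi> (add_atom \<eta> (x, s)) = pairing \<phi> \<eta> + \<phi> (x, s)"
proof -
 have z: "wt \<eta> x = 0" by (rule wt_nonatom[OF \<eta> x])
 have eq: "add_atom \<eta> (x, s) = atomic ((wt \<eta>)(x := 0, x := s))" using s by (simp add: add_atom_def z)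
 show "wt (add_atom \<eta> (x, s)) x = s" unfolding eq using s by (subst atomic_wt) auto
 show "pairing \<phi> (add_atom \<eta> (x, s)) = pairing \<phi> \<eta> + \<phi> (x, s)" if "bdd_supp \<phi>"
  unfolding eq using pairing_move(2)[OF \<eta> that, of s x x] s x bdd_supp_zero[OF that, of 0 x] by (simp add: z)
qed

lemma add_atom_measurable:
 "(\<lambda>q. add_atom (fst q) (snd q)) \<in> measurable (Cc_sigma \<Otimes>\<^sub>M (borel :: ('a::euclidean_space \<times> real) measure)) Cc_sigma"
proof (rule measurable_Cc_sigmaI)
 show "add_atom (fst q) (snd q) \<in> \<K>" if "q \<in> space (Cc_sigma \<Otimes>\<^sub>M (borel :: ('a \<times> real) measure))" for q
  using that by (auto simp: space_pair_measure intro: add_atom_dr)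
 fix f :: "'a \<Rightarrow> real" assume f: "f \<in> Cc"
 have [measurable]: "(\<lambda>\<eta>. \<integral>x. f x \<partial>\<eta>) \<in> borel_measurable Cc_sigma" by (rule Cc_sigma_integral_measurable[OF f])
 have [measurable]: "(\<lambda>p. max 0 (snd p) * f (fst p)) \<in> borel_measurable (borel :: ('a \<times> real) measure)"
  by (intro borel_measurable_times borel_measurable_max borel_measurable_const
    measurable_compose[OF borel_measurable_fst Cc_borel[OF f]] borel_measurable_snd)
 have "(\<lambda>q. (\<integral>x. f x \<partial>fst q) + max 0 (snd (snd q)) * f (fst (snd q))) \<in> borel_measurable (Cc_sigma \<Otimes>\<^sub>M borel)"
  by (intro borel_measurable_add measurable_compose[OF measurable_fst] measurable_compose[OF measurable_snd, where g = "\<lambda>p. max 0 (snd p) * f (fst p)"]) measurable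
 then show "(\<lambda>q. \<integral>y. f y \<partial>add_atom (fst q) (snd q)) \<in> borel_measurable (Cc_sigma \<Otimes>\<^sub>M borel)"
  by (rule measurable_cong[THEN iffD1, rotated]) (auto simp: space_pair_measure integral_add_atom[OF _ f])
qed

section \<open>The first moment of the gamma measure\<close>

lemma lborel_radon: "lborel \<in> radon_measures" using emeasure_compact_finite by (auto simp: radon_measures_def)

lemma exp_weight_integral:
 fixes a :: real
 assumes a: "0 < a" shows "has_bochner_integral lborel (\<lambda>s. if 0 < s then exp (- s * a) else 0) (1 / a)"
proof -
 have m: "exponential_density a \<in> borel_measurable lborel" by simp
 have "(\<integral>\<^sup>+s. ennreal (exponential_density a s) \<partial>lborel) = ennreal 1"
 proof -
  interpret prob_space "density lborel (exponential_density a)" by (rule prob_space_exponential_density[OF a])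
  show ?thesis using emeasure_space_1 by (simp add: emeasure_density)
 qed
 then have "has_bochner_integral lborel (exponential_density a) 1"
  using a by (intro has_bochner_integral_nn_integral) (auto simp: exponential_density_nonneg)
 then have h: "has_bochner_integral lborel (\<lambda>s. exponential_density a s / a) (1 / a)"
  by (intro has_bochner_integral_divide_zero)
 have "AE s in lborel. s \<noteq> (0::real)" by (rule AE_lborel_singleton)
 then have "AE s in lborel. exponential_density a s / a = (if 0 < s then exp (- s * a) else 0)"
  by eventually_elim (use a in \<open>auto simp: exponential_density_def\<close>)
 then show ?thesis using h by (subst (asm) has_bochner_integral_cong_AE) auto
qed

lemma Cc_compose:
 assumes f: "f \<in> Cc" and r: "continuous_on (range f) r" and r0: "r 0 = 0"
 shows "(\<lambda>x. r (f x)) \<in> Cc"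
proof -
 obtain R where R: "\<And>x. R < norm x \<Longrightarrow> f x = 0" and c: "continuous_on UNIV f" using f unfolding Cc_iff by blast
 have "continuous_on UNIV (\<lambda>x. r (f x))" by (rule continuous_on_compose2[OF r c]) auto
 moreover have "\<forall>x. R < norm x \<longrightarrow> r (f x) = 0" using R r0 by simp
 ultimately show ?thesis unfolding Cc_iff by blast
qed

text \<open>The derivative at \<open>t = 0\<close> of the Laplace transform at \<open>\<phi> + t \<theta>\<close>.\<close>

lemma gamma_first_moment:
 assumes G: "gamma_measure \<G>" and \<phi>: "\<phi> \<in> Cc" and \<phi>0: "\<And>x. \<phi> x \<le> 0" and \<theta>: "\<theta> \<in> Cc" and \<theta>0: "\<And>x. 0 \<le> \<theta> x"
 shows "has_bochner_integral \<G> (\<lambda>\<eta>. exp (\<integral>x. \<phi> x \<partial>\<eta>) * (\<integral>x. \<theta> x \<partial>\<eta>))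
  ((\<integral>\<eta>. exp (\<integral>x. \<phi> x \<partial>\<eta>) \<partial>\<G>) * (\<integral>x. \<theta> x / (1 - \<phi> x) \<partial>lborel))"
proof -
 have sG: "sets \<G> = sets Cc_sigma" using G sets_discrete_radon_space by (auto simp: gamma_measure_def)
 have spG: "space \<G> = \<K>" using sets_eq_imp_space_eq[OF sG] by simp
 have Lap: "has_bochner_integral \<G> (\<lambda>\<eta>. exp (\<integral>x. \<psi> x \<partial>\<eta>)) (exp (- (\<integral>x. ln (1 - \<psi> x) \<partial>lborel)))"
  if "\<psi> \<in> Cc" "\<And>x. \<psi> x < 1" for \<psi>
  using G that unfolding gamma_measure_def by blast
 have meas: "(\<lambda>\<eta>. \<integral>x. \<psi> x \<partial>\<eta>) \<in> borel_measurable \<G>" if "\<psi> \<in> Cc" for \<psi>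
  using Cc_sigma_integral_measurable[OF that] measurable_cong_sets[OF sG refl] by blast
 obtain C R where C: "0 \<le> C" "\<And>x. \<bar>\<theta> x\<bar> \<le> C * indicat_real (cball 0 R) x" using Cc_bounded[OF \<theta>] by blast
 have \<theta>C: "\<theta> x \<le> C" for x using C(1) C(2)[of x] by (cases "x \<in> cball 0 R") (auto simp: abs_le_iff)
 \<comment> \<open>Step sizes with \<open>t n * \<theta> x \<le> 1 / 2\<close>: then \<psi> stays
   below 1, as the Laplace transform requires, and \<open>1 - \<psi> n x\<close> stays at least 1/2,
   which controls the logarithms.\<close>
 define t where "t n = 1 / ((2 * (C + 1)) * real (Suc n))" for n
 have t0: "0 < t n" for n using C(1) by (simp add: t_def)
 have tl: "t \<longlonglongrightarrow> 0"
 proof -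
  have "(\<lambda>n. 1 / (2 * (C + 1)) * inverse (real (Suc n))) \<longlonglongrightarrow> 1 / (2 * (C + 1)) * 0"
   by (intro tendsto_intros LIMSEQ_inverse_real_of_nat)
  then show ?thesis by (simp add: t_def[abs_def] divide_inverse mult.assoc)
 qed
 have tmono: "t n \<le> t 0" for n unfolding t_def using C(1) by (intro divide_left_mono mult_left_mono) auto
 have tC: "t n * \<theta> x \<le> 1 / 2" for n x
 proof -
  have "t n * \<theta> x \<le> t 0 * C" using tmono[of n] t0[of n] \<theta>C[of x] \<theta>0[of x] by (intro mult_mono) auto
  also have "\<dots> \<le> 1 / 2" using C(1) by (simp add: t_def field_simps)
  finally show ?thesis .
 qed
 define \<psi> where "\<psi> n x = \<phi> x + t n * \<theta> x" for n x
 have \<psi>C: "\<psi> n \<in> Cc" for n unfolding \<psi>_def[abs_def] using Cc_lin[OF \<phi> \<theta>, of 1 "t n"] by simp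
 have \<psi>1: "\<psi> n x < 1" for n x using tC[of n x] \<phi>0[of x] by (simp add: \<psi>_def)
 have \<phi>1: "\<phi> x < 1" for x using \<phi>0[of x] by simp
 let ?A = "\<lambda>\<eta>. \<integral>x. \<phi> x \<partial>\<eta>" and ?Y = "\<lambda>\<eta>. \<integral>x. \<theta> x \<partial>\<eta>"
 have sum: "(\<integral>x. \<psi> n x \<partial>\<eta>) = ?A \<eta> + t n * ?Y \<eta>" if "\<eta> \<in> radon_measures" for n \<eta>
  unfolding \<psi>_def using Cc_integrable[OF that \<phi>] Cc_integrable[OF that \<theta>] by simp
 have Y0: "0 \<le> ?Y \<eta>" for \<eta> using \<theta>0 by (auto intro: integral_nonneg_AE)
 define q where "q n \<eta> = (exp (\<integral>x. \<psi> n x \<partial>\<eta>) - exp (?A \<eta>)) / t n" for n \<eta>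
 have qe: "q n \<eta> = exp (?A \<eta>) * ((exp (t n * ?Y \<eta>) - 1) / t n)" if "\<eta> \<in> \<K>" for n \<eta>
  unfolding q_def sum[OF subsetD[OF discrete_radon_subset that]] exp_add by (simp add: algebra_simps)
 \<comment> \<open>By convexity the difference quotients of the exponential at 0 increase with the
   step. The one for \<open>t 0\<close> therefore dominates the others, and it is integrable by the
   Laplace transform itself.\<close>
 have conv: "(exp (t n * y) - 1) / t n \<le> (exp (t 0 * y) - 1) / t 0" if "0 \<le> y" for n y
 proof -
  define l where "l = t n / t 0"
  have l: "0 \<le> l" "l \<le> 1" using t0 tmono[of n] less_imp_le[OF t0[of n]] by (auto simp: l_def)
  have "exp ((1 - l) *\<^sub>R 0 + l *\<^sub>R (t 0 * y)) \<le> (1 - l) * exp 0 + l * exp (t 0 * y)"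
   by (rule convex_onD[OF exp_convex]) (use l in auto)
  then have "exp (l * (t 0 * y)) - 1 \<le> l * (exp (t 0 * y) - 1)" by (simp add: algebra_simps)
  moreover have "l * (t 0 * y) = t n * y" using t0[of 0] by (simp add: l_def)
  ultimately have "exp (t n * y) - 1 \<le> t n / t 0 * (exp (t 0 * y) - 1)" by (simp add: l_def)
  then show ?thesis using t0[of n] t0[of 0] by (simp add: field_simps)
 qed
 have L1: "integrable \<G> (\<lambda>\<eta>. exp (?A \<eta>) * ?Y \<eta>)" "(\<lambda>n. \<integral>\<eta>. q n \<eta> \<partial>\<G>) \<longlonglongrightarrow> (\<integral>\<eta>. exp (?A \<eta>) * ?Y \<eta> \<partial>\<G>)"
 proof -
  have qi: "integrable \<G> (q n)" for n
   unfolding q_def using Lap[OF \<psi>C \<psi>1, of n] Lap[OF \<phi> \<phi>1] by (intro integrable_divide_zero Bochner_Integration.integrable_diff) (auto simp: has_bochner_integral_iff)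
  have m: "(\<lambda>\<eta>. exp (?A \<eta>) * ?Y \<eta>) \<in> borel_measurable \<G>" using meas[OF \<phi>] meas[OF \<theta>] by measurable
  have lim: "AE \<eta> in \<G>. (\<lambda>n. q n \<eta>) \<longlonglongrightarrow> exp (?A \<eta>) * ?Y \<eta>"
  proof (rule AE_I2)
   fix \<eta> assume "\<eta> \<in> space \<G>"
   then have \<eta>: "\<eta> \<in> \<K>" by (simp add: spG)
   have "((\<lambda>s. exp (s * ?Y \<eta>)) has_real_derivative ?Y \<eta>) (at 0)" by (auto intro!: derivative_eq_intros)
   then have d: "((\<lambda>h. (exp (h * ?Y \<eta>) - 1) / h) \<longlongrightarrow> ?Y \<eta>) (at 0)" by (simp add: DERIV_def)
   have "filterlim t (at 0) sequentially"
    by (rule filterlim_atI[OF tl]) (use t0 in \<open>auto simp: less_imp_neq[symmetric]\<close>)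
   from filterlim_compose[OF d this]
   have "(\<lambda>n. (exp (t n * ?Y \<eta>) - 1) / t n) \<longlonglongrightarrow> ?Y \<eta>" .
   then show "(\<lambda>n. q n \<eta>) \<longlonglongrightarrow> exp (?A \<eta>) * ?Y \<eta>" unfolding qe[OF \<eta>] by (intro tendsto_intros)
  qed
  have bd: "AE \<eta> in \<G>. norm (q n \<eta>) \<le> q 0 \<eta>" for n
  proof (rule AE_I2)
   fix \<eta> assume "\<eta> \<in> space \<G>"
   then have \<eta>: "\<eta> \<in> \<K>" by (simp add: spG)
   have "0 \<le> (exp (t n * ?Y \<eta>) - 1) / t n" using t0[of n] Y0[of \<eta>] by simp
   then have "norm (q n \<eta>) = q n \<eta>" unfolding qe[OF \<eta>] real_norm_def by (intro abs_of_nonneg mult_nonneg_nonneg) auto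
   also have "\<dots> \<le> q 0 \<eta>" unfolding qe[OF \<eta>] by (rule mult_left_mono[OF conv[OF Y0]]) simp
   finally show "norm (q n \<eta>) \<le> q 0 \<eta>" .
  qed
  show "integrable \<G> (\<lambda>\<eta>. exp (?A \<eta>) * ?Y \<eta>)"
   by (rule integrable_dominated_convergence[OF m _ qi[of 0] lim bd]) (use qi in auto)
  show "(\<lambda>n. \<integral>\<eta>. q n \<eta> \<partial>\<G>) \<longlonglongrightarrow> (\<integral>\<eta>. exp (?A \<eta>) * ?Y \<eta> \<partial>\<G>)"
   by (rule integral_dominated_convergence[OF m _ qi[of 0] lim bd]) (use qi in auto)
 qed
 define b where "b = - (\<integral>x. ln (1 - \<phi> x) \<partial>lborel)"
 define c where "c n = (\<integral>x. (ln (1 - \<phi> x) - ln (1 - \<psi> n x)) / t n \<partial>lborel)" for n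
 have lnC: "(\<lambda>x. ln (1 - \<kappa> x)) \<in> Cc" if \<kappa>: "\<kappa> \<in> Cc" and \<kappa>1: "\<And>x. \<kappa> x < 1" for \<kappa> :: "'a \<Rightarrow> real"
 proof (rule Cc_compose[OF \<kappa>])
  have "1 - s \<noteq> 0" if s: "s \<in> range \<kappa>" for s
  proof -
   obtain x where "s = \<kappa> x" using s by blast
   then show ?thesis using \<kappa>1[of x] by simp
  qed
  then show "continuous_on (range \<kappa>) (\<lambda>s. ln (1 - s))" by (intro continuous_intros) auto
 qed simp
 note li = Cc_integrable[OF lborel_radon lnC]
 have bc: "- (\<integral>x. ln (1 - \<psi> n x) \<partial>lborel) = b + t n * c n" for n
 proof -
  have "t n * c n = (\<integral>x. ln (1 - \<phi> x) - ln (1 - \<psi> n x) \<partial>lborel)" unfolding c_def using t0[of n] by simp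
  also have "\<dots> = (\<integral>x. ln (1 - \<phi> x) \<partial>lborel) - (\<integral>x. ln (1 - \<psi> n x) \<partial>lborel)"
   by (rule Bochner_Integration.integral_diff[OF li[OF \<phi> \<phi>1] li[OF \<psi>C \<psi>1]])
  finally show ?thesis by (simp add: b_def)
 qed
 have cl: "c \<longlonglongrightarrow> (\<integral>x. \<theta> x / (1 - \<phi> x) \<partial>lborel)" unfolding c_def
 proof (rule integral_dominated_convergence[where w = "\<lambda>x. 2 * \<theta> x"])
  have [measurable]: "\<theta> \<in> borel_measurable borel" "\<phi> \<in> borel_measurable borel" "\<psi> n \<in> borel_measurable borel" for n
   using Cc_borel \<theta> \<phi> \<psi>C by auto
  show "(\<lambda>x. \<theta> x / (1 - \<phi> x)) \<in> borel_measurable lborel" by measurable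
  show "(\<lambda>x. (ln (1 - \<phi> x) - ln (1 - \<psi> n x)) / t n) \<in> borel_measurable lborel" for n by measurable
  show "integrable lborel (\<lambda>x. 2 * \<theta> x)" using Cc_integrable[OF lborel_radon \<theta>] by simp
  show "AE x in lborel. (\<lambda>n. (ln (1 - \<phi> x) - ln (1 - \<psi> n x)) / t n) \<longlonglongrightarrow> \<theta> x / (1 - \<phi> x)"
  proof (rule AE_I2)
   fix x
   have p: "0 < 1 - \<phi> x" using \<phi>1[of x] by simp
   have "((\<lambda>s. - ln (1 - \<phi> x - s * \<theta> x)) has_real_derivative \<theta> x / (1 - \<phi> x)) (at 0)"
    using p by (auto intro!: derivative_eq_intros)
   then have d: "((\<lambda>h. (- ln (1 - \<phi> x - h * \<theta> x) - - ln (1 - \<phi> x)) / h) \<longlongrightarrow> \<theta> x / (1 - \<phi> x)) (at 0)"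
    by (simp add: DERIV_def)
   have "filterlim t (at 0) sequentially"
    by (rule filterlim_atI[OF tl]) (use t0 in \<open>auto simp: less_imp_neq[symmetric]\<close>)
   from filterlim_compose[OF d this]
   show "(\<lambda>n. (ln (1 - \<phi> x) - ln (1 - \<psi> n x)) / t n) \<longlonglongrightarrow> \<theta> x / (1 - \<phi> x)" by (simp add: \<psi>_def algebra_simps)
  qed
  show "AE x in lborel. norm ((ln (1 - \<phi> x) - ln (1 - \<psi> n x)) / t n) \<le> 2 * \<theta> x" for n
  proof (rule AE_I2)
   fix x
   have p: "1 \<le> 1 - \<phi> x" "1 / 2 \<le> 1 - \<psi> n x" "1 - \<psi> n x \<le> 1 - \<phi> x"
    using \<phi>0[of x] tC[of n x] t0[of n] \<theta>0[of x] by (auto simp: \<psi>_def)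
   \<comment> \<open>The inequality \<open>ln z \<le> z - 1\<close> leads to the dominating function
     \<open>2 * \<theta> x\<close> for the difference quotients of the logarithms.\<close>
   have "ln ((1 - \<phi> x) / (1 - \<psi> n x)) \<le> (1 - \<phi> x) / (1 - \<psi> n x) - 1" using p by (intro ln_le_minus_one) auto
   also have "\<dots> = t n * \<theta> x / (1 - \<psi> n x)" using p by (simp add: \<psi>_def field_simps)
   also have "\<dots> \<le> t n * \<theta> x / (1 / 2)"
    using p t0[of n] \<theta>0[of x] by (intro divide_left_mono) (auto intro!: mult_nonneg_nonneg)
   finally have "ln (1 - \<phi> x) - ln (1 - \<psi> n x) \<le> t n * (2 * \<theta> x)" using p by (simp add: ln_div)
   moreover have "0 \<le> ln (1 - \<phi> x) - ln (1 - \<psi> n x)" using p by simp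
   ultimately show "norm ((ln (1 - \<phi> x) - ln (1 - \<psi> n x)) / t n) \<le> 2 * \<theta> x" using t0[of n] by (simp add: field_simps)
  qed
 qed
 \<comment> \<open>Caratheodory's factor for \<open>exp\<close> at 0; a quotient by
   \<open>t n * c n\<close> would be meaningless where \<open>c n = 0\<close>.\<close>
 obtain g where g: "\<And>z. exp z - exp 0 = g z * (z - 0)" "isCont g (0::real)" "g 0 = 1"
  using DERIV_exp[of "0::real"] unfolding CARAT_DERIV by auto
 have "(\<integral>\<eta>. q n \<eta> \<partial>\<G>) = exp b * (g (t n * c n) * c n)" for n
 proof -
  have "(\<integral>\<eta>. q n \<eta> \<partial>\<G>) = ((\<integral>\<eta>. exp (\<integral>x. \<psi> n x \<partial>\<eta>) \<partial>\<G>) - (\<integral>\<eta>. exp (?A \<eta>) \<partial>\<G>)) / t n"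
   unfolding q_def using Lap[OF \<psi>C \<psi>1, of n] Lap[OF \<phi> \<phi>1] by (simp add: has_bochner_integral_iff)
  also have "\<dots> = (exp (b + t n * c n) - exp b) / t n"
   using Lap[OF \<psi>C \<psi>1, of n] Lap[OF \<phi> \<phi>1] by (simp add: has_bochner_integral_iff bc b_def)
  also have "\<dots> = exp b * ((exp (t n * c n) - exp 0) / t n)" by (simp add: exp_add algebra_simps)
  also have "\<dots> = exp b * (g (t n * c n) * c n)" unfolding g(1) using t0[of n] by simp
  finally show ?thesis .
 qed
 moreover have "(\<lambda>n. exp b * (g (t n * c n) * c n)) \<longlonglongrightarrow> exp b * (1 * (\<integral>x. \<theta> x / (1 - \<phi> x) \<partial>lborel))"
 proof (intro tendsto_intros cl)
  have "(\<lambda>n. t n * c n) \<longlonglongrightarrow> 0" using tendsto_mult[OF tl cl] by simp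
  then have "(\<lambda>n. g (t n * c n)) \<longlonglongrightarrow> g 0" by (rule isCont_tendsto_compose[OF g(2)])
  then show "(\<lambda>n. g (t n * c n)) \<longlonglongrightarrow> 1" by (simp add: g(3))
 qed
 ultimately have "(\<integral>\<eta>. exp (?A \<eta>) * ?Y \<eta> \<partial>\<G>) = exp b * (1 * (\<integral>x. \<theta> x / (1 - \<phi> x) \<partial>lborel))"
  using LIMSEQ_unique[OF L1(2)] by simp
 moreover have "(\<integral>\<eta>. exp (?A \<eta>) \<partial>\<G>) = exp b" using Lap[OF \<phi> \<phi>1] by (simp add: has_bochner_integral_iff b_def)
 ultimately show ?thesis using L1(1) by (simp add: has_bochner_integral_iff)
qed

text \<open>The intensity of the marks is \<open>exp (- s) / s\<close>; integration against \<eta>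
  counts an atom with its weight \<open>s\<close>, which cancels the singular factor.\<close>

definition mark_density :: "real \<Rightarrow> real" where "mark_density s = (if 0 < s then exp (- s) else 0)"

lemma mark_density: "0 \<le> mark_density s" "s \<le> 0 \<Longrightarrow> mark_density s = 0" by (auto simp: mark_density_def)

lemma mark_density_measurable [measurable]: "mark_density \<in> borel_measurable borel"
 unfolding mark_density_def[abs_def] by measurable

text \<open>The Laplace transform of the exponential law; it produces the factor
  \<open>1 / (1 - \<phi> x)\<close> of \<open>gamma_first_moment\<close>.\<close>

lemma mark_density_exp:
 assumes "a \<le> 0" shows "has_bochner_integral lborel (\<lambda>s. mark_density s * exp (s * a)) (1 / (1 - a))"
proof -
 have "(\<lambda>s. mark_density s * exp (s * a)) = (\<lambda>s. if 0 < s then exp (- s * (1 - a)) else 0)"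
  by (auto simp: mark_density_def fun_eq_iff exp_add[symmetric] algebra_simps)
 then show ?thesis using exp_weight_integral[of "1 - a"] assms by simp
qed

lemma mark_density_product_integrable:
 assumes \<psi>: "\<psi> \<in> Cc"
 shows "integrable lborel (\<lambda>p::'a::euclidean_space \<times> real. mark_density (snd p) * \<psi> (fst p))"
proof -
 have [measurable]: "\<psi> \<in> borel_measurable borel" by (rule Cc_borel[OF \<psi>])
 have "integrable (lborel \<Otimes>\<^sub>M lborel) (\<lambda>p::'a \<times> real. mark_density (snd p) * \<psi> (fst p))"
 proof (rule lborel_pair.Fubini_integrable)
  show "(\<lambda>p::'a \<times> real. mark_density (snd p) * \<psi> (fst p)) \<in> borel_measurable (lborel \<Otimes>\<^sub>M lborel)" by measurable
  have e: "has_bochner_integral lborel mark_density 1" using mark_density_exp[of 0] by simp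
  have "(\<integral>s. norm (mark_density s * \<psi> x) \<partial>lborel) = \<bar>\<psi> x\<bar>" for x
   using e by (simp add: abs_mult mark_density(1) has_bochner_integral_iff)
  then show "integrable lborel (\<lambda>x. \<integral>y. norm (mark_density (snd (x, y)) * \<psi> (fst (x, y))) \<partial>lborel)"
   using Cc_integrable[OF lborel_radon \<psi>] by simp
  show "AE x in lborel. integrable lborel (\<lambda>y. mark_density (snd (x, y)) * \<psi> (fst (x, y)))"
   using e by (simp add: has_bochner_integral_iff)
 qed
 then show ?thesis by (simp add: lborel_prod)
qed

section \<open>The Mecke identity for a gamma measure\<close>

locale gamma =
 fixes \<G> :: "'a::euclidean_space measure measure"
 assumes gamma: "gamma_measure \<G>"
begin

sublocale prob_space \<G> using gamma by (simp add: gamma_measure_def)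

lemma sets_G: "sets \<G> = sets Cc_sigma" using gamma sets_discrete_radon_space by (auto simp: gamma_measure_def)

lemma space_G: "space \<G> = \<K>" using sets_eq_imp_space_eq[OF sets_G] by simp

lemma measurable_G: "measurable \<G> N = measurable Cc_sigma N" by (rule measurable_cong_sets[OF sets_G refl])

sublocale G_lborel: pair_sigma_finite \<G> "lborel :: ('a \<times> real) measure" ..

abbreviation GL :: "('a measure \<times> 'a \<times> real) measure" where "GL \<equiv> \<G> \<Otimes>\<^sub>M lborel"

lemma pair_sets: "sets GL = sets (Cc_sigma \<Otimes>\<^sub>M borel)" by (rule sets_pair_measure_cong) (auto simp: sets_G)

lemma pair_measurable: "measurable GL N = measurable (Cc_sigma \<Otimes>\<^sub>M borel) N"
 by (rule measurable_cong_sets[OF pair_sets refl])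

lemma shift_measurable: "(\<lambda>q. (add_atom (fst q) (snd q), fst (snd q))) \<in> measurable GL (Cc_sigma \<Otimes>\<^sub>M borel)"
 unfolding pair_measurable
 by (intro measurable_Pair add_atom_measurable measurable_compose[OF measurable_snd borel_measurable_fst])

lemma integrable_snd:
 fixes w :: "'a \<times> real \<Rightarrow> real"
 assumes w: "integrable lborel w" shows "integrable GL (\<lambda>q. w (snd q))"
proof (rule G_lborel.Fubini_integrable)
 show "(\<lambda>q. w (snd q)) \<in> borel_measurable GL" using w by measurable
qed (use w in auto)

lemma integrable_Cc: "\<psi> \<in> Cc \<Longrightarrow> (\<And>x. 0 \<le> \<psi> x) \<Longrightarrow> integrable \<G> (\<lambda>\<eta>. \<integral>x. \<psi> x \<partial>\<eta>)"
 using gamma_first_moment[OF gamma Cc_zero, of \<psi>] by (auto simp: has_bochner_integral_iff)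

text \<open>The value 1 off \<open>\<K>\<close> makes \<open>exp_int_mult\<close> and the identity
  of \<open>exp_int\<close> at zero with the constant 1 hold as equations between functions on the
  whole type, as the monotone class argument requires.\<close>

definition exp_int :: "('a \<Rightarrow> real) \<Rightarrow> 'a measure \<Rightarrow> real" where
 "exp_int \<phi> \<eta> = (if \<eta> \<in> \<K> then exp (\<integral>x. \<phi> x \<partial>\<eta>) else 1)"

lemma exp_int_mult:
 assumes "\<phi> \<in> Cc" "\<phi>' \<in> Cc" shows "exp_int \<phi> \<eta> * exp_int \<phi>' \<eta> = exp_int (\<lambda>x. \<phi> x + \<phi>' x) \<eta>"
proof (cases "\<eta> \<in> \<K>")
 case True
 then have "\<eta> \<in> radon_measures" using discrete_radon_subset by auto
 then have "(\<integral>x. \<phi> x + \<phi>' x \<partial>\<eta>) = (\<integral>x. \<phi> x \<partial>\<eta>) + (\<integral>x. \<phi>' x \<partial>\<eta>)"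
  using assms by (intro Bochner_Integration.integral_add Cc_integrable)
 then show ?thesis using True by (simp add: exp_int_def exp_add)
qed (simp add: exp_int_def)

lemma exp_int_measurable:
 assumes "\<phi> \<in> Cc" shows "exp_int \<phi> \<in> borel_measurable Cc_sigma"
proof -
 have [measurable]: "(\<lambda>\<eta>. \<integral>x. \<phi> x \<partial>\<eta>) \<in> borel_measurable Cc_sigma" by (rule Cc_sigma_integral_measurable[OF assms])
 have "(\<lambda>\<eta>. exp (\<integral>x. \<phi> x \<partial>\<eta>)) \<in> borel_measurable Cc_sigma" by measurable
 then show ?thesis by (subst measurable_cong[where g = "\<lambda>\<eta>. exp (\<integral>x. \<phi> x \<partial>\<eta>)"]) (simp_all add: exp_int_def)
qed

lemma exp_int_bounds:
 assumes "\<And>x. \<phi> x \<le> 0" shows "0 \<le> exp_int \<phi> \<eta>" "exp_int \<phi> \<eta> \<le> 1"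
proof -
 have "0 \<le> (\<integral>x. - \<phi> x \<partial>\<eta>)" using assms by (intro integral_nonneg_AE) simp
 then show "0 \<le> exp_int \<phi> \<eta>" "exp_int \<phi> \<eta> \<le> 1" by (auto simp: exp_int_def)
qed

text \<open>The integrand on the right of the Mecke identity, with the new atom already inserted.
  The spatial weight \<psi> makes both sides of the identity finite.\<close>

definition palm :: "('a \<Rightarrow> real) \<Rightarrow> ('a measure \<times> 'a \<Rightarrow> real) \<Rightarrow> 'a measure \<times> ('a \<times> real) \<Rightarrow> real" where
 "palm \<psi> f q = f (add_atom (fst q) (snd q), fst (snd q)) * (mark_density (snd (snd q)) * \<psi> (fst (snd q)))"

context
 fixes \<psi> :: "'a \<Rightarrow> real"
 assumes \<psi>: "\<psi> \<in> Cc" and \<psi>0: "\<And>x. 0 \<le> \<psi> x"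
begin

text \<open>For bounded integrands the left side is dominated by a multiple of the first moment of
  \<psi>, the right side by an integrable function of the new atom alone.\<close>

lemma weighted_integral:
 assumes f: "f \<in> bdd_mble (Cc_sigma \<Otimes>\<^sub>M borel)"
 shows "integrable \<G> (\<lambda>\<eta>. \<integral>x. f (\<eta>, x) * \<psi> x \<partial>\<eta>)" (is "?claim1") "\<eta> \<in> \<K> \<Longrightarrow> integrable \<eta> (\<lambda>x. f (\<eta>, x) * \<psi> x)"
  "integrable GL (palm \<psi> f)"
proof -
 have m: "f \<in> borel_measurable (Cc_sigma \<Otimes>\<^sub>M borel)" using f by (simp add: bdd_mble_def)
 obtain C where C: "\<And>\<eta> x. \<eta> \<in> \<K> \<Longrightarrow> \<bar>f (\<eta>, x)\<bar> \<le> C" using f by (auto simp: bdd_mble_def space_pair_measure)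
 have i: "integrable \<eta> (\<lambda>x. f (\<eta>, x) * \<psi> x)" if "\<eta> \<in> \<K>" for \<eta>
  by (rule weighted_integrable[OF that \<psi> slice_measurable[OF m]]) (use that C in auto)
 then show "\<eta> \<in> \<K> \<Longrightarrow> integrable \<eta> (\<lambda>x. f (\<eta>, x) * \<psi> x)" .
 show ?claim1
 proof (rule Bochner_Integration.integrable_bound)
  show "integrable \<G> (\<lambda>\<eta>. C * (\<integral>x. \<psi> x \<partial>\<eta>))" using integrable_Cc[OF \<psi> \<psi>0] by simp
  show "(\<lambda>\<eta>. \<integral>x. f (\<eta>, x) * \<psi> x \<partial>\<eta>) \<in> borel_measurable \<G>" unfolding measurable_G
   by (rule kernel_integral_measurable[OF measurable_ident \<psi> m, of C, unfolded id_apply]) (use C in auto)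
  show "AE \<eta> in \<G>. norm (\<integral>x. f (\<eta>, x) * \<psi> x \<partial>\<eta>) \<le> norm (C * (\<integral>x. \<psi> x \<partial>\<eta>))"
  proof (rule AE_I2)
   fix \<eta> assume "\<eta> \<in> space \<G>"
   then have \<eta>: "\<eta> \<in> \<K>" by (simp add: space_G)
   have "norm (\<integral>x. f (\<eta>, x) * \<psi> x \<partial>\<eta>) \<le> (\<integral>x. norm (f (\<eta>, x) * \<psi> x) \<partial>\<eta>)" by (rule integral_norm_bound)
   also have "\<dots> \<le> (\<integral>x. C * \<psi> x \<partial>\<eta>)"
   proof (rule integral_mono)
    show "integrable \<eta> (\<lambda>x. norm (f (\<eta>, x) * \<psi> x))" using i[OF \<eta>] by simp
    show "integrable \<eta> (\<lambda>x. C * \<psi> x)" using Cc_integrable[OF _ \<psi>, of \<eta>] \<eta> discrete_radon_subset by auto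
    show "norm (f (\<eta>, x) * \<psi> x) \<le> C * \<psi> x" for x
     using C[OF \<eta>, of x] \<psi>0[of x] by (simp add: abs_mult mult_right_mono)
   qed
   finally show "norm (\<integral>x. f (\<eta>, x) * \<psi> x \<partial>\<eta>) \<le> norm (C * (\<integral>x. \<psi> x \<partial>\<eta>))" by simp
  qed
 qed
 show "integrable GL (palm \<psi> f)"
 proof (rule Bochner_Integration.integrable_bound)
  show "integrable GL (\<lambda>q. C * (mark_density (snd (snd q)) * \<psi> (fst (snd q))))"
   using integrable_snd[OF mark_density_product_integrable[OF \<psi>]] by simp
  then have "(\<lambda>q. mark_density (snd (snd q)) * \<psi> (fst (snd q))) \<in> borel_measurable GL"
   using integrable_snd[OF mark_density_product_integrable[OF \<psi>]] by (simp add: borel_measurable_integrable)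
  then show "palm \<psi> f \<in> borel_measurable GL" unfolding palm_def[abs_def]
   by (rule borel_measurable_times[OF measurable_compose[OF shift_measurable m]])
  show "AE q in GL. norm (palm \<psi> f q) \<le> norm (C * (mark_density (snd (snd q)) * \<psi> (fst (snd q))))"
  proof (rule AE_I2)
   fix q :: "'a measure \<times> 'a \<times> real" assume "q \<in> space GL"
   then have "fst q \<in> \<K>" by (auto simp: space_pair_measure space_G)
   then have "\<bar>f (add_atom (fst q) (snd q), fst (snd q))\<bar> \<le> \<bar>C\<bar>" 
    by (intro order_trans[OF C[OF add_atom_dr] abs_ge_self])
   then show "norm (palm \<psi> f q) \<le> norm (C * (mark_density (snd (snd q)) * \<psi> (fst (snd q))))"
    unfolding palm_def real_norm_def abs_mult[of _ "mark_density _ * _"] by (intro mult_right_mono) auto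
  qed
 qed
qed

text \<open>Adding the atom \<open>(x, s)\<close> multiplies the exponential by
  \<open>exp (s * \<phi> x)\<close>. Integration over \<open>s\<close> against the mark density
  leaves \<open>1 / (1 - \<phi> x)\<close>, and this is \<open>gamma_first_moment\<close> for the
  function \<open>\<psi> * \<theta>\<close>.\<close>

lemma Mecke_product:
 assumes \<phi>: "\<phi> \<in> Cc" and \<phi>0: "\<And>x. \<phi> x \<le> 0" and \<theta>: "continuous_on UNIV \<theta>" and \<theta>01: "\<And>x. 0 \<le> \<theta> x \<and> \<theta> x \<le> 1"
 defines "f \<equiv> (\<lambda>(\<eta>, x). exp_int \<phi> \<eta> * \<theta> x)"
 shows "f \<in> bdd_mble (Cc_sigma \<Otimes>\<^sub>M borel)"
  and "(\<integral>\<eta>. (\<integral>x. f (\<eta>, x) * \<psi> x \<partial>\<eta>) \<partial>\<G>) = (\<integral>q. palm \<psi> f q \<partial>GL)" (is "?claim1")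
proof -
 have [measurable]: "exp_int \<phi> \<in> borel_measurable Cc_sigma" by (rule exp_int_measurable[OF \<phi>])
 have [measurable]: "\<theta> \<in> borel_measurable borel" by (rule borel_measurable_continuous_onI[OF \<theta>])
 have "\<bar>f p\<bar> \<le> 1" for p
  unfolding f_def using \<theta>01 exp_int_bounds[OF \<phi>0] by (auto simp: case_prod_beta abs_mult intro!: mult_le_one)
 moreover have "f \<in> borel_measurable (Cc_sigma \<Otimes>\<^sub>M borel)" unfolding f_def by measurable
 ultimately show fb: "f \<in> bdd_mble (Cc_sigma \<Otimes>\<^sub>M borel)" unfolding bdd_mble_def by blast
 define \<kappa> where "\<kappa> x = \<psi> x * \<theta> x" for x
 have \<kappa>C: "\<kappa> \<in> Cc" unfolding \<kappa>_def[abs_def] by (rule Cc_mult[OF \<psi> \<theta>])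
 have \<kappa>0: "0 \<le> \<kappa> x" for x using \<psi>0 \<theta>01 by (simp add: \<kappa>_def)
 have "(\<integral>x. f (\<eta>, x) * \<psi> x \<partial>\<eta>) = exp (\<integral>x. \<phi> x \<partial>\<eta>) * (\<integral>x. \<kappa> x \<partial>\<eta>)" if \<eta>: "\<eta> \<in> space \<G>" for \<eta>
 proof -
  have "(\<lambda>x. f (\<eta>, x) * \<psi> x) = (\<lambda>x. exp (\<integral>x. \<phi> x \<partial>\<eta>) * \<kappa> x)" 
   using \<eta> by (simp add: f_def \<kappa>_def fun_eq_iff exp_int_def space_G)
  then show ?thesis by (simp only: integral_mult_right_zero)
 qed
 then have "(\<integral>\<eta>. (\<integral>x. f (\<eta>, x) * \<psi> x \<partial>\<eta>) \<partial>\<G>) = (\<integral>\<eta>. exp (\<integral>x. \<phi> x \<partial>\<eta>) * (\<integral>x. \<kappa> x \<partial>\<eta>) \<partial>\<G>)"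
  by (rule Bochner_Integration.integral_cong[OF refl])
 then have L: "(\<integral>\<eta>. (\<integral>x. f (\<eta>, x) * \<psi> x \<partial>\<eta>) \<partial>\<G>) = (\<integral>\<eta>. exp (\<integral>x. \<phi> x \<partial>\<eta>) \<partial>\<G>) * (\<integral>x. \<kappa> x / (1 - \<phi> x) \<partial>lborel)"
  using gamma_first_moment[OF gamma \<phi> \<phi>0 \<kappa>C \<kappa>0] by (simp add: has_bochner_integral_iff)
 define K where "K p = mark_density (snd p) * exp (snd p * \<phi> (fst p)) * \<kappa> (fst p)" for p :: "'a \<times> real"
 have Ki: "integrable (lborel \<Otimes>\<^sub>M lborel) K"
 proof (rule Bochner_Integration.integrable_bound)
  show "integrable (lborel \<Otimes>\<^sub>M lborel) (\<lambda>p::'a \<times> real. mark_density (snd p) * \<kappa> (fst p))"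
   unfolding lborel_prod by (rule mark_density_product_integrable[OF \<kappa>C])
  have [measurable]: "\<phi> \<in> borel_measurable borel" "\<kappa> \<in> borel_measurable borel" using Cc_borel \<phi> \<kappa>C by auto
  show "K \<in> borel_measurable (lborel \<Otimes>\<^sub>M lborel)" unfolding K_def[abs_def] by measurable
  have "norm (K p) \<le> norm (mark_density (snd p) * \<kappa> (fst p))" for p
  proof (cases "0 < snd p")
   case True
   then have "exp (snd p * \<phi> (fst p)) \<le> 1" using \<phi>0[of "fst p"] by (simp add: mult_nonneg_nonpos)
   then have "mark_density (snd p) * exp (snd p * \<phi> (fst p)) \<le> mark_density (snd p)"
    using mark_density(1) by (simp add: mult_left_le)
   then show ?thesis unfolding K_def using mark_density(1)[of "snd p"] \<kappa>0[of "fst p"]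
    by (simp add: abs_mult mult_right_mono)
  qed (simp add: K_def mark_density(2))
  then show "AE p in lborel \<Otimes>\<^sub>M lborel. norm (K p) \<le> norm (mark_density (snd p) * \<kappa> (fst p))" by simp
 qed
 have "(\<integral>p. K p \<partial>lborel) = (\<integral>x. (\<integral>s. K (x, s) \<partial>lborel) \<partial>lborel)"
  unfolding lborel_pair.integral_fst'[OF Ki] lborel_prod ..
 also have "\<dots> = (\<integral>x. \<kappa> x / (1 - \<phi> x) \<partial>lborel)"
 proof (rule Bochner_Integration.integral_cong[OF refl])
  show "(\<integral>s. K (x, s) \<partial>lborel) = \<kappa> x / (1 - \<phi> x)" for x
   using mark_density_exp[OF \<phi>0[of x]] by (simp add: K_def has_bochner_integral_iff)
 qed
 finally have Kint: "(\<integral>p. K p \<partial>lborel) = (\<integral>x. \<kappa> x / (1 - \<phi> x) \<partial>lborel)" .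
 have pK: "palm \<psi> f (\<eta>, p) = exp (\<integral>x. \<phi> x \<partial>\<eta>) * K p" if "\<eta> \<in> \<K>" for \<eta> p
 proof (cases "0 < snd p")
  case True
  then show ?thesis
   by (simp add: palm_def f_def K_def \<kappa>_def exp_int_def add_atom_dr[OF that] integral_add_atom[OF that \<phi>] exp_add mult_ac)
 qed (simp add: palm_def K_def mark_density(2))
 have "(\<integral>q. palm \<psi> f q \<partial>GL) = (\<integral>\<eta>. (\<integral>p. palm \<psi> f (\<eta>, p) \<partial>lborel) \<partial>\<G>)"
  by (rule G_lborel.integral_fst'[OF weighted_integral(3)[OF fb], symmetric])
 also have "\<dots> = (\<integral>\<eta>. exp (\<integral>x. \<phi> x \<partial>\<eta>) * (\<integral>p. K p \<partial>lborel) \<partial>\<G>)"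
  by (rule Bochner_Integration.integral_cong) (auto simp: space_G pK)
 also have "\<dots> = (\<integral>\<eta>. exp (\<integral>x. \<phi> x \<partial>\<eta>) \<partial>\<G>) * (\<integral>x. \<kappa> x / (1 - \<phi> x) \<partial>lborel)" by (simp add: Kint)
 finally show ?claim1 using L by simp
qed

text \<open>Exponents are restricted to nonpositive functions so that the exponentials are bounded.
  They suffice, because every \<open>Cc\<close> function is a difference of two nonpositive
  ones.\<close>

lemma exp_integrals_generate: "sets (Cc_sigma :: 'a measure measure) \<subseteq> sigma_sets (space Cc_sigma)
  {f -` {a<..} \<inter> space Cc_sigma |f a. f \<in> {exp_int \<phi> |\<phi>. \<phi> \<in> (Cc :: ('a \<Rightarrow> real) set) \<and> (\<forall>x. \<phi> x \<le> 0)}}"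
  (is "_ \<subseteq> sigma_sets _ ?G")
proof -
 define S where "S = sigma (\<K> :: 'a measure set) ?G"
 have sS: "sets S = sigma_sets \<K> ?G" unfolding S_def by (rule sets_measure_of) auto
 have spS: "space S = \<K>" unfolding S_def by (rule space_measure_of) auto
 have neg: "(\<lambda>\<eta>. \<integral>x. \<phi> x \<partial>\<eta>) \<in> borel_measurable S" if \<phi>: "\<phi> \<in> Cc" "\<And>x. \<phi> x \<le> 0" for \<phi> :: "'a \<Rightarrow> real"
  unfolding borel_measurable_iff_greater
 proof
  fix a
  have "exp_int \<phi> -` {exp a<..} \<inter> space Cc_sigma \<in> sets S" unfolding sS using \<phi> by (intro sigma_sets.Basic) blast
  moreover have "exp_int \<phi> -` {exp a<..} \<inter> space Cc_sigma = {\<eta> \<in> space S. a < (\<integral>x. \<phi> x \<partial>\<eta>)}"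
   by (auto simp: spS exp_int_def)
  ultimately show "{\<eta> \<in> space S. a < (\<integral>x. \<phi> x \<partial>\<eta>)} \<in> sets S" by simp
 qed
 have "(\<lambda>\<eta>. \<integral>x. f x \<partial>\<eta>) \<in> borel_measurable S" if f: "f \<in> Cc" for f :: "'a \<Rightarrow> real"
 proof -
  define k where "k x = max (f x) 0" for x
  have kC: "k \<in> Cc" unfolding k_def[abs_def] by (rule Cc_max[OF f Cc_zero])
  have 1: "(\<lambda>x. - k x) \<in> Cc" using Cc_lin[OF kC kC, of "-1" 0] by simp
  have 2: "(\<lambda>x. f x - k x) \<in> Cc" using Cc_lin[OF f kC, of 1 "-1"] by simp
  have [measurable]: "(\<lambda>\<eta>. \<integral>x. - k x \<partial>\<eta>) \<in> borel_measurable S" by (rule neg[OF 1]) (simp add: k_def)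
  have [measurable]: "(\<lambda>\<eta>. \<integral>x. f x - k x \<partial>\<eta>) \<in> borel_measurable S" by (rule neg[OF 2]) (simp add: k_def)
  have "(\<integral>x. f x \<partial>\<eta>) = (\<integral>x. f x - k x \<partial>\<eta>) - (\<integral>x. - k x \<partial>\<eta>)" if "\<eta> \<in> space S" for \<eta>
  proof -
   have "\<eta> \<in> radon_measures" using that spS discrete_radon_subset by auto
   then show ?thesis using Cc_integrable[OF _ f, of \<eta>] Cc_integrable[OF _ kC, of \<eta>] by simp
  qed
  moreover have "(\<lambda>\<eta>. (\<integral>x. f x - k x \<partial>\<eta>) - (\<integral>x. - k x \<partial>\<eta>)) \<in> borel_measurable S" by measurable
  ultimately show ?thesis by (subst measurable_cong) auto
 qed
 then have id: "(\<lambda>\<eta>. \<eta>) \<in> measurable S Cc_sigma" by (intro measurable_Cc_sigmaI) (auto simp: spS)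
 have "A \<in> sets S" if "A \<in> sets Cc_sigma" for A :: "'a measure set"
  using measurable_sets[OF id that] sets.sets_into_space[OF that] spS by (simp add: Int_absorb2)
 then show ?thesis unfolding sS by auto
qed

text \<open>The products of \<open>Mecke_product\<close> are closed under multiplication and
  generate the product \<sigma>-algebra; both sides are linear and stable under bounded limits by
  dominated convergence.\<close>

lemma Mecke_weighted:
 assumes fm: "f \<in> borel_measurable (Cc_sigma \<Otimes>\<^sub>M borel)" and fC: "\<And>p. \<bar>f p\<bar> \<le> C"
 shows "(\<integral>\<eta>. (\<integral>x. f (\<eta>, x) * \<psi> x \<partial>\<eta>) \<partial>\<G>) = (\<integral>q. palm \<psi> f q \<partial>GL)"
proof -
 define A where "A = {exp_int \<phi> |\<phi>. \<phi> \<in> (Cc :: ('a \<Rightarrow> real) set) \<and> (\<forall>x. \<phi> x \<le> 0)}"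
 define M where "M = {\<lambda>(\<eta>, x). a \<eta> * \<theta> x |a \<theta>. a \<in> A \<and> continuous_on UNIV \<theta> \<and> (\<forall>x::'a. 0 \<le> \<theta> x \<and> \<theta> x \<le> 1)}"
 define P where "P f \<longleftrightarrow> f \<in> bdd_mble (Cc_sigma \<Otimes>\<^sub>M borel) \<and>
  (\<integral>\<eta>. (\<integral>x. f (\<eta>, x) * \<psi> x \<partial>\<eta>) \<partial>\<G>) = (\<integral>q. palm \<psi> f q \<partial>GL)" for f
 have sp: "space (Cc_sigma \<Otimes>\<^sub>M (borel :: 'a measure)) = space Cc_sigma \<times> UNIV" by (simp add: space_pair_measure)
 have ME: "\<exists>\<phi> \<theta>. f = (\<lambda>(\<eta>, x). exp_int \<phi> \<eta> * \<theta> x) \<and> \<phi> \<in> Cc \<and> (\<forall>x. \<phi> x \<le> 0) \<and> continuous_on UNIV \<theta> \<and> (\<forall>x. 0 \<le> \<theta> x \<and> \<theta> x \<le> 1)"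
  if "f \<in> M" for f
 proof -
  have "\<exists>a \<theta>. f = (\<lambda>(\<eta>, x). a \<eta> * \<theta> x) \<and> a \<in> A \<and> continuous_on UNIV \<theta> \<and> (\<forall>x. 0 \<le> \<theta> x \<and> \<theta> x \<le> 1)"
   using that unfolding M_def by (rule CollectD)
  then obtain a \<theta> where 1: "f = (\<lambda>(\<eta>, x). a \<eta> * \<theta> x) \<and> a \<in> A \<and> continuous_on UNIV \<theta> \<and> (\<forall>x. 0 \<le> \<theta> x \<and> \<theta> x \<le> 1)"
   by (elim exE) (rule that)
  obtain \<phi> where 2: "a = exp_int \<phi>" "\<phi> \<in> Cc" "\<forall>x. \<phi> x \<le> 0" using 1 unfolding A_def by auto
  show ?thesis by (rule exI[of _ \<phi>], rule exI[of _ \<theta>]) (use 1 2 in simp)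
 qed
 have base: "P f" if f: "f \<in> M" for f
 proof -
  obtain \<phi> \<theta> where "f = (\<lambda>(\<eta>, x). exp_int \<phi> \<eta> * \<theta> x)" "\<phi> \<in> Cc" "\<And>x. \<phi> x \<le> 0" "continuous_on UNIV \<theta>" "\<And>x. 0 \<le> \<theta> x \<and> \<theta> x \<le> 1"
   using ME[OF f] by (elim exE conjE) (rule that, assumption+, erule spec, assumption, erule spec)
  then show ?thesis unfolding P_def using Mecke_product[of \<phi> \<theta>] by simp
 qed
 have one: "(\<lambda>_. 1) \<in> A" unfolding A_def using Cc_zero by (intro CollectI exI[of _ "\<lambda>_. 0"]) (simp add: exp_int_def fun_eq_iff)
 have "P f"
 proof (rule monotone_class_induct[where N = "Cc_sigma \<Otimes>\<^sub>M borel" and M = M and \<Omega> = "space Cc_sigma \<times> UNIV" and P = P])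
  show "sets (Cc_sigma \<Otimes>\<^sub>M borel) \<subseteq> sigma_sets (space Cc_sigma \<times> UNIV) {f -` {a<..} \<inter> space Cc_sigma \<times> UNIV |f a. f \<in> M}"
  proof (rule product_borel_generated[OF exp_integrals_generate[folded A_def] one])
   show "(\<lambda>(n, y). a n * \<theta> y) \<in> M" if "a \<in> A" "continuous_on UNIV \<theta>" "\<And>y. 0 \<le> \<theta> y \<and> \<theta> y \<le> 1" for a \<theta>
    unfolding M_def using that by blast
  qed
  show "(\<lambda>x. f x * g x) \<in> M" if f: "f \<in> M" and g: "g \<in> M" for f g
  proof -
   obtain \<phi> \<theta> where 1: "f = (\<lambda>(\<eta>, x). exp_int \<phi> \<eta> * \<theta> x)" "\<phi> \<in> Cc" "\<And>x. \<phi> x \<le> 0" "continuous_on UNIV \<theta>" "\<And>x. 0 \<le> \<theta> x \<and> \<theta> x \<le> 1"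
    using ME[OF f] by (elim exE conjE) (rule that, assumption+, erule spec, assumption, erule spec)
   obtain \<phi>' \<theta>' where 2: "g = (\<lambda>(\<eta>, x). exp_int \<phi>' \<eta> * \<theta>' x)" "\<phi>' \<in> Cc" "\<And>x. \<phi>' x \<le> 0" "continuous_on UNIV \<theta>'" "\<And>x. 0 \<le> \<theta>' x \<and> \<theta>' x \<le> 1"
    using ME[OF g] by (elim exE conjE) (rule that, assumption+, erule spec, assumption, erule spec)
   have h1: "exp_int (\<lambda>x. \<phi> x + \<phi>' x) \<in> A" unfolding A_def
    using Cc_add[OF 1(2) 2(2)] add_nonpos_nonpos[OF 1(3) 2(3)] by blast
   have h2: "continuous_on UNIV (\<lambda>x. \<theta> x * \<theta>' x)" by (intro continuous_intros 1(4) 2(4))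
   have h3: "0 \<le> \<theta> x * \<theta>' x \<and> \<theta> x * \<theta>' x \<le> 1" for x using 1(5)[of x] 2(5)[of x] by (auto intro: mult_le_one)
   have h4: "(\<lambda>x. f x * g x) = (\<lambda>(\<eta>, x). exp_int (\<lambda>x. \<phi> x + \<phi>' x) \<eta> * (\<theta> x * \<theta>' x))"
    unfolding 1(1) 2(1) by (auto simp: fun_eq_iff exp_int_mult[OF 1(2) 2(2), symmetric])
   show ?thesis unfolding M_def mem_Collect_eq
    by (rule exI[of _ "exp_int (\<lambda>x. \<phi> x + \<phi>' x)"], rule exI[of _ "\<lambda>x. \<theta> x * \<theta>' x"], intro conjI allI)
     (rule h4 h1 h2 h3[THEN conjunct1] h3[THEN conjunct2])+
  qed
  show "\<exists>C. \<forall>x\<in>space Cc_sigma \<times> UNIV. \<bar>f x\<bar> \<le> C" if "f \<in> M" for f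
   using base[OF that] by (auto simp: P_def bdd_mble_def sp)
  show "\<bar>f x\<bar> \<le> C" for x by (rule fC)
  show "P f" if "f \<in> M" for f by (rule base[OF that])
  show "P (\<lambda>x. 1)"
  proof (rule base)
   show "(\<lambda>x. 1) \<in> M" unfolding M_def using one by (intro CollectI exI[of _ "\<lambda>_. 1"]) auto
  qed
  show "P (\<lambda>x. a * f x + b * g x)" if "P f" "P g" for f g a b
  proof -
   have fb: "f \<in> bdd_mble (Cc_sigma \<Otimes>\<^sub>M borel)" and gb: "g \<in> bdd_mble (Cc_sigma \<Otimes>\<^sub>M borel)" using that by (auto simp: P_def)
   obtain C D where C: "\<And>p. p \<in> space Cc_sigma \<times> UNIV \<Longrightarrow> \<bar>f p\<bar> \<le> C" and D: "\<And>p. p \<in> space Cc_sigma \<times> UNIV \<Longrightarrow> \<bar>g p\<bar> \<le> D"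
    using fb gb unfolding bdd_mble_def sp by blast
   have "\<bar>a * f p + b * g p\<bar> \<le> \<bar>a\<bar> * C + \<bar>b\<bar> * D" if p: "p \<in> space Cc_sigma \<times> UNIV" for p
   proof -
    have "\<bar>a * f p\<bar> \<le> \<bar>a\<bar> * C" "\<bar>b * g p\<bar> \<le> \<bar>b\<bar> * D"
     unfolding abs_mult using C[OF p] D[OF p] by (auto intro: mult_left_mono)
    then show ?thesis by linarith
   qed
   moreover have "(\<lambda>x. a * f x + b * g x) \<in> borel_measurable (Cc_sigma \<Otimes>\<^sub>M borel)" using fb gb by (auto simp: bdd_mble_def)
   ultimately have m: "(\<lambda>x. a * f x + b * g x) \<in> bdd_mble (Cc_sigma \<Otimes>\<^sub>M borel)" unfolding bdd_mble_def sp by blast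
   have "(\<integral>x. (a * f (\<eta>, x) + b * g (\<eta>, x)) * \<psi> x \<partial>\<eta>) = a * (\<integral>x. f (\<eta>, x) * \<psi> x \<partial>\<eta>) + b * (\<integral>x. g (\<eta>, x) * \<psi> x \<partial>\<eta>)"
    if \<eta>: "\<eta> \<in> space \<G>" for \<eta>
   proof -
    have "(\<integral>x. (a * f (\<eta>, x) + b * g (\<eta>, x)) * \<psi> x \<partial>\<eta>) = (\<integral>x. a * (f (\<eta>, x) * \<psi> x) + b * (g (\<eta>, x) * \<psi> x) \<partial>\<eta>)"
     by (simp add: algebra_simps)
    then show ?thesis using weighted_integral(2)[OF fb, of \<eta>] weighted_integral(2)[OF gb, of \<eta>] \<eta> by (simp add: space_G)
   qed
   then have "(\<integral>\<eta>. (\<integral>x. (a * f (\<eta>, x) + b * g (\<eta>, x)) * \<psi> x \<partial>\<eta>) \<partial>\<G>) =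
    (\<integral>\<eta>. a * (\<integral>x. f (\<eta>, x) * \<psi> x \<partial>\<eta>) + b * (\<integral>x. g (\<eta>, x) * \<psi> x \<partial>\<eta>) \<partial>\<G>)"
    by (rule Bochner_Integration.integral_cong[OF refl])
   also have "\<dots> = a * (\<integral>q. palm \<psi> f q \<partial>GL) + b * (\<integral>q. palm \<psi> g q \<partial>GL)"
    using that weighted_integral(1)[OF fb] weighted_integral(1)[OF gb] by (simp add: P_def)
   also have "\<dots> = (\<integral>q. a * palm \<psi> f q + b * palm \<psi> g q \<partial>GL)"
    using weighted_integral(3)[OF fb] weighted_integral(3)[OF gb] by simp
   also have "(\<lambda>q. a * palm \<psi> f q + b * palm \<psi> g q) = palm \<psi> (\<lambda>x. a * f x + b * g x)"
    by (simp add: palm_def fun_eq_iff algebra_simps)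
   finally show ?thesis using m unfolding P_def by simp
  qed
  show "P f" if Pn: "\<And>n. P (fn n)" and C: "\<And>n x. x \<in> space Cc_sigma \<times> UNIV \<Longrightarrow> \<bar>fn n x\<bar> \<le> C"
   and lim: "\<And>x. x \<in> space Cc_sigma \<times> UNIV \<Longrightarrow> (\<lambda>n. fn n x) \<longlonglongrightarrow> f x" for fn f C
  proof -
   have fnb: "fn n \<in> bdd_mble (Cc_sigma \<Otimes>\<^sub>M borel)" for n using Pn[of n] by (simp add: P_def)
   have m: "f \<in> borel_measurable (Cc_sigma \<Otimes>\<^sub>M borel)"
    by (rule borel_measurable_LIMSEQ_real[of _ fn]) (use lim sp fnb in \<open>auto simp: bdd_mble_def\<close>)
   have "\<bar>f p\<bar> \<le> C" if p: "p \<in> space Cc_sigma \<times> UNIV" for p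
    by (rule LIMSEQ_le_const2[OF tendsto_rabs[OF lim[OF p]]]) (use C[OF p] in auto)
   then have fb: "f \<in> bdd_mble (Cc_sigma \<Otimes>\<^sub>M borel)" unfolding bdd_mble_def sp using m by blast
   have absC: "(\<lambda>p. \<bar>C\<bar>) \<in> bdd_mble (Cc_sigma \<Otimes>\<^sub>M (borel :: 'a measure))" by (auto simp: bdd_mble_def)
   note wC = weighted_integral[OF absC]
   have inner: "(\<lambda>n. \<integral>x. fn n (\<eta>, x) * \<psi> x \<partial>\<eta>) \<longlonglongrightarrow> (\<integral>x. f (\<eta>, x) * \<psi> x \<partial>\<eta>)" 
    and innerb: "\<And>n. norm (\<integral>x. fn n (\<eta>, x) * \<psi> x \<partial>\<eta>) \<le> (\<integral>x. \<bar>C\<bar> * \<psi> x \<partial>\<eta>)" if \<eta>: "\<eta> \<in> \<K>" for \<eta>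
   proof -
    have b: "norm (fn n (\<eta>, x) * \<psi> x) \<le> \<bar>C\<bar> * \<psi> x" for n x
    proof -
     have "\<bar>fn n (\<eta>, x)\<bar> \<le> \<bar>C\<bar>" using C[of "(\<eta>, x)" n] \<eta> by auto
     then show ?thesis using \<psi>0[of x] by (simp add: abs_mult mult_right_mono)
    qed
    show "(\<lambda>n. \<integral>x. fn n (\<eta>, x) * \<psi> x \<partial>\<eta>) \<longlonglongrightarrow> (\<integral>x. f (\<eta>, x) * \<psi> x \<partial>\<eta>)"
    proof (rule integral_dominated_convergence[OF _ _ wC(2)[OF \<eta>]])
     show "(\<lambda>x. f (\<eta>, x) * \<psi> x) \<in> borel_measurable \<eta>" using weighted_integral(2)[OF fb \<eta>] by auto
     show "(\<lambda>x. fn i (\<eta>, x) * \<psi> x) \<in> borel_measurable \<eta>" for i using weighted_integral(2)[OF fnb \<eta>] by auto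
     show "AE x in \<eta>. (\<lambda>i. fn i (\<eta>, x) * \<psi> x) \<longlonglongrightarrow> f (\<eta>, x) * \<psi> x"
      by (rule AE_I2, intro tendsto_intros lim) (use \<eta> in auto)
    qed (use b in simp)
    show "norm (\<integral>x. fn n (\<eta>, x) * \<psi> x \<partial>\<eta>) \<le> (\<integral>x. \<bar>C\<bar> * \<psi> x \<partial>\<eta>)" for n
     by (rule order_trans[OF integral_norm_bound integral_mono[OF _ wC(2)[OF \<eta>] b]])
      (use weighted_integral(2)[OF fnb \<eta>] in simp)
   qed
   have "(\<lambda>n. \<integral>\<eta>. (\<integral>x. fn n (\<eta>, x) * \<psi> x \<partial>\<eta>) \<partial>\<G>) \<longlonglongrightarrow> (\<integral>\<eta>. (\<integral>x. f (\<eta>, x) * \<psi> x \<partial>\<eta>) \<partial>\<G>)"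
   proof (rule integral_dominated_convergence[OF _ _ wC(1)])
    show "(\<lambda>\<eta>. \<integral>x. f (\<eta>, x) * \<psi> x \<partial>\<eta>) \<in> borel_measurable \<G>" using weighted_integral(1)[OF fb] by auto
    show "(\<lambda>\<eta>. \<integral>x. fn n (\<eta>, x) * \<psi> x \<partial>\<eta>) \<in> borel_measurable \<G>" for n using weighted_integral(1)[OF fnb] by auto
    show "AE \<eta> in \<G>. (\<lambda>n. \<integral>x. fn n (\<eta>, x) * \<psi> x \<partial>\<eta>) \<longlonglongrightarrow> (\<integral>x. f (\<eta>, x) * \<psi> x \<partial>\<eta>)"
     by (rule AE_I2, rule inner) (simp add: space_G)
    show "AE \<eta> in \<G>. norm (\<integral>x. fn n (\<eta>, x) * \<psi> x \<partial>\<eta>) \<le> (\<integral>x. \<bar>C\<bar> * \<psi> x \<partial>\<eta>)" for n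
     by (rule AE_I2, rule innerb) (simp add: space_G)
   qed
   moreover have "(\<lambda>n. \<integral>q. palm \<psi> (fn n) q \<partial>GL) \<longlonglongrightarrow> (\<integral>q. palm \<psi> f q \<partial>GL)"
   proof (rule integral_dominated_convergence[OF _ _ wC(3)])
    show "palm \<psi> f \<in> borel_measurable GL" using weighted_integral(3)[OF fb] by auto
    show "palm \<psi> (fn n) \<in> borel_measurable GL" for n using weighted_integral(3)[OF fnb] by auto
    have dr: "(add_atom (fst q) (snd q), fst (snd q)) \<in> space Cc_sigma \<times> UNIV" if "q \<in> space GL" for q
     using that by (auto simp: space_pair_measure space_G intro: add_atom_dr)
    show "AE q in GL. (\<lambda>n. palm \<psi> (fn n) q) \<longlonglongrightarrow> palm \<psi> f q"
     unfolding palm_def by (rule AE_I2, intro tendsto_intros lim dr)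
    show "AE q in GL. norm (palm \<psi> (fn n) q) \<le> palm \<psi> (\<lambda>p. \<bar>C\<bar>) q" for n
    proof (rule AE_I2)
     fix q assume "q \<in> space GL"
     from C[OF dr[OF this], of n] have "\<bar>fn n (add_atom (fst q) (snd q), fst (snd q))\<bar> \<le> \<bar>C\<bar>" by simp
     then show "norm (palm \<psi> (fn n) q) \<le> palm \<psi> (\<lambda>p. \<bar>C\<bar>) q"
      unfolding palm_def using \<psi>0 mark_density(1) by (simp add: abs_mult mult_right_mono)
    qed
   qed
   ultimately show ?thesis using fb Pn LIMSEQ_unique unfolding P_def by fastforce
  qed
 qed (use fm sp in auto)
 then show ?thesis by (simp add: P_def)
qed

end

text \<open>As \<open>f\<close> vanishes for \<open>norm x > R\<close>, multiplying by
  \<open>cutoff R\<close> changes nothing, and the auxiliary weight disappears from the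
  identity.\<close>

theorem Mecke:
 assumes fm: "f \<in> borel_measurable (Cc_sigma \<Otimes>\<^sub>M borel)" and fC: "\<And>p. \<bar>f p\<bar> \<le> C"
  and supp: "\<And>\<eta> x. R < norm x \<Longrightarrow> f (\<eta>, x) = 0"
 shows "integrable \<G> (\<lambda>\<eta>. \<integral>x. f (\<eta>, x) \<partial>\<eta>)" (is "?claim1")
  and "integrable GL (\<lambda>q. f (add_atom (fst q) (snd q), fst (snd q)) * mark_density (snd (snd q)))" (is "?claim2")
  and "(\<integral>\<eta>. (\<integral>x. f (\<eta>, x) \<partial>\<eta>) \<partial>\<G>) = (\<integral>q. f (add_atom (fst q) (snd q), fst (snd q)) * mark_density (snd (snd q)) \<partial>GL)" (is "?claim3")
proof -
 have c: "f (\<eta>, x) * cutoff R x = f (\<eta>, x)" for \<eta> x using supp[of x \<eta>] cutoff(4)[of x R] by (cases "R < norm x") auto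
 have "palm (cutoff R) f q = f (add_atom (fst q) (snd q), fst (snd q)) * cutoff R (fst (snd q)) * mark_density (snd (snd q))" for q
  by (simp add: palm_def mult_ac)
 then have p: "palm (cutoff R) f = (\<lambda>q. f (add_atom (fst q) (snd q), fst (snd q)) * mark_density (snd (snd q)))"
  by (simp add: c fun_eq_iff)
 have fb: "f \<in> bdd_mble (Cc_sigma \<Otimes>\<^sub>M borel)" using fm fC unfolding bdd_mble_def by blast
 note w = weighted_integral[OF cutoff(1,2)[where R = R] fb, unfolded c p]
 show ?claim1 by (rule w(1))
 show ?claim2 by (rule w(3))
 show ?claim3
  using Mecke_weighted[OF cutoff(1,2)[where R = R] fm fC] unfolding c p .
qed

end


section \<open>Integration by parts\<close>

lemma line_derivative:
 assumes "(F has_derivative F') (at p)" shows "((\<lambda>t. F (p + t *\<^sub>R e)) has_real_derivative F' e) (at 0)"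
proof -
 interpret bounded_linear F' by (rule has_derivative_bounded_linear[OF assms])
 have "((\<lambda>t. p + t *\<^sub>R e) has_derivative (\<lambda>t. t *\<^sub>R e)) (at 0)" by (auto intro!: derivative_eq_intros)
 from has_derivative_compose[OF this, of F F'] assms
 have "((\<lambda>t. F (p + t *\<^sub>R e)) has_derivative (\<lambda>t. F' (t *\<^sub>R e))) (at 0)" by simp
 then show ?thesis unfolding scaleR has_field_derivative_def by (simp add: mult.commute[of _ "F' e"] mult_commute_abs)
qed

lemma integrable_bounded_support:
 fixes k :: "'b::euclidean_space \<Rightarrow> real"
 assumes "k \<in> borel_measurable borel" "\<And>p. \<bar>k p\<bar> \<le> C" "\<And>p. k p \<noteq> 0 \<Longrightarrow> norm p \<le> R"
 shows "integrable lborel k"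
proof (rule Bochner_Integration.integrable_bound)
 have "emeasure lborel (cball (0::'b) R) < \<infinity>" by (rule emeasure_bounded_finite) simp
 then show "integrable lborel (\<lambda>p. C * indicator (cball (0::'b) R) p)" by simp
 have "0 \<le> C" using assms(2)[of 0] by linarith
 then have "norm (k p) \<le> norm (C * indicator (cball (0::'b) R) p)" for p
  using assms(2)[of p] assms(3)[of p] by (cases "k p = 0") auto
 then show "AE p in lborel. norm (k p) \<le> norm (C * indicator (cball (0::'b) R) p)" by simp
qed (use assms(1) in simp)

text \<open>By translation invariance the difference quotients of \<open>k\<close> along
  \<open>e\<close> have integral 0, and they converge dominatedly. Regularity enters only along the
  single direction \<open>e\<close>, which allows \<open>k\<close> to contain the merely measurable
  \<open>c\<close> in the other variable.\<close>

lemma lborel_integral_derivative_eq_0: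
 fixes k k' :: "'b::euclidean_space \<Rightarrow> real"
 assumes km: "k \<in> borel_measurable borel" and k'm: "k' \<in> borel_measurable borel"
  and kb: "\<And>p. \<bar>k p\<bar> \<le> C" and k'b: "\<And>p. \<bar>k' p\<bar> \<le> C"
  and supp: "\<And>p. k p \<noteq> 0 \<Longrightarrow> norm p \<le> R"
  and d: "\<And>p. ((\<lambda>t. k (p + t *\<^sub>R e)) has_real_derivative k' p) (at 0)"
 shows "(\<integral>p. k' p \<partial>lborel) = 0"
proof -
 define t where "t n = inverse (real (Suc n))" for n
 have t: "0 < t n" "t n \<le> 1" for n unfolding t_def by (simp, simp add: inverse_le_1_iff)
 have tl: "t \<longlonglongrightarrow> 0" unfolding t_def by (rule LIMSEQ_inverse_real_of_nat)
 have ft: "filterlim t (at 0) sequentially"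
  by (rule filterlim_atI[OF tl]) (use t(1) in \<open>auto simp: less_imp_neq[symmetric]\<close>)
 have ki: "integrable lborel k" by (rule integrable_bounded_support[OF km kb supp])
 have shift: "(\<integral>p. k (p + a) \<partial>lborel) = (\<integral>p. k p \<partial>lborel)" "integrable lborel (\<lambda>p. k (p + a))" for a
 proof -
  have "(\<lambda>p. p + a) = (+) a" by (simp add: fun_eq_iff add.commute)
  then have 1: "lborel = distr lborel borel (\<lambda>p::'b. p + a)" using lborel_distr_plus[of a] by simp
  show "(\<integral>p. k (p + a) \<partial>lborel) = (\<integral>p. k p \<partial>lborel)" by (subst (2) 1, subst integral_distr) (use km in auto)
  have "integrable (distr lborel borel (\<lambda>p::'b. p + a)) k" using ki 1 by simp
  then show "integrable lborel (\<lambda>p. k (p + a))" using km by (subst (asm) integrable_distr_eq) auto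
 qed
 have "(\<lambda>n. \<integral>p. (k (p + t n *\<^sub>R e) - k p) / t n \<partial>lborel) \<longlonglongrightarrow> (\<integral>p. k' p \<partial>lborel)"
 proof (rule integral_dominated_convergence[where w = "\<lambda>p. C * indicator (cball 0 (R + norm e)) p"])
  show "k' \<in> borel_measurable lborel" using k'm by simp
  show "(\<lambda>p. (k (p + t n *\<^sub>R e) - k p) / t n) \<in> borel_measurable lborel" for n using km by measurable
  have "emeasure lborel (cball (0::'b) (R + norm e)) < \<infinity>" by (rule emeasure_bounded_finite) simp
  then show "integrable lborel (\<lambda>p. C * indicator (cball (0::'b) (R + norm e)) p)" by simp
  show "AE p in lborel. (\<lambda>n. (k (p + t n *\<^sub>R e) - k p) / t n) \<longlonglongrightarrow> k' p"
  proof (rule AE_I2)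
   fix p
   have "((\<lambda>h. (k (p + h *\<^sub>R e) - k p) / h) \<longlongrightarrow> k' p) (at 0)" using d[of p] by (simp add: DERIV_def)
   from filterlim_compose[OF this ft] show "(\<lambda>n. (k (p + t n *\<^sub>R e) - k p) / t n) \<longlonglongrightarrow> k' p" .
  qed
  \<comment> \<open>The mean value theorem bounds the quotient by \<open>C\<close>, and steps of
    length at most 1 keep its support within the enlarged radius \<open>R + norm e\<close>.\<close>
  show "AE p in lborel. norm ((k (p + t n *\<^sub>R e) - k p) / t n) \<le> C * indicator (cball 0 (R + norm e)) p" for n
  proof (rule AE_I2)
   fix p :: 'b
   show "norm ((k (p + t n *\<^sub>R e) - k p) / t n) \<le> C * indicator (cball 0 (R + norm e)) p"
   proof (cases "norm p \<le> R + norm e")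
    case True
    have D: "((\<lambda>s. k (p + s *\<^sub>R e)) has_real_derivative k' (p + s *\<^sub>R e)) (at s)" for s
    proof -
     have "((\<lambda>t. k ((p + s *\<^sub>R e) + (t + - s) *\<^sub>R e)) has_real_derivative k' (p + s *\<^sub>R e)) (at s)"
      using DERIV_shift[of "\<lambda>t. k ((p + s *\<^sub>R e) + t *\<^sub>R e)" "k' (p + s *\<^sub>R e)" s "- s"] d[of "p + s *\<^sub>R e"] by simp
     then show ?thesis by (simp add: algebra_simps)
    qed
    obtain z where "k (p + t n *\<^sub>R e) - k (p + 0 *\<^sub>R e) = (t n - 0) * k' (p + z *\<^sub>R e)"
     using MVT2[of 0 "t n" "\<lambda>s. k (p + s *\<^sub>R e)" "\<lambda>s. k' (p + s *\<^sub>R e)"] t(1)[of n] D by auto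
    then have "(k (p + t n *\<^sub>R e) - k p) / t n = k' (p + z *\<^sub>R e)" using t(1)[of n] by simp
    then show ?thesis using k'b[of "p + z *\<^sub>R e"] True by simp
   next
    case False
    have "norm p \<le> norm (p + t n *\<^sub>R e) + norm (t n *\<^sub>R e)" using norm_triangle_ineq4[of "p + t n *\<^sub>R e" "t n *\<^sub>R e"] by simp
    also have "norm (t n *\<^sub>R e) \<le> norm e" using t[of n] by (simp add: mult_left_le_one_le)
    finally have "R < norm (p + t n *\<^sub>R e)" using False by simp
    moreover have "R < norm p" using False norm_ge_zero[of e] by linarith
    ultimately have "k (p + t n *\<^sub>R e) = 0" "k p = 0" using supp by force+
    then show ?thesis using False by simp
   qed
  qed
 qed
 moreover have "(\<integral>p. (k (p + t n *\<^sub>R e) - k p) / t n \<partial>lborel) = 0" for n using shift[of "t n *\<^sub>R e"] ki by simp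
 ultimately have "(\<lambda>n::nat. 0::real) \<longlonglongrightarrow> (\<integral>p. k' p \<partial>lborel)" by (simp only:)
 then show ?thesis by (rule LIMSEQ_unique[OF _ tendsto_const])
qed

text \<open>Bounded with support in a fixed bounded region away from mark 0, uniformly in a
  parameter. The parameter will hold the pairings of the remaining atoms, which vary with \<eta>;
  uniformity yields the global bounds in the Mecke identity.\<close>

definition tame :: "('w \<Rightarrow> 'a::euclidean_space \<times> real \<Rightarrow> real) \<Rightarrow> bool" where
 "tame h \<longleftrightarrow> (\<exists>C R a. 0 < a \<and> (\<forall>w p. \<bar>h w p\<bar> \<le> C \<and> (h w p \<noteq> 0 \<longrightarrow> norm p \<le> R \<and> a \<le> snd p)))"

lemma tame_bounded: "tame h \<Longrightarrow> \<exists>C. \<forall>w p. \<bar>h w p\<bar> \<le> C" unfolding tame_def by blast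

lemma tame_nonpos: "tame h \<Longrightarrow> snd p \<le> 0 \<Longrightarrow> h w p = 0" unfolding tame_def by (metis less_le_not_le order_trans)

lemma tame_test:
 assumes "\<phi> \<in> test_functions" shows "tame (\<lambda>w. \<phi>)"
proof -
 obtain A a b where A: "compact A" "0 < a" "a < b" "\<And>p. p \<notin> A \<times> {a..b} \<Longrightarrow> \<phi> p = 0"
  using test_functionsE[OF assms] by blast
 obtain C where C: "\<And>p. \<bar>\<phi> p\<bar> \<le> C" using test_bounded_ex[OF assms] by blast
 have "bounded (A \<times> {a..b})" using A(1) by (intro compact_imp_bounded compact_Times) auto
 then obtain R where R: "\<And>p. p \<in> A \<times> {a..b} \<Longrightarrow> norm p \<le> R" unfolding bounded_iff by blast
 have "norm p \<le> R \<and> a \<le> snd p" if "\<phi> p \<noteq> 0" for p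
 proof -
  have "p \<in> A \<times> {a..b}" using A(4) that by blast
  then show ?thesis using R by auto
 qed
 then show ?thesis unfolding tame_def using A(2) C by blast
qed

lemma tame_add:
 assumes "tame h" "tame k" shows "tame (\<lambda>w p. h w p + k w p)"
proof -
 obtain C R a where h: "0 < a" "\<And>w p. \<bar>h w p\<bar> \<le> C" "\<And>w p. h w p \<noteq> 0 \<Longrightarrow> norm p \<le> R \<and> a \<le> snd p"
  using assms(1) unfolding tame_def by blast
 obtain D S b where k: "0 < b" "\<And>w p. \<bar>k w p\<bar> \<le> D" "\<And>w p. k w p \<noteq> 0 \<Longrightarrow> norm p \<le> S \<and> b \<le> snd p"
  using assms(2) unfolding tame_def by blast
 have 1: "\<bar>h w p + k w p\<bar> \<le> C + D" for w p using h(2)[of w p] k(2)[of w p] by linarith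
 have 2: "norm p \<le> max R S \<and> min a b \<le> snd p" if "h w p + k w p \<noteq> 0" for w p
 proof -
  have "h w p \<noteq> 0 \<or> k w p \<noteq> 0" using that by auto
  then show ?thesis using h(3)[of w p] k(3)[of w p] by (auto simp: le_max_iff_disj min_le_iff_disj)
 qed
 have "0 < min a b" using h(1) k(1) by simp
 then show ?thesis unfolding tame_def using 1 2 by blast
qed

lemma tame_mult:
 assumes "tame h" "\<exists>D. \<forall>w p. \<bar>B w p\<bar> \<le> D" shows "tame (\<lambda>w p. B w p * h w p)"
proof -
 obtain C R a where h: "0 < a" "\<And>w p. \<bar>h w p\<bar> \<le> C" "\<And>w p. h w p \<noteq> 0 \<Longrightarrow> norm p \<le> R \<and> a \<le> snd p"
  using assms(1) unfolding tame_def by blast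
 obtain D where D: "\<And>w p. \<bar>B w p\<bar> \<le> D" using assms(2) by blast
 have "\<bar>B w p * h w p\<bar> \<le> D * C" for w p unfolding abs_mult using D[of w p] h(2)[of w p] by (intro mult_mono) auto
 moreover have "norm p \<le> R \<and> a \<le> snd p" if "B w p * h w p \<noteq> 0" for w p using h(3)[of w p] that by auto
 ultimately show ?thesis unfolding tame_def using h(1) by blast
qed

lemma tame_cmult: "tame h \<Longrightarrow> tame (\<lambda>w p. c * h w p)" by (rule tame_mult) auto

lemma tame_sum: "(\<And>i. i \<in> I \<Longrightarrow> tame (h i)) \<Longrightarrow> tame (\<lambda>w p. \<Sum>i\<in>I. h i w p)"
proof (induction I rule: infinite_finite_induct)
 case (insert i I) then show ?case using tame_add[of "h i" "\<lambda>w p. \<Sum>i\<in>I. h i w p"] by simp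
qed (auto simp: tame_def intro: exI[of _ 1])

text \<open>On the support the mark lies between \<open>a\<close> and \<open>R\<close>, because it
  is at most the norm of \<open>p\<close>; there local boundedness of \<open>c\<close> gives a
  bound.\<close>

lemma tame_rescale:
 assumes "tame h" and c: "\<And>a b. 0 < a \<Longrightarrow> \<exists>C. \<forall>s\<in>{a..b}. \<bar>c s\<bar> \<le> C"
 shows "tame (\<lambda>w p. c (snd p) * h w p)"
proof -
 obtain C R a where h: "0 < a" "\<And>w p. \<bar>h w p\<bar> \<le> C" "\<And>w p. h w p \<noteq> 0 \<Longrightarrow> norm p \<le> R \<and> a \<le> snd p"
  using assms(1) unfolding tame_def by blast
 obtain D where D: "\<And>s. s \<in> {a..R} \<Longrightarrow> \<bar>c s\<bar> \<le> D" using c[OF h(1), of R] by blast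
 have "\<bar>c (snd p) * h w p\<bar> \<le> \<bar>D\<bar> * \<bar>C\<bar>" for w p
 proof (cases "h w p = 0")
  case False
  have "\<bar>snd p\<bar> \<le> norm p" using norm_snd_le[of "snd p" "fst p"] by simp
  then have "snd p \<in> {a..R}" using h(3)[OF False] by auto
  from D[OF this] show ?thesis unfolding abs_mult using h(2)[of w p] by (intro mult_mono) auto
 qed simp
 moreover have "norm p \<le> R \<and> a \<le> snd p" if "c (snd p) * h w p \<noteq> 0" for w p using h(3)[of w p] that by auto
 ultimately show ?thesis unfolding tame_def using h(1) by blast
qed

lemma tame_integrable:
 assumes h: "tame h" and m: "h w \<in> borel_measurable borel"
 shows "integrable lborel (\<lambda>p. mark_density (snd p) * h w p)"
proof -
 obtain C R where C: "\<And>w p. \<bar>h w p\<bar> \<le> C" "\<And>w p. h w p \<noteq> 0 \<Longrightarrow> norm p \<le> R" using h unfolding tame_def by blast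
 have b: "\<bar>mark_density (snd p) * h w p\<bar> \<le> C" for p
 proof -
  have "\<bar>mark_density (snd p)\<bar> \<le> 1" by (simp add: mark_density_def)
  then show ?thesis unfolding abs_mult using mult_right_mono[of "\<bar>mark_density (snd p)\<bar>" 1 "\<bar>h w p\<bar>"] C(1)[of w p] by simp
 qed
 have "(\<lambda>p. mark_density (snd p) * h w p) \<in> borel_measurable borel"
  by (intro borel_measurable_times m measurable_compose[OF borel_measurable_snd mark_density_measurable])
 then show ?thesis by (rule integrable_bounded_support[OF _ b]) (use C(2) in auto)
qed

lemma Cb_smooth_bounded_ex: "g \<in> Cb_smooth N \<Longrightarrow> \<exists>D. \<forall>w p. \<bar>g (u w p)\<bar> \<le> D" using Cb_smooth_bounded by blast

text \<open>Every summand is a bounded derivative of \<open>g\<close>, or a sum of products of such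
  with bounded functions, times a derivative of a test function; the bounds on \<open>g\<close> do
  not depend on the shift.\<close>

lemma tame_shifted_D:
 assumes g: "g \<in> Cb_smooth N" and \<phi>: "\<And>i. \<phi> i \<in> test_functions" and e: "e \<in> Basis"
 shows "tame (\<lambda>w. shifted_D1 N g \<phi> e (f w))" (is "?claim1") "tame (\<lambda>w. shifted_D2 N g \<phi> e (f w))" (is "?claim2")
proof -
 note t = tame_test[OF \<phi>] and t1 = tame_test[OF test_dir_deriv[OF \<phi> e]] and t2 = tame_test[OF test_dir_deriv[OF test_dir_deriv[OF \<phi> e] e]]
 show ?claim1 unfolding shifted_D1_def
  by (intro tame_sum tame_mult[OF t1] Cb_smooth_bounded_ex[OF Cb_smooth_D[OF g]]) simp
 have "tame (\<lambda>w p. \<Sum>j<N. coord_deriv j (coord_deriv i g) (\<lambda>j. f w j + \<phi> j p) * dir_deriv e (\<phi> j) p)" if "i < N" for i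
  by (intro tame_sum tame_mult[OF t1] Cb_smooth_bounded_ex[OF Cb_smooth_D[OF Cb_smooth_D[OF g that]]]) simp
 from tame_bounded[OF this] show ?claim2 unfolding shifted_D2_def
  by (intro tame_sum tame_add tame_mult[OF t1] tame_mult[OF t2] Cb_smooth_bounded_ex[OF Cb_smooth_D[OF g]]) simp_all
qed

lemma shifted_measurable:
 assumes g: "g \<in> Cb_smooth N" and v: "\<And>j. (\<lambda>z. v z j + \<phi> j (m z)) \<in> borel_measurable M"
 shows "(\<lambda>z. shifted g \<phi> (v z) (m z)) \<in> borel_measurable M"
 unfolding shifted_def by (rule Cb_smooth_measurable[OF g v])

lemma shifted_D_measurable:
 assumes g: "g \<in> Cb_smooth N" and \<phi>: "\<And>i. \<phi> i \<in> test_functions" and e: "e \<in> Basis"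
  and m: "m \<in> measurable M borel" and v: "\<And>j. (\<lambda>z. v z j + \<phi> j (m z)) \<in> borel_measurable M"
 shows "(\<lambda>z. shifted_D1 N g \<phi> e (v z) (m z)) \<in> borel_measurable M" (is "?claim1")
  and "(\<lambda>z. shifted_D2 N g \<phi> e (v z) (m z)) \<in> borel_measurable M" (is "?claim2")
proof -
 have D: "(\<lambda>z. dir_deriv e (\<phi> i) (m z)) \<in> borel_measurable M" "(\<lambda>z. dir_deriv e (dir_deriv e (\<phi> i)) (m z)) \<in> borel_measurable M" for i
  by (rule measurable_compose[OF m test_measurable], intro test_dir_deriv \<phi> e)+
 have g1: "(\<lambda>z. coord_deriv i g (\<lambda>j. v z j + \<phi> j (m z))) \<in> borel_measurable M" if "i < N" for i
  by (rule Cb_smooth_measurable[OF Cb_smooth_D[OF g that] v])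
 have g2: "(\<lambda>z. coord_deriv j (coord_deriv i g) (\<lambda>j. v z j + \<phi> j (m z))) \<in> borel_measurable M" if "i < N" "j < N" for i j
  by (rule Cb_smooth_measurable[OF Cb_smooth_D[OF Cb_smooth_D[OF g that(1)] that(2)] v])
 show ?claim1
  unfolding shifted_D1_def by (intro borel_measurable_sum borel_measurable_times D g1) simp
 show ?claim2
  unfolding shifted_D2_def by (intro borel_measurable_sum borel_measurable_add borel_measurable_times D g1 g2) simp_all
qed

section \<open>Weights of the directions and integration by parts in a basis direction\<close>

locale coefficient =
 fixes c :: "real \<Rightarrow> real"
 assumes c_nonneg: "\<And>s. 0 < s \<Longrightarrow> 0 \<le> c s"
  and c_measurable: "c \<in> borel_measurable (restrict_space borel {0<..})"
  and c_bounded: "\<And>a b. 0 < a \<Longrightarrow> a < b \<Longrightarrow> bounded (c ` {a..b})"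
begin

text \<open>The last component of a basis vector tells spatial directions from the mark direction.
  The quotient by \<open>s^2\<close> collects the factor \<open>1 / s\<close> of the two intrinsic
  gradients.\<close>

definition ew :: "'a::euclidean_space \<times> real \<Rightarrow> real \<Rightarrow> real" where
 "ew e s = (if snd e = 0 then (if 0 < s then c s / s\<^sup>2 else 0) else 1)"

lemma ew_nonneg: "0 \<le> ew e s" by (simp add: ew_def c_nonneg)

lemma ew_measurable [measurable]: "ew e \<in> borel_measurable borel"
proof -
 have [measurable]: "(\<lambda>s. indicator {0<..} s *\<^sub>R c s) \<in> borel_measurable borel"
  using c_measurable by (subst (asm) borel_measurable_restrict_space_iff) auto
 have "(\<lambda>s. (indicator {0<..} s *\<^sub>R c s) / s\<^sup>2) \<in> borel_measurable borel" by measurable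
 also have "(\<lambda>s. (indicator {0<..} s *\<^sub>R c s) / s\<^sup>2) = (\<lambda>s. if 0 < s then c s / s\<^sup>2 else 0)" by (auto simp: fun_eq_iff)
 finally show ?thesis unfolding ew_def[abs_def] by simp
qed

lemma ew_bounded:
 assumes a: "0 < a" shows "\<exists>C. \<forall>s\<in>{a..b}. \<bar>ew e s\<bar> \<le> C"
proof -
 have "bounded (c ` {a..max b (a + 1)})" by (rule c_bounded[OF a]) simp
 then have "\<exists>K. \<forall>s\<in>{a..max b (a + 1)}. \<bar>c s\<bar> \<le> K" by (simp add: bounded_iff)
 then obtain K where K: "\<And>s. s \<in> {a..max b (a + 1)} \<Longrightarrow> \<bar>c s\<bar> \<le> K" by blast
 have "\<bar>ew e s\<bar> \<le> max 1 (K / a\<^sup>2)" if s: "s \<in> {a..b}" for s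
 proof (cases "snd e = 0")
  case True
  have "\<bar>c s\<bar> / s\<^sup>2 \<le> K / a\<^sup>2"
  proof (rule frac_le)
   show cs: "\<bar>c s\<bar> \<le> K" using K[of s] s by (simp add: le_max_iff_disj)
   then show "0 \<le> K" by linarith
  qed (use s a in \<open>auto intro: power_mono\<close>)
  then show ?thesis using True s a by (simp add: ew_def)
 qed (simp add: ew_def)
 then show ?thesis by blast
qed

lemmas tame_ew = tame_rescale[OF _ ew_bounded]

text \<open>\<open>h1 + h2\<close>, weighted by the mark density, is the derivative along
  \<open>e\<close> of the weighted product of \<open>shifted g' \<phi>'\<close> and
  \<open>shifted_D1 N g \<phi> e\<close>. The term with \<open>- snd e\<close> comes from
  differentiating the density.\<close>

lemma weighted_integration_by_parts:
 assumes g: "g \<in> Cb_smooth N" and \<phi>: "\<And>i. \<phi> i \<in> test_functions" and e: "e \<in> Basis"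
  and g': "g' \<in> Cb_smooth N'" and \<phi>': "\<And>i. \<phi>' i \<in> test_functions"
 defines "h1 \<equiv> \<lambda>w p. ew e (snd p) * (shifted_D1 N' g' \<phi>' e (snd w) p * shifted_D1 N g \<phi> e (fst w) p)"
  and "h2 \<equiv> \<lambda>w p. ew e (snd p) * (shifted g' \<phi>' (snd w) p * (shifted_D2 N g \<phi> e (fst w) p + (- snd e) * shifted_D1 N g \<phi> e (fst w) p))"
 shows "tame h1" "tame h2" "h1 w \<in> borel_measurable borel" "h2 w \<in> borel_measurable borel"
  "(\<integral>p. mark_density (snd p) * h1 w p \<partial>lborel) = - (\<integral>p. mark_density (snd p) * h2 w p \<partial>lborel)" (is "?claim1")
proof -
 let ?D1 = "\<lambda>w. shifted_D1 N g \<phi> e (fst w)" and ?D2 = "\<lambda>w. shifted_D2 N g \<phi> e (fst w)"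
  and ?D1' = "\<lambda>w. shifted_D1 N' g' \<phi>' e (snd w)" and ?S = "\<lambda>w. shifted g' \<phi>' (snd w)"
 note D = tame_shifted_D[where \<phi> = \<phi> and f = "fst :: (nat \<Rightarrow> real) \<times> (nat \<Rightarrow> real) \<Rightarrow> _", OF g \<phi> e] and D' = tame_shifted_D(1)[where \<phi> = \<phi>' and f = "snd :: (nat \<Rightarrow> real) \<times> (nat \<Rightarrow> real) \<Rightarrow> _", OF g' \<phi>' e]
 have Sb: "\<exists>D. \<forall>w p. \<bar>?S w p\<bar> \<le> D" unfolding shifted_def using Cb_smooth_bounded[OF g'] by blast
 show t1: "tame h1" unfolding h1_def by (intro tame_ew tame_mult D tame_bounded[OF D'])
 show t2: "tame h2" unfolding h2_def by (intro tame_ew tame_mult[OF _ Sb] tame_add tame_cmult D)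
 define h where "h w p = ew e (snd p) * (?S w p * ?D1 w p)" for w p
 have t: "tame h" unfolding h_def by (intro tame_ew tame_mult[OF _ Sb] D)
 have add_m: "(\<lambda>p. v j + \<phi> j p) \<in> borel_measurable borel" "(\<lambda>p. v j + \<phi>' j p) \<in> borel_measurable borel" for v j
  using test_measurable[OF \<phi>] test_measurable[OF \<phi>'] by measurable
 have idm: "(\<lambda>p. p) \<in> measurable borel (borel :: ('a \<times> real) measure)" by simp
 have m[measurable]: "?D1 w \<in> borel_measurable borel" "?D2 w \<in> borel_measurable borel" "?D1' w \<in> borel_measurable borel" "?S w \<in> borel_measurable borel" for w
 proof -
  show "?D1 w \<in> borel_measurable borel" by (rule shifted_D_measurable(1)[where v = "\<lambda>_. fst w", OF g \<phi> e idm]) (rule add_m)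
  show "?D2 w \<in> borel_measurable borel" by (rule shifted_D_measurable(2)[where v = "\<lambda>_. fst w", OF g \<phi> e idm]) (rule add_m)
  show "?D1' w \<in> borel_measurable borel" by (rule shifted_D_measurable(1)[where v = "\<lambda>_. snd w", OF g' \<phi>' e idm]) (rule add_m)
  show "?S w \<in> borel_measurable borel" by (rule shifted_measurable[where v = "\<lambda>_. snd w" and m = "\<lambda>p. p", OF g']) (rule add_m)
 qed
 have wm[measurable]: "(\<lambda>p::'a \<times> real. ew e (snd p)) \<in> borel_measurable borel" "(\<lambda>p::'a \<times> real. mark_density (snd p)) \<in> borel_measurable borel"
  by (rule measurable_compose[OF borel_measurable_snd], simp)+
 show m1[measurable]: "h1 w \<in> borel_measurable borel" for w unfolding h1_def by measurable
 show m2[measurable]: "h2 w \<in> borel_measurable borel" for w unfolding h2_def by measurable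
 have m0[measurable]: "h w \<in> borel_measurable borel" for w unfolding h_def by measurable
 \<comment> \<open>Agrees with the full weight for positive marks and is differentiable along
   \<open>e\<close> everywhere: constant along spatial lines, and without the jump of the density at
   0 in the mark direction. The change is harmless because the other factors vanish for
   \<open>s \<le> 0\<close>.\<close>
 define q where "q s = (if snd e = 0 then mark_density s * ew e s else exp (- s))" for s
 have qw: "mark_density s * (ew e s * y) = q s * y" if "s \<le> 0 \<Longrightarrow> y = 0" for s y
  using that by (cases "0 < s") (auto simp: q_def ew_def mark_density_def)
 have z: "?D1 w p = 0" "?D2 w p = 0" if "snd p \<le> 0" for p using tame_nonpos[OF D(1) that] tame_nonpos[OF D(2) that] by simp_all
 \<comment> \<open>Spatial directions leave the mark and hence \<open>q\<close> unchanged; in the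
   mark direction the exponential reproduces itself with factor -1.\<close>
 have qd: "((\<lambda>t. q (snd (p + t *\<^sub>R e))) has_real_derivative - snd e * q (snd p)) (at 0)" for p
  by (cases "snd e = 0") (auto simp: q_def intro!: derivative_eq_intros)
 have 0: "(\<integral>p. mark_density (snd p) * h1 w p + mark_density (snd p) * h2 w p \<partial>lborel) = 0"
 proof -
  obtain C R where C: "\<And>p. \<bar>h w p\<bar> \<le> C" "\<And>p. h w p \<noteq> 0 \<Longrightarrow> norm p \<le> R" using t unfolding tame_def by blast
  obtain C' where C': "\<And>w p. \<bar>h1 w p + h2 w p\<bar> \<le> C'" using tame_bounded[OF tame_add[OF t1 t2]] by blast
  have le: "\<bar>mark_density s * y\<bar> \<le> \<bar>y\<bar>" for s y by (simp add: mark_density_def abs_mult mult_left_le_one_le)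
  show ?thesis
  proof (rule lborel_integral_derivative_eq_0[where k = "\<lambda>p. mark_density (snd p) * h w p" and C = "max C C'" and R = R and e = e])
   show "(\<lambda>p. mark_density (snd p) * h w p) \<in> borel_measurable borel" by measurable
   show "(\<lambda>p. mark_density (snd p) * h1 w p + mark_density (snd p) * h2 w p) \<in> borel_measurable borel" by measurable
   show "\<bar>mark_density (snd p) * h w p\<bar> \<le> max C C'" for p using le[of "snd p" "h w p"] C(1)[of p] by linarith
   show "\<bar>mark_density (snd p) * h1 w p + mark_density (snd p) * h2 w p\<bar> \<le> max C C'" for p
    using le[of "snd p" "h1 w p + h2 w p"] C'[of w p] by (simp add: distrib_left)
   show "mark_density (snd p) * h w p \<noteq> 0 \<Longrightarrow> norm p \<le> R" for p using C(2)[of p] by auto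
   fix p
   have "(\<lambda>t. mark_density (snd (p + t *\<^sub>R e)) * h w (p + t *\<^sub>R e)) = (\<lambda>t. q (snd (p + t *\<^sub>R e)) * (?S w (p + t *\<^sub>R e) * ?D1 w (p + t *\<^sub>R e)))"
    unfolding h_def by (intro ext qw) (use z in simp)
   moreover have "((\<lambda>t. q (snd (p + t *\<^sub>R e)) * (?S w (p + t *\<^sub>R e) * ?D1 w (p + t *\<^sub>R e))) has_real_derivative
    q (snd p) * (?D1' w p * ?D1 w p) + q (snd p) * (?S w p * (?D2 w p + (- snd e) * ?D1 w p))) (at 0)"
   proof -
    have 1: "((\<lambda>t. ?S w (p + t *\<^sub>R e)) has_real_derivative ?D1' w p) (at 0)"
     by (rule line_derivative[OF shifted_derivative[OF g']]) (use \<phi>' in simp)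
    have 2: "((\<lambda>t. ?D1 w (p + t *\<^sub>R e)) has_real_derivative ?D2 w p) (at 0)"
     using line_derivative[OF shifted_D1_derivative(1)[OF g _ e, of \<phi>], of "fst w" p e]
      shifted_D1_derivative(2)[OF g _ e, of \<phi> "fst w" p] \<phi> by (simp add: dir_deriv_def)
    from DERIV_mult[OF qd[of p] DERIV_mult[OF 1 2]] show ?thesis by (rule DERIV_cong) (simp add: algebra_simps)
   qed
   moreover have "q (snd p) * (?D1' w p * ?D1 w p) = mark_density (snd p) * h1 w p" unfolding h1_def
    by (rule qw[symmetric]) (use z in simp)
   moreover have "q (snd p) * (?S w p * (?D2 w p + (- snd e) * ?D1 w p)) = mark_density (snd p) * h2 w p" unfolding h2_def
    by (rule qw[symmetric]) (use z in simp)
   ultimately show "((\<lambda>t. mark_density (snd (p + t *\<^sub>R e)) * h w (p + t *\<^sub>R e)) has_real_derivative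
     mark_density (snd p) * h1 w p + mark_density (snd p) * h2 w p) (at 0)" by simp
  qed
 qed
 then show ?claim1
  using Bochner_Integration.integral_add[OF tame_integrable[OF t1 m1] tame_integrable[OF t2 m2], of w w] by linarith
qed

end


section \<open>Closability, the Markov property and the Friedrichs extension\<close>

text \<open>A smooth version of \<open>min (max t 0) 1\<close>: the difference of two softened ramps
  starting at 0 and at 1. Both arguments have the shape \<open>k * t + a\<close>, so that one
  derivative rule serves both.\<close>

definition soft_clip :: "real \<Rightarrow> real \<Rightarrow> real" where
 "soft_clip k t = 1 / k * softplus (k * t + 0) + (- 1 / k) * softplus (k * t + - k)"

text \<open>The excess over the positive part is exactly
  \<open>ln (1 + exp (- \<bar>s\<bar>))\<close>.\<close>

lemma softplus_approx: "0 \<le> softplus s - max s 0" "softplus s - max s 0 \<le> ln 2"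
proof -
 have "softplus s - max s 0 = ln (1 + exp (- \<bar>s\<bar>))"
 proof (cases "0 < s")
  case True
  have "1 + exp s = exp s * (1 + exp (- s))" by (simp add: distrib_left exp_minus)
  then have "softplus s = ln (exp s) + ln (1 + exp (- s))" unfolding softplus_def
   by (simp only: ln_mult_pos exp_gt_zero add_pos_pos zero_less_one)
  then show ?thesis using True by simp
 qed (simp add: softplus_def max_def)
 moreover have "ln (1 + exp (- \<bar>s\<bar>)) \<le> ln 2" by (subst ln_le_cancel_iff) (auto simp: add_pos_pos)
 moreover have "0 \<le> ln (1 + exp (- \<bar>s\<bar>))" by (rule ln_ge_zero) simp
 ultimately show "0 \<le> softplus s - max s 0" "softplus s - max s 0 \<le> ln 2" by simp_all
qed

text \<open>The errors of the two ramps lie in the same interval from 0 to \<open>ln 2\<close> and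
  are subtracted, so that \<open>ln 2\<close> and not its double appears.\<close>

lemma soft_clip_approx:
 assumes k: "0 < k" shows "\<bar>soft_clip k t - min (max t 0) 1\<bar> \<le> ln 2 / k"
proof -
 have m: "max (k * t) 0 = k * max t 0" "max (k * t + - k) 0 = k * max (t - 1) 0"
  using k by (auto simp: max_def field_simps mult_le_0_iff zero_le_mult_iff)
 have "soft_clip k t - min (max t 0) 1 = ((softplus (k * t) - max (k * t) 0) - (softplus (k * t + - k) - max (k * t + - k) 0)) / k"
 proof -
  have c: "min (max t 0) 1 = max t 0 - max (t - 1) 0" by (simp add: max_def min_def)
  show ?thesis using k unfolding m c soft_clip_def by (simp add: field_simps)
 qed
 moreover have "\<bar>(softplus (k * t) - max (k * t) 0) - (softplus (k * t + - k) - max (k * t + - k) 0)\<bar> \<le> ln 2"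
  using softplus_approx[of "k * t"] softplus_approx[of "k * t + - k"] by linarith
 ultimately show ?thesis using k by (simp add: divide_right_mono)
qed

lemma soft_clip_deriv:
 assumes k: "0 < k"
 shows "(soft_clip k has_real_derivative logistic (k * t) - logistic (k * t + - k)) (at t)" (is "?claim1")
  and "\<bar>logistic (k * t) - logistic (k * t + - k)\<bar> \<le> 1" (is "?claim2")
proof -
 have "((\<lambda>t. softplus (k * t + a)) has_real_derivative logistic (k * t + a) * k) (at t)" for a
  by (rule DERIV_chain2[OF softplus_deriv]) (auto intro!: derivative_eq_intros)
 from DERIV_add[OF DERIV_cmult[OF this[of 0], of "1 / k"] DERIV_cmult[OF this[of "- k"], of "- 1 / k"]]
 show ?claim1
  unfolding soft_clip_def[abs_def] using k by simp
 show ?claim2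
  using logistic_bounds[of "k * t"] logistic_bounds[of "k * t + - k"] by linarith
qed

lemma Cb_smooth_soft_clip: "g \<in> Cb_smooth N \<Longrightarrow> (\<lambda>v. soft_clip k (g v)) \<in> Cb_smooth N"
 unfolding soft_clip_def by (intro Cb_smooth_add Cb_smooth_mult Cb_smooth_const Cb_smooth_softplus)

context gamma
begin

text \<open>Collects what the abstract part uses about a form and its generator, in a shape that is
  stable under sums; thus \<open>E_M\<close> is covered by its two parts. The last clause is the
  contraction property for smooth \<psi> with derivative of modulus at most 1.\<close>

definition generated_form where "generated_form E L \<longleftrightarrow> (\<forall>F\<in>FC. L F \<in> L2 \<G> \<and> 0 \<le> E F F) \<and>
   (\<forall>F\<in>FC. \<forall>G\<in>FC. E F G = - L2_inner \<G> (L F) G \<and> E F G = E G F \<and>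
    (\<forall>a b. AE \<eta> in \<G>. L (\<lambda>\<eta>. a * F \<eta> + b * G \<eta>) \<eta> = a * L F \<eta> + b * L G \<eta>)) \<and>
   (\<forall>F\<in>FC. \<forall>\<psi> \<psi>'. (\<forall>N g. g \<in> Cb_smooth N \<longrightarrow> (\<lambda>v. \<psi> (g v)) \<in> Cb_smooth N) \<longrightarrow>
    (\<forall>t. (\<psi> has_real_derivative \<psi>' t) (at t) \<and> \<bar>\<psi>' t\<bar> \<le> 1) \<longrightarrow> E (\<lambda>\<eta>. \<psi> (F \<eta>)) (\<lambda>\<eta>. \<psi> (F \<eta>)) \<le> E F F)"

lemma dense_FC: "dense_subspace \<G> FC" by (rule FC_dense[OF prob_space_axioms sets_G])

lemma FC_L2: "F \<in> FC \<Longrightarrow> F \<in> L2 \<G>" using dense_FC by (auto simp: dense_subspace_def)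

lemma generated_form_add:
 assumes 1: "generated_form E L" and 2: "generated_form E' L'"
 shows "generated_form (\<lambda>F G. E F G + E' F G) (\<lambda>F \<eta>. L F \<eta> + L' F \<eta>)"
 unfolding generated_form_def
proof (intro conjI ballI allI impI)
 fix F G :: "'a measure \<Rightarrow> real" assume F: "F \<in> FC" and G: "G \<in> FC"
 have LF: "L F \<in> L2 \<G>" "L' F \<in> L2 \<G>" using 1 2 F unfolding generated_form_def by blast+
 show "(\<lambda>\<eta>. L F \<eta> + L' F \<eta>) \<in> L2 \<G>" using L2_lin[OF LF, of 1 1] by simp
 have "0 \<le> E F F" "0 \<le> E' F F" using 1 2 F unfolding generated_form_def by blast+
 then show "0 \<le> E F F + E' F F" by linarith
 have "E F G = - L2_inner \<G> (L F) G" "E' F G = - L2_inner \<G> (L' F) G" using 1 2 F G unfolding generated_form_def by blast+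
 then show "E F G + E' F G = - L2_inner \<G> (\<lambda>\<eta>. L F \<eta> + L' F \<eta>) G" using L2.lin1[OF LF FC_L2[OF G], of 1 1] by simp
 have "E F G = E G F" "E' F G = E' G F" using 1 2 F G unfolding generated_form_def by blast+
 then show "E F G + E' F G = E G F + E' G F" by simp
 fix a b :: real
 have "AE \<eta> in \<G>. L (\<lambda>\<eta>. a * F \<eta> + b * G \<eta>) \<eta> = a * L F \<eta> + b * L G \<eta>"
  "AE \<eta> in \<G>. L' (\<lambda>\<eta>. a * F \<eta> + b * G \<eta>) \<eta> = a * L' F \<eta> + b * L' G \<eta>" using 1 2 F G unfolding generated_form_def by blast+
 then show "AE \<eta> in \<G>. L (\<lambda>\<eta>. a * F \<eta> + b * G \<eta>) \<eta> + L' (\<lambda>\<eta>. a * F \<eta> + b * G \<eta>) \<eta> = a * (L F \<eta> + L' F \<eta>) + b * (L G \<eta> + L' G \<eta>)"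
  by eventually_elim (simp add: algebra_simps)
next
 fix F :: "'a measure \<Rightarrow> real" and \<psi> \<psi>' :: "real \<Rightarrow> real" assume h: "F \<in> FC" "\<forall>N g. g \<in> Cb_smooth N \<longrightarrow> (\<lambda>v. \<psi> (g v)) \<in> Cb_smooth N"
  "\<forall>t. (\<psi> has_real_derivative \<psi>' t) (at t) \<and> \<bar>\<psi>' t\<bar> \<le> 1"
 have "E (\<lambda>\<eta>. \<psi> (F \<eta>)) (\<lambda>\<eta>. \<psi> (F \<eta>)) \<le> E F F" using 1 h unfolding generated_form_def by blast
 moreover have "E' (\<lambda>\<eta>. \<psi> (F \<eta>)) (\<lambda>\<eta>. \<psi> (F \<eta>)) \<le> E' F F" using 2 h unfolding generated_form_def by blast
 ultimately show "E (\<lambda>\<eta>. \<psi> (F \<eta>)) (\<lambda>\<eta>. \<psi> (F \<eta>)) + E' (\<lambda>\<eta>. \<psi> (F \<eta>)) (\<lambda>\<eta>. \<psi> (F \<eta>)) \<le> E F F + E' F F" by linarith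
qed

text \<open>Two errors are controlled: the distance between \<open>soft_clip\<close> and the sharp
  clip, uniform of size \<open>ln 2 / (n + 1)\<close>, and the distance between clips of
  \<open>u n\<close> and \<open>f\<close>, at most that of \<open>u n\<close> and \<open>f\<close>
  since clipping is 1-Lipschitz.\<close>

lemma soft_clip_L2_limit:
 assumes u: "\<And>n. u n \<in> FC" and f: "f \<in> L2 \<G>" and lim: "(\<lambda>n. L2_dist \<G> (u n) f) \<longlonglongrightarrow> 0"
 shows "(\<lambda>n. L2_norm \<G> (\<lambda>x. soft_clip (real (Suc n)) (u n x) - min (max (f x) 0) 1)) \<longlonglongrightarrow> 0"
proof -
 define f1 where "f1 x = min (max (f x) 0) 1" for x
 define v where "v n x = soft_clip (real (Suc n)) (u n x)" for n x
 define \<delta> where "\<delta> n = ln 2 * inverse (real (Suc n))" for n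
 have fm: "f \<in> borel_measurable \<G>" using f by (simp add: L2_def)
 have f1m: "f1 \<in> borel_measurable \<G>" unfolding f1_def[abs_def] using fm by measurable
 have f1L: "f1 \<in> L2 \<G>" by (rule bounded_L2[OF prob_space_axioms f1m, of 1]) (simp add: f1_def)
 have vFC: "v n \<in> FC" for n unfolding v_def[abs_def] by (rule FC_compose(1)[OF u Cb_smooth_soft_clip])
 have dL: "(\<lambda>x. u n x - f x) \<in> L2 \<G>" "(\<lambda>x. v n x - f1 x) \<in> L2 \<G>" for n
  using L2.diff_mem[OF FC_L2[OF u] f] L2.diff_mem[OF FC_L2[OF vFC] f1L] by blast+
 have b: "(L2_dist \<G> (v n) f1)\<^sup>2 \<le> 2 * (\<delta> n)\<^sup>2 + 2 * (L2_dist \<G> (u n) f)\<^sup>2" for n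
 proof -
  have "(v n x - f1 x)\<^sup>2 \<le> 2 * (\<delta> n)\<^sup>2 + 2 * (u n x - f x)\<^sup>2" for x
  proof -
   have "\<bar>v n x - min (max (u n x) 0) 1\<bar> \<le> \<delta> n"
    unfolding v_def \<delta>_def using soft_clip_approx[of "real (Suc n)" "u n x"] by (simp add: divide_inverse)
   moreover have "\<bar>min (max (u n x) 0) 1 - f1 x\<bar> \<le> \<bar>u n x - f x\<bar>" unfolding f1_def by linarith
   ultimately have "\<bar>v n x - f1 x\<bar> \<le> \<delta> n + \<bar>u n x - f x\<bar>" by linarith
   then have "(v n x - f1 x)\<^sup>2 \<le> (\<delta> n + \<bar>u n x - f x\<bar>)\<^sup>2" using power_mono[of "\<bar>v n x - f1 x\<bar>" _ 2] by simp
   also have "\<dots> \<le> 2 * (\<delta> n)\<^sup>2 + 2 * \<bar>u n x - f x\<bar>\<^sup>2"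
    using zero_le_power2[of "\<delta> n - \<bar>u n x - f x\<bar>"] unfolding power2_diff power2_sum by linarith
   finally show ?thesis by simp
  qed
  then have "(\<integral>x. (v n x - f1 x)\<^sup>2 \<partial>\<G>) \<le> (\<integral>x. 2 * (\<delta> n)\<^sup>2 + 2 * (u n x - f x)\<^sup>2 \<partial>\<G>)"
   using dL[of n] by (intro integral_mono) (auto simp: L2_def)
  then show ?thesis unfolding L2_norm_sq using dL[of n] by (simp add: L2_def prob_space)
 qed
 have "(\<lambda>n. 2 * (\<delta> n)\<^sup>2 + 2 * (L2_dist \<G> (u n) f)\<^sup>2) \<longlonglongrightarrow> 2 * (ln 2 * 0)\<^sup>2 + 2 * 0\<^sup>2"
  unfolding \<delta>_def by (intro tendsto_intros lim LIMSEQ_inverse_real_of_nat)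
 then have r: "(\<lambda>n. 2 * (\<delta> n)\<^sup>2 + 2 * (L2_dist \<G> (u n) f)\<^sup>2) \<longlonglongrightarrow> 0" by simp
 have "(\<lambda>n. (L2_dist \<G> (v n) f1)\<^sup>2) \<longlonglongrightarrow> 0" by (rule tendsto_sandwich[OF _ _ tendsto_const r]) (use b in auto)
 from tendsto_real_sqrt[OF this] show ?thesis by (simp add: v_def f1_def)
qed

text \<open>Closability and the Friedrichs extension follow from the representation by
  \<open>L\<close>. For the Markov property the approximants of \<open>f\<close> are soft-clipped:
  their energies do not increase, they converge to the clipped \<open>f\<close> in
  \<open>L2\<close>, and \<open>closure_lsc\<close> passes to the limit.\<close>

theorem generated_form_closable:
 assumes EL: "generated_form E L"
 shows "symmetric_operator \<G> L FC" "\<And>F G. F \<in> FC \<Longrightarrow> G \<in> FC \<Longrightarrow> E F G = L2_inner \<G> (\<lambda>\<eta>. - L F \<eta>) G"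
  "closable_form \<G> E FC" "dirichlet_form \<G> (closure_form \<G> E FC) (closure_dom \<G> E FC)" (is "?claim1")
  "\<exists>B D. friedrichs_extension \<G> (\<lambda>F \<eta>. - L F \<eta>) FC B D" (is "?claim2")
proof -
 have LL: "L F \<in> L2 \<G>" and E0: "0 \<le> E F F" if "F \<in> FC" for F using EL that unfolding generated_form_def by blast+
 have rep: "E F G = - L2_inner \<G> (L F) G" and sym: "E F G = E G F"
  and lin: "AE \<eta> in \<G>. L (\<lambda>\<eta>. a * F \<eta> + b * G \<eta>) \<eta> = a * L F \<eta> + b * L G \<eta>" if "F \<in> FC" "G \<in> FC" for F G a b
  using EL that unfolding generated_form_def by blast+
 have neg: "L2_inner \<G> (\<lambda>\<eta>. - f \<eta>) g = - L2_inner \<G> f g" "L2_inner \<G> g (\<lambda>\<eta>. - f \<eta>) = - L2_inner \<G> g f" for f g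
  by (simp_all add: L2_inner_def)
 have negL2: "(\<lambda>\<eta>. - f \<eta>) \<in> L2 \<G>" if "f \<in> L2 \<G>" for f using L2_lin[OF that that, of "-1" 0] by simp
 show rep': "E F G = L2_inner \<G> (\<lambda>\<eta>. - L F \<eta>) G" if "F \<in> FC" "G \<in> FC" for F G using rep[OF that] by (simp add: neg)
 have Lsym: "L2_inner \<G> (L F) G = L2_inner \<G> F (L G)" if "F \<in> FC" "G \<in> FC" for F G
  using rep[OF that] rep[OF that(2,1)] sym[OF that] L2.sym[OF LL[OF that(2)] FC_L2[OF that(1)]] by simp
 \<comment> \<open>Symmetry on a dense domain forces \<open>L\<close> to respect equality almost
   everywhere: the inner product of \<open>L F - L G\<close> with any \<open>H\<close> in
   \<open>FC\<close> is that of \<open>F - G\<close> with \<open>L H\<close>.\<close>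
 have LAE: "AE \<eta> in \<G>. L F \<eta> = L G \<eta>" if F: "F \<in> FC" and G: "G \<in> FC" and eq: "AE \<eta> in \<G>. F \<eta> = G \<eta>" for F G
 proof -
  have "AE \<eta> in \<G>. L F \<eta> - L G \<eta> = 0"
  proof (rule dense_orthogonal[OF dense_FC L2.diff_mem[OF LL[OF F] LL[OF G]]])
   fix H :: "'a measure \<Rightarrow> real" assume H: "H \<in> FC"
   have "L2_inner \<G> (\<lambda>\<eta>. L F \<eta> - L G \<eta>) H = L2_inner \<G> (L F) H - L2_inner \<G> (L G) H"
    using L2.lin1[OF LL[OF F] LL[OF G] FC_L2[OF H], of 1 "-1"] by simp
   also have "\<dots> = L2_inner \<G> F (L H) - L2_inner \<G> G (L H)" by (simp only: Lsym[OF F H] Lsym[OF G H])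
   also have "L2_inner \<G> F (L H) = L2_inner \<G> G (L H)" by (rule L2_inner_cong) (use FC_L2 LL F G H eq in auto)
   finally show "L2_inner \<G> (\<lambda>\<eta>. L F \<eta> - L G \<eta>) H = 0" by simp
  qed
  then show ?thesis by eventually_elim simp
 qed
 show so: "symmetric_operator \<G> L FC" unfolding symmetric_operator_def
  by (intro conjI ballI allI impI dense_FC LL LAE lin Lsym)
 have "symmetric_operator \<G> (\<lambda>F \<eta>. - L F \<eta>) FC" unfolding symmetric_operator_def
 proof (intro conjI ballI allI impI dense_FC negL2 LL)
  fix F G :: "'a measure \<Rightarrow> real" assume F: "F \<in> FC" and G: "G \<in> FC"
  show "AE \<eta> in \<G>. - L F \<eta> = - L G \<eta>" if "AE \<eta> in \<G>. F \<eta> = G \<eta>" using LAE[OF F G that] by simp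
  show "AE \<eta> in \<G>. - L (\<lambda>\<eta>. a * F \<eta> + b * G \<eta>) \<eta> = a * - L F \<eta> + b * - L G \<eta>" for a b
   using lin[OF F G, of a b] by eventually_elim simp
  show "L2_inner \<G> (\<lambda>\<eta>. - L F \<eta>) G = L2_inner \<G> F (\<lambda>\<eta>. - L G \<eta>)" unfolding neg Lsym[OF F G] ..
 qed
 then show ?claim2
  by (rule friedrichs_extension_exists) (use E0 rep' in simp)
 have linFC: "(\<lambda>\<eta>. a * F \<eta> + b * G \<eta>) \<in> FC" if "F \<in> FC" "G \<in> FC" for F G :: "'a measure \<Rightarrow> real" and a b
  by (rule FC_lin(1)[OF that])
 have sf: "symmetric_form \<G> E FC" unfolding symmetric_form_def
 proof (intro conjI ballI allI impI dense_FC sym E0)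
  fix F G H :: "'a measure \<Rightarrow> real" assume F: "F \<in> FC" and G: "G \<in> FC" and H: "H \<in> FC"
  show "E F H = E G H" if "AE \<eta> in \<G>. F \<eta> = G \<eta>" unfolding rep[OF F H] rep[OF G H]
   by (rule arg_cong[where f = uminus], rule L2_inner_cong) (use LL F G FC_L2[OF H] LAE[OF F G that] in auto)
  show "E (\<lambda>\<eta>. a * F \<eta> + b * G \<eta>) H = a * E F H + b * E G H" for a b
  proof -
   have "L2_inner \<G> (L (\<lambda>\<eta>. a * F \<eta> + b * G \<eta>)) H = L2_inner \<G> (\<lambda>\<eta>. a * L F \<eta> + b * L G \<eta>) H"
    by (rule L2_inner_cong[OF LL[OF linFC[OF F G]] L2_lin[OF LL[OF F] LL[OF G]] FC_L2[OF H] FC_L2[OF H] lin[OF F G]]) simp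
   then show ?thesis unfolding rep[OF linFC[OF F G] H] rep[OF F H] rep[OF G H]
    using L2.lin1[OF LL[OF F] LL[OF G] FC_L2[OF H], of a b] by simp
  qed
 qed
 show cl: "closable_form \<G> E FC"
 proof (rule closable_formI[OF sf])
  fix F :: "'a measure \<Rightarrow> real" assume F: "F \<in> FC"
  show "\<exists>h\<in>L2 \<G>. \<forall>G\<in>FC. E F G = L2_inner \<G> h G" using negL2[OF LL[OF F]] rep'[OF F] by blast
 qed
 interpret C: closable \<G> E FC by unfold_locales (rule cl)
 show ?claim1 unfolding dirichlet_form_def Let_def
 proof (intro conjI ballI C.closed_closure)
  fix f assume f: "f \<in> closure_dom \<G> E FC"
  let ?f1 = "\<lambda>x. min (max (f x) 0) 1"
  have fL: "f \<in> L2 \<G>" by (rule C.closure_dom_L2[OF f])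
  then have [measurable]: "f \<in> borel_measurable \<G>" by (simp add: L2_def)
  have "?f1 \<in> borel_measurable \<G>" by measurable
  then have f1L: "?f1 \<in> L2 \<G>" by (rule bounded_L2[OF prob_space_axioms, of _ 1]) simp
  obtain u where u: "approximates \<G> E FC u f" using f by (auto simp: closure_dom_def)
  have uFC: "u n \<in> FC" for n by (rule C.approx_mem[OF u])
  define v where "v n = (\<lambda>x. soft_clip (real (Suc n)) (u n x))" for n
  have vFC: "v n \<in> FC" for n unfolding v_def by (rule FC_compose(1)[OF uFC Cb_smooth_soft_clip])
  have vE: "E (v n) (v n) \<le> E (u n) (u n)" for n
  proof -
   have M: "(\<forall>N g. g \<in> Cb_smooth N \<longrightarrow> (\<lambda>v. \<psi> (g v)) \<in> Cb_smooth N) \<Longrightarrow>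
    (\<forall>t. (\<psi> has_real_derivative \<psi>' t) (at t) \<and> \<bar>\<psi>' t\<bar> \<le> 1) \<Longrightarrow> E (\<lambda>\<eta>. \<psi> (u n \<eta>)) (\<lambda>\<eta>. \<psi> (u n \<eta>)) \<le> E (u n) (u n)" for \<psi> \<psi>'
    using EL uFC[of n] unfolding generated_form_def by blast
   show ?thesis unfolding v_def
   proof (rule M)
    show "\<forall>N g. g \<in> Cb_smooth N \<longrightarrow> (\<lambda>v. soft_clip (real (Suc n)) (g v)) \<in> Cb_smooth N" using Cb_smooth_soft_clip by blast
    show "\<forall>t. (soft_clip (real (Suc n)) has_real_derivative logistic (real (Suc n) * t) - logistic (real (Suc n) * t + - real (Suc n))) (at t)
     \<and> \<bar>logistic (real (Suc n) * t) - logistic (real (Suc n) * t + - real (Suc n))\<bar> \<le> 1"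
     by (intro allI conjI soft_clip_deriv) simp_all
   qed
  qed
  have vlim: "(\<lambda>n. L2_dist \<G> (v n) ?f1) \<longlonglongrightarrow> 0"
   unfolding v_def by (rule soft_clip_L2_limit[OF uFC fL C.approx_L2[OF u]])
  have Elim: "(\<lambda>n. E (u n) (u n)) \<longlonglongrightarrow> closure_form \<G> E FC f f" by (rule C.closure_form_limit[OF u u fL fL])
  \<comment> \<open>\<open>closure_lsc\<close> asks one bound for all members of the sequence, so an
    initial segment is dropped and \<open>e\<close> is added to the limiting energy.\<close>
  have key: "?f1 \<in> closure_dom \<G> E FC \<and> closure_form \<G> E FC ?f1 ?f1 \<le> closure_form \<G> E FC f f + e" if e: "0 < e" for e
  proof -
   have "eventually (\<lambda>n. E (u n) (u n) < closure_form \<G> E FC f f + e) sequentially"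
    by (rule order_tendstoD(2)[OF Elim]) (use e in simp)
   then obtain n0 where n0: "\<And>n. n0 \<le> n \<Longrightarrow> E (u n) (u n) < closure_form \<G> E FC f f + e" by (auto simp: eventually_sequentially)
   show ?thesis
   proof (rule C.closure_lsc[of "\<lambda>n. v (n + n0)"])
    show "v (n + n0) \<in> FC" for n by (rule vFC)
    show "?f1 \<in> L2 \<G>" by (rule f1L)
    show "(\<lambda>n. L2_dist \<G> (v (n + n0)) ?f1) \<longlonglongrightarrow> 0" by (rule LIMSEQ_ignore_initial_segment[OF vlim])
    show "E (v (n + n0)) (v (n + n0)) \<le> closure_form \<G> E FC f f + e" for n
     using vE[of "n + n0"] n0[of "n + n0"] by simp
   qed
  qed
  show "?f1 \<in> closure_dom \<G> E FC" using key[of 1] by simp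
  show "closure_form \<G> E FC ?f1 ?f1 \<le> closure_form \<G> E FC f f" by (rule field_le_epsilon) (use key in blast)
 qed
qed

end


section \<open>The forms and their generators\<close>

text \<open>Indices from \<open>N\<close> on are filled with \<phi> 0, which exists because
  \<open>1 \<le> N\<close>; then conditions on test functions can be stated for all indices.\<close>

lemma FC_E_test:
 assumes "F \<in> FC" obtains N g \<phi> where "FC_repr N g \<phi> F" "\<forall>i. \<phi> i \<in> test_functions"
proof -
 obtain N g \<phi> where F: "FC_repr N g \<phi> F" by (rule FC_E[OF assms])
 note r = FC_reprD[OF F]
 have "FC_repr N g (\<lambda>i. if i < N then \<phi> i else \<phi> 0) F" unfolding FC_repr_def
 proof (intro conjI r(1,2) ballI)
  fix \<eta> :: "'a measure" assume \<eta>: "\<eta> \<in> \<K>"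
  show "F \<eta> = g (\<lambda>i. pairing (if i < N then \<phi> i else \<phi> 0) \<eta>)"
   unfolding r(4)[OF \<eta>] by (rule Cb_smooth_cong[OF r(2)]) simp
 qed (use r(3) in simp)
 moreover have "\<forall>i. (if i < N then \<phi> i else \<phi> 0) \<in> test_functions" using r(1,3) by auto
 ultimately show ?thesis by (rule that)
qed

locale gamma_coefficient = gamma \<G> + coefficient c for \<G> :: "'a::euclidean_space measure measure" and c
begin

text \<open>The atoms are countable, so the lines above them form a Lebesgue null set of the product
  space.\<close>

lemma AE_new_atom:
 assumes \<eta>: "\<eta> \<in> \<K>" shows "AE p in (lborel :: ('a \<times> real) measure). fst p \<notin> atoms \<eta>"
proof (rule AE_I')
 have c: "countable (atoms \<eta>)" by (rule discrete_radonE(3)[OF \<eta>])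
 have s: "atoms \<eta> \<in> sets lborel" using sets.countable[OF _ c, of borel] by simp
 have "emeasure (lborel \<Otimes>\<^sub>M lborel) (atoms \<eta> \<times> (UNIV :: real set)) = 0"
  using s by (subst lborel.emeasure_pair_measure_Times) (auto simp: emeasure_lborel_countable[OF c])
 moreover have "atoms \<eta> \<times> UNIV \<in> sets (lborel \<Otimes>\<^sub>M (lborel :: real measure))" using s by (intro pair_measureI) auto
 ultimately have "atoms \<eta> \<times> UNIV \<in> null_sets (lborel \<Otimes>\<^sub>M (lborel :: real measure))" by (rule null_setsI)
 then show "atoms \<eta> \<times> UNIV \<in> null_sets (lborel :: ('a \<times> real) measure)" by (simp only: lborel_prod)
qed auto

text \<open>The system seen from the atom at \<open>x\<close>: the parameter of \<open>H\<close>
  holds the pairings of all other atoms with both families of test functions, and its argument is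
  the atom itself.\<close>

definition at_atom :: "(nat \<Rightarrow> 'a \<times> real \<Rightarrow> real) \<Rightarrow> (nat \<Rightarrow> 'a \<times> real \<Rightarrow> real) \<Rightarrow>
  ((nat \<Rightarrow> real) \<times> (nat \<Rightarrow> real) \<Rightarrow> 'a \<times> real \<Rightarrow> real) \<Rightarrow> 'a measure \<times> 'a \<Rightarrow> real" where
 "at_atom \<phi> \<phi>' H z = H (reduced \<phi> (fst z) (snd z), reduced \<phi>' (fst z) (snd z)) (snd z, wt (fst z) (snd z))"

text \<open>The Mecke identity adds an atom \<open>p\<close> to \<eta>. Almost everywhere its place
  is new, and then the reduced pairings of the enlarged measure are the pairings of \<eta>. So the
  parameter of \<open>H\<close> no longer depends on \<open>p\<close>, and an ordinary integral over
  \<open>p\<close> remains for fixed \<eta>.\<close>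

lemma Mecke_tame:
 assumes H: "tame H" and Hm: "\<And>w. H w \<in> borel_measurable borel"
  and \<phi>: "\<And>i. \<phi> i \<in> test_functions" and \<phi>': "\<And>i. \<phi>' i \<in> test_functions"
  and m: "at_atom \<phi> \<phi>' H \<in> borel_measurable (Cc_sigma \<Otimes>\<^sub>M borel)"
 shows "integrable \<G> (\<lambda>\<eta>. \<integral>x. at_atom \<phi> \<phi>' H (\<eta>, x) \<partial>\<eta>)"
  and "\<eta> \<in> \<K> \<Longrightarrow> integrable \<eta> (\<lambda>x. at_atom \<phi> \<phi>' H (\<eta>, x))"
  and "(\<lambda>\<eta>. \<integral>x. at_atom \<phi> \<phi>' H (\<eta>, x) \<partial>\<eta>) \<in> L2 \<G>"
  and "(\<integral>\<eta>. (\<integral>x. at_atom \<phi> \<phi>' H (\<eta>, x) \<partial>\<eta>) \<partial>\<G>) =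
   (\<integral>\<eta>. (\<integral>p. mark_density (snd p) * H (\<lambda>i. pairing (\<phi> i) \<eta>, \<lambda>i. pairing (\<phi>' i) \<eta>) p \<partial>lborel) \<partial>\<G>)"
proof -
 let ?f = "at_atom \<phi> \<phi>' H"
 obtain C R where C: "\<And>w p. \<bar>H w p\<bar> \<le> C" and R: "\<And>w p. H w p \<noteq> 0 \<Longrightarrow> norm p \<le> R" using H unfolding tame_def by blast
 have fC: "\<bar>?f z\<bar> \<le> C" for z unfolding at_atom_def by (rule C)
 have C0: "0 \<le> C" using fC[of undefined] by linarith
 have supp: "?f (\<eta>, x) = 0" if "R < norm x" for \<eta> x
 proof (rule ccontr)
  assume "?f (\<eta>, x) \<noteq> 0"
  then have "norm (x, wt \<eta> x) \<le> R" unfolding at_atom_def using R by auto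
  moreover have "norm x \<le> norm (x, wt \<eta> x)" by (rule norm_fst_le)
  ultimately show False using that by linarith
 qed
 note M = Mecke[OF m fC supp]
 show i1: "integrable \<G> (\<lambda>\<eta>. \<integral>x. ?f (\<eta>, x) \<partial>\<eta>)" by (rule M(1))
 have cut: "?f (\<eta>, x) * cutoff R x = ?f (\<eta>, x)" for \<eta> x
  using supp[of x \<eta>] cutoff(4)[of x R] by (cases "R < norm x") auto
 have sl: "(\<lambda>x. ?f (\<eta>, x)) \<in> borel_measurable borel" if "\<eta> \<in> \<K>" for \<eta>
  by (rule slice_measurable[OF m]) (use that in simp)
 have fi: "integrable \<eta> (\<lambda>x. ?f (\<eta>, x))" if "\<eta> \<in> \<K>" for \<eta>
  using weighted_integrable[OF that cutoff(1) sl[OF that] fC, of R] unfolding cut .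
 then show "\<eta> \<in> \<K> \<Longrightarrow> integrable \<eta> (\<lambda>x. ?f (\<eta>, x))" .
 define Y where "Y \<eta> = (\<integral>x. cutoff R x \<partial>\<eta>)" for \<eta> :: "'a measure"
 have Y0: "0 \<le> Y \<eta>" for \<eta> unfolding Y_def by (intro integral_nonneg_AE AE_I2) (rule cutoff(2))
 have le: "\<bar>\<integral>x. ?f (\<eta>, x) \<partial>\<eta>\<bar> \<le> C * Y \<eta>" if \<eta>: "\<eta> \<in> \<K>" for \<eta>
 proof -
  have ci: "integrable \<eta> (\<lambda>x. C * cutoff R x)" using Cc_integrable[OF _ cutoff(1), of \<eta> R] \<eta> discrete_radon_subset by auto
  have "norm (\<integral>x. ?f (\<eta>, x) \<partial>\<eta>) \<le> (\<integral>x. norm (?f (\<eta>, x)) \<partial>\<eta>)" by (rule integral_norm_bound)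
  also have "\<dots> \<le> (\<integral>x. C * cutoff R x \<partial>\<eta>)"
  proof (rule integral_mono[OF _ ci])
   show "integrable \<eta> (\<lambda>x. norm (?f (\<eta>, x)))" using fi[OF \<eta>] by simp
   show "norm (?f (\<eta>, x)) \<le> C * cutoff R x" for x
   proof -
    have "norm (?f (\<eta>, x)) = \<bar>?f (\<eta>, x)\<bar> * cutoff R x"
     using arg_cong[OF cut[of \<eta> x], of abs] cutoff(2)[of R x] by (simp add: abs_mult)
    also have "\<bar>?f (\<eta>, x)\<bar> * cutoff R x \<le> C * cutoff R x" by (rule mult_right_mono[OF fC cutoff(2)])
    finally show ?thesis .
   qed
  qed
  finally show ?thesis by (simp add: Y_def)
 qed
 show "(\<lambda>\<eta>. \<integral>x. ?f (\<eta>, x) \<partial>\<eta>) \<in> L2 \<G>" unfolding L2_def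
 proof (intro CollectI conjI)
  show bm: "(\<lambda>\<eta>. \<integral>x. ?f (\<eta>, x) \<partial>\<eta>) \<in> borel_measurable \<G>" using i1 by simp
  show "integrable \<G> (\<lambda>\<eta>. (\<integral>x. ?f (\<eta>, x) \<partial>\<eta>)\<^sup>2)"
  proof (rule Bochner_Integration.integrable_bound)
   \<comment> \<open>Half of the cutoff is below 1, so the Laplace transform supplies an exponential
     moment of \<open>Y \<eta> / 2\<close>, which dominates the square of
     \<open>Y \<eta>\<close>.\<close>
   have "(\<lambda>x. (1 / 2) * cutoff R x + 0 * cutoff R x) \<in> (Cc :: ('a \<Rightarrow> real) set)" by (rule Cc_lin[OF cutoff(1) cutoff(1)])
   then have h: "(\<lambda>x. cutoff R x / 2) \<in> (Cc :: ('a \<Rightarrow> real) set)" by simp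
   have "cutoff R x / 2 < 1" for x :: 'a using cutoff(3)[of R x] by simp
   then have h1: "\<forall>x::'a. cutoff R x / 2 < 1" by blast
   have "\<forall>\<phi>\<in>Cc. (\<forall>x. \<phi> x < 1) \<longrightarrow> has_bochner_integral \<G> (\<lambda>\<eta>. exp (\<integral>x. \<phi> x \<partial>\<eta>)) (exp (- (\<integral>x. ln (1 - \<phi> x) \<partial>lborel)))"
    using gamma unfolding gamma_measure_def by blast
   from bspec[OF this h, THEN mp, OF h1] have "integrable \<G> (\<lambda>\<eta>. exp (\<integral>x. cutoff R x / 2 \<partial>\<eta>))"
    by (rule integrable.intros)
   then show "integrable \<G> (\<lambda>\<eta>. C\<^sup>2 * (8 * exp (Y \<eta> / 2)))" by (simp add: Y_def)
   show "(\<lambda>\<eta>. (\<integral>x. ?f (\<eta>, x) \<partial>\<eta>)\<^sup>2) \<in> borel_measurable \<G>" using bm by measurable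
   show "AE \<eta> in \<G>. norm ((\<integral>x. ?f (\<eta>, x) \<partial>\<eta>)\<^sup>2) \<le> norm (C\<^sup>2 * (8 * exp (Y \<eta> / 2)))"
   proof (rule AE_I2)
    fix \<eta> assume "\<eta> \<in> space \<G>"
    then have \<eta>: "\<eta> \<in> \<K>" by (simp add: space_G)
    have "(\<integral>x. ?f (\<eta>, x) \<partial>\<eta>)\<^sup>2 \<le> (C * Y \<eta>)\<^sup>2" using power_mono[OF le[OF \<eta>] abs_ge_zero, of 2] by simp
    also have "\<dots> = C\<^sup>2 * (Y \<eta>)\<^sup>2" by (simp add: power_mult_distrib)
    also have "\<dots> \<le> C\<^sup>2 * (8 * exp (Y \<eta> / 2))"
    proof (rule mult_left_mono)
     \<comment> \<open>The quadratic term of the expansion is one eighth of the square of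
       \<open>Y \<eta>\<close>, the source of the constant 8.\<close>
     have "1 + Y \<eta> / 2 + (Y \<eta> / 2)\<^sup>2 / 2 \<le> exp (Y \<eta> / 2)" by (rule exp_lower_Taylor_quadratic) (simp add: Y0)
     then show "(Y \<eta>)\<^sup>2 \<le> 8 * exp (Y \<eta> / 2)" using Y0[of \<eta>] by (simp add: power_divide)
    qed simp
    finally show "norm ((\<integral>x. ?f (\<eta>, x) \<partial>\<eta>)\<^sup>2) \<le> norm (C\<^sup>2 * (8 * exp (Y \<eta> / 2)))" by simp
   qed
  qed
 qed
 let ?P = "\<lambda>q. ?f (add_atom (fst q) (snd q), fst (snd q)) * mark_density (snd (snd q))"
 have "(\<integral>\<eta>. (\<integral>x. ?f (\<eta>, x) \<partial>\<eta>) \<partial>\<G>) = (\<integral>q. ?P q \<partial>GL)" by (rule M(3))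
 also have "\<dots> = (\<integral>\<eta>. (\<integral>p. ?P (\<eta>, p) \<partial>lborel) \<partial>\<G>)" by (rule G_lborel.integral_fst'[OF M(2), symmetric])
 also have "\<dots> = (\<integral>\<eta>. (\<integral>p. mark_density (snd p) * H (\<lambda>i. pairing (\<phi> i) \<eta>, \<lambda>i. pairing (\<phi>' i) \<eta>) p \<partial>lborel) \<partial>\<G>)"
 proof (rule Bochner_Integration.integral_cong[OF refl])
  fix \<eta> assume e: "\<eta> \<in> space \<G>"
  then have \<eta>: "\<eta> \<in> \<K>" by (simp add: space_G)
  show "(\<integral>p. ?P (\<eta>, p) \<partial>lborel) = (\<integral>p. mark_density (snd p) * H (\<lambda>i. pairing (\<phi> i) \<eta>, \<lambda>i. pairing (\<phi>' i) \<eta>) p \<partial>lborel)"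
  proof (rule integral_cong_AE)
   show "(\<lambda>p. ?P (\<eta>, p)) \<in> borel_measurable lborel"
    by (rule measurable_compose[OF measurable_Pair1'[OF e] borel_measurable_integrable[OF M(2)]])
   show "(\<lambda>p. mark_density (snd p) * H (\<lambda>i. pairing (\<phi> i) \<eta>, \<lambda>i. pairing (\<phi>' i) \<eta>) p) \<in> borel_measurable lborel"
    by (rule borel_measurable_integrable[OF tame_integrable[OF H Hm]])
   show "AE p in lborel. ?P (\<eta>, p) = mark_density (snd p) * H (\<lambda>i. pairing (\<phi> i) \<eta>, \<lambda>i. pairing (\<phi>' i) \<eta>) p"
    using AE_new_atom[OF \<eta>]
   proof (rule AE_mp, intro AE_I2 impI)
    fix p :: "'a \<times> real" assume x: "fst p \<notin> atoms \<eta>"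
    obtain x s where p: "p = (x, s)" by (cases p)
    show "?P (\<eta>, p) = mark_density (snd p) * H (\<lambda>i. pairing (\<phi> i) \<eta>, \<lambda>i. pairing (\<phi>' i) \<eta>) p"
    proof (cases "0 < s")
     case True
     have xa: "x \<notin> atoms \<eta>" using x p by simp
     note a = add_atom_new[OF \<eta> xa True]
     have "reduced \<theta> (add_atom \<eta> (x, s)) x = (\<lambda>i. pairing (\<theta> i) \<eta>)" if "\<And>i. \<theta> i \<in> test_functions" for \<theta>
      unfolding reduced_def a(1) using a(2)[OF test_bdd_supp[OF that]] by simp
     from this[of \<phi>, OF \<phi>] this[of \<phi>', OF \<phi>'] show ?thesis by (simp add: at_atom_def p a(1))
    qed (simp add: p mark_density(2))
   qed
  qed
 qed
 finally show "(\<integral>\<eta>. (\<integral>x. ?f (\<eta>, x) \<partial>\<eta>) \<partial>\<G>) =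
   (\<integral>\<eta>. (\<integral>p. mark_density (snd p) * H (\<lambda>i. pairing (\<phi> i) \<eta>, \<lambda>i. pairing (\<phi>' i) \<eta>) p \<partial>lborel) \<partial>\<G>)" .
qed

end

lemma L2_cong: "f \<in> L2 M \<Longrightarrow> (\<And>x. x \<in> space M \<Longrightarrow> g x = f x) \<Longrightarrow> g \<in> L2 M"
 unfolding L2_def using measurable_cong[of M g f borel] Bochner_Integration.integrable_cong[of M M "\<lambda>x. (g x)\<^sup>2" "\<lambda>x. (f x)\<^sup>2"] by simp

lemma dir_deriv_lin:
 assumes f: "\<And>p. f differentiable (at p)" and g: "\<And>p. g differentiable (at p)"
 shows "dir_deriv e (\<lambda>p. a * f p + b * g p) = (\<lambda>p. a * dir_deriv e f p + b * dir_deriv e g p)"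
proof
 fix p
 have "((\<lambda>p. a * f p + b * g p) has_derivative (\<lambda>h. a * frechet_derivative f (at p) h + b * frechet_derivative g (at p) h)) (at p)"
  by (intro has_derivative_add has_derivative_mult_right differentiable_frechet f g)
 then show "dir_deriv e (\<lambda>p. a * f p + b * g p) p = a * dir_deriv e f p + b * dir_deriv e g p"
  by (simp add: dir_derivI dir_deriv_def[of e f] dir_deriv_def[of e g])
qed

lemma moved_atom_differentiable:
 assumes "F \<in> FC" "\<eta> \<in> \<K>"
 shows "moved_atom F \<eta> x differentiable (at p)" "e \<in> Basis \<Longrightarrow> dir_deriv e (moved_atom F \<eta> x) differentiable (at p)"
proof -
 obtain N g \<phi> where F: "FC_repr N g \<phi> F" by (rule FC_E[OF assms(1)])
 note r = FC_reprD(2,3)[OF F]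
 show "moved_atom F \<eta> x differentiable (at p)" unfolding moved_atom_eq[OF F assms(2)]
  by (rule differentiableI[OF shifted_derivative[OF r]])
 show "dir_deriv e (moved_atom F \<eta> x) differentiable (at p)" if "e \<in> Basis"
  unfolding moved_atom_eq[OF F assms(2)] shifted_dir_deriv[OF r]
  by (rule differentiableI[OF shifted_D1_derivative(1)[OF r that]])
qed

lemma atom_D_lin:
 assumes F: "F \<in> FC" and G: "G \<in> FC" and \<eta>: "\<eta> \<in> \<K>" and e: "e \<in> Basis"
 shows "atom_D1 e (\<lambda>\<eta>. a * F \<eta> + b * G \<eta>) \<eta> x = a * atom_D1 e F \<eta> x + b * atom_D1 e G \<eta> x"
  and "atom_D2 e (\<lambda>\<eta>. a * F \<eta> + b * G \<eta>) \<eta> x = a * atom_D2 e F \<eta> x + b * atom_D2 e G \<eta> x"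
 unfolding atom_D1_def atom_D2_def FC_lin(2)[OF F G \<eta>]
  dir_deriv_lin[OF moved_atom_differentiable(1)[OF F \<eta>] moved_atom_differentiable(1)[OF G \<eta>]]
  dir_deriv_lin[OF moved_atom_differentiable(2)[OF F \<eta> e] moved_atom_differentiable(2)[OF G \<eta> e]] by (rule refl)+

lemma atom_D1_compose:
 assumes F: "F \<in> FC" and \<eta>: "\<eta> \<in> \<K>"
  and \<psi>: "\<And>N g. g \<in> Cb_smooth N \<Longrightarrow> (\<lambda>v. \<psi> (g v)) \<in> Cb_smooth N" and d: "\<And>t. (\<psi> has_real_derivative \<psi>' t) (at t)"
 shows "atom_D1 e (\<lambda>\<eta>. \<psi> (F \<eta>)) \<eta> x = \<psi>' (moved_atom F \<eta> x (x, wt \<eta> x)) * atom_D1 e F \<eta> x"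
proof -
 let ?m = "moved_atom F \<eta> x" and ?p = "(x, wt \<eta> x)"
 have "((\<lambda>p. \<psi> (?m p)) has_derivative (\<lambda>h. \<psi>' (?m ?p) * frechet_derivative ?m (at ?p) h)) (at ?p)"
  using has_derivative_compose[OF differentiable_frechet[OF moved_atom_differentiable(1)[OF F \<eta>]] d[unfolded has_field_derivative_def]] .
 moreover have "moved_atom (\<lambda>\<eta>. \<psi> (F \<eta>)) \<eta> x = (\<lambda>p. \<psi> (?m p))" by (rule FC_compose(2)[OF F _ \<eta>]) (rule \<psi>)
 ultimately show ?thesis unfolding atom_D1_def by (simp add: dir_derivI dir_deriv_def[of e ?m])
qed

section \<open>Carre du champ and generator, summed over a set of directions\<close>

context gamma_coefficient
begin

text \<open>The carre du champ at one atom. The set \<open>J\<close> selects the spatial directions,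
  which give \<open>E_int\<close>, or the mark direction, which gives \<open>E_ext\<close>.\<close>

definition carre where "carre J F G \<eta> x = (\<Sum>e\<in>J. ew e (wt \<eta> x) * (atom_D1 e F \<eta> x * atom_D1 e G \<eta> x))"

text \<open>The factor \<open>- snd e\<close> is the logarithmic derivative of
  \<open>exp (- s)\<close> along \<open>e\<close>: 0 in spatial directions, and -1 in the mark
  direction, where it yields the drift of \<open>Delta_R\<close>.\<close>

definition gen where "gen J F \<eta> x = (\<Sum>e\<in>J. ew e (wt \<eta> x) * (atom_D2 e F \<eta> x + (- snd e) * atom_D1 e F \<eta> x))"

definition carre_shifted where
 "carre_shifted J N g \<phi> N' g' \<phi>' w p = (\<Sum>e\<in>J. ew e (snd p) * (shifted_D1 N' g' \<phi>' e (snd w) p * shifted_D1 N g \<phi> e (fst w) p))"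

text \<open>Contains the second cylinder function as a factor, because the Mecke identity is applied
  to the generator at an atom times \<open>G \<eta>\<close>, and \<open>G\<close> changes when the
  atom is inserted.\<close>

definition gen_shifted where "gen_shifted J N g \<phi> g' \<phi>' w p = (\<Sum>e\<in>J. ew e (snd p) *
   (shifted g' \<phi>' (snd w) p * (shifted_D2 N g \<phi> e (fst w) p + (- snd e) * shifted_D1 N g \<phi> e (fst w) p)))"

lemma at_atom_carre_shifted:
 assumes F: "FC_repr N g \<phi> F" and G: "FC_repr N' g' \<phi>' G" and \<eta>: "\<eta> \<in> \<K>"
 shows "at_atom \<phi> \<phi>' (carre_shifted J N g \<phi> N' g' \<phi>') (\<eta>, x) = carre J F G \<eta> x"
 by (simp add: at_atom_def carre_shifted_def carre_def atom_D_eq(1)[OF F \<eta>] atom_D_eq(1)[OF G \<eta>] mult_ac)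

lemma at_atom_gen_shifted:
 assumes F: "FC_repr N g \<phi> F" and G: "FC_repr N' g' \<phi>' G" and \<eta>: "\<eta> \<in> \<K>" and J: "J \<subseteq> Basis"
 shows "at_atom \<phi> \<phi>' (gen_shifted J N g \<phi> g' \<phi>') (\<eta>, x) = gen J F \<eta> x * G \<eta>"
proof -
 have "shifted g' \<phi>' (reduced \<phi>' \<eta> x) (x, wt \<eta> x) = G \<eta>" unfolding shifted_def reduced_add FC_reprD(4)[OF G \<eta>] ..
 then show ?thesis unfolding at_atom_def gen_shifted_def gen_def sum_distrib_right fst_conv snd_conv
  by (intro sum.cong refl) (use J in \<open>auto simp: atom_D_eq(1)[OF F \<eta>] atom_D_eq(2)[OF F \<eta>] mult_ac\<close>)
qed

context
 fixes N N' g g' and \<phi> \<phi>' :: "nat \<Rightarrow> 'a \<times> real \<Rightarrow> real" and J :: "('a \<times> real) set"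
 assumes g: "g \<in> Cb_smooth N" and \<phi>: "\<And>i. \<phi> i \<in> test_functions"
  and g': "g' \<in> Cb_smooth N'" and \<phi>': "\<And>i. \<phi>' i \<in> test_functions" and J: "J \<subseteq> Basis"
begin

lemma shifted_ibp:
 shows "tame (carre_shifted J N g \<phi> N' g' \<phi>')" (is "?claim1") "tame (gen_shifted J N g \<phi> g' \<phi>')"
  "carre_shifted J N g \<phi> N' g' \<phi>' w \<in> borel_measurable borel" (is "?claim2") "gen_shifted J N g \<phi> g' \<phi>' w \<in> borel_measurable borel"
  "(\<integral>p. mark_density (snd p) * carre_shifted J N g \<phi> N' g' \<phi>' w p \<partial>lborel) = - (\<integral>p. mark_density (snd p) * gen_shifted J N g \<phi> g' \<phi>' w p \<partial>lborel)" (is "?claim3")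
proof -
 let ?h1 = "\<lambda>e w p. ew e (snd p) * (shifted_D1 N' g' \<phi>' e (snd w) p * shifted_D1 N g \<phi> e (fst w) p)"
 let ?h2 = "\<lambda>e w p. ew e (snd p) * (shifted g' \<phi>' (snd w) p * (shifted_D2 N g \<phi> e (fst w) p + (- snd e) * shifted_D1 N g \<phi> e (fst w) p))"
 have ibp: "tame (?h1 e)" "tame (?h2 e)" "?h1 e w \<in> borel_measurable borel" "?h2 e w \<in> borel_measurable borel"
  "(\<integral>p. mark_density (snd p) * ?h1 e w p \<partial>lborel) = - (\<integral>p. mark_density (snd p) * ?h2 e w p \<partial>lborel)" if "e \<in> J" for e w
  using weighted_integration_by_parts[where \<phi> = \<phi> and \<phi>' = \<phi>' and e = e, OF g \<phi> _ g' \<phi>'] that J by auto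
 show ?claim1 "tame (gen_shifted J N g \<phi> g' \<phi>')"
  unfolding carre_shifted_def[abs_def] gen_shifted_def[abs_def] by (intro tame_sum ibp; assumption)+
 show ?claim2 "gen_shifted J N g \<phi> g' \<phi>' w \<in> borel_measurable borel"
  unfolding carre_shifted_def[abs_def] gen_shifted_def[abs_def] by (intro borel_measurable_sum ibp(3,4); assumption)+
 have "(\<integral>p. mark_density (snd p) * carre_shifted J N g \<phi> N' g' \<phi>' w p \<partial>lborel) = (\<Sum>e\<in>J. \<integral>p. mark_density (snd p) * ?h1 e w p \<partial>lborel)"
  unfolding carre_shifted_def sum_distrib_left by (rule Bochner_Integration.integral_sum) (rule tame_integrable[OF ibp(1,3)])
 also have "\<dots> = - (\<Sum>e\<in>J. \<integral>p. mark_density (snd p) * ?h2 e w p \<partial>lborel)"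
  unfolding sum_negf[symmetric] by (rule sum.cong[OF refl ibp(5)])
 also have "(\<Sum>e\<in>J. \<integral>p. mark_density (snd p) * ?h2 e w p \<partial>lborel) = (\<integral>p. mark_density (snd p) * gen_shifted J N g \<phi> g' \<phi>' w p \<partial>lborel)"
  unfolding gen_shifted_def sum_distrib_left by (rule Bochner_Integration.integral_sum[symmetric]) (rule tame_integrable[OF ibp(2,4)])
 finally show ?claim3 .
qed

lemma at_atom_measurable: "at_atom \<phi> \<phi>' (carre_shifted J N g \<phi> N' g' \<phi>') \<in> borel_measurable (Cc_sigma \<Otimes>\<^sub>M borel)"
 "at_atom \<phi> \<phi>' (gen_shifted J N g \<phi> g' \<phi>') \<in> borel_measurable (Cc_sigma \<Otimes>\<^sub>M borel)"
proof -
 let ?N = "Cc_sigma \<Otimes>\<^sub>M (borel :: 'a measure)" and ?m = "\<lambda>z. (snd z, wt (fst z) (snd z))"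
 have m: "?m \<in> measurable ?N borel" by (rule marks_measurable)
 have v: "(\<lambda>z. reduced \<theta> (fst z) (snd z) j + \<theta> j (?m z)) \<in> borel_measurable ?N" if "\<And>i. \<theta> i \<in> test_functions" for \<theta> j
  using measurable_compose[OF measurable_fst test_pairing_measurable[OF that]] by (simp add: reduced_def)
 note v1 = v[of \<phi>, OF \<phi>] and v2 = v[of \<phi>', OF \<phi>']
 have e: "(\<lambda>z. ew e (wt (fst z) (snd z))) \<in> borel_measurable ?N" for e
  using measurable_compose[OF measurable_compose[OF m borel_measurable_snd] ew_measurable[of e]] by simp
 have d: "(\<lambda>z. shifted_D1 N g \<phi> e (reduced \<phi> (fst z) (snd z)) (?m z)) \<in> borel_measurable ?N"
  "(\<lambda>z. shifted_D2 N g \<phi> e (reduced \<phi> (fst z) (snd z)) (?m z)) \<in> borel_measurable ?N"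
  "(\<lambda>z. shifted_D1 N' g' \<phi>' e (reduced \<phi>' (fst z) (snd z)) (?m z)) \<in> borel_measurable ?N" if "e \<in> J" for e
 proof -
  have eB: "e \<in> Basis" using that J by auto
  show "(\<lambda>z. shifted_D1 N g \<phi> e (reduced \<phi> (fst z) (snd z)) (?m z)) \<in> borel_measurable ?N"
   by (rule shifted_D_measurable(1)[where v = "\<lambda>z. reduced \<phi> (fst z) (snd z)" and m = ?m and \<phi> = \<phi>, OF g \<phi> eB m v1])
  show "(\<lambda>z. shifted_D2 N g \<phi> e (reduced \<phi> (fst z) (snd z)) (?m z)) \<in> borel_measurable ?N"
   by (rule shifted_D_measurable(2)[where v = "\<lambda>z. reduced \<phi> (fst z) (snd z)" and m = ?m and \<phi> = \<phi>, OF g \<phi> eB m v1])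
  show "(\<lambda>z. shifted_D1 N' g' \<phi>' e (reduced \<phi>' (fst z) (snd z)) (?m z)) \<in> borel_measurable ?N"
   by (rule shifted_D_measurable(1)[where v = "\<lambda>z. reduced \<phi>' (fst z) (snd z)" and m = ?m and \<phi> = \<phi>', OF g' \<phi>' eB m v2])
 qed
 have s: "(\<lambda>z. shifted g' \<phi>' (reduced \<phi>' (fst z) (snd z)) (?m z)) \<in> borel_measurable ?N"
  by (rule shifted_measurable[where v = "\<lambda>z. reduced \<phi>' (fst z) (snd z)" and m = ?m and \<phi> = \<phi>', OF g' v2])
 show "at_atom \<phi> \<phi>' (carre_shifted J N g \<phi> N' g' \<phi>') \<in> borel_measurable ?N"
  unfolding at_atom_def[abs_def] carre_shifted_def fst_conv snd_conv by (intro borel_measurable_sum borel_measurable_times e d)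
 show "at_atom \<phi> \<phi>' (gen_shifted J N g \<phi> g' \<phi>') \<in> borel_measurable ?N"
  unfolding at_atom_def[abs_def] gen_shifted_def fst_conv snd_conv
  by (intro borel_measurable_sum borel_measurable_times borel_measurable_add borel_measurable_const e d s)
qed

lemmas Mecke_carre_shifted = Mecke_tame[where \<phi> = \<phi> and \<phi>' = \<phi>', OF shifted_ibp(1,3) \<phi> \<phi>' at_atom_measurable(1)]
 and Mecke_gen_shifted = Mecke_tame[where \<phi> = \<phi> and \<phi>' = \<phi>', OF shifted_ibp(2,4) \<phi> \<phi>' at_atom_measurable(2)]

end

lemma carre_integrable:
 assumes F: "F \<in> FC" and G: "G \<in> FC" and J: "J \<subseteq> Basis"
 shows "integrable \<G> (\<lambda>\<eta>. \<integral>x. carre J F G \<eta> x \<partial>\<eta>)" (is "?claim1") "\<eta> \<in> \<K> \<Longrightarrow> integrable \<eta> (carre J F G \<eta>)"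
proof -
 obtain N g \<phi> where F: "FC_repr N g \<phi> F" and \<phi>: "\<forall>i. \<phi> i \<in> test_functions" by (rule FC_E_test[OF F])
 obtain N' g' \<phi>' where G: "FC_repr N' g' \<phi>' G" and \<phi>': "\<forall>i. \<phi>' i \<in> test_functions" by (rule FC_E_test[OF G])
 note M = Mecke_carre_shifted[of g N \<phi> g' N' \<phi>' J, OF FC_reprD(2)[OF F] \<phi>[rule_format] FC_reprD(2)[OF G] \<phi>'[rule_format] J]
 have "(\<integral>x. carre J F G \<eta> x \<partial>\<eta>) = (\<integral>x. at_atom \<phi> \<phi>' (carre_shifted J N g \<phi> N' g' \<phi>') (\<eta>, x) \<partial>\<eta>)" if "\<eta> \<in> space \<G>" for \<eta>
  using that by (simp add: space_G at_atom_carre_shifted[OF F G])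
 then show ?claim1
  by (rule Bochner_Integration.integrable_cong[OF refl, THEN iffD2, OF _ M(1)])
 show "integrable \<eta> (carre J F G \<eta>)" if "\<eta> \<in> \<K>"
  using M(2)[OF that] by (simp add: at_atom_carre_shifted[OF F G that])
qed

text \<open>The Mecke identity is used in both directions, with integration by parts for fixed
  \<eta> in between. At the end \<open>G \<eta>\<close> does not depend on the atom and leaves the
  integral against \<eta>.\<close>

lemma carre_integral:
 assumes F: "F \<in> FC" and G: "G \<in> FC" and J: "J \<subseteq> Basis"
 shows "(\<integral>\<eta>. (\<integral>x. carre J F G \<eta> x \<partial>\<eta>) \<partial>\<G>) = - L2_inner \<G> (\<lambda>\<eta>. \<integral>x. gen J F \<eta> x \<partial>\<eta>) G"
proof -
 obtain N g \<phi> where F: "FC_repr N g \<phi> F" and \<phi>: "\<forall>i. \<phi> i \<in> test_functions" by (rule FC_E_test[OF F])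
 obtain N' g' \<phi>' where G: "FC_repr N' g' \<phi>' G" and \<phi>': "\<forall>i. \<phi>' i \<in> test_functions" by (rule FC_E_test[OF G])
 note M1 = Mecke_carre_shifted[of g N \<phi> g' N' \<phi>' J, OF FC_reprD(2)[OF F] \<phi>[rule_format] FC_reprD(2)[OF G] \<phi>'[rule_format] J]
  and M2 = Mecke_gen_shifted[of g N \<phi> g' N' \<phi>' J, OF FC_reprD(2)[OF F] \<phi>[rule_format] FC_reprD(2)[OF G] \<phi>'[rule_format] J]
  and I = shifted_ibp(5)[of g N \<phi> g' N' \<phi>' J, OF FC_reprD(2)[OF F] \<phi>[rule_format] FC_reprD(2)[OF G] \<phi>'[rule_format] J]
 have "(\<integral>\<eta>. (\<integral>x. carre J F G \<eta> x \<partial>\<eta>) \<partial>\<G>) = (\<integral>\<eta>. (\<integral>x. at_atom \<phi> \<phi>' (carre_shifted J N g \<phi> N' g' \<phi>') (\<eta>, x) \<partial>\<eta>) \<partial>\<G>)"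
  by (rule Bochner_Integration.integral_cong) (simp_all add: space_G at_atom_carre_shifted[OF F G])
 also have "\<dots> = - (\<integral>\<eta>. (\<integral>x. at_atom \<phi> \<phi>' (gen_shifted J N g \<phi> g' \<phi>') (\<eta>, x) \<partial>\<eta>) \<partial>\<G>)" unfolding M1(4) M2(4) I by simp
 also have "(\<integral>\<eta>. (\<integral>x. at_atom \<phi> \<phi>' (gen_shifted J N g \<phi> g' \<phi>') (\<eta>, x) \<partial>\<eta>) \<partial>\<G>) = L2_inner \<G> (\<lambda>\<eta>. \<integral>x. gen J F \<eta> x \<partial>\<eta>) G"
  unfolding L2_inner_def by (rule Bochner_Integration.integral_cong) (simp_all add: space_G at_atom_gen_shifted[OF F G _ J])
 finally show ?thesis .
qed

lemma gen_integrable: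
 assumes F: "F \<in> FC" and J: "J \<subseteq> Basis"
 shows "(\<lambda>\<eta>. \<integral>x. gen J F \<eta> x \<partial>\<eta>) \<in> L2 \<G>" (is "?claim1") "\<eta> \<in> \<K> \<Longrightarrow> integrable \<eta> (gen J F \<eta>)"
proof -
 obtain N g \<phi> where F: "FC_repr N g \<phi> F" and \<phi>: "\<forall>i. \<phi> i \<in> test_functions" by (rule FC_E_test[OF F])
 \<comment> \<open>With the constant 1 as second function the factor \<open>G\<close> in
   \<open>gen_shifted\<close> disappears, and the general statement specialises to the generator
   alone.\<close>
 have one: "FC_repr N (\<lambda>v. 1) \<phi> (\<lambda>\<eta>. 1)" using F Cb_smooth_const by (auto simp: FC_repr_def)
 note M = Mecke_gen_shifted[of g N \<phi> "\<lambda>v. 1" N \<phi> J, OF FC_reprD(2)[OF F] \<phi>[rule_format] Cb_smooth_const \<phi>[rule_format] J]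
 note a = at_atom_gen_shifted[OF F one _ J]
 show ?claim1 by (rule L2_cong[OF M(3)]) (simp add: space_G a)
 show "integrable \<eta> (gen J F \<eta>)" if "\<eta> \<in> \<K>" using M(2)[OF that] by (simp add: a[OF that])
qed

text \<open>Representation and symmetry come from \<open>carre_integral\<close> and the shape of
  \<open>carre\<close>. The contraction is pointwise: the chain rule multiplies every
  \<open>atom_D1\<close> by a number of modulus at most 1, and \<open>carre\<close> is a sum of
  nonnegatively weighted squares.\<close>

theorem generated_form_carre:
 assumes J: "J \<subseteq> Basis"
  and E: "\<And>F G. F \<in> FC \<Longrightarrow> G \<in> FC \<Longrightarrow> E F G = (\<integral>\<eta>. (\<integral>x. carre J F G \<eta> x \<partial>\<eta>) \<partial>\<G>)"
  and L: "\<And>F \<eta>. F \<in> FC \<Longrightarrow> \<eta> \<in> \<K> \<Longrightarrow> L F \<eta> = (\<integral>x. gen J F \<eta> x \<partial>\<eta>)"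
 shows "generated_form E L"
 unfolding generated_form_def
proof (intro conjI ballI allI impI)
 fix F G :: "'a measure \<Rightarrow> real" assume F: "F \<in> FC" and G: "G \<in> FC"
 show "L F \<in> L2 \<G>" by (rule L2_cong[OF gen_integrable(1)[OF F J]]) (simp add: space_G L[OF F])
 show "0 \<le> E F F" unfolding E[OF F F] carre_def
  by (intro integral_nonneg_AE AE_I2 sum_nonneg mult_nonneg_nonneg[OF ew_nonneg] zero_le_square)
 have "L2_inner \<G> (L F) G = L2_inner \<G> (\<lambda>\<eta>. \<integral>x. gen J F \<eta> x \<partial>\<eta>) G"
  unfolding L2_inner_def by (rule Bochner_Integration.integral_cong) (simp_all add: space_G L[OF F])
 then show "E F G = - L2_inner \<G> (L F) G" unfolding E[OF F G] carre_integral[OF F G J] by simp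
 show "E F G = E G F" unfolding E[OF F G] E[OF G F] carre_def by (simp add: mult.commute)
 fix a b :: real
 show "AE \<eta> in \<G>. L (\<lambda>\<eta>. a * F \<eta> + b * G \<eta>) \<eta> = a * L F \<eta> + b * L G \<eta>"
 proof (rule AE_I2)
  fix \<eta> assume "\<eta> \<in> space \<G>"
  then have \<eta>: "\<eta> \<in> \<K>" by (simp add: space_G)
  have eq: "gen J (\<lambda>\<eta>. a * F \<eta> + b * G \<eta>) \<eta> x = a * gen J F \<eta> x + b * gen J G \<eta> x" for x
   unfolding gen_def sum_distrib_left sum.distrib[symmetric]
  proof (rule sum.cong[OF refl])
   fix e assume "e \<in> J"
   then have e: "e \<in> Basis" using J by blast
   show "ew e (wt \<eta> x) * (atom_D2 e (\<lambda>\<eta>. a * F \<eta> + b * G \<eta>) \<eta> x + - snd e * atom_D1 e (\<lambda>\<eta>. a * F \<eta> + b * G \<eta>) \<eta> x) =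
    a * (ew e (wt \<eta> x) * (atom_D2 e F \<eta> x + - snd e * atom_D1 e F \<eta> x)) +
    b * (ew e (wt \<eta> x) * (atom_D2 e G \<eta> x + - snd e * atom_D1 e G \<eta> x))"
    by (simp only: atom_D_lin[OF F G \<eta> e, of a b]) (simp add: algebra_simps)
  qed
  have "L (\<lambda>\<eta>. a * F \<eta> + b * G \<eta>) \<eta> = (\<integral>x. gen J (\<lambda>\<eta>. a * F \<eta> + b * G \<eta>) \<eta> x \<partial>\<eta>)" by (rule L[OF FC_lin(1)[OF F G] \<eta>])
  also have "\<dots> = (\<integral>x. a * gen J F \<eta> x + b * gen J G \<eta> x \<partial>\<eta>)"
   by (rule Bochner_Integration.integral_cong[OF refl]) (rule eq)
  also have "\<dots> = a * (\<integral>x. gen J F \<eta> x \<partial>\<eta>) + b * (\<integral>x. gen J G \<eta> x \<partial>\<eta>)"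
   using gen_integrable(2)[OF F J \<eta>] gen_integrable(2)[OF G J \<eta>] by simp
  finally show "L (\<lambda>\<eta>. a * F \<eta> + b * G \<eta>) \<eta> = a * L F \<eta> + b * L G \<eta>" by (simp only: L[OF F \<eta>] L[OF G \<eta>])
 qed
next
 fix F :: "'a measure \<Rightarrow> real" and \<psi> \<psi>' :: "real \<Rightarrow> real"
 assume F: "F \<in> FC" and \<psi>: "\<forall>N g. g \<in> Cb_smooth N \<longrightarrow> (\<lambda>v. \<psi> (g v)) \<in> Cb_smooth N"
  and d: "\<forall>t. (\<psi> has_real_derivative \<psi>' t) (at t) \<and> \<bar>\<psi>' t\<bar> \<le> 1"
 let ?F = "\<lambda>\<eta>. \<psi> (F \<eta>)"
 have F': "?F \<in> FC" by (rule FC_compose(1)[OF F]) (use \<psi> in simp)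
 have le: "carre J ?F ?F \<eta> x \<le> carre J F F \<eta> x" if \<eta>: "\<eta> \<in> \<K>" for \<eta> x unfolding carre_def
 proof (intro sum_mono mult_left_mono ew_nonneg)
  fix e
  have D: "atom_D1 e ?F \<eta> x = \<psi>' (moved_atom F \<eta> x (x, wt \<eta> x)) * atom_D1 e F \<eta> x"
   by (rule atom_D1_compose[OF F \<eta>]) (use \<psi> d in auto)
  have "\<bar>atom_D1 e ?F \<eta> x\<bar> \<le> \<bar>atom_D1 e F \<eta> x\<bar>" unfolding D abs_mult by (rule mult_left_le_one_le) (use d in auto)
  then have "\<bar>atom_D1 e ?F \<eta> x\<bar>\<^sup>2 \<le> \<bar>atom_D1 e F \<eta> x\<bar>\<^sup>2" by (rule power_mono) simp
  then show "atom_D1 e ?F \<eta> x * atom_D1 e ?F \<eta> x \<le> atom_D1 e F \<eta> x * atom_D1 e F \<eta> x" by (simp add: power2_eq_square)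
 qed
 show "E ?F ?F \<le> E F F" unfolding E[OF F' F'] E[OF F F]
 proof (rule integral_mono[OF carre_integrable(1)[OF F' F' J] carre_integrable(1)[OF F F J]])
  fix \<eta> assume "\<eta> \<in> space \<G>"
  then have \<eta>: "\<eta> \<in> \<K>" by (simp add: space_G)
  show "(\<integral>x. carre J ?F ?F \<eta> x \<partial>\<eta>) \<le> (\<integral>x. carre J F F \<eta> x \<partial>\<eta>)"
   by (rule integral_mono[OF carre_integrable(2)[OF F' F' J \<eta>] carre_integrable(2)[OF F F J \<eta>] le[OF \<eta>]])
 qed
qed

lemma basis_sum: "(\<Sum>e\<in>(\<lambda>b::'a. (b, 0::real)) ` Basis. f e) = (\<Sum>b\<in>Basis. f (b, 0))"
 by (subst sum.reindex) (auto simp: inj_on_def)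

text \<open>At points without mass the right side is a quotient by 0 and so equals 0 by convention,
  in agreement with \<open>ew\<close>; the identity therefore needs no case distinction under the
  integral.\<close>

lemma ew_wt: "ew (b, 0) (wt \<eta> x) = c (wt \<eta> x) / (wt \<eta> x)\<^sup>2"
proof (cases "0 < wt \<eta> x")
 case False
 then have "wt \<eta> x = 0" using wt_nonneg[of \<eta> x] by linarith
 then show ?thesis by (simp add: ew_def)
qed (simp add: ew_def)

lemma basis_inner: "(\<Sum>b\<in>Basis. f b *\<^sub>R b) \<bullet> (k *\<^sub>R (\<Sum>b\<in>Basis. g b *\<^sub>R b)) = (\<Sum>b\<in>Basis. k * (f b * g b))"
 unfolding inner_scaleR_right by (subst euclidean_inner) (simp add: sum_distrib_left)

theorem generated_form_int: "generated_form (E_int \<G> c) (L_int c)"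
proof (rule generated_form_carre[where J = "(\<lambda>b. (b, 0)) ` Basis"])
 show "(\<lambda>b. (b, 0)) ` Basis \<subseteq> (Basis :: ('a \<times> real) set)" by (auto simp: Basis_prod_def)
 fix F :: "'a measure \<Rightarrow> real" assume "F \<in> FC"
 then obtain N g \<phi> where F: "FC_repr N g \<phi> F" by (rule FC_E)
 {
  fix \<eta> :: "'a measure" assume \<eta>: "\<eta> \<in> \<K>"
  show "L_int c F \<eta> = (\<integral>x. gen ((\<lambda>b. (b, 0)) ` Basis) F \<eta> x \<partial>\<eta>)"
   unfolding L_int_def gen_def basis_sum ew_wt by (simp add: Delta_X_eq[OF F \<eta>] sum_distrib_left)
 }
 fix G :: "'a measure \<Rightarrow> real" assume "G \<in> FC"
 then obtain N' g' \<phi>' where G: "FC_repr N' g' \<phi>' G" by (rule FC_E)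
 show "E_int \<G> c F G = (\<integral>\<eta>. (\<integral>x. carre ((\<lambda>b. (b, 0)) ` Basis) F G \<eta> x \<partial>\<eta>) \<partial>\<G>)" unfolding E_int_def
 proof (intro Bochner_Integration.integral_cong refl)
  fix \<eta> x assume "\<eta> \<in> space \<G>"
  then have \<eta>: "\<eta> \<in> \<K>" by (simp add: space_G)
  show "grad_int F \<eta> x \<bullet> (c (wt \<eta> x) *\<^sub>R grad_int G \<eta> x) = carre ((\<lambda>b. (b, 0)) ` Basis) F G \<eta> x"
   unfolding grad_int_eq[OF F \<eta>] grad_int_eq[OF G \<eta>] carre_def basis_sum ew_wt basis_inner
   by (intro sum.cong refl) (simp add: power2_eq_square)
 qed
qed

theorem generated_form_ext: "generated_form (E_ext \<G>) L_ext"
proof (rule generated_form_carre[where J = "{(0, 1)}"])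
 show "{(0, 1)} \<subseteq> (Basis :: ('a \<times> real) set)" by (auto simp: Basis_prod_def)
 fix F :: "'a measure \<Rightarrow> real" assume "F \<in> FC"
 then obtain N g \<phi> where F: "FC_repr N g \<phi> F" by (rule FC_E)
 {
  fix \<eta> :: "'a measure" assume \<eta>: "\<eta> \<in> \<K>"
  show "L_ext F \<eta> = (\<integral>x. gen {(0, 1)} F \<eta> x \<partial>\<eta>)"
   unfolding L_ext_def by (rule Bochner_Integration.integral_cong[OF refl]) (simp add: Delta_R_eq[OF F \<eta>] gen_def ew_def)
 }
 fix G :: "'a measure \<Rightarrow> real" assume "G \<in> FC"
 then obtain N' g' \<phi>' where G: "FC_repr N' g' \<phi>' G" by (rule FC_E)
 show "E_ext \<G> F G = (\<integral>\<eta>. (\<integral>x. carre {(0, 1)} F G \<eta> x \<partial>\<eta>) \<partial>\<G>)" unfolding E_ext_def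
  by (intro Bochner_Integration.integral_cong refl)
   (simp add: space_G grad_ext_eq[OF F] grad_ext_eq[OF G] carre_def ew_def)
qed

theorem generated_form_M: "generated_form (E_M \<G> c) (L_M c)"
 using generated_form_add[OF generated_form_int generated_form_ext] unfolding E_M_def[abs_def] L_M_def[abs_def] .

end

theorem proposition4p5:
 fixes \<G> :: "(real ^ 'd) measure measure" and c :: "real \<Rightarrow> real"
 assumes "gamma_measure \<G>"
  and "\<And>s. 0 < s \<Longrightarrow> 0 \<le> c s"
  and "c \<in> borel_measurable (restrict_space borel {0<..})"
  and "\<And>a b. 0 < a \<Longrightarrow> a < b \<Longrightarrow> bounded (c ` {a..b})"
 shows "\<forall>(E, L) \<in> {(E_int \<G> c, L_int c), (E_ext \<G>, L_ext), (E_M \<G> c, L_M c)}.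
   (symmetric_operator \<G> L FC \<and>
   (\<forall>F\<in>FC. \<forall>G\<in>FC. E F G = L2_inner \<G> (\<lambda>\<eta>. - L F \<eta>) G)) \<and>
   (closable_form \<G> E FC \<and>
   dirichlet_form \<G> (closure_form \<G> E FC) (closure_dom \<G> E FC)) \<and>
   (\<exists>B D. friedrichs_extension \<G> (\<lambda>F \<eta>. - L F \<eta>) FC B D)"
proof -
 interpret gamma_coefficient \<G> c by unfold_locales (use assms in auto)
 have g: "generated_form E L"
  if "(E, L) \<in> {(E_int \<G> c, L_int c), (E_ext \<G>, L_ext), (E_M \<G> c, L_M c)}" for E L
  using that generated_form_int generated_form_ext generated_form_M by auto
 have main: "(symmetric_operator \<G> L FC \<and>
   (\<forall>F\<in>FC. \<forall>G\<in>FC. E F G = L2_inner \<G> (\<lambda>\<eta>. - L F \<eta>) G)) \<and>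
   (closable_form \<G> E FC \<and>
   dirichlet_form \<G> (closure_form \<G> E FC) (closure_dom \<G> E FC)) \<and>
   (\<exists>B D. friedrichs_extension \<G> (\<lambda>F \<eta>. - L F \<eta>) FC B D)"
  if "(E, L) \<in> {(E_int \<G> c, L_int c), (E_ext \<G>, L_ext), (E_M \<G> c, L_M c)}" for E L
 proof -
  note r = generated_form_closable[OF g[OF that]]
  show ?thesis
   by (rule conjI[OF conjI[OF r(1)] conjI[OF conjI[OF r(3,4)] r(5)]]) (intro ballI r(2))
 qed
 show ?thesis by (rule ballI, rule case_prodI2, rule main, hypsubst)
qed

end
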